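(* Let $\gamma>0$ and $\eta\in(\gamma-\mathfrak s_1,\gamma]$. Then for any $M=(\Pi,\Gamma)\in\mathscr M_w(\mathscr T)$ and $f\in\mathcal D_v^{\gamma,\eta}(\Gamma)^\#$, there exists a unique reconstruction $\mathcal Rf\in C^{\zeta,Q}(wv)$ of $f$ for $M$ with $\zeta:=\eta\wedge\alpha_0\wedge0$, and it holds that $$\|\mathcal Rf\|_{C^{\zeta,Q}(wv)}\lesssim\|\Pi\|_{\gamma,w}\,|\!|\!|f|\!|\!|_{\gamma,\eta,v}^\#,\qquad [\![\mathcal Rf]\!]_{\gamma,\eta,wv}\lesssim\|\Pi\|_{\gamma,w}\,\|f\|_{\gamma,\eta,v}^\#,$$ with implicit constants independent of $M$ and $f$. Moreover, there is an affine function $C_R>0$ of $R>0$ such that $$\|\mathcal Rf^{(1)}-\mathcal Rf^{(2)}\|_{C^{\zeta,Q}(wv)}\le C_R\big(\|\Pi^{(1)}-\Pi^{(2)}\|_{\gamma,w}+|\!|\!|f^{(1)};f^{(2)}|\!|\!|_{\gamma,\eta,v}^\#\big),$$ $$[\![\mathcal Rf^{(1)};\mathcal Rf^{(2)}]\!]_{\gamma,\eta,wv}\le C_R\big(\|\Pi^{(1)}-\Pi^{(2)}\|_{\gamma,w}+\|f^{(1)};f^{(2)}\|_{\gamma,\eta,v}^\#\big)$$ for any $M^{(i)}=(\Pi^{(i)},\Gamma^{(i)})\in\mathscr M_w(\mathscr T)$ and $f^{(i)}\in\mathcal D_v^{\gamma,\eta}(\Gamma^{(i)})^\#$ with $i\in\{1,2\}$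 such that $|\!|\!|M^{(i)}|\!|\!|_{\gamma,w}\le R$ and $|\!|\!|f^{(i)}|\!|\!|_{\gamma,\eta,v}^\#\le R$.
   Context: **Basic notation.** Fix an integer $d\ge1$, a scaling $\mathfrak s=(\mathfrak s_1,\dots,\mathfrak s_d)\in[1,\infty)^d$ and $\ell>0$. Put $|\mathfrak s|=\sum_i\mathfrak s_i$, $\|x\|_{\mathfrak s}=\sum_i|x_i|^{1/\mathfrak s_i}$, $t^{\pm\mathfrak s/\ell}x=(t^{\pm\mathfrak s_i/\ell}x_i)_i$. Fix a nonnegative measurable $G:\mathbb R^d\to\mathbb R$ and put $G_t(x)=t^{-|\mathfrak s|/\ell}G(t^{-\mathfrak s/\ell}x)$, $t>0$. Let $\varphi(x)=|x_1|^{1/\mathfrak s_1}\wedge1$ and $\varphi(x,y)=\varphi(x)\wedge\varphi(y)$. $A\lesssim B$ means $A\le cB$ for a constant $c>0$ independent of the variables. **Weights.** A weight is a continuous $w:\mathbb R^d\to[0,1]$ that is strictly positive outside a Lebesgue null set; $\|f\|_{L^\infty(w)}=\|fw\|_{L^\infty(\mathbb R^d)}$, $L^\infty(w)$ is the space of measurable $f$ with finite norm, $C(w)=C(\mathbb R^d)\cap L^\infty(w)$. A weight $w$ is $G$-controlled if $w>0$ everywhere and there is a continuous $w^*:\mathbb R^d\to[1,\infty)$ (fixed along with $w$) with $w(x+y)\le w^*(x)w(y)$ for all $x,y$ and $\sup_{0<t\le T}\sup_x\|x\|_{\mathfrak s}^n\,w^*(t^{\mathfrak s/\ell}x)G(x)<\infty$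 for all $n\ge0$, $T>0$. For products of such weights "$wv$ is $G$-controlled" is understood with $(wv)^*=w^*v^*$. **Semigroup and Besov spaces.** Fix a $G$-type semigroup: continuous functions $Q_t:\mathbb R^d\times\mathbb R^d\to\mathbb R$, $t>0$, with (i) $\int Q_{t-s}(x,z)Q_s(z,y)dz=Q_t(x,y)$ for $0<s<t$; (ii) $\lim_{t\downarrow0}\int Q_t(x,y)dy=1$ for all $x$; (iii) $|Q_t(x,y)|\le C_1G_t(x-y)$; (iv) $Q_t(x,y)$ is differentiable in $t$ and $|\partial_tQ_t(x,y)|\le C_2t^{-1}G_t(x-y)$, for constants $C_1,C_2>0$. Write $(Q_tf)(x)=Q_t(x,f)=\int Q_t(x,y)f(y)dy$. For a $G$-controlled weight $w$ and $\alpha\le0$, $C^{\alpha,Q}(w)$ is the completion of $C(w)$ under $\|f\|_{C^{\alpha,Q}(w)}=\sup_{0<t\le1}t^{-\alpha/\ell}\|Q_tf\|_{L^\infty(w)}$; these spaces are continuously and injectively nested ($C^{\alpha_2,Q}(w)\hookrightarrow C^{\alpha_1,Q}(w)$ for $\alpha_1<\alpha_2\le0$), and $Q_t$ extends continuously to $Q_t:C^{\alpha,Q}(w)\to C(w)$. **Regularity structure.** $\mathscr T=(\mathbf A,\mathbf T,\mathbf G)$: $\mathbf A\subset\mathbb R$ is locally finite and bounded below with smallest element $\alpha_0$ (the regularity of $\mathscr T$); $\mathbf T=\bigoplus_{\alpha\in\mathbf A}\mathbf T_\alpha$ is an algebraic sum of Banach spaces $(\mathbf T_\alpha,\|\cdot\|_\alpha)$;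 $\mathbf G$ is a group of continuous linear operators on $\mathbf T$ with $(\Gamma-\mathrm{id})\mathbf T_\alpha\subset\mathbf T_{<\alpha}:=\bigoplus_{\beta\in\mathbf A,\beta<\alpha}\mathbf T_\beta$. For $\tau\in\mathbf T$, $\|\tau\|_\alpha:=\|P_\alpha\tau\|_\alpha$ with $P_\alpha:\mathbf T\to\mathbf T_\alpha$ the projection. Indices $\alpha,\beta$ in maxima and sums below run in $\mathbf A$. **Models.** For a $G$-controlled $w$, a smooth model $M=(\Pi,\Gamma)$ consists of continuous linear $\Pi_x:\mathbf T\to C(w)$ and $\Gamma_{xy}\in\mathbf G$ ($x,y\in\mathbb R^d$) with $\Pi_x\Gamma_{xy}=\Pi_y$, $\Gamma_{xx}=\mathrm{id}$, $\Gamma_{xy}\Gamma_{yz}=\Gamma_{xz}$, and for all $\gamma\in\mathbb R$, finiteness of $$\|\Pi\|_{\gamma,w}=\max_{\alpha<\gamma}\sup_{0<t\le1}\sup_x\sup_{\tau\in\mathbf T_\alpha\setminus\{0\}}t^{-\alpha/\ell}w(x)\frac{|Q_t(x,\Pi_x\tau)|}{\|\tau\|_\alpha},\quad \|\Gamma\|_{\gamma,w}=\max_{\beta<\alpha<\gamma}\sup_{x\ne y}\sup_{\tau\in\mathbf T_\alpha\setminus\{0\}}\frac{w(x)\|\Gamma_{yx}\tau\|_\beta}{w^*(y-x)\|y-x\|_{\mathfrak s}^{\alpha-\beta}\|\tau\|_\alpha}.$$ $|\!|\!|M|\!|\!|_{\gamma,w}=\|\Pi\|_{\gamma,w}+\|\Gamma\|_{\gamma,w}$;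 $|\!|\!|M^{(1)};M^{(2)}|\!|\!|_{\gamma,w}=\|\Pi^{(1)}-\Pi^{(2)}\|_{\gamma,w}+\|\Gamma^{(1)}-\Gamma^{(2)}\|_{\gamma,w}$ (same formulas with differences). $\mathscr M_w(\mathscr T)$ is the completion of the set of smooth models under these pseudo-metrics for all $\gamma\in\mathbb R$; its elements are called models. Standing assumption: there are $G$-controlled weights $w_1,w_2$ with $ww_1,ww_2$ $G$-controlled and $\sup_x\{\|x\|_{\mathfrak s}^nw^*(x)w_1(x)\}+\sup_x\{\|x\|_{\mathfrak s}^nw_1^*(x)w_2(x)\}<\infty$ for all $n\ge0$; then $\Pi_x\tau$ is regarded as an element of $C^{\alpha_0\wedge0,Q}(ww_1)$. Throughout, $\mathscr T$ is a fixed regularity structure of regularity $\alpha_0$, and $w,v$ are fixed $G$-controlled weights with $wv$ also $G$-controlled. **Singular modelled distributions.** For $M=(\Pi,\Gamma)\in\mathscr M_w(\mathscr T)$, $\eta\le\gamma$ and $f:(\mathbb R\setminus\{0\})\times\mathbb R^{d-1}\to\mathbf T_{<\gamma}$, put $\Delta^\Gamma_{yx}f=f(y)-\Gamma_{yx}f(x)$, $$(\!(f)\!)_{\gamma,\eta,v}=\max_{\alpha<\gamma}\sup_x\frac{v(x)\|f(x)\|_\alpha}{\varphi(x)^{(\eta-\alpha)\wedge0}},\qquad \|f\|^\#_{\gamma,\eta,v}=\max_{\alpha<\gamma}\sup_{x\neq y}\frac{v(x)\|\Delta^\Gamma_{yx}f\|_\alpha}{\varphi(x,y)^{\eta-\gamma}v^*(x-y)\|y-x\|_{\mathfrak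 s}^{\gamma-\alpha}},$$ suprema over $x,y\in(\mathbb R\setminus\{0\})\times\mathbb R^{d-1}$. $\mathcal D_v^{\gamma,\eta}(\Gamma)^\#$ is the space of $f$ with $|\!|\!|f|\!|\!|^\#_{\gamma,\eta,v}:=(\!(f)\!)_{\gamma,\eta,v}+\|f\|^\#_{\gamma,\eta,v}<\infty$. For $f^{(i)}\in\mathcal D_v^{\gamma,\eta}(\Gamma^{(i)})^\#$, $\|f^{(1)};f^{(2)}\|^\#_{\gamma,\eta,v}$ is defined as $\|\cdot\|^\#$ with $\Delta^\Gamma_{yx}f$ replaced by $\Delta^{\Gamma^{(1)}}_{yx}f^{(1)}-\Delta^{\Gamma^{(2)}}_{yx}f^{(2)}$, and $|\!|\!|f^{(1)};f^{(2)}|\!|\!|^\#_{\gamma,\eta,v}=(\!(f^{(1)}-f^{(2)})\!)_{\gamma,\eta,v}+\|f^{(1)};f^{(2)}\|^\#_{\gamma,\eta,v}$. **Reconstruction.** $\Lambda\in C^{\zeta,Q}(wv)$ (some $\zeta\le0$) is a reconstruction of $f$ for $M$ if, with $\Lambda_x:=\Lambda-\Pi_xf(x)$, $$[\![\Lambda]\!]_{\gamma,\eta,wv}:=\sup_{0<t\le1}\sup_{x\in(\mathbb R\setminus\{0\})\times\mathbb R^{d-1}}t^{-\gamma/\ell}\varphi(x)^{\gamma-\eta}(wv)(x)|Q_t(x,\Lambda_x)|<\infty.$$ $[\![\Lambda^{(1)};\Lambda^{(2)}]\!]_{\gamma,\eta,wv}$ is defined by the same formula with $\Lambda_x$ replaced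 by $\Lambda_x^{(1)}-\Lambda_x^{(2)}$, $\Lambda_x^{(i)}=\Lambda^{(i)}-\Pi^{(i)}_xf^{(i)}(x)$. In the last estimates $\mathcal Rf^{(i)}$ is the reconstruction of $f^{(i)}$ for $M^{(i)}$.
   Formalization: Membership of Rf in C^{ζ,Q}(wv) is claimed only if α0∧0 < η; for η ≤ α0∧0, where it can fail (e.g. f=|x|^η with the heat semigroup), it is replaced by a finite ζ-norm and Rf in C^{ζ',Q}(wv) for all ζ'<ζ. *)

theory Defs
  imports "HOL-Analysis.Analysis" "HOL-Probability.Essential_Supremum"
begin

section \<open>Scalings, weights and semigroups\<close>

text \<open>
  Norms and suprema take values in \<^typ>\<open>ennreal\<close>, so that they are total and "finite" is
  \<open>< \<infinity>\<close>.  The field \<open>axis1\<close> is the label of the coordinate called $x_1$ in the definition of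
  \<open>phi\<close>; any index may play this role.
\<close>

record ('n::finite) setting =
  scl :: "real^'n"
  ell :: real
  axis1 :: 'n
  Gfun :: "real^'n \<Rightarrow> real"
  Qker :: "real \<Rightarrow> real^'n \<Rightarrow> real^'n \<Rightarrow> real"

definition sdim :: "('n::finite) setting \<Rightarrow> real" where
  "sdim S = (\<Sum>i\<in>UNIV. scl S $ i)"

definition snorm :: "('n::finite) setting \<Rightarrow> real^'n \<Rightarrow> real" where
  "snorm S x = (\<Sum>i\<in>UNIV. \<bar>x $ i\<bar> powr (1 / scl S $ i))"

definition sdil :: "('n::finite) setting \<Rightarrow> real \<Rightarrow> real^'n \<Rightarrow> real^'n" where
  "sdil S t x = (\<chi> i. t powr (scl S $ i / ell S) * x $ i)"

definition Gt :: "('n::finite) setting \<Rightarrow> real \<Rightarrow> real^'n \<Rightarrow> real" where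
  "Gt S t x = t powr (- sdim S / ell S) * Gfun S (sdil S (1 / t) x)"

definition phi :: "('n::finite) setting \<Rightarrow> real^'n \<Rightarrow> real" where
  "phi S x = min (\<bar>x $ axis1 S\<bar> powr (1 / scl S $ axis1 S)) 1"

definition phi2 :: "('n::finite) setting \<Rightarrow> real^'n \<Rightarrow> real^'n \<Rightarrow> real" where
  "phi2 S x y = min (phi S x) (phi S y)"

definition off_hyp :: "('n::finite) setting \<Rightarrow> (real^'n) set" where
  "off_hyp S = {x. x $ axis1 S \<noteq> 0}"

text \<open>A weight carries its companion function \<open>wstar\<close>, which is fixed along with it.\<close>

record ('n::finite) weight =
  wfun :: "real^'n \<Rightarrow> real"
  wstar :: "real^'n \<Rightarrow> real"

definition wmul :: "('n::finite) weight \<Rightarrow> 'n weight \<Rightarrow> 'n weight" where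
  "wmul w v = \<lparr>wfun = (\<lambda>x. wfun w x * wfun v x), wstar = (\<lambda>x. wstar w x * wstar v x)\<rparr>"

definition is_weight :: "(real^'n \<Rightarrow> real) \<Rightarrow> bool" where
  "is_weight w \<longleftrightarrow> continuous_on UNIV w \<and> (\<forall>x. 0 \<le> w x \<and> w x \<le> 1) \<and> negligible {x. \<not> 0 < w x}"

definition G_controlled :: "('n::finite) setting \<Rightarrow> 'n weight \<Rightarrow> bool" where
  "G_controlled S w \<longleftrightarrow>
     is_weight (wfun w) \<and> (\<forall>x. 0 < wfun w x) \<and>
     continuous_on UNIV (wstar w) \<and> (\<forall>x. 1 \<le> wstar w x) \<and>
     (\<forall>x y. wfun w (x + y) \<le> wstar w x * wfun w y) \<and>
     (\<forall>(n::nat) T. 0 < T \<longrightarrow>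
        (\<exists>C. \<forall>t x. 0 < t \<and> t \<le> T \<longrightarrow> snorm S x ^ n * wstar w (sdil S t x) * Gfun S x \<le> C))"

definition Linf :: "('n::finite) weight \<Rightarrow> (real^'n \<Rightarrow> real) \<Rightarrow> ennreal" where
  "Linf w f = esssup lborel (\<lambda>x. ennreal \<bar>f x * wfun w x\<bar>)"

definition Cw :: "('n::finite) weight \<Rightarrow> (real^'n \<Rightarrow> real) set" where
  "Cw w = {f. continuous_on UNIV f \<and> Linf w f < \<infinity>}"

definition G_semigroup :: "('n::finite) setting \<Rightarrow> bool" where
  "G_semigroup S \<longleftrightarrow>
     (\<forall>i. 1 \<le> scl S $ i) \<and> 0 < ell S \<and>
     Gfun S \<in> borel_measurable borel \<and> (\<forall>x. 0 \<le> Gfun S x) \<and>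
     (\<forall>t>0. continuous_on UNIV (\<lambda>(x, y). Qker S t x y)) \<and>
     (\<forall>s t x y. 0 < s \<and> s < t \<longrightarrow>
        has_bochner_integral lborel (\<lambda>z. Qker S (t - s) x z * Qker S s z y) (Qker S t x y)) \<and>
     (\<forall>x. ((\<lambda>t. LINT y|lborel. Qker S t x y) \<longlongrightarrow> 1) (at_right 0)) \<and>
     (\<exists>C1>0. \<forall>t>0. \<forall>x y. \<bar>Qker S t x y\<bar> \<le> C1 * Gt S t (x - y)) \<and>
     (\<exists>C2>0. \<forall>t>0. \<forall>x y. \<exists>D.
        ((\<lambda>r. Qker S r x y) has_real_derivative D) (at t) \<and> \<bar>D\<bar> \<le> C2 * (1 / t) * Gt S t (x - y))"

section \<open>Besov spaces\<close>

text \<open>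
  For $\alpha \le 0$ the map \<open>qfam S\<close>, which sends $f$ to $(Q_t f)_{0 < t \le 1}$, is by the very
  definition of the norm a linear isometry of $C(w)$ with the norm of $C^{\alpha,Q}(w)$ into the
  Banach space of families $(\Lambda_t)_{0 < t \le 1}$ in $C(w)$ with
  $\sup_{0 < t \le 1} t^{-\alpha/\ell} \|\Lambda_t\|_{L^\infty(w)} < \infty$.  The completion of
  $C(w)$ is the closure of its image.  Thus an element $\Lambda$ of $C^{\alpha,Q}(w)$ is the family
  of its images $Q_t \Lambda$ under the extended operators: \<open>\<Lambda> t x\<close> is $Q_t(x, \Lambda)$, and the
  nestings in $\alpha$ (and in the weight) are inclusions of sets.
  Outside $0 < t \le 1$ the families are set to zero, so that equality in the completion is equality
  in HOL.
\<close>

type_synonym 'n qdist = "real \<Rightarrow> real^'n \<Rightarrow> real"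

definition qfam :: "('n::finite) setting \<Rightarrow> (real^'n \<Rightarrow> real) \<Rightarrow> 'n qdist" where
  "qfam S f = (\<lambda>t x. if 0 < t \<and> t \<le> 1 then LINT y|lborel. Qker S t x y * f y else 0)"

definition qdiff :: "('n::finite) qdist \<Rightarrow> 'n qdist \<Rightarrow> 'n qdist" where
  "qdiff \<Lambda> \<Lambda>' = (\<lambda>t x. \<Lambda> t x - \<Lambda>' t x)"

definition besov_norm :: "('n::finite) setting \<Rightarrow> real \<Rightarrow> 'n weight \<Rightarrow> 'n qdist \<Rightarrow> ennreal" where
  "besov_norm S \<alpha> w \<Lambda> = (SUP t\<in>{0<..1}. ennreal (t powr (- \<alpha> / ell S)) * Linf w (\<Lambda> t))"

definition besov :: "('n::finite) setting \<Rightarrow> real \<Rightarrow> 'n weight \<Rightarrow> 'n qdist set" where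
  "besov S \<alpha> w =
     {\<Lambda>. (\<forall>t\<in>{0<..1}. \<Lambda> t \<in> Cw w) \<and> (\<forall>t. t \<notin> {0<..1} \<longrightarrow> \<Lambda> t = (\<lambda>x. 0)) \<and>
          (\<exists>u. (\<forall>n::nat. u n \<in> Cw w) \<and>
               (\<lambda>n. besov_norm S \<alpha> w (qdiff \<Lambda> (qfam S (u n)))) \<longlonglongrightarrow> 0)}"

section \<open>Regularity structures\<close>

text \<open>
  The algebraic sum $\mathbf T$ is the whole type \<^typ>\<open>'v\<close>, the internal direct sum of the subspaces
  \<open>sector \<T> \<alpha>\<close>, \<open>\<alpha> \<in> idx \<T>\<close>, each of which is a Banach space under \<open>secnorm \<T> \<alpha>\<close>.
\<close>

record 'v regstruct =
  idx :: "real set"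
  sector :: "real \<Rightarrow> 'v set"
  secnorm :: "real \<Rightarrow> 'v \<Rightarrow> real"
  sgroup :: "('v \<Rightarrow> 'v) set"

definition banach_on :: "('v::real_vector) set \<Rightarrow> ('v \<Rightarrow> real) \<Rightarrow> bool" where
  "banach_on V N \<longleftrightarrow>
     subspace V \<and>
     (\<forall>x\<in>V. 0 \<le> N x \<and> (N x = 0 \<longleftrightarrow> x = 0)) \<and>
     (\<forall>x\<in>V. \<forall>a. N (a *\<^sub>R x) = \<bar>a\<bar> * N x) \<and>
     (\<forall>x\<in>V. \<forall>y\<in>V. N (x + y) \<le> N x + N y) \<and>
     (\<forall>u. (\<forall>n::nat. u n \<in> V) \<and> (\<forall>e>0. \<exists>k. \<forall>m\<ge>k. \<forall>n\<ge>k. N (u m - u n) < e)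
        \<longrightarrow> (\<exists>x\<in>V. (\<lambda>n. N (u n - x)) \<longlonglongrightarrow> 0))"

definition decomp :: "('v::real_vector) regstruct \<Rightarrow> 'v \<Rightarrow> (real \<Rightarrow> 'v) \<Rightarrow> bool" where
  "decomp \<T> \<tau> c \<longleftrightarrow>
     (\<forall>\<alpha>\<in>idx \<T>. c \<alpha> \<in> sector \<T> \<alpha>) \<and> (\<forall>\<alpha>. \<alpha> \<notin> idx \<T> \<longrightarrow> c \<alpha> = 0) \<and>
     finite {\<alpha>. c \<alpha> \<noteq> 0} \<and> \<tau> = (\<Sum>\<alpha> | c \<alpha> \<noteq> 0. c \<alpha>)"

definition proj :: "('v::real_vector) regstruct \<Rightarrow> real \<Rightarrow> 'v \<Rightarrow> 'v" where
  "proj \<T> \<alpha> \<tau> = (THE c. decomp \<T> \<tau> c) \<alpha>"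

definition hnorm :: "('v::real_vector) regstruct \<Rightarrow> real \<Rightarrow> 'v \<Rightarrow> real" where
  "hnorm \<T> \<alpha> \<tau> = secnorm \<T> \<alpha> (proj \<T> \<alpha> \<tau>)"

definition below :: "('v::real_vector) regstruct \<Rightarrow> real \<Rightarrow> 'v set" where
  "below \<T> \<gamma> = {\<tau>. \<forall>\<alpha>\<in>idx \<T>. \<gamma> \<le> \<alpha> \<longrightarrow> proj \<T> \<alpha> \<tau> = 0}"

text \<open>
  Continuity on the algebraic sum refers to the direct sum topology, i.e. it is continuity on every
  summand.  The values of the operators below on one summand lie in finitely many summands (the
  index set is locally finite and bounded below), so boundedness can be expressed by components.
\<close>

definition continuous_op :: "('v::real_vector) regstruct \<Rightarrow> ('v \<Rightarrow> 'v) \<Rightarrow> bool" where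
  "continuous_op \<T> L \<longleftrightarrow>
     linear L \<and>
     (\<forall>\<alpha>\<in>idx \<T>. \<forall>\<beta>\<in>idx \<T>. \<exists>C. \<forall>\<tau>\<in>sector \<T> \<alpha>. hnorm \<T> \<beta> (L \<tau>) \<le> C * secnorm \<T> \<alpha> \<tau>)"

definition lower_triangular :: "('v::real_vector) regstruct \<Rightarrow> ('v \<Rightarrow> 'v) \<Rightarrow> bool" where
  "lower_triangular \<T> L \<longleftrightarrow> (\<forall>\<alpha>\<in>idx \<T>. \<forall>\<tau>\<in>sector \<T> \<alpha>. L \<tau> - \<tau> \<in> below \<T> \<alpha>)"

definition regularity_structure :: "('v::real_vector) regstruct \<Rightarrow> real \<Rightarrow> bool" where
  "regularity_structure \<T> \<alpha>0 \<longleftrightarrow>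
     \<alpha>0 \<in> idx \<T> \<and> (\<forall>\<alpha>\<in>idx \<T>. \<alpha>0 \<le> \<alpha>) \<and> (\<forall>a b. finite (idx \<T> \<inter> {a..b})) \<and>
     (\<forall>\<alpha>\<in>idx \<T>. banach_on (sector \<T> \<alpha>) (secnorm \<T> \<alpha>)) \<and>
     (\<forall>\<tau>. \<exists>!c. decomp \<T> \<tau> c) \<and>
     (\<forall>L\<in>sgroup \<T>. continuous_op \<T> L \<and> lower_triangular \<T> L) \<and>
     id \<in> sgroup \<T> \<and>
     (\<forall>L\<in>sgroup \<T>. \<forall>L'\<in>sgroup \<T>. L \<circ> L' \<in> sgroup \<T>) \<and>
     (\<forall>L\<in>sgroup \<T>. \<exists>L'\<in>sgroup \<T>. L \<circ> L' = id \<and> L' \<circ> L = id)"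

section \<open>Models\<close>

text \<open>\<open>P x \<tau>\<close> stands for $\Pi_x \tau$, and \<open>P x \<tau> t y\<close> for $Q_t(y, \Pi_x \tau)$.\<close>

type_synonym ('n, 'v) pimap = "real^'n \<Rightarrow> 'v \<Rightarrow> 'n qdist"
type_synonym ('n, 'v) gmap = "real^'n \<Rightarrow> real^'n \<Rightarrow> 'v \<Rightarrow> 'v"

definition pi_norm ::
  "('n::finite) setting \<Rightarrow> ('v::real_vector) regstruct \<Rightarrow> real \<Rightarrow> 'n weight \<Rightarrow> ('n, 'v) pimap \<Rightarrow> ennreal" where
  "pi_norm S \<T> \<gamma> w P =
     (SUP \<alpha>\<in>{\<alpha>\<in>idx \<T>. \<alpha> < \<gamma>}. SUP t\<in>{0<..1}. SUP x. SUP \<tau>\<in>sector \<T> \<alpha> - {0}.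
        ennreal (t powr (- \<alpha> / ell S) * wfun w x * (\<bar>P x \<tau> t x\<bar> / secnorm \<T> \<alpha> \<tau>)))"

definition gamma_norm ::
  "('n::finite) setting \<Rightarrow> ('v::real_vector) regstruct \<Rightarrow> real \<Rightarrow> 'n weight \<Rightarrow> ('n, 'v) gmap \<Rightarrow> ennreal" where
  "gamma_norm S \<T> \<gamma> w \<Gamma> =
     (SUP \<alpha>\<in>{\<alpha>\<in>idx \<T>. \<alpha> < \<gamma>}. SUP \<beta>\<in>{\<beta>\<in>idx \<T>. \<beta> < \<alpha>}. SUP x. SUP y\<in>- {x}. SUP \<tau>\<in>sector \<T> \<alpha> - {0}.
        ennreal (wfun w x * hnorm \<T> \<beta> (\<Gamma> y x \<tau>) /
                 (wstar w (y - x) * snorm S (y - x) powr (\<alpha> - \<beta>) * secnorm \<T> \<alpha> \<tau>)))"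

definition pi_diff :: "('n::finite, 'v) pimap \<Rightarrow> ('n, 'v) pimap \<Rightarrow> ('n, 'v) pimap" where
  "pi_diff P P' = (\<lambda>x \<tau>. qdiff (P x \<tau>) (P' x \<tau>))"

definition gamma_diff :: "('n::finite, 'v::real_vector) gmap \<Rightarrow> ('n, 'v) gmap \<Rightarrow> ('n, 'v) gmap" where
  "gamma_diff \<Gamma> \<Gamma>' = (\<lambda>y x \<tau>. \<Gamma> y x \<tau> - \<Gamma>' y x \<tau>)"

definition model_norm ::
  "('n::finite) setting \<Rightarrow> ('v::real_vector) regstruct \<Rightarrow> real \<Rightarrow> 'n weight
     \<Rightarrow> ('n, 'v) pimap \<times> ('n, 'v) gmap \<Rightarrow> ennreal" where
  "model_norm S \<T> \<gamma> w M = pi_norm S \<T> \<gamma> w (fst M) + gamma_norm S \<T> \<gamma> w (snd M)"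

definition model_dist ::
  "('n::finite) setting \<Rightarrow> ('v::real_vector) regstruct \<Rightarrow> real \<Rightarrow> 'n weight
     \<Rightarrow> ('n, 'v) pimap \<times> ('n, 'v) gmap \<Rightarrow> ('n, 'v) pimap \<times> ('n, 'v) gmap \<Rightarrow> ennreal" where
  "model_dist S \<T> \<gamma> w M M' =
     pi_norm S \<T> \<gamma> w (pi_diff (fst M) (fst M')) + gamma_norm S \<T> \<gamma> w (gamma_diff (snd M) (snd M'))"

text \<open>
  In a smooth model $\Pi_x \tau$ is a genuine function \<open>Pf x \<tau>\<close> in $C(w)$.
\<close>

definition smooth_model ::
  "('n::finite) setting \<Rightarrow> ('v::real_vector) regstruct \<Rightarrow> 'n weight
     \<Rightarrow> (real^'n \<Rightarrow> 'v \<Rightarrow> real^'n \<Rightarrow> real) \<Rightarrow> ('n, 'v) gmap \<Rightarrow> bool" where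
  "smooth_model S \<T> w Pf \<Gamma> \<longleftrightarrow>
     (\<forall>x y. linear (\<lambda>\<tau>. Pf x \<tau> y)) \<and>
     (\<forall>x \<tau>. Pf x \<tau> \<in> Cw w) \<and>
     (\<forall>x. \<forall>\<alpha>\<in>idx \<T>. \<exists>C. \<forall>\<tau>\<in>sector \<T> \<alpha>. Linf w (Pf x \<tau>) \<le> ennreal (C * secnorm \<T> \<alpha> \<tau>)) \<and>
     (\<forall>x y. \<Gamma> x y \<in> sgroup \<T>) \<and>
     (\<forall>x y \<tau>. Pf x (\<Gamma> x y \<tau>) = Pf y \<tau>) \<and>
     (\<forall>x. \<Gamma> x x = id) \<and> (\<forall>x y z. \<Gamma> x y \<circ> \<Gamma> y z = \<Gamma> x z) \<and>
     (\<forall>\<gamma>. pi_norm S \<T> \<gamma> w (\<lambda>x \<tau>. qfam S (Pf x \<tau>)) < \<infinity> \<and> gamma_norm S \<T> \<gamma> w \<Gamma> < \<infinity>)"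

text \<open>
  The completion of the smooth models, realised by limits: for a Cauchy sequence of smooth models
  the components of $\Gamma_{yx} \tau$ converge in the Banach spaces $\mathbf T_\beta$, and
  $Q_t(y, \Pi_x \tau) = Q_t(y, \Pi_y \Gamma_{yx} \tau)$ converges for all $t, x, y$.  The algebraic
  conditions pass to the limit and make it unique: the pseudo-metrics only see the components of
  $\Gamma_{yx} \tau$, $\tau \in \mathbf T_\alpha$, of degree less than $\alpha$, and $\Pi_x \tau$
  tested at $x$.  As completing does not keep the operators $\Gamma_{xy}$ in the group, only
  linearity and the triangular form are required of them.  The weight \<open>w1\<close> is the one for which
  $\Pi_x \tau$ is regarded as an element of $C^{\alpha_0 \wedge 0, Q}(w w_1)$.
\<close>

definition models ::
  "('n::finite) setting \<Rightarrow> ('v::real_vector) regstruct \<Rightarrow> real \<Rightarrow> 'n weight \<Rightarrow> 'n weight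
     \<Rightarrow> (('n, 'v) pimap \<times> ('n, 'v) gmap) set" where
  "models S \<T> \<alpha>0 w w1 =
     {(P, \<Gamma>).
        (\<forall>x \<tau>. P x \<tau> \<in> besov S (min \<alpha>0 0) (wmul w w1)) \<and>
        (\<forall>x t y. linear (\<lambda>\<tau>. P x \<tau> t y)) \<and>
        (\<forall>x y. linear (\<Gamma> x y) \<and> lower_triangular \<T> (\<Gamma> x y)) \<and>
        (\<forall>x y \<tau>. P x (\<Gamma> x y \<tau>) = P y \<tau>) \<and>
        (\<forall>x. \<Gamma> x x = id) \<and> (\<forall>x y z. \<Gamma> x y \<circ> \<Gamma> y z = \<Gamma> x z) \<and>
        (\<exists>Pn \<Gamma>n. (\<forall>n::nat. smooth_model S \<T> w (Pn n) (\<Gamma>n n)) \<and>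
           (\<forall>\<gamma>. (\<lambda>n. model_dist S \<T> \<gamma> w (\<lambda>x \<tau>. qfam S (Pn n x \<tau>), \<Gamma>n n) (P, \<Gamma>)) \<longlonglongrightarrow> 0))}"

definition auxiliary_weights :: "('n::finite) setting \<Rightarrow> 'n weight \<Rightarrow> 'n weight \<Rightarrow> 'n weight \<Rightarrow> bool" where
  "auxiliary_weights S w w1 w2 \<longleftrightarrow>
     G_controlled S w1 \<and> G_controlled S w2 \<and>
     G_controlled S (wmul w w1) \<and> G_controlled S (wmul w w2) \<and>
     (\<forall>n::nat. \<exists>C. \<forall>x. snorm S x ^ n * wstar w x * wfun w1 x \<le> C) \<and>
     (\<forall>n::nat. \<exists>C. \<forall>x. snorm S x ^ n * wstar w1 x * wfun w2 x \<le> C)"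

section \<open>Singular modelled distributions and reconstruction\<close>

text \<open>
  Modelled distributions are total functions of which only the values on \<open>off_hyp S\<close> are used.  The
  argument \<open>\<Delta>\<close> of \<open>sharp_norm\<close> is either \<open>delta \<Gamma> f\<close> or a difference of two such maps.
\<close>

definition delta :: "('n::finite, 'v::real_vector) gmap \<Rightarrow> (real^'n \<Rightarrow> 'v) \<Rightarrow> real^'n \<Rightarrow> real^'n \<Rightarrow> 'v" where
  "delta \<Gamma> f y x = f y - \<Gamma> y x (f x)"

definition sing_norm ::
  "('n::finite) setting \<Rightarrow> ('v::real_vector) regstruct \<Rightarrow> real \<Rightarrow> real \<Rightarrow> 'n weight \<Rightarrow> (real^'n \<Rightarrow> 'v) \<Rightarrow> ennreal" where
  "sing_norm S \<T> \<gamma> \<eta> v f =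
     (SUP \<alpha>\<in>{\<alpha>\<in>idx \<T>. \<alpha> < \<gamma>}. SUP x\<in>off_hyp S.
        ennreal (wfun v x * hnorm \<T> \<alpha> (f x) / phi S x powr (min (\<eta> - \<alpha>) 0)))"

definition sharp_norm ::
  "('n::finite) setting \<Rightarrow> ('v::real_vector) regstruct \<Rightarrow> real \<Rightarrow> real \<Rightarrow> 'n weight
     \<Rightarrow> (real^'n \<Rightarrow> real^'n \<Rightarrow> 'v) \<Rightarrow> ennreal" where
  "sharp_norm S \<T> \<gamma> \<eta> v \<Delta> =
     (SUP \<alpha>\<in>{\<alpha>\<in>idx \<T>. \<alpha> < \<gamma>}. SUP x\<in>off_hyp S. SUP y\<in>off_hyp S - {x}.
        ennreal (wfun v x * hnorm \<T> \<alpha> (\<Delta> y x) /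
                 (phi2 S x y powr (\<eta> - \<gamma>) * wstar v (x - y) * snorm S (y - x) powr (\<gamma> - \<alpha>))))"

definition md_norm ::
  "('n::finite) setting \<Rightarrow> ('v::real_vector) regstruct \<Rightarrow> real \<Rightarrow> real \<Rightarrow> 'n weight
     \<Rightarrow> ('n, 'v) gmap \<Rightarrow> (real^'n \<Rightarrow> 'v) \<Rightarrow> ennreal" where
  "md_norm S \<T> \<gamma> \<eta> v \<Gamma> f = sing_norm S \<T> \<gamma> \<eta> v f + sharp_norm S \<T> \<gamma> \<eta> v (delta \<Gamma> f)"

definition modelled ::
  "('n::finite) setting \<Rightarrow> ('v::real_vector) regstruct \<Rightarrow> real \<Rightarrow> real \<Rightarrow> 'n weight
     \<Rightarrow> ('n, 'v) gmap \<Rightarrow> (real^'n \<Rightarrow> 'v) set" where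
  "modelled S \<T> \<gamma> \<eta> v \<Gamma> =
     {f. (\<forall>x\<in>off_hyp S. f x \<in> below \<T> \<gamma>) \<and> md_norm S \<T> \<gamma> \<eta> v \<Gamma> f < \<infinity>}"

definition sharp_dist ::
  "('n::finite) setting \<Rightarrow> ('v::real_vector) regstruct \<Rightarrow> real \<Rightarrow> real \<Rightarrow> 'n weight
     \<Rightarrow> ('n, 'v) gmap \<Rightarrow> (real^'n \<Rightarrow> 'v) \<Rightarrow> ('n, 'v) gmap \<Rightarrow> (real^'n \<Rightarrow> 'v) \<Rightarrow> ennreal" where
  "sharp_dist S \<T> \<gamma> \<eta> v \<Gamma>1 f1 \<Gamma>2 f2 =
     sharp_norm S \<T> \<gamma> \<eta> v (\<lambda>y x. delta \<Gamma>1 f1 y x - delta \<Gamma>2 f2 y x)"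

definition md_dist ::
  "('n::finite) setting \<Rightarrow> ('v::real_vector) regstruct \<Rightarrow> real \<Rightarrow> real \<Rightarrow> 'n weight
     \<Rightarrow> ('n, 'v) gmap \<Rightarrow> (real^'n \<Rightarrow> 'v) \<Rightarrow> ('n, 'v) gmap \<Rightarrow> (real^'n \<Rightarrow> 'v) \<Rightarrow> ennreal" where
  "md_dist S \<T> \<gamma> \<eta> v \<Gamma>1 f1 \<Gamma>2 f2 =
     sing_norm S \<T> \<gamma> \<eta> v (\<lambda>x. f1 x - f2 x) + sharp_dist S \<T> \<gamma> \<eta> v \<Gamma>1 f1 \<Gamma>2 f2"

text \<open>\<open>local_err P f \<Lambda> x\<close> is $\Lambda_x = \Lambda - \Pi_x f(x)$.\<close>

definition local_err ::
  "('n::finite, 'v) pimap \<Rightarrow> (real^'n \<Rightarrow> 'v) \<Rightarrow> 'n qdist \<Rightarrow> real^'n \<Rightarrow> 'n qdist" where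
  "local_err P f \<Lambda> x = qdiff \<Lambda> (P x (f x))"

definition rec_norm ::
  "('n::finite) setting \<Rightarrow> real \<Rightarrow> real \<Rightarrow> 'n weight \<Rightarrow> (real^'n \<Rightarrow> 'n qdist) \<Rightarrow> ennreal" where
  "rec_norm S \<gamma> \<eta> u E =
     (SUP t\<in>{0<..1}. SUP x\<in>off_hyp S.
        ennreal (t powr (- \<gamma> / ell S) * phi S x powr (\<gamma> - \<eta>) * wfun u x * \<bar>E x t x\<bar>))"

text \<open>
  A pitfall of the spaces \<open>besov\<close>, being closures of $C(w)$: for $\alpha < 0$ their elements satisfy
  $t^{-\alpha/\ell} \|Q_t \Lambda\|_{L^\infty(w)} \to 0$ as $t \to 0$, and for $\alpha = 0$ they are
  continuous functions.  A reconstruction $\Lambda$ with finite norm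
  of exponent $\zeta = \eta \wedge \alpha_0 \wedge 0$ need not lie in the closure of exponent $\zeta$
  when $\zeta = \eta$.  Take $d = \mathfrak s_1 = 1$, the heat semigroup ($\ell = 2$), all weights
  $w = v = 1$, $\mathbf T = \mathbf T_0 = \mathbf R$ with $\Pi_x 1 = 1$, $\Gamma_{xy} = \mathrm{id}$,
  $\gamma = 1/2$, $\eta = -1/4$ and $f(x) = |x|^\eta 1$: the only reconstruction is the function
  $|x|^\eta$, for which $t^{-\eta/2} Q_t(0, \Lambda)$ is a positive constant.  With $\eta = 0$ and
  $f = \mathrm{sgn}$ one gets a discontinuous $\Lambda$ for $\zeta = 0$.  In these cases $\Lambda$ lies
  in \<open>besov S \<zeta>' u\<close> for every \<open>\<zeta>' < \<zeta>\<close> and has finite \<open>besov_norm S \<zeta> u\<close>.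
\<close>

definition is_reconstruction ::
  "('n::finite) setting \<Rightarrow> real \<Rightarrow> real \<Rightarrow> 'n weight \<Rightarrow> ('n, 'v) pimap \<Rightarrow> (real^'n \<Rightarrow> 'v) \<Rightarrow> 'n qdist \<Rightarrow> bool" where
  "is_reconstruction S \<gamma> \<eta> u P f \<Lambda> \<longleftrightarrow>
     (\<exists>\<zeta>\<le>0. \<Lambda> \<in> besov S \<zeta> u) \<and> rec_norm S \<gamma> \<eta> u (local_err P f \<Lambda>) < \<infinity>"

definition reconstruction ::
  "('n::finite) setting \<Rightarrow> real \<Rightarrow> real \<Rightarrow> 'n weight \<Rightarrow> ('n, 'v) pimap \<Rightarrow> (real^'n \<Rightarrow> 'v) \<Rightarrow> 'n qdist" where
  "reconstruction S \<gamma> \<eta> u P f = (THE \<Lambda>. is_reconstruction S \<gamma> \<eta> u P f \<Lambda>)"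

end

theory Submission
  imports Defs "HOL-Probability.Sinc_Integral"
begin

text \<open>
  Put \<open>F s y\<close> for $Q_s(y, \Pi_y f(y))$. Since $\Pi_y f(y) - \Pi_x f(x) = \Pi_y \Delta_{yx} f$,
  the modelled distribution bound gives, for \<open>s\<close> comparable to \<open>r\<close>, that $Q_r F_s(x)$ and
  $Q_{r+s}(x, \Pi_x f(x))$ differ by at most a multiple of
  $r^{\gamma/\ell} \varphi(x)^{\eta-\gamma}$. Hence the increments of $Q_{t-s} F_s$ along
  $s = 2^{-n}$ are summable, because $\gamma > 0$ and because $\varphi^{\eta-\gamma}$ stays bounded
  by $\max(\varphi(x), t^{1/\ell})^{\eta-\gamma}$ under $Q_t$; the latter needs only
  $\gamma - \eta < \mathfrak s_1$. The limit is the reconstruction. Two reconstructions differ by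
  $D_t = Q_{t-s} D_s = O(s^{\gamma/\ell})$, so they agree. As everything is linear in the germ
  \<open>F\<close>, the estimates for two models are the estimates for the difference of their germs.

  Membership in the closure of exponent $\zeta = \alpha_0 \wedge 0 < \eta$ is a separate matter.
  If $\alpha_0 < 0$, then $t^{-\alpha_0/\ell} \|Q_t \Lambda\| \to 0$ since the lowest sector is
  approximated by smooth models, on which it is translation invariant. If $\alpha_0 \ge 0$, then
  $\Lambda$ is the function $y \mapsto (\Pi_y f(y))(y)$, which sees only the component of $f$ of
  degree 0; that component extends continuously across the hyperplane because $\eta > 0$.
\<close>

section \<open>The Cauchy kernel\<close>

text \<open>\<open>G\<close> is known only through decay conditions weighted by
  \<open>wstar\<close>, and it need not factorise, while \<open>phi\<close> depends on a single
  coordinate. So \<open>Q\<close> is dominated by a product of one-dimensional Cauchy kernels with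
  the same scaling. The singularity then meets one integral on the line, where it is |u| to the
  power -\<kappa>/s1 with \<kappa> = \<gamma> - \<eta>; integrability there is the condition \<eta>
  > \<gamma> - s1. Elements of the completion are handled as families stable under \<open>Q\<close>.
  The point that gives access to the closure of C(w) is that a stable family of order
  o(t^(\<zeta>/ell)) is approximated by its own member at a small time. Coherence and size of a germ
  carry separate constants, because the local bound is to depend on the increments of f alone,
  whereas the Besov bound needs both. Every constant is obtained before the germ is fixed, which is
  where the uniformity in models and modelled distributions comes from.\<close>

lemma nn_integral_cauchy:
  fixes x \<rho> :: real
  assumes "0 < \<rho>"
  shows "(\<integral>\<^sup>+u. ennreal (\<rho> / (\<rho>\<^sup>2 + (x - u)\<^sup>2)) \<partial>lborel) = ennreal pi"
proof -
  have "einterval (-\<infinity>) \<infinity> = (UNIV :: real set)"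
    by (auto simp: einterval_def)
  then have int: "integrable lborel (\<lambda>x::real. inverse (1 + x\<^sup>2))"
    and val: "(LINT x|lborel. inverse (1 + x\<^sup>2 :: real)) = pi"
    using integrable_inverse_1_plus_square LBINT_inverse_1_plus_square
    by (simp_all add: set_integrable_def interval_lebesgue_integral_def set_lebesgue_integral_def)
  have "(\<integral>\<^sup>+u. ennreal (\<rho> / (\<rho>\<^sup>2 + (x - u)\<^sup>2)) \<partial>lborel)
      = \<bar>\<rho>\<bar> * (\<integral>\<^sup>+u. ennreal (\<rho> / (\<rho>\<^sup>2 + (x - (x + \<rho> * u))\<^sup>2)) \<partial>lborel)"
    using assms by (intro nn_integral_real_affine) auto
  also have "\<dots> = (\<integral>\<^sup>+u. ennreal \<rho> * ennreal (\<rho> / (\<rho>\<^sup>2 + (x - (x + \<rho> * u))\<^sup>2)) \<partial>lborel)"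
    using assms by (simp add: nn_integral_cmult)
  also have "\<dots> = (\<integral>\<^sup>+u. ennreal (inverse (1 + u\<^sup>2)) \<partial>lborel)"
  proof (intro nn_integral_cong)
    fix u :: real
    have "\<rho>\<^sup>2 + (x - (x + \<rho> * u))\<^sup>2 = \<rho> * (\<rho> * (1 + u\<^sup>2))"
      by (simp add: power2_eq_square algebra_simps)
    then have "\<rho> * (\<rho> / (\<rho>\<^sup>2 + (x - (x + \<rho> * u))\<^sup>2)) = inverse (1 + u\<^sup>2)"
      using assms by (simp only: mult_divide_mult_cancel_left_if times_divide_eq_right) (simp add: inverse_eq_divide)
    then show "ennreal \<rho> * ennreal (\<rho> / (\<rho>\<^sup>2 + (x - (x + \<rho> * u))\<^sup>2)) = ennreal (inverse (1 + u\<^sup>2))"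
      using assms by (subst ennreal_mult[symmetric]) auto
  qed
  also have "\<dots> = ennreal pi"
    using int val by (subst nn_integral_eq_integral) auto
  finally show ?thesis .
qed

lemma nn_integral_abs_powr:
  fixes \<theta> \<delta> :: real
  assumes "0 \<le> \<theta>" "\<theta> < 1" "0 < \<delta>"
  shows "(\<integral>\<^sup>+u. ennreal (\<bar>u\<bar> powr (-\<theta>) * indicator {-\<delta>..\<delta>} u) \<partial>lborel) \<le> ennreal (2 * \<delta> powr (1 - \<theta>) / (1 - \<theta>))"
proof -
  let ?f = "\<lambda>u::real. \<bar>u\<bar> powr (-\<theta>)"
  have "((\<lambda>u. u powr (-\<theta>)) has_integral (\<delta> powr (-\<theta> + 1) / (-\<theta> + 1))) {0..\<delta>}"
    by (rule has_integral_powr_from_0) (use assms in auto)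
  then have "(?f has_integral (\<delta> powr (-\<theta> + 1) / (-\<theta> + 1))) {0..\<delta>}"
    by (rule has_integral_eq[rotated]) auto
  then have "(\<integral>\<^sup>+u. ennreal (indicator {0..\<delta>} u * ?f u) \<partial>lborel) = ennreal (\<delta> powr (-\<theta> + 1) / (-\<theta> + 1))"
    unfolding has_integral_restrict_UNIV[symmetric, of _ _ "{0..\<delta>}"]
    by (intro nn_integral_has_integral_lborel) (auto simp: indicator_def elim!: has_integral_eq[rotated])
  then have pos: "(\<integral>\<^sup>+u. ennreal (indicator {0..\<delta>} u * ?f u) \<partial>lborel) = ennreal (\<delta> powr (1 - \<theta>) / (1 - \<theta>))"
    by (simp add: algebra_simps)
  have "(\<integral>\<^sup>+u. ennreal (indicator {0..\<delta>} u * ?f u) \<partial>lborel)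
      = ennreal \<bar>-1\<bar> * (\<integral>\<^sup>+u. ennreal (indicator {0..\<delta>} (0 + (-1) * u) * ?f (0 + (-1) * u)) \<partial>lborel)"
    by (rule nn_integral_real_affine) auto
  then have neg: "(\<integral>\<^sup>+u. ennreal (indicator {0..\<delta>} (-u) * ?f u) \<partial>lborel) = ennreal (\<delta> powr (1 - \<theta>) / (1 - \<theta>))"
    using pos by simp
  have "(\<integral>\<^sup>+u. ennreal (?f u * indicator {-\<delta>..\<delta>} u) \<partial>lborel)
     \<le> (\<integral>\<^sup>+u. ennreal (indicator {0..\<delta>} u * ?f u) + ennreal (indicator {0..\<delta>} (-u) * ?f u) \<partial>lborel)"
    by (intro nn_integral_mono) (auto simp: indicator_def)
  also have "\<dots> = ennreal (\<delta> powr (1 - \<theta>) / (1 - \<theta>)) + ennreal (\<delta> powr (1 - \<theta>) / (1 - \<theta>))"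
    by (subst nn_integral_add) (simp_all add: pos neg)
  also have "\<dots> = ennreal (2 * \<delta> powr (1 - \<theta>) / (1 - \<theta>))"
    using assms by (subst ennreal_plus[symmetric]) (auto simp flip: add_divide_distrib)
  finally show ?thesis .
qed

text \<open>Split at |u| = \<delta>. Outside, the singular factor is at most \<delta> powr -\<theta>
  and the kernel has mass pi. Inside, the kernel is at most 1/\<delta> by \<open>small\<close>, and
  |u| powr -\<theta> integrates over [-\<delta>, \<delta>] to order \<delta> powr (1 - \<theta>).
  The hypothesis \<open>small\<close> covers two situations at once: a kernel of width at least
  \<delta>, and a kernel whose centre is far from the singularity.\<close>

lemma nn_integral_cauchy_powr:
  fixes x \<rho> \<theta> \<delta> :: real
  assumes "0 < \<rho>" "0 \<le> \<theta>" "\<theta> < 1" "0 < \<delta>" "\<delta> \<le> 1"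
    and small: "\<And>u. \<bar>u\<bar> < \<delta> \<Longrightarrow> \<rho> / (\<rho>\<^sup>2 + (x - u)\<^sup>2) \<le> 1 / \<delta>"
  shows "(\<integral>\<^sup>+u. ennreal (\<rho> / (\<rho>\<^sup>2 + (x - u)\<^sup>2) * min \<bar>u\<bar> 1 powr (-\<theta>)) \<partial>lborel)
           \<le> ennreal ((pi + 2 / (1 - \<theta>)) * \<delta> powr (-\<theta>))"
proof -
  have pt: "\<rho> / (\<rho>\<^sup>2 + (x - u)\<^sup>2) * min \<bar>u\<bar> 1 powr (-\<theta>)
     \<le> \<rho> / (\<rho>\<^sup>2 + (x - u)\<^sup>2) * \<delta> powr (-\<theta>) + 1 / \<delta> * (\<bar>u\<bar> powr (-\<theta>) * indicator {-\<delta>..\<delta>} u)" for u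
  proof (cases "\<bar>u\<bar> < \<delta>")
    case True
    have "\<rho> / (\<rho>\<^sup>2 + (x - u)\<^sup>2) * min \<bar>u\<bar> 1 powr (-\<theta>) \<le> 1 / \<delta> * \<bar>u\<bar> powr (-\<theta>)"
      using True \<open>\<delta> \<le> 1\<close> by (intro mult_mono small) auto
    moreover have "0 \<le> \<rho> / (\<rho>\<^sup>2 + (x - u)\<^sup>2) * \<delta> powr (-\<theta>)"
      using assms(1) by simp
    ultimately show ?thesis
      using True by (auto simp: indicator_def)
  next
    case False
    then have "min \<bar>u\<bar> 1 powr (-\<theta>) \<le> \<delta> powr (-\<theta>)"
      using assms by (intro powr_mono2') auto
    then have "\<rho> / (\<rho>\<^sup>2 + (x - u)\<^sup>2) * min \<bar>u\<bar> 1 powr (-\<theta>) \<le> \<rho> / (\<rho>\<^sup>2 + (x - u)\<^sup>2) * \<delta> powr (-\<theta>)"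
      using assms(1) by (intro mult_left_mono) auto
    moreover have "0 \<le> 1 / \<delta> * (\<bar>u\<bar> powr (-\<theta>) * indicator {-\<delta>..\<delta>} u)"
      using assms by simp
    ultimately show ?thesis by linarith
  qed
  have "(\<integral>\<^sup>+u. ennreal (\<rho> / (\<rho>\<^sup>2 + (x - u)\<^sup>2) * min \<bar>u\<bar> 1 powr (-\<theta>)) \<partial>lborel)
     \<le> (\<integral>\<^sup>+u. ennreal (\<rho> / (\<rho>\<^sup>2 + (x - u)\<^sup>2)) * ennreal (\<delta> powr (-\<theta>))
          + ennreal (1 / \<delta>) * ennreal (\<bar>u\<bar> powr (-\<theta>) * indicator {-\<delta>..\<delta>} u) \<partial>lborel)"
    using assms by (intro nn_integral_mono, subst ennreal_mult[symmetric], simp, simp,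
        subst ennreal_mult[symmetric], simp, simp, subst ennreal_plus[symmetric], simp, simp,
        intro ennreal_leI pt)
  also have "\<dots> = (\<integral>\<^sup>+u. ennreal (\<rho> / (\<rho>\<^sup>2 + (x - u)\<^sup>2)) \<partial>lborel) * ennreal (\<delta> powr (-\<theta>))
          + ennreal (1 / \<delta>) * (\<integral>\<^sup>+u. ennreal (\<bar>u\<bar> powr (-\<theta>) * indicator {-\<delta>..\<delta>} u) \<partial>lborel)"
    by (subst nn_integral_add) (simp_all add: nn_integral_multc nn_integral_cmult)
  also have "\<dots> \<le> ennreal pi * ennreal (\<delta> powr (-\<theta>)) + ennreal (1 / \<delta>) * ennreal (2 * \<delta> powr (1 - \<theta>) / (1 - \<theta>))"
    using assms by (intro add_mono mult_mono nn_integral_abs_powr) (auto simp: nn_integral_cauchy)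
  also have "\<dots> = ennreal (pi * \<delta> powr (-\<theta>) + 1 / \<delta> * (2 * \<delta> powr (1 - \<theta>) / (1 - \<theta>)))"
    using assms by (subst ennreal_plus) (auto simp: ennreal_mult simp flip: ennreal_mult intro!: mult_nonneg_nonneg)
  also have "1 / \<delta> * (2 * \<delta> powr (1 - \<theta>) / (1 - \<theta>)) = 2 / (1 - \<theta>) * \<delta> powr (-\<theta>)"
    using assms by (simp add: powr_diff powr_minus field_simps)
  finally show ?thesis by (simp add: algebra_simps)
qed

text \<open>\<open>nn_integral_lborel_prod\<close> factorises over \<open>Basis\<close>, while
  everything here is indexed by coordinates; \<open>THE i. b = axis i 1\<close> recovers the
  coordinate of a basis vector.\<close>

lemma prod_Basis_vec:
  fixes f :: "'n::finite \<Rightarrow> real \<Rightarrow> 'a::comm_monoid_mult"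
  shows "(\<Prod>b\<in>Basis. f (THE i. b = axis i 1) ((x::real^'n) \<bullet> b)) = (\<Prod>i\<in>UNIV. f i (x $ i))"
proof -
  have B: "(Basis :: (real^'n) set) = range (\<lambda>i. axis i 1)"
    by (auto simp: Basis_vec_def)
  have inj: "inj (\<lambda>i::'n. axis i (1::real))"
    by (auto intro!: injI simp: axis_eq_axis)
  show ?thesis
    unfolding B by (subst prod.reindex[OF inj]) (simp add: axis_eq_axis inner_axis)
qed

lemma nn_integral_prod_vec:
  fixes f :: "'n::finite \<Rightarrow> real \<Rightarrow> ennreal"
  assumes [measurable]: "\<And>i. f i \<in> borel_measurable borel"
  shows "(\<integral>\<^sup>+x. (\<Prod>i\<in>UNIV. f i ((x::real^'n) $ i)) \<partial>lborel) = (\<Prod>i\<in>UNIV. (\<integral>\<^sup>+u. f i u \<partial>lborel))"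
proof -
  have "(\<integral>\<^sup>+x. (\<Prod>i\<in>UNIV. f i ((x::real^'n) $ i)) \<partial>lborel)
      = (\<integral>\<^sup>+(x::real^'n). (\<Prod>b\<in>Basis. f (THE i. b = axis i 1) (x \<bullet> b)) \<partial>lborel)"
    by (simp only: prod_Basis_vec)
  also have "\<dots> = (\<Prod>b\<in>(Basis::(real^'n) set). (\<integral>\<^sup>+u. f (THE i. b = axis i 1) u \<partial>lborel))"
    by (rule nn_integral_lborel_prod) auto
  also have "\<dots> = (\<Prod>i\<in>UNIV. (\<integral>\<^sup>+u. f i u \<partial>lborel))"
    using prod_Basis_vec[of "\<lambda>i _. \<integral>\<^sup>+u. f i u \<partial>lborel"] by simp
  finally show ?thesis .
qed

text \<open>Up to a constant power of pi, a product of Cauchy densities whose width in coordinate i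
  is \<open>r powr (scl S $ i / ell S)\<close>, the scaling of \<open>Gt\<close>.\<close>

definition kern :: "('n::finite) setting \<Rightarrow> real \<Rightarrow> real^'n \<Rightarrow> real" where
  "kern S r x = (\<Prod>i\<in>UNIV. r powr (scl S $ i / ell S) / ((r powr (scl S $ i / ell S))\<^sup>2 + (x $ i)\<^sup>2))"

text \<open>The distance \<open>phi\<close> to the hyperplane as seen at the spatial resolution
  \<open>r powr (1 / ell S)\<close> of time r. Smoothing at time r replaces \<open>phi\<close> by
  this in all singular bounds.\<close>

definition pmax :: "('n::finite) setting \<Rightarrow> real \<Rightarrow> real^'n \<Rightarrow> real" where
  "pmax S r x = max (phi S x) (r powr (1 / ell S))"

locale gsemi =
  fixes S :: "('n::finite) setting"
  assumes semi: "G_semigroup S"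
begin

abbreviation "s1 \<equiv> scl S $ axis1 S"

lemma scl_ge1: "1 \<le> scl S $ i" and ell_pos: "0 < ell S"
  using semi by (auto simp: G_semigroup_def)

lemma s1_pos: "0 < s1"
  using scl_ge1[of "axis1 S"] by linarith

lemma phi_le1: "phi S x \<le> 1"
  by (auto simp: phi_def)

lemma phi_pos: "x \<in> off_hyp S \<Longrightarrow> 0 < phi S x"
  by (auto simp: phi_def off_hyp_def)

text \<open>Moving the truncation inside the power exhibits powers of \<open>phi\<close> as
  functions of one real coordinate, with the exponent divided by \<open>s1\<close>.\<close>

lemma phi_powr: "phi S x powr a = min \<bar>x $ axis1 S\<bar> 1 powr (a / s1)"
proof -
  have "phi S x = min \<bar>x $ axis1 S\<bar> 1 powr (1 / s1)"
    using s1_pos by (cases "\<bar>x $ axis1 S\<bar> \<le> 1") (auto simp: phi_def min_def ge_one_powr_ge_zero powr_mono2 powr_le1 not_le dest: powr_less_mono2[of "1/s1" 1] intro!: antisym)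
  then show ?thesis by (simp add: powr_powr)
qed

lemma continuous_phi: "continuous_on UNIV (phi S)"
  unfolding phi_def using s1_pos by (intro continuous_intros continuous_on_powr') auto

lemma phi_measurable [measurable]: "phi S \<in> borel_measurable borel"
  using continuous_phi by (rule borel_measurable_continuous_onI)

lemma off_hyp_sets [measurable]: "off_hyp S \<in> sets borel"
  unfolding off_hyp_def by measurable

lemma kern_pos: "0 < r \<Longrightarrow> 0 < kern S r x"
  unfolding kern_def by (intro prod_pos) (auto intro!: divide_pos_pos add_pos_nonneg)

lemma kern_measurable [measurable]: "kern S r \<in> borel_measurable borel"
  unfolding kern_def by measurable

lemma pmax_pos: "0 < r \<Longrightarrow> 0 < pmax S r x"
  by (auto simp: pmax_def less_max_iff_disj)

lemma pmax_le1: "0 < r \<Longrightarrow> r \<le> 1 \<Longrightarrow> pmax S r x \<le> 1"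
  using ell_pos by (auto simp: pmax_def phi_le1 powr_le1)

text \<open>Both factors split over the coordinates, so the integral is a product: pi for each
  coordinate other than \<open>axis1 S\<close>, and there one Cauchy integral against a power above
  -1.\<close>

lemma kern_phi_integral:
  assumes "0 \<le> \<kappa>" "\<kappa> < s1"
  obtains C where "0 < C"
    "\<And>r x. 0 < r \<Longrightarrow> r \<le> 1 \<Longrightarrow>
       (\<integral>\<^sup>+z. ennreal (kern S r (x - z) * phi S z powr (-\<kappa>)) \<partial>lborel) \<le> ennreal (C * pmax S r x powr (-\<kappa>))"
proof
  define \<theta> where "\<theta> = \<kappa> / s1"
  have th: "0 \<le> \<theta>" "\<theta> < 1"
    using assms s1_pos by (auto simp: \<theta>_def)
  let ?C1 = "(pi + 2 / (1 - \<theta>)) * 2 powr \<theta>"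
  let ?C = "?C1 * pi ^ card (UNIV - {axis1 S})"
  show "0 < ?C"
    using th by (intro mult_pos_pos add_pos_pos) (auto simp: pi_gt_zero)
  fix r x assume r: "0 < r" "r \<le> (1::real)"
  define M where "M = pmax S r x"
  \<comment> \<open>\<open>M powr s1\<close> is either the kernel width in the first coordinate or
    min |x1| 1. With half of it, |u| < \<delta> leaves u at distance at least \<delta> from x1 in
    the second case, so \<open>small\<close> holds in both.\<close>
  define \<delta> where "\<delta> = M powr s1 / 2"
  let ?\<rho> = "\<lambda>i. r powr (scl S $ i / ell S)"
  have M: "0 < M" "M \<le> 1" using r by (auto simp: M_def pmax_pos pmax_le1)
  then have \<delta>: "0 < \<delta>" "\<delta> \<le> 1" using powr_le1[of s1 M] s1_pos by (auto simp: \<delta>_def)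
  have small: "?\<rho> (axis1 S) / ((?\<rho> (axis1 S))\<^sup>2 + (x $ axis1 S - u)\<^sup>2) \<le> 1 / \<delta>" if u: "\<bar>u\<bar> < \<delta>" for u
  proof -
    let ?p = "?\<rho> (axis1 S)"
    have p: "0 < ?p" using r by simp
    consider "M = r powr (1 / ell S)" | "M = phi S x" unfolding M_def pmax_def max_def by metis
    then show ?thesis
    proof cases
      case 1
      have "?p / (?p\<^sup>2 + (x $ axis1 S - u)\<^sup>2) \<le> ?p / ?p\<^sup>2"
        using p by (intro divide_left_mono) (auto intro!: mult_pos_pos add_pos_nonneg)
      also have "\<dots> = 1 / ?p" using p by (simp add: power2_eq_square)
      also have "\<dots> \<le> 1 / \<delta>"
      proof -
        have "?p = 2 * \<delta>" using 1 r by (simp add: \<delta>_def powr_powr)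
        then show ?thesis using \<delta> by (simp add: field_simps)
      qed
      finally show ?thesis .
    next
      case 2
      have "2 * \<delta> = min \<bar>x $ axis1 S\<bar> 1" using s1_pos by (simp add: \<delta>_def 2 phi_powr)
      then have "2 * \<delta> \<le> \<bar>x $ axis1 S\<bar>" by linarith
      with u have d: "\<delta> \<le> \<bar>x $ axis1 S - u\<bar>" by linarith
      then have d2: "\<delta>\<^sup>2 \<le> (x $ axis1 S - u)\<^sup>2"
        using \<delta> by (metis abs_le_square_iff abs_of_pos)
      have "?p * \<delta> \<le> ?p\<^sup>2 + \<delta>\<^sup>2"
        using sum_squares_bound[of ?p \<delta>] p \<delta> mult_pos_pos[of ?p \<delta>] by linarith
      also have "\<dots> \<le> ?p\<^sup>2 + (x $ axis1 S - u)\<^sup>2" using d2 by simp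
      finally have "?p * \<delta> \<le> ?p\<^sup>2 + (x $ axis1 S - u)\<^sup>2" .
      then have "?p / (?p\<^sup>2 + (x $ axis1 S - u)\<^sup>2) \<le> ?p / (?p * \<delta>)"
        using p \<delta> by (intro divide_left_mono) (auto intro!: mult_pos_pos add_pos_nonneg)
      then show ?thesis using p by simp
    qed
  qed
  let ?f = "\<lambda>i u. ennreal (if i = axis1 S then ?\<rho> i / ((?\<rho> i)\<^sup>2 + (x $ i - u)\<^sup>2) * min \<bar>u\<bar> 1 powr (-\<theta>) else ?\<rho> i / ((?\<rho> i)\<^sup>2 + (x $ i - u)\<^sup>2))"
  have split: "(\<Prod>i\<in>UNIV. g i) = g (axis1 S) * (\<Prod>i\<in>UNIV - {axis1 S}. g i)" for g :: "'n \<Rightarrow> 'b::comm_monoid_mult"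
    by (rule prod.remove) auto
  have "ennreal (kern S r (x - z) * phi S z powr (-\<kappa>)) = (\<Prod>i\<in>UNIV. ?f i (z $ i))" for z
    unfolding kern_def
    by (subst prod_ennreal)
       (auto simp: split phi_powr \<theta>_def mult.assoc mult.commute intro!: arg_cong[where f=ennreal])
  then have "(\<integral>\<^sup>+z. ennreal (kern S r (x - z) * phi S z powr (-\<kappa>)) \<partial>lborel) = (\<Prod>i\<in>UNIV. \<integral>\<^sup>+u. ?f i u \<partial>lborel)"
    by (simp only:, intro nn_integral_prod_vec) measurable
  also have "\<dots> \<le> ennreal ((pi + 2 / (1 - \<theta>)) * \<delta> powr (-\<theta>)) * (\<Prod>i\<in>UNIV - {axis1 S}. ennreal pi)"
    unfolding split
  proof (intro mult_mono prod_mono_ennreal)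
    show "(\<integral>\<^sup>+u. ?f (axis1 S) u \<partial>lborel) \<le> ennreal ((pi + 2 / (1 - \<theta>)) * \<delta> powr (-\<theta>))"
      using nn_integral_cauchy_powr[OF _ th \<delta> small] r by simp
  qed (use r in \<open>auto simp: nn_integral_cauchy\<close>)
  also have "\<dots> = ennreal (((pi + 2 / (1 - \<theta>)) * \<delta> powr (-\<theta>)) * pi ^ card (UNIV - {axis1 S}))"
    using th by (simp add: ennreal_mult prod_ennreal ennreal_power)
  also have "\<delta> powr (-\<theta>) = 2 powr \<theta> * M powr (-\<kappa>)"
    using M s1_pos by (simp add: \<delta>_def powr_divide powr_powr \<theta>_def powr_minus field_simps)
  finally show "(\<integral>\<^sup>+z. ennreal (kern S r (x - z) * phi S z powr (-\<kappa>)) \<partial>lborel) \<le> ennreal (?C * pmax S r x powr (-\<kappa>))"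
    by (simp add: M_def mult_ac)
qed

end

section \<open>The action of the semigroup on weighted functions\<close>

text \<open>A weighted sup bound that tolerates a singularity of order \<kappa> at the hyperplane.
  It is imposed on \<open>off_hyp S\<close>, a set of full measure, so that functions that are
  singular on the hyperplane qualify.\<close>

definition dominated :: "('n::finite) setting \<Rightarrow> 'n weight \<Rightarrow> real \<Rightarrow> real \<Rightarrow> (real^'n \<Rightarrow> real) \<Rightarrow> bool" where
  "dominated S u \<kappa> B g \<longleftrightarrow>
     g \<in> borel_measurable borel \<and> (\<forall>z\<in>off_hyp S. \<bar>g z\<bar> \<le> B * phi S z powr (-\<kappa>) / wfun u z)"

text \<open>The operator behind \<open>qfam\<close> without the cut-off to times in (0, 1].\<close>

definition qint :: "('n::finite) setting \<Rightarrow> real \<Rightarrow> (real^'n \<Rightarrow> real) \<Rightarrow> real^'n \<Rightarrow> real" where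
  "qint S r g x = (LINT y|lborel. Qker S r x y * g y)"

text \<open>The scaled norm in units of the resolution at time r; in this variable the moments of
  the kernel are bounded uniformly in r.\<close>

definition snormr :: "('n::finite) setting \<Rightarrow> real \<Rightarrow> real^'n \<Rightarrow> real" where
  "snormr S r x = snorm S x / r powr (1 / ell S)"

lemma
  assumes "G_controlled S u"
  shows wfun_pos: "0 < wfun u x" and wfun_le1: "wfun u x \<le> 1"
    and wstar_ge1: "1 \<le> wstar u x"
    and wfun_add_le: "wfun u (x + y) \<le> wstar u x * wfun u y"
    and continuous_wfun: "continuous_on UNIV (wfun u)"
    and continuous_wstar: "continuous_on UNIV (wstar u)"
  using assms by (auto simp: G_controlled_def is_weight_def)

lemma wfun_measurable: "G_controlled S u \<Longrightarrow> wfun u \<in> borel_measurable borel"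
  and wstar_measurable: "G_controlled S u \<Longrightarrow> wstar u \<in> borel_measurable borel"
  by (auto intro: borel_measurable_continuous_onI continuous_wfun continuous_wstar)

text \<open>Trades the weight at the integration point for the weight at the evaluation point. The
  price depends on the difference of the points alone and is paid by the decay of the
  kernel.\<close>

lemma inverse_wfun_le:
  assumes "G_controlled S u"
  shows "1 / wfun u z \<le> wstar u (x - z) / wfun u x"
  using wfun_add_le[OF assms, of "x - z" z] wfun_pos[OF assms, of x] wfun_pos[OF assms, of z]
  by (simp add: field_simps)

lemma one_plus_power_le:
  fixes s :: real
  assumes "0 \<le> s"
  shows "(1 + s) ^ M \<le> 2 ^ M * (1 + s ^ M)"
proof -
  have "(1 + s) ^ M \<le> (2 * max 1 s) ^ M"
    using assms by (intro power_mono) auto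
  also have "\<dots> = 2 ^ M * max 1 s ^ M" by (simp add: power_mult_distrib)
  also have "\<dots> \<le> 2 ^ M * (1 + s ^ M)"
    using assms by (intro mult_left_mono) (auto simp: max_def)
  finally show ?thesis .
qed

context gsemi
begin

section \<open>The scaled norm and domination of the semigroup by the Cauchy kernel\<close>

lemma snorm_nonneg: "0 \<le> snorm S x"
  unfolding snorm_def by (intro sum_nonneg) auto

lemma snorm_minus_commute: "snorm S (x - y) = snorm S (y - x)"
  unfolding snorm_def by (simp add: abs_minus_commute)

lemma snormr_nonneg: "0 \<le> snormr S r x"
  unfolding snormr_def by (simp add: snorm_nonneg)

lemma continuous_snorm: "continuous_on UNIV (snorm S)"
  unfolding snorm_def
proof (intro continuous_on_sum continuous_on_powr')
  show "\<forall>x\<in>UNIV. 0 \<le> \<bar>(x::real^'n) $ i\<bar> \<and> (\<bar>x $ i\<bar> = 0 \<longrightarrow> 0 < 1 / scl S $ i)" for i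
    using scl_ge1[of i] by auto
qed (intro continuous_intros)+

lemma snorm_measurable [measurable]: "snorm S \<in> borel_measurable borel"
  by (rule borel_measurable_continuous_onI[OF continuous_snorm])

lemma snormr_measurable [measurable]: "snormr S r \<in> borel_measurable borel"
  unfolding snormr_def by measurable

lemma component_le_snorm: "\<bar>x $ i\<bar> \<le> snorm S x powr (scl S $ i)"
proof -
  have "\<bar>x $ i\<bar> powr (1 / scl S $ i) \<le> snorm S x"
    unfolding snorm_def by (rule member_le_sum) auto
  then have "(\<bar>x $ i\<bar> powr (1 / scl S $ i)) powr (scl S $ i) \<le> snorm S x powr (scl S $ i)"
    using scl_ge1[of i] by (intro powr_mono2) auto
  then show ?thesis
    using scl_ge1[of i] by (simp add: powr_powr)
qed

lemma snorm_pos: "x \<noteq> 0 \<Longrightarrow> 0 < snorm S x"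
proof (rule ccontr)
  assume "x \<noteq> 0" "\<not> 0 < snorm S x"
  then have "snorm S x = 0" using snorm_nonneg[of x] by linarith
  then have "\<bar>x $ i\<bar> \<le> 0" for i using component_le_snorm[of x i] by simp
  with \<open>x \<noteq> 0\<close> show False by (auto simp: vec_eq_iff)
qed

lemma snorm_0 [simp]: "snorm S 0 = 0"
  by (simp add: snorm_def)

lemma sdil_inverse:
  assumes "0 < r"
  shows "sdil S r (sdil S (1 / r) x) = x"
  using assms by (simp add: sdil_def vec_eq_iff powr_divide)

lemma snorm_sdil:
  assumes "0 < r"
  shows "snorm S (sdil S (1 / r) x) = snormr S r x"
proof -
  have "\<bar>(1 / r) powr (scl S $ i / ell S) * x $ i\<bar> powr (1 / scl S $ i) = \<bar>x $ i\<bar> powr (1 / scl S $ i) / r powr (1 / ell S)" for i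
    using assms scl_ge1[of i] by (simp add: abs_mult powr_mult powr_powr powr_divide)
  then show ?thesis
    by (simp add: snorm_def sdil_def snormr_def sum_divide_distrib)
qed

text \<open>Shows that \<open>kern\<close> scales exactly like \<open>Gt\<close>, so that the two
  need to be compared at unit scale only.\<close>

lemma kern_eq:
  assumes "0 < r"
  shows "kern S r x = r powr (- sdim S / ell S) * (\<Prod>i\<in>UNIV. 1 / (1 + (sdil S (1 / r) x $ i)\<^sup>2))"
proof -
  have 1: "r powr (scl S $ i / ell S) / ((r powr (scl S $ i / ell S))\<^sup>2 + (x $ i)\<^sup>2)
      = r powr (- scl S $ i / ell S) * (1 / (1 + (sdil S (1 / r) x $ i)\<^sup>2))" for i
  proof -
    define p where "p = r powr (scl S $ i / ell S)"
    have p: "0 < p" using assms by (simp add: p_def)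
    have "sdil S (1 / r) x $ i = x $ i / p" "r powr (- scl S $ i / ell S) = 1 / p"
      using assms by (simp_all add: sdil_def p_def powr_divide powr_minus_divide)
    moreover have "p / (p\<^sup>2 + (x $ i)\<^sup>2) = 1 / p * (1 / (1 + (x $ i / p)\<^sup>2))"
      using p by (simp add: power_divide divide_simps power2_eq_square add_pos_nonneg)
    ultimately show ?thesis by (simp add: p_def)
  qed
  have "(\<Prod>i\<in>UNIV. r powr (- scl S $ i / ell S)) = r powr (\<Sum>i\<in>UNIV. - scl S $ i / ell S)"
    using assms by (subst powr_sum) auto
  also have "(\<Sum>i\<in>UNIV. - scl S $ i / ell S) = - sdim S / ell S"
    by (simp add: sdim_def sum_divide_distrib sum_negf)
  finally show ?thesis
    unfolding kern_def by (simp only: 1 prod.distrib)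
qed

text \<open>By scaling it suffices to look at \<open>y = sdil S (1 / r) x\<close>. If m bounds all
  scalings, the denominators of the Cauchy product at y are at most 2^d (1 + |y|)^(2md), so a moment
  of \<open>Gfun\<close> absorbs them; the degree M pays for these and for the N extra powers. As r
  \<le> 1, the decay condition is used with T = 1 at the point
  \<open>x = sdil S r y\<close>.\<close>

lemma Gt_le_kern:
  assumes u: "G_controlled S u"
  obtains C where "0 < C"
    "\<And>r x. 0 < r \<Longrightarrow> r \<le> 1 \<Longrightarrow> Gt S r x * wstar u x * (1 + snormr S r x) ^ N \<le> C * kern S r x"
proof -
  obtain m :: nat where m: "sdim S \<le> real m" using real_arch_simple by blast
  have sm: "scl S $ i \<le> real m" for i
  proof -
    have "scl S $ i \<le> sdim S"
      unfolding sdim_def using scl_ge1 by (intro member_le_sum) (auto intro: order_trans[OF _ scl_ge1])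
    with m show ?thesis by linarith
  qed
  let ?d = "CARD('n)"
  define M where "M = N + 2 * m * ?d"
  have bd: "(\<Prod>i\<in>UNIV. 1 + (y $ i)\<^sup>2) \<le> 2 ^ ?d * (1 + snorm S y) ^ (2 * m * ?d)" for y :: "real^'n"
  proof -
    have "(\<Prod>i\<in>UNIV. 1 + (y $ i)\<^sup>2) \<le> (\<Prod>i\<in>(UNIV::'n set). 2 * (1 + snorm S y) ^ (2 * m))"
    proof (intro prod_mono conjI)
      fix i
      let ?b = "(1 + snorm S y) ^ m"
      have "\<bar>y $ i\<bar> \<le> snorm S y powr (scl S $ i)" by (rule component_le_snorm)
      also have "\<dots> \<le> (1 + snorm S y) powr (scl S $ i)"
        using scl_ge1[of i] snorm_nonneg by (intro powr_mono2) auto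
      also have "\<dots> \<le> (1 + snorm S y) powr (real m)"
        using sm snorm_nonneg by (intro powr_mono) auto
      also have "\<dots> = ?b" using snorm_nonneg[of y] by (intro powr_realpow) linarith
      finally have "(y $ i)\<^sup>2 \<le> ?b\<^sup>2" by (metis abs_ge_zero power2_abs power_mono)
      moreover have "1 \<le> ?b\<^sup>2" using snorm_nonneg[of y] by (intro one_le_power) auto
      ultimately show "1 + (y $ i)\<^sup>2 \<le> 2 * (1 + snorm S y) ^ (2 * m)"
        by (simp add: power_mult[symmetric] mult.commute)
    qed (auto intro: add_nonneg_nonneg)
    also have "\<dots> = 2 ^ ?d * (1 + snorm S y) ^ (2 * m * ?d)"
      by (simp add: power_mult_distrib power_mult)
    finally show ?thesis .
  qed
  from u have dec: "\<forall>(n::nat) T. 0 < T \<longrightarrow>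
        (\<exists>C. \<forall>t x. 0 < t \<and> t \<le> T \<longrightarrow> snorm S x ^ n * wstar u (sdil S t x) * Gfun S x \<le> C)"
    by (simp add: G_controlled_def)
  from dec[rule_format, of 1 0] obtain C0 where
    C0: "\<And>t x. 0 < t \<Longrightarrow> t \<le> 1 \<Longrightarrow> wstar u (sdil S t x) * Gfun S x \<le> C0" by auto
  from dec[rule_format, of 1 M] obtain CM where
    CM: "\<And>t x. 0 < t \<Longrightarrow> t \<le> 1 \<Longrightarrow> snorm S x ^ M * wstar u (sdil S t x) * Gfun S x \<le> CM" by auto
  have Gnn: "0 \<le> Gfun S x" for x using semi by (auto simp: G_semigroup_def)
  define C where "C = 2 ^ ?d * (2 ^ M * (\<bar>C0\<bar> + \<bar>CM\<bar> + 1))"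
  show ?thesis
  proof
    show "0 < C" unfolding C_def by (intro mult_pos_pos) auto
    fix r :: real and x :: "real^'n" assume r: "0 < r" "r \<le> 1"
    define y where "y = sdil S (1 / r) x"
    have x: "sdil S r y = x" using r by (simp add: y_def sdil_inverse)
    have sn: "snormr S r x = snorm S y" using r by (simp add: y_def snorm_sdil)
    have wG: "0 \<le> wstar u x * Gfun S y" using Gnn wstar_ge1[OF u, of x] by auto
    have "Gfun S y * wstar u x * (1 + snorm S y) ^ N * (\<Prod>i\<in>UNIV. 1 + (y $ i)\<^sup>2)
       \<le> Gfun S y * wstar u x * (1 + snorm S y) ^ N * (2 ^ ?d * (1 + snorm S y) ^ (2 * m * ?d))"
      using wG snorm_nonneg[of y] by (intro mult_left_mono[OF bd]) (auto simp: mult.commute)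
    also have "\<dots> = 2 ^ ?d * ((wstar u x * Gfun S y) * (1 + snorm S y) ^ M)"
      by (simp add: M_def power_add)
    also have "\<dots> \<le> 2 ^ ?d * ((wstar u x * Gfun S y) * (2 ^ M * (1 + snorm S y ^ M)))"
      using wG snorm_nonneg[of y] by (intro mult_left_mono one_plus_power_le) auto
    also have "\<dots> = 2 ^ ?d * (2 ^ M * (wstar u x * Gfun S y + snorm S y ^ M * wstar u x * Gfun S y))"
      by (simp add: algebra_simps)
    also have "\<dots> \<le> C"
      unfolding C_def using C0[of r y] CM[of r y] r by (intro mult_left_mono) (auto simp: x)
    finally have main: "Gfun S y * wstar u x * (1 + snorm S y) ^ N * (\<Prod>i\<in>UNIV. 1 + (y $ i)\<^sup>2) \<le> C" .
    have pp: "0 < (\<Prod>i\<in>UNIV. 1 + (y $ i)\<^sup>2)" by (intro prod_pos) (auto intro: add_pos_nonneg)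
    have "Gfun S y * wstar u x * (1 + snorm S y) ^ N \<le> C * (1 / (\<Prod>i\<in>UNIV. 1 + (y $ i)\<^sup>2))"
      using main pp by (simp add: field_simps)
    then have "r powr (- sdim S / ell S) * (Gfun S y * wstar u x * (1 + snorm S y) ^ N)
       \<le> r powr (- sdim S / ell S) * (C * (1 / (\<Prod>i\<in>UNIV. 1 + (y $ i)\<^sup>2)))"
      by (intro mult_left_mono) auto
    then show "Gt S r x * wstar u x * (1 + snormr S r x) ^ N \<le> C * kern S r x"
      using r by (simp add: Gt_def kern_eq sn y_def[symmetric] prod_dividef mult_ac)
  qed
qed

lemma Q_le_kern:
  assumes u: "G_controlled S u"
  obtains C where "0 < C"
    "\<And>r x y. 0 < r \<Longrightarrow> r \<le> 1 \<Longrightarrow>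
       \<bar>Qker S r x y\<bar> * (wstar u (x - y) * (1 + snormr S r (x - y)) ^ N) \<le> C * kern S r (x - y)"
proof -
  obtain C where C: "0 < C" "\<And>r x. 0 < r \<Longrightarrow> r \<le> 1 \<Longrightarrow> Gt S r x * wstar u x * (1 + snormr S r x) ^ N \<le> C * kern S r x"
    using Gt_le_kern[OF u, of N] by blast
  have "\<exists>C1>0. \<forall>t>0. \<forall>x y. \<bar>Qker S t x y\<bar> \<le> C1 * Gt S t (x - y)"
    using semi unfolding G_semigroup_def by (elim conjE) assumption
  then obtain C1 where C1: "C1 > 0" "\<And>t x y. t > 0 \<Longrightarrow> \<bar>Qker S t x y\<bar> \<le> C1 * Gt S t (x - y)"
    by auto
  show ?thesis
  proof
    show "0 < C1 * C" using C C1 by simp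
    fix r :: real and x y assume r: "0 < r" "r \<le> 1"
    have "\<bar>Qker S r x y\<bar> * (wstar u (x - y) * (1 + snormr S r (x - y)) ^ N)
       \<le> C1 * Gt S r (x - y) * (wstar u (x - y) * (1 + snormr S r (x - y)) ^ N)"
      using C1(2)[OF r(1)] wstar_ge1[OF u, of "x - y"] snormr_nonneg[of r "x - y"]
      by (intro mult_right_mono) (auto intro!: mult_nonneg_nonneg)
    also have "\<dots> = C1 * (Gt S r (x - y) * wstar u (x - y) * (1 + snormr S r (x - y)) ^ N)" by simp
    also have "\<dots> \<le> C1 * (C * kern S r (x - y))"
      using C1 C(2)[OF r] by (intro mult_left_mono) auto
    finally show "\<bar>Qker S r x y\<bar> * (wstar u (x - y) * (1 + snormr S r (x - y)) ^ N) \<le> C1 * C * kern S r (x - y)"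
      by simp
  qed
qed

text \<open>For times bounded away from 0 the kernels have one common majorant, which makes time
  increments integrable uniformly.\<close>

lemma kern_le_kern1:
  assumes "0 < \<delta>" "\<delta> \<le> r" "r \<le> 1"
  shows "kern S r x \<le> (\<Prod>i\<in>UNIV. 1 / (\<delta> powr (scl S $ i / ell S))\<^sup>2) * kern S 1 x"
  unfolding kern_def prod.distrib[symmetric]
proof (intro prod_mono conjI)
  fix i
  let ?p = "r powr (scl S $ i / ell S)" and ?q = "\<delta> powr (scl S $ i / ell S)"
  have e: "0 \<le> scl S $ i / ell S" using ell_pos scl_ge1[of i] by auto
  have p: "?q \<le> ?p" "?p \<le> 1" "0 < ?q"
    using assms e by (auto intro!: powr_mono2 powr_le1)
  then have q2: "?q\<^sup>2 \<le> ?p\<^sup>2" "?q\<^sup>2 \<le> 1" by (auto intro!: power_mono power_le_one)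
  have "?q\<^sup>2 * (1 + (x $ i)\<^sup>2) = ?q\<^sup>2 + ?q\<^sup>2 * (x $ i)\<^sup>2" by (simp add: algebra_simps)
  also have "\<dots> \<le> ?p\<^sup>2 + 1 * (x $ i)\<^sup>2"
    using q2 by (intro add_mono mult_right_mono) auto
  finally have "?p / (?p\<^sup>2 + (x $ i)\<^sup>2) \<le> 1 / (?q\<^sup>2 * (1 + (x $ i)\<^sup>2))"
    using p by (intro frac_le) (auto intro!: mult_pos_pos add_pos_nonneg)
  then show "?p / (?p\<^sup>2 + (x $ i)\<^sup>2) \<le> 1 / ?q\<^sup>2 * (1 powr (scl S $ i / ell S) / ((1 powr (scl S $ i / ell S))\<^sup>2 + (x $ i)\<^sup>2))"
    by simp
qed (auto intro!: divide_nonneg_nonneg add_nonneg_nonneg)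

text \<open>For centres whose coordinates differ by at most R one has b^2 \<le> 2 a^2 + 2 R^2 in
  each coordinate, so the kernels are comparable. This yields a single dominating function while the
  evaluation point moves.\<close>

lemma kern_shift:
  assumes "0 < r" "\<And>i. \<bar>(x - x0) $ i\<bar> \<le> R"
  shows "kern S r (x - z) \<le> (\<Prod>i\<in>UNIV. 2 * (1 + R\<^sup>2 / (r powr (scl S $ i / ell S))\<^sup>2)) * kern S r (x0 - z)"
  unfolding kern_def prod.distrib[symmetric]
proof (intro prod_mono conjI)
  fix i
  let ?p = "r powr (scl S $ i / ell S)" and ?a = "(x - z) $ i" and ?b = "(x0 - z) $ i"
  have p: "0 < ?p" using assms by simp
  have "?b = ?a - (x - x0) $ i" by simp
  then have "?b\<^sup>2 \<le> 2 * ?a\<^sup>2 + 2 * ((x - x0) $ i)\<^sup>2"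
    using sum_squares_bound[of ?a "- ((x - x0) $ i)"] by (simp add: power2_eq_square algebra_simps)
  also have "((x - x0) $ i)\<^sup>2 \<le> R\<^sup>2"
    using assms(2)[of i] by (metis abs_ge_zero power2_abs power_mono)
  finally have b: "?b\<^sup>2 \<le> 2 * ?a\<^sup>2 + 2 * R\<^sup>2" by simp
  let ?K = "2 * (1 + R\<^sup>2 / ?p\<^sup>2)"
  have "?p\<^sup>2 + ?b\<^sup>2 \<le> ?K * ?p\<^sup>2 + 2 * ?a\<^sup>2"
  proof -
    have "?K * ?p\<^sup>2 = 2 * ?p\<^sup>2 + 2 * R\<^sup>2" using p by (simp add: field_simps)
    then show ?thesis using b zero_le_power2[of ?p] by linarith
  qed
  also have "\<dots> \<le> ?K * ?p\<^sup>2 + ?K * ?a\<^sup>2"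
    by (intro add_mono mult_right_mono) auto
  finally have "?p\<^sup>2 + ?b\<^sup>2 \<le> ?K * (?p\<^sup>2 + ?a\<^sup>2)" by (simp add: algebra_simps)
  moreover have "0 < ?p\<^sup>2 + ?a\<^sup>2" "0 < ?p\<^sup>2 + ?b\<^sup>2" using p by (auto intro: add_pos_nonneg)
  ultimately have "1 / (?p\<^sup>2 + ?a\<^sup>2) \<le> ?K / (?p\<^sup>2 + ?b\<^sup>2)"
  proof -
    have "1 / A \<le> K / B" if "B \<le> K * A" "0 < A" "0 < B" for A B K :: real
      using that by (simp add: field_simps)
    then show "?p\<^sup>2 + ?b\<^sup>2 \<le> ?K * (?p\<^sup>2 + ?a\<^sup>2) \<Longrightarrow> 0 < ?p\<^sup>2 + ?a\<^sup>2 \<Longrightarrow> 0 < ?p\<^sup>2 + ?b\<^sup>2 \<Longrightarrow> ?thesis"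
      by blast
  qed
  from mult_left_mono[OF this, of ?p] p
  show "?p / (?p\<^sup>2 + ?a\<^sup>2) \<le> ?K * (?p / (?p\<^sup>2 + ?b\<^sup>2))"
    by (simp add: mult_ac)
qed (auto intro!: divide_nonneg_nonneg add_nonneg_nonneg)

section \<open>Weighted integral bounds, continuity and the semigroup law for the operators\<close>

lemma continuous_Q: "0 < r \<Longrightarrow> continuous_on UNIV (\<lambda>(x, y). Qker S r x y)"
  using semi by (simp add: G_semigroup_def)

lemma continuous_Q1: "0 < r \<Longrightarrow> continuous_on UNIV (\<lambda>x. Qker S r x y)"
  and continuous_Q2: "0 < r \<Longrightarrow> continuous_on UNIV (\<lambda>y. Qker S r x y)"
  using continuous_on_compose2[OF continuous_Q, of r UNIV "\<lambda>x. (x, y)"]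
    continuous_on_compose2[OF continuous_Q, of r UNIV "\<lambda>y. (x, y)"]
  by (simp_all add: continuous_on_Pair continuous_on_id continuous_on_const)

lemma Q_measurable2: "0 < r \<Longrightarrow> Qker S r x \<in> borel_measurable borel"
  using borel_measurable_continuous_onI[OF continuous_Q2] by simp

lemma Q_measurable: "0 < r \<Longrightarrow> (\<lambda>(x, y). Qker S r x y) \<in> borel_measurable (lborel \<Otimes>\<^sub>M lborel)"
  using borel_measurable_continuous_onI[OF continuous_Q] by (simp add: lborel_prod)

lemma AE_off_hyp: "AE z in lborel. z \<in> off_hyp S"
proof -
  have "negligible {x::real^'n. axis (axis1 S) 1 \<bullet> x = 0}"
    by (rule negligible_hyperplane) (simp add: axis_eq_0_iff)
  moreover have "{x::real^'n. axis (axis1 S) 1 \<bullet> x = 0} = - off_hyp S"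
    by (auto simp: off_hyp_def inner_axis')
  ultimately have "- off_hyp S \<in> null_sets lebesgue"
    by (simp add: negligible_iff_null_sets)
  moreover have "- off_hyp S \<in> sets lborel" by simp
  ultimately have "- off_hyp S \<in> null_sets lborel"
    by (subst (asm) null_sets_completion_iff) auto
  then show ?thesis by (rule AE_I') auto
qed

text \<open>The three factors have separate purposes: \<open>wstar\<close> moves the weight, the
  powers of 1 + \<open>snormr\<close> pay for the polynomial growth of local errors, and
  \<open>phi\<close> powr -\<kappa> is the singularity, which the kernel regularises to
  \<open>pmax\<close>.\<close>

lemma Q_weighted_integral:
  assumes u: "G_controlled S u" and k: "0 \<le> \<kappa>" "\<kappa> < s1"
  obtains C where "0 < C"
    "\<And>r x. 0 < r \<Longrightarrow> r \<le> 1 \<Longrightarrow>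
       integrable lborel (\<lambda>z. \<bar>Qker S r x z\<bar> * (wstar u (x - z) * (1 + snormr S r (x - z)) ^ N) * phi S z powr (-\<kappa>))"
    "\<And>r x. 0 < r \<Longrightarrow> r \<le> 1 \<Longrightarrow>
       (LINT z|lborel. \<bar>Qker S r x z\<bar> * (wstar u (x - z) * (1 + snormr S r (x - z)) ^ N) * phi S z powr (-\<kappa>))
          \<le> C * pmax S r x powr (-\<kappa>)"
proof -
  obtain C1 where C1: "0 < C1"
    "\<And>r x y. 0 < r \<Longrightarrow> r \<le> 1 \<Longrightarrow> \<bar>Qker S r x y\<bar> * (wstar u (x - y) * (1 + snormr S r (x - y)) ^ N) \<le> C1 * kern S r (x - y)"
    using Q_le_kern[OF u] by blast
  obtain C2 where C2: "0 < C2" "\<And>r x. 0 < r \<Longrightarrow> r \<le> 1 \<Longrightarrow>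
       (\<integral>\<^sup>+z. ennreal (kern S r (x - z) * phi S z powr (-\<kappa>)) \<partial>lborel) \<le> ennreal (C2 * pmax S r x powr (-\<kappa>))"
    using kern_phi_integral[OF k] by blast
  define h where "h = (\<lambda>r x z. \<bar>Qker S r x z\<bar> * (wstar u (x - z) * (1 + snormr S r (x - z)) ^ N) * phi S z powr (-\<kappa>))"
  have *: "integrable lborel (h r x) \<and> integral\<^sup>L lborel (h r x) \<le> C1 * C2 * pmax S r x powr (-\<kappa>)"
    if r: "0 < r" "r \<le> 1" for r x
  proof -
    note [measurable] = Q_measurable2[OF r(1)] wstar_measurable[OF u]
    have meas: "h r x \<in> borel_measurable lborel"
      unfolding h_def by measurable
    have nn: "0 \<le> h r x z" for z
      using wstar_ge1[OF u, of "x - z"] snormr_nonneg[of r "x - z"]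
      by (auto simp: h_def intro!: mult_nonneg_nonneg)
    have "(\<integral>\<^sup>+z. ennreal (h r x z) \<partial>lborel) \<le> (\<integral>\<^sup>+z. ennreal C1 * ennreal (kern S r (x - z) * phi S z powr (-\<kappa>)) \<partial>lborel)"
    proof (intro nn_integral_mono)
      fix z
      have "h r x z \<le> C1 * kern S r (x - z) * phi S z powr (-\<kappa>)"
        unfolding h_def by (intro mult_right_mono C1(2) r) simp
      then show "ennreal (h r x z) \<le> ennreal C1 * ennreal (kern S r (x - z) * phi S z powr (-\<kappa>))"
        using C1 kern_pos[OF r(1), of "x - z"]
        by (subst ennreal_mult[symmetric]) (auto intro!: ennreal_leI simp: mult.assoc)
    qed
    also have "\<dots> = ennreal C1 * (\<integral>\<^sup>+z. ennreal (kern S r (x - z) * phi S z powr (-\<kappa>)) \<partial>lborel)"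
      by (intro nn_integral_cmult) measurable
    also have "\<dots> \<le> ennreal C1 * ennreal (C2 * pmax S r x powr (-\<kappa>))"
      using C2(2)[OF r] by (intro mult_left_mono) auto
    also have "\<dots> = ennreal (C1 * C2 * pmax S r x powr (-\<kappa>))"
      using C1 C2 by (simp add: ennreal_mult[symmetric] mult.assoc)
    finally have le: "(\<integral>\<^sup>+z. ennreal (h r x z) \<partial>lborel) \<le> ennreal (C1 * C2 * pmax S r x powr (-\<kappa>))" .
    then have int: "integrable lborel (h r x)"
      using meas nn by (intro integrableI_nonneg) (auto intro: le_less_trans)
    moreover have "ennreal (integral\<^sup>L lborel (h r x)) \<le> ennreal (C1 * C2 * pmax S r x powr (-\<kappa>))"
      using le int nn by (simp add: nn_integral_eq_integral)
    ultimately show ?thesis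
      using C1 C2 by (subst (asm) ennreal_le_iff) auto
  qed
  show ?thesis
    by (rule that[of "C1 * C2"]) (use * C1 C2 in \<open>auto simp: h_def\<close>)
qed

lemma dominated_0I:
  assumes "G_controlled S u" "g \<in> borel_measurable borel" "\<And>z. \<bar>g z\<bar> \<le> B / wfun u z"
  shows "dominated S u 0 B g"
  using assms phi_pos by (auto simp: dominated_def dest!: phi_pos less_imp_neq)

lemma dominated_bound:
  assumes u: "G_controlled S u" and d: "dominated S u \<kappa> B g" and "0 \<le> B" and z: "z \<in> off_hyp S"
  shows "\<bar>g z\<bar> \<le> B / wfun u x * (wstar u (x - z) * phi S z powr (-\<kappa>))"
proof -
  have "\<bar>g z\<bar> \<le> B * phi S z powr (-\<kappa>) * (1 / wfun u z)"
    using d z by (simp add: dominated_def)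
  also have "\<dots> \<le> B * phi S z powr (-\<kappa>) * (wstar u (x - z) / wfun u x)"
    using assms by (intro mult_left_mono inverse_wfun_le) auto
  finally show ?thesis by (simp add: mult_ac)
qed

text \<open>The bound on the integral of the absolute value is a conclusion of its own: Fubini needs
  it in \<open>qint_qint\<close>, and \<open>main_term_bound\<close> adds several singular orders
  under the absolute value.\<close>

lemma qint_dominated:
  assumes u: "G_controlled S u" and k: "0 \<le> \<kappa>" "\<kappa> < s1"
  obtains C where "0 < C"
    "\<And>g B r x. dominated S u \<kappa> B g \<Longrightarrow> 0 \<le> B \<Longrightarrow> 0 < r \<Longrightarrow> r \<le> 1 \<Longrightarrow> integrable lborel (\<lambda>z. Qker S r x z * g z)"
    "\<And>g B r x. dominated S u \<kappa> B g \<Longrightarrow> 0 \<le> B \<Longrightarrow> 0 < r \<Longrightarrow> r \<le> 1 \<Longrightarrow>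
       (LINT z|lborel. \<bar>Qker S r x z * g z\<bar>) \<le> C * B * pmax S r x powr (-\<kappa>) / wfun u x"
    "\<And>g B r x. dominated S u \<kappa> B g \<Longrightarrow> 0 \<le> B \<Longrightarrow> 0 < r \<Longrightarrow> r \<le> 1 \<Longrightarrow>
       \<bar>qint S r g x\<bar> \<le> C * B * pmax S r x powr (-\<kappa>) / wfun u x"
proof -
  obtain C where C: "0 < C"
    "\<And>r x. 0 < r \<Longrightarrow> r \<le> 1 \<Longrightarrow>
       integrable lborel (\<lambda>z. \<bar>Qker S r x z\<bar> * (wstar u (x - z) * (1 + snormr S r (x - z)) ^ 0) * phi S z powr (-\<kappa>))"
    "\<And>r x. 0 < r \<Longrightarrow> r \<le> 1 \<Longrightarrow>
       (LINT z|lborel. \<bar>Qker S r x z\<bar> * (wstar u (x - z) * (1 + snormr S r (x - z)) ^ 0) * phi S z powr (-\<kappa>))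
          \<le> C * pmax S r x powr (-\<kappa>)"
    using Q_weighted_integral[OF u k, of 0] by blast
  have *: "integrable lborel (\<lambda>z. Qker S r x z * g z) \<and>
      (LINT z|lborel. \<bar>Qker S r x z * g z\<bar>) \<le> C * B * pmax S r x powr (-\<kappa>) / wfun u x"
    if g: "dominated S u \<kappa> B g" and B: "0 \<le> B" and r: "0 < r" "r \<le> 1" for g B r x
  proof -
    note [measurable] = Q_measurable2[OF r(1)]
    have [measurable]: "g \<in> borel_measurable borel" using g by (simp add: dominated_def)
    let ?h = "\<lambda>z. \<bar>Qker S r x z\<bar> * (wstar u (x - z) * (1 + snormr S r (x - z)) ^ 0) * phi S z powr (-\<kappa>)"
    have hi: "integrable lborel (\<lambda>z. B / wfun u x * ?h z)" using C(2)[OF r] by (intro integrable_mult_right)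
    have le: "AE z in lborel. \<bar>Qker S r x z * g z\<bar> \<le> B / wfun u x * ?h z"
      using AE_off_hyp
    proof eventually_elim
      case (elim z)
      have "\<bar>Qker S r x z * g z\<bar> \<le> \<bar>Qker S r x z\<bar> * (B / wfun u x * (wstar u (x - z) * phi S z powr (-\<kappa>)))"
        unfolding abs_mult by (intro mult_left_mono dominated_bound[OF u g B elim]) auto
      then show ?case by (simp add: mult_ac)
    qed
    have int: "integrable lborel (\<lambda>z. Qker S r x z * g z)"
      by (rule Bochner_Integration.integrable_bound[OF hi]) (measurable, use le in eventually_elim, unfold real_norm_def, rule order_trans[OF _ abs_ge_self])
    have "(LINT z|lborel. \<bar>Qker S r x z * g z\<bar>) \<le> (LINT z|lborel. B / wfun u x * ?h z)"
      using int hi le by (intro integral_mono_AE integrable_abs)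
    also have "\<dots> = B / wfun u x * (LINT z|lborel. ?h z)" by (rule integral_mult_right_zero)
    also have "\<dots> \<le> B / wfun u x * (C * pmax S r x powr (-\<kappa>))"
      using B wfun_pos[OF u, of x] by (intro mult_left_mono C(3)[OF r]) auto
    finally show ?thesis using int by (simp add: mult_ac)
  qed
  show ?thesis
    by (rule that[OF C(1)]) (use * in \<open>auto simp: qint_def intro: order_trans[OF integral_abs_bound]\<close>)
qed

lemma qint_integrable:
  assumes "G_controlled S u" "0 \<le> \<kappa>" "\<kappa> < s1" "dominated S u \<kappa> B g" "0 \<le> B" "0 < r" "r \<le> 1"
  shows "integrable lborel (\<lambda>z. Qker S r x z * g z)"
  by (rule qint_dominated[OF assms(1-3)]) (use assms in blast)

lemma qint_bound:
  assumes "G_controlled S u" "0 \<le> \<kappa>" "\<kappa> < s1"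
  obtains C where "0 < C"
    "\<And>g B r x. dominated S u \<kappa> B g \<Longrightarrow> 0 \<le> B \<Longrightarrow> 0 < r \<Longrightarrow> r \<le> 1 \<Longrightarrow>
       \<bar>qint S r g x\<bar> \<le> C * B * pmax S r x powr (-\<kappa>) / wfun u x"
  by (rule qint_dominated[OF assms]) (rule that)

lemma qint_bound_0:
  assumes u: "G_controlled S u"
  obtains C where "0 < C"
    "\<And>g B r x. dominated S u 0 B g \<Longrightarrow> 0 \<le> B \<Longrightarrow> 0 < r \<Longrightarrow> r \<le> 1 \<Longrightarrow> \<bar>qint S r g x\<bar> \<le> C * B / wfun u x"
proof (rule qint_bound[OF u order_refl s1_pos])
  fix C assume C: "0 < C" "\<And>g B r x. dominated S u 0 B g \<Longrightarrow> 0 \<le> B \<Longrightarrow> 0 < r \<Longrightarrow> r \<le> 1 \<Longrightarrow>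
       \<bar>qint S r g x\<bar> \<le> C * B * pmax S r x powr (-0) / wfun u x"
  show thesis
  proof (rule that[OF C(1)])
    fix g B and r :: real and x assume "dominated S u 0 B g" "0 \<le> B" "0 < r" "r \<le> 1"
    with C(2)[OF this, of x] pmax_pos[of r x] show "\<bar>qint S r g x\<bar> \<le> C * B / wfun u x" by simp
  qed
qed

text \<open>Dominated convergence along a sequence. A convergent sequence is bounded, so
  \<open>kern_shift\<close> gives one majorant, and 1 / \<open>wfun\<close> is bounded along it
  because the weight is continuous and positive.\<close>

lemma qint_continuous:
  assumes u: "G_controlled S u" and k: "0 \<le> \<kappa>" "\<kappa> < s1"
    and g: "dominated S u \<kappa> B g" and B: "0 \<le> B" and r: "0 < r" "r \<le> 1"
  shows "continuous_on UNIV (qint S r g)"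
proof (rule continuous_on_sequentiallyI)
  fix X :: "nat \<Rightarrow> real^'n" and a assume X: "X \<longlonglongrightarrow> a"
  have [measurable]: "g \<in> borel_measurable borel" using g by (simp add: dominated_def)
  note [measurable] = Q_measurable2[OF r(1)]
  obtain C where C: "0 < C"
    "\<And>r x y. 0 < r \<Longrightarrow> r \<le> 1 \<Longrightarrow> \<bar>Qker S r x y\<bar> * (wstar u (x - y) * (1 + snormr S r (x - y)) ^ 0) \<le> C * kern S r (x - y)"
    using Q_le_kern[OF u, of 0] by blast
  obtain C2 where "0 < C2" and C2: "\<And>r x. 0 < r \<Longrightarrow> r \<le> 1 \<Longrightarrow>
       (\<integral>\<^sup>+z. ennreal (kern S r (x - z) * phi S z powr (-\<kappa>)) \<partial>lborel) \<le> ennreal (C2 * pmax S r x powr (-\<kappa>))"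
    using kern_phi_integral[OF k] by blast
  have "(\<lambda>n. X n - a) \<longlonglongrightarrow> 0" using X by (simp add: LIM_zero_iff)
  then have "Bseq (\<lambda>n. X n - a)" by (intro convergent_imp_Bseq) (auto simp: convergent_def)
  then obtain R where R: "\<And>n. norm (X n - a) \<le> R" by (auto simp: Bseq_def)
  have "(\<lambda>n. 1 / wfun u (X n)) \<longlonglongrightarrow> 1 / wfun u a"
    using continuous_wfun[OF u] X wfun_pos[OF u, of a]
    by (intro tendsto_divide tendsto_const) (auto simp: continuous_on_sequentially comp_def)
  then have "Bseq (\<lambda>n. 1 / wfun u (X n))" by (intro convergent_imp_Bseq) (auto simp: convergent_def)
  then obtain W where W: "\<And>n. 1 / wfun u (X n) \<le> W" by (auto simp: Bseq_def abs_of_pos[OF wfun_pos[OF u]])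
  let ?K = "\<Prod>i\<in>UNIV. 2 * (1 + R\<^sup>2 / (r powr (scl S $ i / ell S))\<^sup>2)"
  let ?D = "\<lambda>z. B * W * C * ?K * (kern S r (a - z) * phi S z powr (-\<kappa>))"
  have Wnn: "0 \<le> W" using W[of 0] wfun_pos[OF u, of "X 0"] by (auto intro: order_trans[rotated])
  show "(\<lambda>n. qint S r g (X n)) \<longlonglongrightarrow> qint S r g a"
    unfolding qint_def
  proof (rule integral_dominated_convergence)
    show "integrable lborel ?D"
    proof (rule integrable_mult_right, rule integrableI_nonneg)
      show "AE z in lborel. 0 \<le> kern S r (a - z) * phi S z powr (-\<kappa>)"
        by (intro AE_I2 mult_nonneg_nonneg less_imp_le[OF kern_pos[OF r(1)]]) simp
      show "(\<integral>\<^sup>+z. ennreal (kern S r (a - z) * phi S z powr (-\<kappa>)) \<partial>lborel) < \<infinity>"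
        using C2[OF r, of a] by (auto intro: le_less_trans)
    qed measurable
    show "AE z in lborel. (\<lambda>n. Qker S r (X n) z * g z) \<longlonglongrightarrow> Qker S r a z * g z"
      using continuous_Q1[OF r(1)] X
      by (intro AE_I2 tendsto_mult tendsto_const) (auto simp: continuous_on_sequentially comp_def)
    show "AE z in lborel. norm (Qker S r (X n) z * g z) \<le> ?D z" for n
      using AE_off_hyp
    proof eventually_elim
      case (elim z)
      have "norm (Qker S r (X n) z * g z) \<le> \<bar>Qker S r (X n) z\<bar> * (B / wfun u (X n) * (wstar u (X n - z) * phi S z powr (-\<kappa>)))"
        unfolding real_norm_def abs_mult by (intro mult_left_mono dominated_bound[OF u g B elim]) auto
      also have "\<dots> = B * (1 / wfun u (X n)) * ((\<bar>Qker S r (X n) z\<bar> * (wstar u (X n - z) * (1 + snormr S r (X n - z)) ^ 0)) * phi S z powr (-\<kappa>))"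
        by simp
      also have "\<dots> \<le> B * W * (C * (?K * kern S r (a - z)) * phi S z powr (-\<kappa>))"
      proof (rule mult_mono)
        show "B * (1 / wfun u (X n)) \<le> B * W" by (intro mult_left_mono W B)
        have "\<bar>(X n - a) $ i\<bar> \<le> R" for i using R[of n] component_le_norm_cart[of "X n - a" i] by linarith
        then have "kern S r (X n - z) \<le> ?K * kern S r (a - z)" using r by (intro kern_shift) auto
        then have "C * kern S r (X n - z) \<le> C * (?K * kern S r (a - z))" using C by (intro mult_left_mono) auto
        then have "\<bar>Qker S r (X n) z\<bar> * (wstar u (X n - z) * (1 + snormr S r (X n - z)) ^ 0) \<le> C * (?K * kern S r (a - z))"
          using C(2)[OF r, of "X n" z] by linarith
        then show "(\<bar>Qker S r (X n) z\<bar> * (wstar u (X n - z) * (1 + snormr S r (X n - z)) ^ 0)) * phi S z powr (-\<kappa>)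
          \<le> C * (?K * kern S r (a - z)) * phi S z powr (-\<kappa>)"
          by (rule mult_right_mono) simp
        show "0 \<le> B * W" using B Wnn by simp
        show "0 \<le> (\<bar>Qker S r (X n) z\<bar> * (wstar u (X n - z) * (1 + snormr S r (X n - z)) ^ 0)) * phi S z powr (-\<kappa>)"
          using wstar_ge1[OF u, of "X n - z"] by (intro mult_nonneg_nonneg) auto
      qed
      finally show ?case by (simp add: mult_ac)
    qed
  qed measurable
qed

lemma Q_semigroup:
  assumes "0 < r" "0 < s"
  shows "has_bochner_integral lborel (\<lambda>z. Qker S r x z * Qker S s z y) (Qker S (r + s) x y)"
proof -
  have "has_bochner_integral lborel (\<lambda>z. Qker S (r + s - s) x z * Qker S s z y) (Qker S (r + s) x y)"
    using semi assms unfolding G_semigroup_def by (metis less_add_same_cancel2)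
  then show ?thesis by simp
qed

lemma qint_qint:
  assumes u: "G_controlled S u" and k: "0 \<le> \<kappa>" "\<kappa> < s1"
    and g: "dominated S u \<kappa> B g" and B: "0 \<le> B" and r: "0 < r" and s: "0 < s" and rs: "r + s \<le> 1"
  shows "qint S r (qint S s g) x = qint S (r + s) g x"
proof -
  have [measurable]: "g \<in> borel_measurable borel" using g by (simp add: dominated_def)
  note [measurable] = Q_measurable2[OF r] Q_measurable2[OF s] Q_measurable[OF s]
  have r1: "r \<le> 1" and sl1: "s \<le> 1" using r s rs by auto
  obtain C where C: "0 < C"
    "\<And>g B r x. dominated S u \<kappa> B g \<Longrightarrow> 0 \<le> B \<Longrightarrow> 0 < r \<Longrightarrow> r \<le> 1 \<Longrightarrow> integrable lborel (\<lambda>z. Qker S r x z * g z)"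
    "\<And>g B r x. dominated S u \<kappa> B g \<Longrightarrow> 0 \<le> B \<Longrightarrow> 0 < r \<Longrightarrow> r \<le> 1 \<Longrightarrow>
       (LINT z|lborel. \<bar>Qker S r x z * g z\<bar>) \<le> C * B * pmax S r x powr (-\<kappa>) / wfun u x"
    by (rule qint_dominated[OF u k]) (rule that)
  define k2 where "k2 = (\<lambda>y. LINT z|lborel. \<bar>Qker S s y z * g z\<bar>)"
  have k2m [measurable]: "k2 \<in> borel_measurable borel"
    unfolding k2_def measurable_lborel2[symmetric]
    by (rule sigma_finite_measure.borel_measurable_lebesgue_integral[OF sigma_finite_lborel]) measurable
  \<comment> \<open>At time s > 0 the singularity is already smoothed, since \<open>pmax\<close> is
    at least \<open>s powr (1 / ell S)\<close>. Hence the inner absolute integral \<open>k2\<close>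
    is dominated with exponent 0 and can be integrated once more, which is what Fubini asks
    for.\<close>
  define B' where "B' = C * B * s powr (-\<kappa> / ell S)"
  have pm: "pmax S s y powr (-\<kappa>) \<le> s powr (-\<kappa> / ell S)" for y
  proof -
    have "pmax S s y powr (-\<kappa>) \<le> (s powr (1 / ell S)) powr (-\<kappa>)"
      using k s by (intro powr_mono2') (auto simp: pmax_def)
    then show ?thesis by (simp add: powr_powr)
  qed
  have B'nn: "0 \<le> B'" using C B by (simp add: B'_def)
  have k2d: "dominated S u 0 B' k2"
  proof (rule dominated_0I[OF u k2m])
    fix y
    have "\<bar>k2 y\<bar> = k2 y" unfolding k2_def by simp
    also have "\<dots> \<le> C * B * pmax S s y powr (-\<kappa>) / wfun u y"
      unfolding k2_def by (rule C(3)[OF g B s sl1])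
    also have "\<dots> \<le> B' / wfun u y"
      unfolding B'_def using pm C B wfun_pos[OF u, of y] by (intro divide_right_mono mult_left_mono) auto
    finally show "\<bar>k2 y\<bar> \<le> B' / wfun u y" .
  qed
  have int2: "integrable lborel (\<lambda>y. Qker S r x y * k2 y)"
    by (rule qint_integrable[OF u order_refl s1_pos k2d B'nn r r1])
  interpret lborel_pair: pair_sigma_finite "lborel :: (real^'n) measure" "lborel :: (real^'n) measure" ..
  have pint: "integrable (lborel \<Otimes>\<^sub>M lborel) (\<lambda>(y, z). Qker S r x y * (Qker S s y z * g z))"
  proof (rule lborel_pair.Fubini_integrable)
    have "integrable lborel (\<lambda>y. \<bar>Qker S r x y * k2 y\<bar>)" using int2 by (rule integrable_abs)
    moreover have "\<bar>Qker S r x y * k2 y\<bar> = (LINT z|lborel. norm (case (y, z) of (y, z) \<Rightarrow> Qker S r x y * (Qker S s y z * g z)))" for y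
    proof -
      have "0 \<le> k2 y" unfolding k2_def by simp
      then show ?thesis unfolding k2_def by (simp add: abs_mult mult.assoc)
    qed
    ultimately show "integrable lborel (\<lambda>y. LINT z|lborel. norm (case (y, z) of (y, z) \<Rightarrow> Qker S r x y * (Qker S s y z * g z)))"
      by simp
    show "AE y in lborel. integrable lborel (\<lambda>z. case (y, z) of (y, z) \<Rightarrow> Qker S r x y * (Qker S s y z * g z))"
      using C(2)[OF g B s sl1] by auto
  qed measurable
  have "qint S r (qint S s g) x = (LINT y|lborel. LINT z|lborel. Qker S r x y * (Qker S s y z * g z))"
    unfolding qint_def by simp
  also have "\<dots> = (LINT z|lborel. LINT y|lborel. Qker S r x y * (Qker S s y z * g z))"
    using lborel_pair.Fubini_integral[of "\<lambda>y z. Qker S r x y * (Qker S s y z * g z)"] pint by simp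
  also have "\<dots> = (LINT z|lborel. Qker S (r + s) x z * g z)"
  proof (rule Bochner_Integration.integral_cong[OF refl])
    fix z
    have "(LINT y|lborel. Qker S r x y * (Qker S s y z * g z)) = (LINT y|lborel. (Qker S r x y * Qker S s y z) * g z)"
      by (simp add: mult.assoc)
    also have "\<dots> = (LINT y|lborel. Qker S r x y * Qker S s y z) * g z" by simp
    also have "(LINT y|lborel. Qker S r x y * Qker S s y z) = Qker S (r + s) x z"
      using Q_semigroup[OF r s] by (rule has_bochner_integral_integral_eq)
    finally show "(LINT y|lborel. Qker S r x y * (Qker S s y z * g z)) = Qker S (r + s) x z * g z" .
  qed
  finally show ?thesis by (simp add: qint_def)
qed

text \<open>Mean value theorem in time: at t \<ge> \<delta> the derivative is at most C2 / \<delta>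
  times \<open>Gt\<close>, and the common majorant \<open>kern S 1\<close> controls that.\<close>

lemma Q_time_difference:
  assumes u: "G_controlled S u" and \<delta>: "0 < \<delta>"
  obtains C where "0 < C"
    "\<And>r r' x y. \<delta> \<le> r \<Longrightarrow> r \<le> r' \<Longrightarrow> r' \<le> 1 \<Longrightarrow>
       \<bar>Qker S r' x y - Qker S r x y\<bar> * wstar u (x - y) \<le> C * (r' - r) * kern S 1 (x - y)"
proof -
  obtain C where C: "0 < C" "\<And>r x. 0 < r \<Longrightarrow> r \<le> 1 \<Longrightarrow> Gt S r x * wstar u x * (1 + snormr S r x) ^ 0 \<le> C * kern S r x"
    using Gt_le_kern[OF u, of 0] by blast
  have "\<exists>C2>0. \<forall>t>0. \<forall>x y. \<exists>D.
        ((\<lambda>r. Qker S r x y) has_real_derivative D) (at t) \<and> \<bar>D\<bar> \<le> C2 * (1 / t) * Gt S t (x - y)"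
    using semi unfolding G_semigroup_def by (elim conjE) assumption
  then obtain C2 where C2: "C2 > 0" and
     D: "\<forall>t>0. \<forall>x y. \<exists>D. ((\<lambda>r. Qker S r x y) has_real_derivative D) (at t) \<and> \<bar>D\<bar> \<le> C2 * (1 / t) * Gt S t (x - y)"
    by auto
  let ?K = "\<Prod>i\<in>UNIV. 1 / (\<delta> powr (scl S $ i / ell S))\<^sup>2"
  have K: "0 < ?K" using \<delta> by (intro prod_pos) auto
  show ?thesis
  proof
    show "0 < C2 * (1 / \<delta>) * C * ?K" using C2 \<delta> C K by (intro mult_pos_pos) auto
    fix r r' :: real and x y assume r: "\<delta> \<le> r" "r \<le> r'" "r' \<le> 1"
    show "\<bar>Qker S r' x y - Qker S r x y\<bar> * wstar u (x - y) \<le> C2 * (1 / \<delta>) * C * ?K * (r' - r) * kern S 1 (x - y)"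
    proof (cases "r = r'")
      case False
      with r have "r < r'" by simp
      define d where "d = deriv (\<lambda>r. Qker S r x y)"
      have d: "((\<lambda>r. Qker S r x y) has_real_derivative d t) (at t) \<and> \<bar>d t\<bar> \<le> C2 * (1 / t) * Gt S t (x - y)" if "0 < t" for t
      proof -
        from D that obtain e where e: "((\<lambda>r. Qker S r x y) has_real_derivative e) (at t)" "\<bar>e\<bar> \<le> C2 * (1 / t) * Gt S t (x - y)"
          by blast
        with DERIV_imp_deriv[OF e(1)] show ?thesis by (simp add: d_def)
      qed
      have "\<exists>t. r < t \<and> t < r' \<and> Qker S r' x y - Qker S r x y = (r' - r) * d t"
        using \<open>r < r'\<close> d \<delta> r(1) by (intro MVT2) auto
      then obtain t where t: "r < t" "t < r'" "Qker S r' x y - Qker S r x y = (r' - r) * d t" by blast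
      have t0: "0 < t" "t \<le> 1" "\<delta> \<le> t" using t r \<delta> by auto
      have Gnn: "0 \<le> Gt S t (x - y)"
        using semi by (auto simp: Gt_def G_semigroup_def)
      have w1: "0 \<le> wstar u (x - y)" using wstar_ge1[OF u, of "x - y"] by linarith
      have "\<bar>d t\<bar> * wstar u (x - y) \<le> C2 * (1 / t) * Gt S t (x - y) * wstar u (x - y)"
        using d[OF t0(1)] w1 by (intro mult_right_mono) auto
      also have "\<dots> \<le> C2 * (1 / \<delta>) * Gt S t (x - y) * wstar u (x - y)"
        using t0 C2 \<delta> Gnn w1 by (intro mult_right_mono mult_left_mono divide_left_mono) auto
      also have "\<dots> = C2 * (1 / \<delta>) * (Gt S t (x - y) * wstar u (x - y) * (1 + snormr S t (x - y)) ^ 0)" by simp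
      also have "\<dots> \<le> C2 * (1 / \<delta>) * (C * (?K * kern S 1 (x - y)))"
      proof (intro mult_left_mono order_trans[OF C(2)[OF t0(1,2)]])
        show "kern S t (x - y) \<le> ?K * kern S 1 (x - y)" using t0 \<delta> by (intro kern_le_kern1) auto
      qed (use C2 \<delta> C in auto)
      finally have "(r' - r) * (\<bar>d t\<bar> * wstar u (x - y)) \<le> (r' - r) * (C2 * (1 / \<delta>) * (C * (?K * kern S 1 (x - y))))"
        using \<open>r < r'\<close> by (intro mult_left_mono) auto
      then show ?thesis using \<open>r < r'\<close> by (simp add: t(3) abs_mult mult_ac)
    qed simp
  qed
qed

text \<open>Used where no smallness at short times is available: to compare a family with its time
  shift at times bounded below, and for continuity in time.\<close>

lemma qint_time_difference:
  assumes u: "G_controlled S u" and \<delta>: "0 < \<delta>"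
  obtains C where "0 < C"
    "\<And>g B r r' x. dominated S u 0 B g \<Longrightarrow> 0 \<le> B \<Longrightarrow> \<delta> \<le> r \<Longrightarrow> r \<le> r' \<Longrightarrow> r' \<le> 1 \<Longrightarrow>
       \<bar>qint S r' g x - qint S r g x\<bar> \<le> C * (r' - r) * B / wfun u x"
proof -
  obtain C where C: "0 < C"
    "\<And>r r' x y. \<delta> \<le> r \<Longrightarrow> r \<le> r' \<Longrightarrow> r' \<le> 1 \<Longrightarrow>
       \<bar>Qker S r' x y - Qker S r x y\<bar> * wstar u (x - y) \<le> C * (r' - r) * kern S 1 (x - y)"
    using Q_time_difference[OF u \<delta>] by blast
  obtain C1 where C1: "0 < C1" "\<And>r x. 0 < r \<Longrightarrow> r \<le> 1 \<Longrightarrow>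
       (\<integral>\<^sup>+z. ennreal (kern S r (x - z) * phi S z powr (-0)) \<partial>lborel) \<le> ennreal (C1 * pmax S r x powr (-0))"
    using kern_phi_integral[OF order_refl s1_pos] by blast
  have le: "(\<integral>\<^sup>+z. ennreal (kern S 1 (x - z)) \<partial>lborel) \<le> ennreal C1" for x
  proof -
    have "(\<integral>\<^sup>+z. ennreal (kern S 1 (x - z)) \<partial>lborel) = (\<integral>\<^sup>+z. ennreal (kern S 1 (x - z) * phi S z powr (-0)) \<partial>lborel)"
      by (rule nn_integral_cong_AE) (use AE_off_hyp in eventually_elim, auto dest: phi_pos)
    also have "\<dots> \<le> ennreal (C1 * pmax S 1 x powr (-0))" by (rule C1) auto
    also have "\<dots> = ennreal C1" using pmax_pos[of 1 x] by simp
    finally show ?thesis .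
  qed
  have kint: "integrable lborel (\<lambda>z. kern S 1 (x - z))" for x
    using le[of x] kern_pos[of 1] by (intro integrableI_nonneg) (auto intro: le_less_trans less_imp_le)
  have kle: "(LINT z|lborel. kern S 1 (x - z)) \<le> C1" for x
  proof -
    have "ennreal (LINT z|lborel. kern S 1 (x - z)) \<le> ennreal C1"
      using le[of x] kern_pos[of 1] nn_integral_eq_integral[OF kint, of x] by (simp add: less_imp_le)
    then show ?thesis using C1(1) by simp
  qed
  show ?thesis
  proof
    show "0 < C * C1" using C C1 by simp
    fix g B r r' x
    assume g: "dominated S u 0 B g" and B: "0 \<le> B" and r: "\<delta> \<le> r" "r \<le> r'" "r' \<le> 1"
    have i: "integrable lborel (\<lambda>z. Qker S t x z * g z)" if "0 < t" "t \<le> 1" for t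
      by (rule qint_integrable[OF u order_refl s1_pos g B that])
    have ii: "integrable lborel (\<lambda>z. Qker S r' x z * g z - Qker S r x z * g z)"
      using i[of r] i[of r'] r \<delta> by auto
    have "\<bar>qint S r' g x - qint S r g x\<bar> = \<bar>LINT z|lborel. Qker S r' x z * g z - Qker S r x z * g z\<bar>"
      unfolding qint_def using i[of r] i[of r'] r \<delta> by simp
    also have "\<dots> \<le> (LINT z|lborel. \<bar>Qker S r' x z * g z - Qker S r x z * g z\<bar>)" by (rule integral_abs_bound)
    also have "\<dots> \<le> (LINT z|lborel. B / wfun u x * (C * (r' - r)) * kern S 1 (x - z))"
    proof (rule integral_mono_AE)
      show "integrable lborel (\<lambda>z. B / wfun u x * (C * (r' - r)) * kern S 1 (x - z))"
        by (intro integrable_mult_right kint)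
      show "AE z in lborel. \<bar>Qker S r' x z * g z - Qker S r x z * g z\<bar> \<le> B / wfun u x * (C * (r' - r)) * kern S 1 (x - z)"
        using AE_off_hyp
      proof eventually_elim
        case (elim z)
        have "\<bar>Qker S r' x z * g z - Qker S r x z * g z\<bar> = \<bar>Qker S r' x z - Qker S r x z\<bar> * \<bar>g z\<bar>"
          by (simp add: abs_mult[symmetric] algebra_simps)
        also have "\<dots> \<le> \<bar>Qker S r' x z - Qker S r x z\<bar> * (B / wfun u x * (wstar u (x - z) * phi S z powr (-0)))"
          by (intro mult_left_mono dominated_bound[OF u g B elim]) auto
        also have "\<dots> = B / wfun u x * (\<bar>Qker S r' x z - Qker S r x z\<bar> * wstar u (x - z))"
          using phi_pos[OF elim] by simp
        also have "\<dots> \<le> B / wfun u x * (C * (r' - r) * kern S 1 (x - z))"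
          using B wfun_pos[OF u, of x] by (intro mult_left_mono C r) auto
        finally show ?case by (simp add: mult_ac)
      qed
    qed (use ii in auto)
    also have "\<dots> = B / wfun u x * (C * (r' - r)) * (LINT z|lborel. kern S 1 (x - z))" by simp
    also have "\<dots> \<le> B / wfun u x * (C * (r' - r)) * C1"
      using B wfun_pos[OF u, of x] C r by (intro mult_left_mono kle) auto
    finally show "\<bar>qint S r' g x - qint S r g x\<bar> \<le> C * C1 * (r' - r) * B / wfun u x" by (simp add: mult_ac)
  qed
qed

end

section \<open>Besov spaces as consistent families\<close>

text \<open>What remains visible, on families, of being of the form Q_t applied to one object: for a
  function it is \<open>qint_qint\<close>, and in the completion it is inherited by limits. It
  recovers the member at time t from members at arbitrarily small times.\<close>

definition consistent :: "('n::finite) setting \<Rightarrow> 'n qdist \<Rightarrow> bool" where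
  "consistent S \<Lambda> \<longleftrightarrow> (\<forall>r s x. 0 < r \<longrightarrow> 0 < s \<longrightarrow> r + s \<le> 1 \<longrightarrow> qint S r (\<Lambda> s) x = \<Lambda> (r + s) x)"

lemma consistentD: "consistent S \<Lambda> \<Longrightarrow> 0 < r \<Longrightarrow> 0 < s \<Longrightarrow> r + s \<le> 1 \<Longrightarrow> qint S r (\<Lambda> s) x = \<Lambda> (r + s) x"
  by (auto simp: consistent_def)

text \<open>The set where a continuous function exceeds the bound is open; being null, it is empty.
  So the essential supremum turns into a bound at every point, on the hyperplane as well.\<close>

lemma Linf_le_iff:
  assumes u: "G_controlled S u" and f: "continuous_on UNIV f" and c: "0 \<le> c"
  shows "Linf u f \<le> ennreal c \<longleftrightarrow> (\<forall>x. \<bar>f x\<bar> \<le> c / wfun u x)"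
proof -
  have eq: "\<bar>f x\<bar> \<le> c / wfun u x \<longleftrightarrow> \<bar>f x * wfun u x\<bar> \<le> c" for x
    using wfun_pos[OF u, of x] by (simp add: abs_mult field_simps)
  have cont: "continuous_on UNIV (\<lambda>x. \<bar>f x * wfun u x\<bar>)"
    using f continuous_wfun[OF u] by (intro continuous_intros)
  have meas: "(\<lambda>x. ennreal \<bar>f x * wfun u x\<bar>) \<in> borel_measurable lborel"
    using borel_measurable_continuous_onI[OF cont] by measurable
  show ?thesis
  proof
    assume "Linf u f \<le> ennreal c"
    then have "AE x in lborel. ennreal \<bar>f x * wfun u x\<bar> \<le> ennreal c"
      unfolding Linf_def using esssup_AE[of "\<lambda>x. ennreal \<bar>f x * wfun u x\<bar>" lborel]
      by (auto elim!: eventually_mono intro: order_trans)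
    then have ae: "AE x in lborel. \<bar>f x * wfun u x\<bar> \<le> c"
      using c by (auto elim!: eventually_mono)
    let ?U = "{x. c < \<bar>f x * wfun u x\<bar>}"
    have "open ?U"
      using cont by (intro open_Collect_less continuous_on_const)
    moreover have "?U \<in> null_sets lborel"
    proof (rule AE_iff_null_sets[THEN iffD2])
      show "?U \<in> sets lborel" using \<open>open ?U\<close> by simp
      show "AE x in lborel. x \<notin> ?U" using ae by eventually_elim auto
    qed
    then have "negligible ?U"
      by (meson negligible_iff_null_sets null_sets_completionI)
    ultimately have "?U = {}" using open_not_negligible by blast
    then show "\<forall>x. \<bar>f x\<bar> \<le> c / wfun u x" unfolding eq by (auto simp: not_less)
  next
    assume "\<forall>x. \<bar>f x\<bar> \<le> c / wfun u x"
    then show "Linf u f \<le> ennreal c"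
      unfolding Linf_def eq using meas by (intro esssup_I) (auto intro: ennreal_leI)
  qed
qed

lemma Cw_iff:
  assumes u: "G_controlled S u"
  shows "f \<in> Cw u \<longleftrightarrow> continuous_on UNIV f \<and> (\<exists>B\<ge>0. \<forall>x. \<bar>f x\<bar> \<le> B / wfun u x)"
proof -
  have "Linf u f < \<infinity> \<longleftrightarrow> (\<exists>B\<ge>0. Linf u f \<le> ennreal B)"
    by (cases "Linf u f") (auto intro: le_less_trans simp: top_unique)
  then show ?thesis
    unfolding Cw_def using Linf_le_iff[OF u] by auto
qed

lemma Cw_D:
  assumes "G_controlled S u" "f \<in> Cw u"
  obtains B where "0 \<le> B" "\<And>x. \<bar>f x\<bar> \<le> B / wfun u x"
  using assms Cw_iff by blast

lemma Cw_continuous: "f \<in> Cw u \<Longrightarrow> continuous_on UNIV f"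
  by (simp add: Cw_def)

lemma Cw_measurable: "f \<in> Cw u \<Longrightarrow> f \<in> borel_measurable borel"
  by (intro borel_measurable_continuous_onI Cw_continuous)

lemma Cw_dominated:
  assumes "G_controlled S u" "f \<in> Cw u"
  obtains B where "0 \<le> B" "dominated S u 0 B f"
proof -
  obtain B where B: "0 \<le> B" "\<And>x. \<bar>f x\<bar> \<le> B / wfun u x" by (rule Cw_D[OF assms]) (rule that)
  have "phi S z \<noteq> 0" if "z \<in> off_hyp S" for z using that by (auto simp: phi_def off_hyp_def min_def split: if_splits)
  with B have "dominated S u 0 B f"
    using Cw_measurable[OF assms(2)] by (auto simp: dominated_def)
  with B that show ?thesis by blast
qed

lemma Cw_diff: 
  assumes u: "G_controlled S u" and "f \<in> Cw u" "g \<in> Cw u" 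
  shows "(\<lambda>x. f x - g x) \<in> Cw u"
proof -
  obtain B where B: "0 \<le> B" "\<And>x. \<bar>f x\<bar> \<le> B / wfun u x" by (rule Cw_D[OF u assms(2)]) (rule that)
  obtain B' where B': "0 \<le> B'" "\<And>x. \<bar>g x\<bar> \<le> B' / wfun u x" by (rule Cw_D[OF u assms(3)]) (rule that)
  have "\<bar>f x - g x\<bar> \<le> (B + B') / wfun u x" for x
    using B(2)[of x] B'(2)[of x] by (simp add: add_divide_distrib)
  then show ?thesis
    unfolding Cw_iff[OF u] using B B' Cw_continuous[OF assms(2)] Cw_continuous[OF assms(3)]
    by (auto intro!: continuous_on_diff exI[of _ "B + B'"])
qed

context gsemi
begin

lemma qint_Cw:
  assumes u: "G_controlled S u" and g: "g \<in> Cw u" and r: "0 < r" "r \<le> 1"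
  shows "qint S r g \<in> Cw u"
proof -
  obtain B where B: "0 \<le> B" "dominated S u 0 B g" by (rule Cw_dominated[OF u g]) (rule that)
  obtain C where C: "0 < C"
    "\<And>g B r x. dominated S u 0 B g \<Longrightarrow> 0 \<le> B \<Longrightarrow> 0 < r \<Longrightarrow> r \<le> 1 \<Longrightarrow>
       \<bar>qint S r g x\<bar> \<le> C * B / wfun u x"
    by (rule qint_bound_0[OF u]) (rule that)
  show ?thesis
    unfolding Cw_iff[OF u]
  proof (intro conjI exI allI)
    show "continuous_on UNIV (qint S r g)" using qint_continuous[OF u order_refl s1_pos B(2,1) r] .
    show "0 \<le> C * B" using C B by simp
    show "\<bar>qint S r g x\<bar> \<le> C * B / wfun u x" for x using C(2)[OF B(2,1) r, of x] .
  qed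
qed

lemma qint_diff:
  assumes u: "G_controlled S u" and k: "0 \<le> \<kappa>" "\<kappa> < s1"
    and f: "dominated S u \<kappa> A f" "0 \<le> A" and g: "dominated S u \<kappa> B g" "0 \<le> B" and r: "0 < r" "r \<le> 1"
  shows "qint S r (\<lambda>z. f z - g z) x = qint S r f x - qint S r g x"
proof -
  have "integrable lborel (\<lambda>z. Qker S r x z * f z)" "integrable lborel (\<lambda>z. Qker S r x z * g z)"
    by (rule qint_integrable[OF u k f r] qint_integrable[OF u k g r])+
  then show ?thesis by (simp add: qint_def right_diff_distrib)
qed

lemma besov_norm_le_iff:
  assumes u: "G_controlled S u" and f: "\<And>t. t \<in> {0<..1} \<Longrightarrow> continuous_on UNIV (\<Lambda> t)" and c: "0 \<le> c"
  shows "besov_norm S \<zeta> u \<Lambda> \<le> ennreal c \<longleftrightarrow> (\<forall>t\<in>{0<..1}. \<forall>x. \<bar>\<Lambda> t x\<bar> \<le> c * t powr (\<zeta> / ell S) / wfun u x)"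
proof -
  have "ennreal (t powr (- \<zeta> / ell S)) * Linf u (\<Lambda> t) \<le> ennreal c \<longleftrightarrow> (\<forall>x. \<bar>\<Lambda> t x\<bar> \<le> c * t powr (\<zeta> / ell S) / wfun u x)"
    if t: "t \<in> {0<..1}" for t
  proof -
    let ?p = "t powr (\<zeta> / ell S)"
    have p: "0 < ?p" "t powr (- \<zeta> / ell S) = 1 / ?p"
      using t by (auto simp: powr_minus_divide)
    have one: "ennreal ?p * ennreal (1 / ?p) = 1" "ennreal (1 / ?p) * ennreal ?p = 1"
      using p by (subst ennreal_mult[symmetric]; simp)+
    have cp: "ennreal (c * ?p) = ennreal ?p * ennreal c"
      using p c by (subst ennreal_mult[symmetric]) (auto simp: mult.commute)
    have "ennreal (1 / ?p) * Linf u (\<Lambda> t) \<le> ennreal c \<longleftrightarrow> Linf u (\<Lambda> t) \<le> ennreal (c * ?p)"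
    proof
      assume "ennreal (1 / ?p) * Linf u (\<Lambda> t) \<le> ennreal c"
      then have "ennreal ?p * (ennreal (1 / ?p) * Linf u (\<Lambda> t)) \<le> ennreal ?p * ennreal c"
        by (intro mult_left_mono) auto
      then show "Linf u (\<Lambda> t) \<le> ennreal (c * ?p)"
        by (simp only: cp mult.assoc[symmetric] one mult_1)
    next
      assume "Linf u (\<Lambda> t) \<le> ennreal (c * ?p)"
      then have "ennreal (1 / ?p) * Linf u (\<Lambda> t) \<le> ennreal (1 / ?p) * ennreal (c * ?p)"
        by (intro mult_left_mono) auto
      then show "ennreal (1 / ?p) * Linf u (\<Lambda> t) \<le> ennreal c"
        by (simp only: cp mult.assoc[symmetric] one mult_1)
    qed
    then show ?thesis
      unfolding p(2) using Linf_le_iff[OF u f[OF t], of "c * ?p"] p c by simp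
  qed
  then show ?thesis unfolding besov_norm_def SUP_le_iff by auto
qed

text \<open>Restates convergence in norm through an arbitrary error e; the converse direction picks
  the errors 1 / (n + 1).\<close>

lemma besov_iff:
  assumes u: "G_controlled S u"
  shows "\<Lambda> \<in> besov S \<zeta> u \<longleftrightarrow>
     (\<forall>t\<in>{0<..1}. \<Lambda> t \<in> Cw u) \<and> (\<forall>t. t \<notin> {0<..1} \<longrightarrow> \<Lambda> t = (\<lambda>x. 0)) \<and>
     (\<forall>e>0. \<exists>g\<in>Cw u. \<forall>t\<in>{0<..1}. \<forall>x. \<bar>\<Lambda> t x - qint S t g x\<bar> \<le> e * t powr (\<zeta> / ell S) / wfun u x)"
    (is "_ \<longleftrightarrow> ?C \<and> ?Z \<and> ?A")
proof -
  have iff: "besov_norm S \<zeta> u (qdiff \<Lambda> (qfam S g)) \<le> ennreal e \<longleftrightarrow>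
      (\<forall>t\<in>{0<..1}. \<forall>x. \<bar>\<Lambda> t x - qint S t g x\<bar> \<le> e * t powr (\<zeta> / ell S) / wfun u x)"
    if C: ?C and g: "g \<in> Cw u" and e: "0 \<le> e" for g e
  proof -
    have eq: "qdiff \<Lambda> (qfam S g) t = (\<lambda>x. \<Lambda> t x - qint S t g x)" if "t \<in> {0<..1}" for t
      using that by (simp add: qdiff_def qfam_def qint_def)
    have "continuous_on UNIV (qdiff \<Lambda> (qfam S g) t)" if "t \<in> {0<..1}" for t
      unfolding eq[OF that] using C g that qint_Cw[OF u g, of t] by (intro continuous_on_diff Cw_continuous) auto
    from besov_norm_le_iff[OF u this e, where \<zeta>=\<zeta>] show ?thesis by (auto simp: eq)
  qed
  have "(\<exists>v. (\<forall>n::nat. v n \<in> Cw u) \<and> (\<lambda>n. besov_norm S \<zeta> u (qdiff \<Lambda> (qfam S (v n)))) \<longlonglongrightarrow> 0) \<longleftrightarrow>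
     (\<forall>(e::real)>0. \<exists>g\<in>Cw u. besov_norm S \<zeta> u (qdiff \<Lambda> (qfam S g)) \<le> ennreal e)"
  proof
    assume "\<exists>v. (\<forall>n::nat. v n \<in> Cw u) \<and> (\<lambda>n. besov_norm S \<zeta> u (qdiff \<Lambda> (qfam S (v n)))) \<longlonglongrightarrow> 0"
    then obtain v where v: "\<And>n::nat. v n \<in> Cw u" "(\<lambda>n. besov_norm S \<zeta> u (qdiff \<Lambda> (qfam S (v n)))) \<longlonglongrightarrow> 0" by auto
    show "\<forall>e>0. \<exists>g\<in>Cw u. besov_norm S \<zeta> u (qdiff \<Lambda> (qfam S g)) \<le> ennreal e"
    proof (intro allI impI)
      fix e :: real assume "0 < e"
      then have "\<forall>\<^sub>F n in sequentially. besov_norm S \<zeta> u (qdiff \<Lambda> (qfam S (v n))) < ennreal e"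
        by (intro order_tendstoD(2)[OF v(2)]) simp
      then obtain n where "besov_norm S \<zeta> u (qdiff \<Lambda> (qfam S (v n))) < ennreal e"
        by (auto simp: eventually_sequentially)
      with v(1) show "\<exists>g\<in>Cw u. besov_norm S \<zeta> u (qdiff \<Lambda> (qfam S g)) \<le> ennreal e" by (auto intro: less_imp_le)
    qed
  next
    assume A: "\<forall>e>0. \<exists>g\<in>Cw u. besov_norm S \<zeta> u (qdiff \<Lambda> (qfam S g)) \<le> ennreal e"
    have "\<exists>g\<in>Cw u. besov_norm S \<zeta> u (qdiff \<Lambda> (qfam S g)) \<le> ennreal (inverse (real (Suc n)))" for n
      using A by simp
    then obtain v where v: "\<And>n. v n \<in> Cw u" "\<And>n. besov_norm S \<zeta> u (qdiff \<Lambda> (qfam S (v n))) \<le> ennreal (inverse (real (Suc n)))"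
      by metis
    have "(\<lambda>n. ennreal (inverse (real (Suc n)))) \<longlonglongrightarrow> ennreal 0"
      by (rule tendsto_ennrealI[OF LIMSEQ_inverse_real_of_nat])
    then have "(\<lambda>n. besov_norm S \<zeta> u (qdiff \<Lambda> (qfam S (v n)))) \<longlonglongrightarrow> 0"
      using v(2) by (rule_tac tendsto_sandwich[OF _ _ tendsto_const[of 0]]) (auto simp del: of_nat_Suc)
    with v(1) show "\<exists>v. (\<forall>n::nat. v n \<in> Cw u) \<and> (\<lambda>n. besov_norm S \<zeta> u (qdiff \<Lambda> (qfam S (v n)))) \<longlonglongrightarrow> 0" by blast
  qed
  moreover have "(\<forall>e>0. \<exists>g\<in>Cw u. besov_norm S \<zeta> u (qdiff \<Lambda> (qfam S g)) \<le> ennreal e) \<longleftrightarrow> ?A" if ?C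
    using iff[OF that] by (meson less_imp_le)
  ultimately show ?thesis unfolding besov_def by auto
qed

lemma eq_if_abs_diff_le_multiple:
  fixes a b K :: real
  assumes "\<And>e. 0 < e \<Longrightarrow> \<bar>a - b\<bar> \<le> K * e" 
  shows "a = b"
proof (rule ccontr)
  assume "a \<noteq> b"
  let ?e = "\<bar>a - b\<bar> / (2 * (\<bar>K\<bar> + 1))"
  have "0 < ?e" using \<open>a \<noteq> b\<close> by simp
  with assms have "\<bar>a - b\<bar> \<le> K * ?e" by blast
  also have "\<dots> \<le> (\<bar>K\<bar> + 1) * ?e" using \<open>0 < ?e\<close> by (intro mult_right_mono) auto
  also have "\<dots> = \<bar>a - b\<bar> / 2"
  proof -
    have "c * (d / (2 * c)) = d / 2" if "0 < c" for c d :: real using that by simp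
    from this[of "\<bar>K\<bar> + 1" "\<bar>a - b\<bar>"] show ?thesis by (simp only: add_nonneg_pos abs_ge_zero zero_less_one)
  qed
  finally show False using \<open>a \<noteq> b\<close> by simp
qed

text \<open>The operator at time r is bounded for the weighted sup norm, so the relation passes from
  the approximating functions to the limit. The factor \<open>s powr (\<zeta> / ell S)\<close> does
  no harm, as s is fixed.\<close>

lemma besov_consistent:
  assumes u: "G_controlled S u" and L: "\<Lambda> \<in> besov S \<zeta> u"
  shows "consistent S \<Lambda>"
  unfolding consistent_def
proof (intro allI impI)
  fix r s x assume r: "0 < r" and s: "0 < (s::real)" and rs: "r + s \<le> (1::real)"
  then have r1: "r \<le> 1" and sl: "s \<in> {0<..1}" and rsl: "r + s \<in> {0<..1}" by auto
  from L have Cw: "\<And>t. t \<in> {0<..1} \<Longrightarrow> \<Lambda> t \<in> Cw u"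
    and A: "\<And>e. e > 0 \<Longrightarrow> \<exists>g\<in>Cw u. \<forall>t\<in>{0<..1}. \<forall>x. \<bar>\<Lambda> t x - qint S t g x\<bar> \<le> e * t powr (\<zeta> / ell S) / wfun u x"
    by (auto simp: besov_iff[OF u])
  obtain C where C: "0 < C"
    "\<And>g B r x. dominated S u 0 B g \<Longrightarrow> 0 \<le> B \<Longrightarrow> 0 < r \<Longrightarrow> r \<le> 1 \<Longrightarrow>
       \<bar>qint S r g x\<bar> \<le> C * B / wfun u x"
    by (rule qint_bound_0[OF u]) (rule that)
  show "qint S r (\<Lambda> s) x = \<Lambda> (r + s) x"
  proof (rule eq_if_abs_diff_le_multiple)
    fix e :: real assume e: "0 < e"
    from A[OF e] obtain g where g: "g \<in> Cw u"
      and gb: "\<And>t x. t \<in> {0<..1} \<Longrightarrow> \<bar>\<Lambda> t x - qint S t g x\<bar> \<le> e * t powr (\<zeta> / ell S) / wfun u x" by blast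
    obtain B where B: "0 \<le> B" "dominated S u 0 B g" by (rule Cw_dominated[OF u g]) (rule that)
    obtain B1 where B1: "0 \<le> B1" "dominated S u 0 B1 (\<Lambda> s)" by (rule Cw_dominated[OF u Cw[OF sl]]) (rule that)
    obtain B2 where B2: "0 \<le> B2" "dominated S u 0 B2 (qint S s g)" using Cw_dominated[OF u qint_Cw[OF u g]] sl by auto
    have D: "dominated S u 0 (e * s powr (\<zeta> / ell S)) (\<lambda>z. \<Lambda> s z - qint S s g z)"
      using gb[OF sl] B1 B2 by (intro dominated_0I[OF u]) (auto simp: dominated_def)
    have "qint S r (\<Lambda> s) x - qint S (r + s) g x = qint S r (\<lambda>z. \<Lambda> s z - qint S s g z) x"
      using qint_diff[OF u order_refl s1_pos B1(2,1) B2(2,1) r r1] qint_qint[OF u order_refl s1_pos B(2,1) r s rs] by simp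
    then have "\<bar>qint S r (\<Lambda> s) x - qint S (r + s) g x\<bar> \<le> C * (e * s powr (\<zeta> / ell S)) / wfun u x"
      using C(2)[OF D _ r r1, of x] e by simp
    with gb[OF rsl, of x]
    have "\<bar>qint S r (\<Lambda> s) x - \<Lambda> (r + s) x\<bar> \<le> C * (e * s powr (\<zeta> / ell S)) / wfun u x + e * (r + s) powr (\<zeta> / ell S) / wfun u x"
      by linarith
    then show "\<bar>qint S r (\<Lambda> s) x - \<Lambda> (r + s) x\<bar> \<le> ((C * s powr (\<zeta> / ell S) + (r + s) powr (\<zeta> / ell S)) / wfun u x) * e"
      by (simp add: algebra_simps add_divide_distrib)
  qed
qed

text \<open>The approximating function is the member of the family at a small time \<epsilon>. For t
  \<le> \<delta> the members at t and t + \<epsilon> are both small by \<open>van\<close>; for t >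
  \<delta> the Lipschitz bound in time gives an error of order \<epsilon>. As \<zeta> \<le> 0, the
  rate \<open>t powr (\<zeta> / ell S)\<close> is nonincreasing in t and at least 1, so both errors
  are admissible.\<close>

lemma besovI_vanishing:
  assumes u: "G_controlled S u" and cons: "consistent S \<Lambda>"
    and Cw: "\<And>t. t \<in> {0<..1} \<Longrightarrow> \<Lambda> t \<in> Cw u" and Z: "\<And>t. t \<notin> {0<..1} \<Longrightarrow> \<Lambda> t = (\<lambda>x. 0)"
    and \<zeta>: "\<zeta> \<le> 0"
    and van: "\<And>e. 0 < e \<Longrightarrow> \<exists>\<delta>>0. \<forall>t x. 0 < t \<longrightarrow> t \<le> \<delta> \<longrightarrow> t \<le> 1 \<longrightarrow> \<bar>\<Lambda> t x\<bar> \<le> e * t powr (\<zeta> / ell S) / wfun u x"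
  shows "\<Lambda> \<in> besov S \<zeta> u"
  unfolding besov_iff[OF u]
proof (intro conjI allI impI ballI)
  fix e :: real assume e: "0 < e"
  from van[of "e / 2"] e obtain \<delta>0 where d0: "0 < \<delta>0"
    "\<And>t x. 0 < t \<Longrightarrow> t \<le> \<delta>0 \<Longrightarrow> t \<le> 1 \<Longrightarrow> \<bar>\<Lambda> t x\<bar> \<le> e / 2 * t powr (\<zeta> / ell S) / wfun u x" by auto
  \<comment> \<open>Halving keeps t + \<epsilon> below \<delta>0 and below 1 whenever t \<le>
    \<delta>.\<close>
  define \<delta> where "\<delta> = min (\<delta>0 / 2) (1 / 2)"
  have d: "0 < \<delta>" "2 * \<delta> \<le> \<delta>0" "2 * \<delta> \<le> 1" using d0 by (auto simp: \<delta>_def min_def)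
  have dh: "\<delta> / 2 \<in> {0<..1}" using d by auto
  obtain B where B: "0 \<le> B" "dominated S u 0 B (\<Lambda> (\<delta> / 2))" by (rule Cw_dominated[OF u Cw[OF dh]]) (rule that)
  obtain C where C: "0 < C"
    "\<And>g B r r' x. dominated S u 0 B g \<Longrightarrow> 0 \<le> B \<Longrightarrow> \<delta> / 2 \<le> r \<Longrightarrow> r \<le> r' \<Longrightarrow> r' \<le> 1 \<Longrightarrow>
       \<bar>qint S r' g x - qint S r g x\<bar> \<le> C * (r' - r) * B / wfun u x"
    using qint_time_difference[OF u, of "\<delta> / 2"] d by auto
  define \<epsilon> where "\<epsilon> = min (\<delta> / 4) (e / (C * B + 1))"
  have CB: "0 < C * B + 1" using C B by (intro add_nonneg_pos mult_nonneg_nonneg) auto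
  have ep: "0 < \<epsilon>" "\<epsilon> \<le> \<delta> / 4" "\<epsilon> \<le> e / (C * B + 1)"
  proof -
    show "0 < \<epsilon>" unfolding \<epsilon>_def using d e CB by simp
  qed (unfold \<epsilon>_def, rule min.cobounded1, rule min.cobounded2)
  have ep1: "\<epsilon> \<in> {0<..1}" using ep d by auto
  obtain B0 where B0: "0 \<le> B0" "dominated S u 0 B0 (\<Lambda> \<epsilon>)" by (rule Cw_dominated[OF u Cw[OF ep1]]) (rule that)
  show "\<exists>g\<in>Cw u. \<forall>t\<in>{0<..1}. \<forall>x. \<bar>\<Lambda> t x - qint S t g x\<bar> \<le> e * t powr (\<zeta> / ell S) / wfun u x"
  proof (intro bexI[of _ "\<Lambda> \<epsilon>"] ballI allI)
    show "\<Lambda> \<epsilon> \<in> Cw u" by (rule Cw[OF ep1])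
    fix t x assume t: "t \<in> {0<..(1::real)}"
    have z: "\<zeta> / ell S \<le> 0" using \<zeta> ell_pos by (simp add: divide_le_0_iff)
    note wp = wfun_pos[OF u, of x]
    show "\<bar>\<Lambda> t x - qint S t (\<Lambda> \<epsilon>) x\<bar> \<le> e * t powr (\<zeta> / ell S) / wfun u x"
    proof (cases "t \<le> \<delta>")
      case True
      have "qint S t (\<Lambda> \<epsilon>) x = \<Lambda> (t + \<epsilon>) x"
        using t True ep d by (intro consistentD[OF cons]) auto
      then have "\<bar>\<Lambda> t x - qint S t (\<Lambda> \<epsilon>) x\<bar> \<le> \<bar>\<Lambda> t x\<bar> + \<bar>\<Lambda> (t + \<epsilon>) x\<bar>" by simp
      also have "\<dots> \<le> e / 2 * t powr (\<zeta> / ell S) / wfun u x + e / 2 * t powr (\<zeta> / ell S) / wfun u x"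
      proof (rule add_mono)
        show "\<bar>\<Lambda> t x\<bar> \<le> e / 2 * t powr (\<zeta> / ell S) / wfun u x"
          using t True d by (intro d0(2)) auto
        have "\<bar>\<Lambda> (t + \<epsilon>) x\<bar> \<le> e / 2 * (t + \<epsilon>) powr (\<zeta> / ell S) / wfun u x"
          using t True d ep by (intro d0(2)) auto
        also have "\<dots> \<le> e / 2 * t powr (\<zeta> / ell S) / wfun u x"
          using t ep e z wp by (intro divide_right_mono mult_left_mono powr_mono2') auto
        finally show "\<bar>\<Lambda> (t + \<epsilon>) x\<bar> \<le> e / 2 * t powr (\<zeta> / ell S) / wfun u x" .
      qed
      also have "\<dots> = e * t powr (\<zeta> / ell S) / wfun u x" by (simp add: field_simps)
      finally show ?thesis .
    next
      case False
      have 1: "\<Lambda> t x = qint S (t - \<delta> / 2) (\<Lambda> (\<delta> / 2)) x"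
        using consistentD[OF cons, of "t - \<delta> / 2" "\<delta> / 2" x] t False d by simp
      \<comment> \<open>Here t + \<epsilon> may exceed 1, where the family is set to 0, so Q_t of
        the member at \<epsilon> cannot be read as a member of the family. Both quantities are
        instead written as operators applied to the member at \<delta> / 2.\<close>
      have "\<Lambda> (\<delta> / 2) = qint S (\<delta> / 2 - \<epsilon>) (\<Lambda> \<epsilon>)"
        using consistentD[OF cons, of "\<delta> / 2 - \<epsilon>" \<epsilon>] ep d by (intro ext) auto
      then have "qint S (t - (\<delta> / 2 - \<epsilon>)) (\<Lambda> (\<delta> / 2)) x = qint S (t - (\<delta> / 2 - \<epsilon>) + (\<delta> / 2 - \<epsilon>)) (\<Lambda> \<epsilon>) x"
        using qint_qint[OF u order_refl s1_pos B0(2,1), of "t - (\<delta> / 2 - \<epsilon>)" "\<delta> / 2 - \<epsilon>" x] t False ep d by simp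
      then have 2: "qint S t (\<Lambda> \<epsilon>) x = qint S (t - \<delta> / 2 + \<epsilon>) (\<Lambda> (\<delta> / 2)) x" by (simp add: algebra_simps)
      have "\<bar>qint S (t - \<delta> / 2 + \<epsilon>) (\<Lambda> (\<delta> / 2)) x - qint S (t - \<delta> / 2) (\<Lambda> (\<delta> / 2)) x\<bar>
         \<le> C * (t - \<delta> / 2 + \<epsilon> - (t - \<delta> / 2)) * B / wfun u x"
        using t False ep d by (intro C(2)[OF B(2,1)]) auto
      then have "\<bar>\<Lambda> t x - qint S t (\<Lambda> \<epsilon>) x\<bar> \<le> (C * B) * \<epsilon> / wfun u x"
        unfolding 1 2 by (simp add: abs_minus_commute mult_ac)
      also have "\<dots> \<le> (C * B + 1) * (e / (C * B + 1)) / wfun u x"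
        using ep C B CB wp by (intro divide_right_mono mult_mono) auto
      also have "\<dots> = e * 1 / wfun u x" using CB by simp
      also have "\<dots> \<le> e * t powr (\<zeta> / ell S) / wfun u x"
      proof (intro divide_right_mono mult_left_mono)
        show "1 \<le> t powr (\<zeta> / ell S)"
          using powr_mono2'[of "\<zeta> / ell S" t 1] t z by simp
      qed (use e wp in auto)
      finally show ?thesis .
    qed
  qed
qed (use Cw Z in auto)

section \<open>Reconstruction of germs\<close>

text \<open>The difference is controlled off the hyperplane only, and with a singularity. Integrated
  against the kernel at time t - s \<ge> t / 2 it gives a bound whose singular factor does not
  degenerate as s tends to 0.\<close>

lemma consistent_eqI:
  assumes u: "G_controlled S u" and k: "0 \<le> \<kappa>" "\<kappa> < s1" and \<gamma>: "0 < \<gamma>"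
    and c: "consistent S \<Lambda>" "consistent S \<Lambda>'"
    and Cw: "\<And>t. t \<in> {0<..1} \<Longrightarrow> \<Lambda> t \<in> Cw u" "\<And>t. t \<in> {0<..1} \<Longrightarrow> \<Lambda>' t \<in> Cw u"
    and bd: "\<And>t x. t \<in> {0<..1} \<Longrightarrow> x \<in> off_hyp S \<Longrightarrow> \<bar>\<Lambda> t x - \<Lambda>' t x\<bar> \<le> K * t powr (\<gamma> / ell S) * phi S x powr (-\<kappa>) / wfun u x"
    and t: "t \<in> {0<..1}"
  shows "\<Lambda> t x = \<Lambda>' t x"
proof (rule ccontr)
  assume ne: "\<Lambda> t x \<noteq> \<Lambda>' t x"
  obtain C where C: "0 < C"
    "\<And>g B r x. dominated S u \<kappa> B g \<Longrightarrow> 0 \<le> B \<Longrightarrow> 0 < r \<Longrightarrow> r \<le> 1 \<Longrightarrow>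
       \<bar>qint S r g x\<bar> \<le> C * B * pmax S r x powr (-\<kappa>) / wfun u x"
    by (rule qint_bound[OF u k]) (rule that)
  define K' where "K' = \<bar>K\<bar>"
  have main: "\<bar>\<Lambda> t x - \<Lambda>' t x\<bar> \<le> C * (K' * s powr (\<gamma> / ell S)) * pmax S (t / 2) x powr (-\<kappa>) / wfun u x" if s: "0 < s" "s \<le> t / 2" for s
  proof -
    have sl: "s \<in> {0<..1}" and ts: "0 < t - s" "t - s \<le> 1" using s t by auto
    obtain B1 where B1: "0 \<le> B1" "dominated S u 0 B1 (\<Lambda> s)" by (rule Cw_dominated[OF u Cw(1)[OF sl]]) (rule that)
    obtain B2 where B2: "0 \<le> B2" "dominated S u 0 B2 (\<Lambda>' s)" by (rule Cw_dominated[OF u Cw(2)[OF sl]]) (rule that)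
    have "\<Lambda> t x - \<Lambda>' t x = qint S (t - s) (\<lambda>z. \<Lambda> s z - \<Lambda>' s z) x"
      using qint_diff[OF u order_refl s1_pos B1(2,1) B2(2,1) ts] consistentD[OF c(1), of "t - s" s x] consistentD[OF c(2), of "t - s" s x] ts s t
      by simp
    moreover have "dominated S u \<kappa> (K' * s powr (\<gamma> / ell S)) (\<lambda>z. \<Lambda> s z - \<Lambda>' s z)"
      unfolding dominated_def
    proof (intro conjI ballI)
      show "(\<lambda>z. \<Lambda> s z - \<Lambda>' s z) \<in> borel_measurable borel" using B1 B2 by (auto simp: dominated_def)
      fix z assume z: "z \<in> off_hyp S"
      show "\<bar>\<Lambda> s z - \<Lambda>' s z\<bar> \<le> K' * s powr (\<gamma> / ell S) * phi S z powr - \<kappa> / wfun u z"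
        using wfun_pos[OF u, of z]
        by (rule_tac order_trans[OF bd[OF sl z]]) (auto simp: K'_def intro!: divide_right_mono mult_right_mono)
    qed
    ultimately have "\<bar>\<Lambda> t x - \<Lambda>' t x\<bar> \<le> C * (K' * s powr (\<gamma> / ell S)) * pmax S (t - s) x powr (-\<kappa>) / wfun u x"
      using C(2)[OF _ _ ts, of "K' * s powr (\<gamma> / ell S)"] by (simp add: K'_def)
    also have "\<dots> \<le> C * (K' * s powr (\<gamma> / ell S)) * pmax S (t / 2) x powr (-\<kappa>) / wfun u x"
    proof (intro divide_right_mono mult_left_mono powr_mono2')
      have "(t / 2) powr (1 / ell S) \<le> (t - s) powr (1 / ell S)"
        using s t ell_pos by (intro powr_mono2) auto
      then show "pmax S (t / 2) x \<le> pmax S (t - s) x" by (auto simp: pmax_def)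
      show "0 < pmax S (t / 2) x" using t by (intro pmax_pos) auto
    qed (use k C wfun_pos[OF u, of x] in \<open>auto simp: K'_def\<close>)
    finally show ?thesis .
  qed
  define M where "M = C * K' * pmax S (t / 2) x powr (-\<kappa>) / wfun u x"
  have "((\<lambda>s. M * s powr (\<gamma> / ell S)) \<longlongrightarrow> M * 0) (at_right 0)"
  proof (intro tendsto_mult tendsto_const)
    have "((\<lambda>s. s powr (\<gamma> / ell S)) \<longlongrightarrow> 0 powr (\<gamma> / ell S)) (at_right 0)"
      by (intro tendsto_powr') (use \<gamma> ell_pos in \<open>auto simp: eventually_at_filter intro: tendsto_eq_intros\<close>)
    then show "((\<lambda>s. s powr (\<gamma> / ell S)) \<longlongrightarrow> 0) (at_right 0)" by simp
  qed
  moreover have "\<forall>\<^sub>F s in at_right 0. \<bar>\<Lambda> t x - \<Lambda>' t x\<bar> \<le> M * s powr (\<gamma> / ell S)"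
    unfolding eventually_at_right_field using main t
    by (intro exI[of _ "t / 2"]) (auto simp: M_def mult_ac)
  ultimately have "\<bar>\<Lambda> t x - \<Lambda>' t x\<bar> \<le> M * 0"
    by (intro tendsto_lowerbound) auto
  with ne show False by simp
qed

end

section \<open>Comparable times and geometric series\<close>

lemma powr_comparable:
  fixes r s a :: real
  assumes "0 < s" "s \<le> r" "r \<le> 4 * s"
  shows "s powr a \<le> 4 powr \<bar>a\<bar> * r powr a"
proof (cases "0 \<le> a")
  case True
  have "s powr a \<le> 1 * r powr a" using assms True by (simp add: powr_mono2)
  also have "\<dots> \<le> 4 powr \<bar>a\<bar> * r powr a"
    using True by (intro mult_right_mono) (auto intro: ge_one_powr_ge_zero)
  finally show ?thesis .
next
  case False
  have "s powr a \<le> (r / 4) powr a" using assms False by (intro powr_mono2') auto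
  also have "\<dots> = 4 powr \<bar>a\<bar> * r powr a"
    using assms False by (simp add: powr_divide powr_minus_divide)
  finally show ?thesis .
qed

text \<open>Takes the first dyadic number not above t / 2. It exceeds t / 4, hence is comparable
  with t.\<close>

lemma dyadic_near:
  fixes t :: real
  assumes "0 < t" "t \<le> 1"
  obtains n where "(1/2) ^ n \<le> t / 2" "t / 2 < 2 * (1/2) ^ n"
proof -
  have "\<exists>n. (1/2::real) ^ n < t / 2" using assms by (intro real_arch_pow_inv) auto
  then have ex: "\<exists>n. (1/2::real) ^ n \<le> t / 2" by (auto intro: less_imp_le)
  define n where "n = (LEAST n. (1/2::real) ^ n \<le> t / 2)"
  have 1: "(1/2) ^ n \<le> t / 2" unfolding n_def using ex by (rule LeastI_ex)
  then have "n \<noteq> 0" using assms by (auto intro: ccontr)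
  then obtain m where m: "n = Suc m" by (cases n) auto
  have "\<not> (1/2::real) ^ m \<le> t / 2" using not_less_Least[of m "\<lambda>n. (1/2::real) ^ n \<le> t / 2"] unfolding n_def[symmetric] by (simp add: m)
  then have "t / 2 < 2 * (1/2) ^ n" by (simp add: m)
  with 1 that show ?thesis by blast
qed

lemma geometric_increments:
  fixes a :: "nat \<Rightarrow> real"
  assumes q: "0 < q" "q < 1" and inc: "\<And>n. n0 \<le> n \<Longrightarrow> \<bar>a (Suc n) - a n\<bar> \<le> K * q ^ n"
  shows "convergent a" and "\<And>n. n0 \<le> n \<Longrightarrow> \<bar>lim a - a n\<bar> \<le> K * q ^ n / (1 - q)"
proof -
  have step: "\<bar>a (n + k) - a n\<bar> \<le> K * q ^ n / (1 - q)" if n: "n0 \<le> n" for n k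
  proof -
    have "\<bar>a (n + k) - a n\<bar> \<le> (\<Sum>j<k. K * q ^ (n + j))"
    proof (induction k)
      case (Suc k)
      have "\<bar>a (n + Suc k) - a n\<bar> \<le> \<bar>a (Suc (n + k)) - a (n + k)\<bar> + \<bar>a (n + k) - a n\<bar>" by simp
      also have "\<dots> \<le> K * q ^ (n + k) + (\<Sum>j<k. K * q ^ (n + j))" using Suc inc[of "n + k"] n by (intro add_mono) auto
      finally show ?case by simp
    qed simp
    also have "\<dots> = K * q ^ n * (\<Sum>j<k. q ^ j)" by (simp add: sum_distrib_left power_add mult_ac)
    also have "\<dots> \<le> K * q ^ n * (1 / (1 - q))"
    proof (rule mult_left_mono)
      show "(\<Sum>j<k. q ^ j) \<le> 1 / (1 - q)" using q by (simp add: sum_gp_strict divide_right_mono)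
      show "0 \<le> K * q ^ n" using inc[OF n] by (meson abs_ge_zero order_trans)
    qed
    finally show ?thesis by simp
  qed
  have K: "0 \<le> K"
    using inc[of n0] q by (metis abs_ge_zero order_refl order_trans zero_le_mult_iff zero_less_power not_le)
  show conv: "convergent a"
  proof (rule Cauchy_convergent, rule metric_CauchyI)
    fix e :: real assume e: "0 < e"
    have "(\<lambda>n. K * q ^ n / (1 - q)) \<longlonglongrightarrow> K * 0 / (1 - q)"
      using q by (intro tendsto_intros LIMSEQ_realpow_zero) auto
    then have "\<forall>\<^sub>F n in sequentially. K * q ^ n / (1 - q) < e / 2"
      using e by (intro order_tendstoD) auto
    then obtain n1 where n1: "\<And>n. n1 \<le> n \<Longrightarrow> K * q ^ n / (1 - q) < e / 2" by (auto simp: eventually_sequentially)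
    let ?m = "max n0 n1"
    have "\<bar>a n - a ?m\<bar> < e / 2" if "?m \<le> n" for n
      using step[of ?m "n - ?m"] n1[of ?m] that le_add_diff_inverse[OF that]
        by (metis le_less_trans max.cobounded1 max.cobounded2)
    then show "\<exists>M. \<forall>m\<ge>M. \<forall>n\<ge>M. dist (a m) (a n) < e"
      by (intro exI[of _ ?m] allI impI) (smt (verit) dist_real_def field_sum_of_halves)
  qed
  fix n assume n: "n0 \<le> n"
  have "(\<lambda>k. \<bar>a (n + k) - a n\<bar>) \<longlonglongrightarrow> \<bar>lim a - a n\<bar>"
    using LIMSEQ_ignore_initial_segment[of a "lim a" n] conv
    by (intro tendsto_intros) (simp add: convergent_LIMSEQ_iff add.commute)
  then show "\<bar>lim a - a n\<bar> \<le> K * q ^ n / (1 - q)"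
    using step[OF n] by (intro LIMSEQ_le_const2) auto
qed

section \<open>Coherent germs and their reconstruction\<close>

locale germ_setting = gsemi S for S :: "('n::finite) setting" +
  fixes u :: "'n weight" and I :: "real set" and \<gamma> \<eta> :: real
  assumes u: "G_controlled S u" and finI: "finite I" and I_less: "\<And>\<alpha>. \<alpha> \<in> I \<Longrightarrow> \<alpha> < \<gamma>"
    and \<gamma>: "0 < \<gamma>" and \<eta>: "\<gamma> - s1 < \<eta>" "\<eta> \<le> \<gamma>"
begin

text \<open>Abstracts F s y as Q_s(y, \<Pi> of f(y) at base y) and H x s z as Q_s(z, \<Pi> of f(x)
  at base x). A is the coherence constant and B the size constant. No structure of models is left,
  so that the difference of two models is covered as well. Integrability is a clause of its own
  because \<open>H x s\<close> is in general controlled by another weight than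
  \<open>u\<close>.\<close>

definition germ :: "real \<Rightarrow> real \<Rightarrow> (real \<Rightarrow> real^'n \<Rightarrow> real) \<Rightarrow> (real^'n \<Rightarrow> real \<Rightarrow> real^'n \<Rightarrow> real) \<Rightarrow> bool" where
  "germ A B F H \<longleftrightarrow>
    (\<forall>s\<in>{0<..1}. F s \<in> borel_measurable borel) \<and>
    (\<forall>x\<in>off_hyp S. \<forall>s\<in>{0<..1}. F s x = H x s x) \<and>
    (\<forall>x\<in>off_hyp S. \<forall>r s y. 0 < r \<longrightarrow> 0 < s \<longrightarrow> r + s \<le> 1 \<longrightarrow>
       integrable lborel (\<lambda>z. Qker S r y z * H x s z) \<and> qint S r (H x s) y = H x (r + s) y) \<and>
    (\<forall>x\<in>off_hyp S. \<forall>z\<in>off_hyp S. \<forall>s\<in>{0<..1}. \<bar>F s z - H x s z\<bar> \<le>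
       A / wfun u x * wstar u (x - z) * phi2 S x z powr (\<eta> - \<gamma>) *
         (\<Sum>\<alpha>\<in>I. s powr (\<alpha> / ell S) * snorm S (z - x) powr (\<gamma> - \<alpha>))) \<and>
    (\<forall>y\<in>off_hyp S. \<forall>s\<in>{0<..1}. \<bar>F s y\<bar> \<le>
       B / wfun u y * (\<Sum>\<alpha>\<in>I. s powr (\<alpha> / ell S) * phi S y powr (min (\<eta> - \<alpha>) 0)))"

abbreviation "\<kappa> \<equiv> \<gamma> - \<eta>"

lemma kap: "0 \<le> \<kappa>" "\<kappa> < s1"
  using \<eta> by auto

text \<open>A qualitative bound, whose sum may blow up as s tends to 0. Since \<alpha> < \<gamma>,
  every singular exponent is at least -\<kappa>, so all integrals of the germ exist.\<close>

lemma germ_dominated: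
  assumes g: "germ A B F H" and B: "0 \<le> B" and s: "s \<in> {0<..1}"
  shows "dominated S u \<kappa> (B * (\<Sum>\<alpha>\<in>I. s powr (\<alpha> / ell S))) (F s)"
  unfolding dominated_def
proof (intro conjI ballI)
  show "F s \<in> borel_measurable borel" using g s by (simp add: germ_def)
  fix y assume y: "y \<in> off_hyp S"
  have "\<bar>F s y\<bar> \<le> B / wfun u y * (\<Sum>\<alpha>\<in>I. s powr (\<alpha> / ell S) * phi S y powr (min (\<eta> - \<alpha>) 0))"
    using g s y unfolding germ_def by blast
  also have "\<dots> \<le> B / wfun u y * (\<Sum>\<alpha>\<in>I. s powr (\<alpha> / ell S) * phi S y powr (- \<kappa>))"
  proof (intro mult_left_mono sum_mono)
    fix \<alpha> assume "\<alpha> \<in> I"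
    then have "- \<kappa> \<le> min (\<eta> - \<alpha>) 0" using I_less[of \<alpha>] \<eta> by auto
    then show "phi S y powr (min (\<eta> - \<alpha>) 0) \<le> phi S y powr (- \<kappa>)"
      using phi_pos[OF y] phi_le1[of y] by (intro powr_mono') auto
  qed (use B wfun_pos[OF u, of y] in auto)
  finally show "\<bar>F s y\<bar> \<le> B * (\<Sum>\<alpha>\<in>I. s powr (\<alpha> / ell S)) * phi S y powr (- \<kappa>) / wfun u y"
    by (simp add: sum_distrib_right[symmetric] mult_ac)
qed

text \<open>Writing |z - x| as \<open>r powr (1 / ell S)\<close> times \<open>snormr\<close>, each
  term of the coherence bound becomes \<open>r powr (\<gamma> / ell S)\<close> times a power of
  \<open>snormr\<close>, because s and r are comparable; the kernel absorbs these powers and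
  \<open>wstar\<close>. The minimum in \<open>phi2\<close> is bounded by a sum: its first term is
  constant in z, its second is smoothed to \<open>pmax\<close>, which is at least
  \<open>phi S x\<close>.\<close>

lemma local_error:
  obtains C where "0 < C"
    "\<And>A B F H x r s. germ A B F H \<Longrightarrow> 0 \<le> A \<Longrightarrow> 0 \<le> B \<Longrightarrow> x \<in> off_hyp S \<Longrightarrow> 0 < s \<Longrightarrow> s \<le> r \<Longrightarrow> r \<le> 4 * s \<Longrightarrow>
       r + s \<le> 1 \<Longrightarrow> \<bar>qint S r (F s) x - H x (r + s) x\<bar> \<le> C * A * r powr (\<gamma> / ell S) * phi S x powr (-\<kappa>) / wfun u x"
proof -
  \<comment> \<open>All \<gamma> - \<alpha> are positive, so their sum bounds each of them and one
    exponent N serves every degree.\<close>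
  obtain N :: nat where N0: "(\<Sum>\<alpha>\<in>I. \<gamma> - \<alpha>) \<le> real N" using real_arch_simple by blast
  have N: "\<gamma> - \<alpha> \<le> real N" if "\<alpha> \<in> I" for \<alpha>
    using member_le_sum[of \<alpha> I "\<lambda>\<alpha>. \<gamma> - \<alpha>"] that finI I_less N0 by (auto simp: less_imp_le)
  let ?h = "\<lambda>\<kappa> r x z. \<bar>Qker S r x z\<bar> * (wstar u (x - z) * (1 + snormr S r (x - z)) ^ N) * phi S z powr (-\<kappa>)"
  obtain C0 where C0: "0 < C0"
    "\<And>r x. 0 < r \<Longrightarrow> r \<le> 1 \<Longrightarrow> integrable lborel (?h 0 r x)"
    "\<And>r x. 0 < r \<Longrightarrow> r \<le> 1 \<Longrightarrow> (LINT z|lborel. ?h 0 r x z) \<le> C0 * pmax S r x powr (-0)"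
    by (rule Q_weighted_integral[OF u order_refl s1_pos, of N]) (rule that)
  obtain C1 where C1: "0 < C1"
    "\<And>r x. 0 < r \<Longrightarrow> r \<le> 1 \<Longrightarrow> integrable lborel (?h \<kappa> r x)"
    "\<And>r x. 0 < r \<Longrightarrow> r \<le> 1 \<Longrightarrow> (LINT z|lborel. ?h \<kappa> r x z) \<le> C1 * pmax S r x powr (-\<kappa>)"
    by (rule Q_weighted_integral[OF u kap, of N]) (rule that)
  define M where "M = (\<Sum>\<alpha>\<in>I. 4 powr \<bar>\<alpha> / ell S\<bar>) + 1"
  have M: "0 < M" unfolding M_def by (intro add_nonneg_pos sum_nonneg) auto
  show ?thesis
  proof (rule that[of "M * (C0 + C1)"])
    show "0 < M * (C0 + C1)" using M C0 C1 by simp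
    fix A B F H x r s
    assume g: "germ A B F H" and A: "0 \<le> A" and B: "0 \<le> B" and x: "x \<in> off_hyp S"
      and s: "0 < s" "s \<le> r" "r \<le> 4 * s" "r + s \<le> (1::real)"
    have r: "0 < r" "r \<le> 1" and s1': "s \<in> {0<..1}" using s by auto
    have iF: "integrable lborel (\<lambda>z. Qker S r x z * F s z)"
      by (rule qint_integrable[OF u kap germ_dominated[OF g B s1'] _ r]) (use B in \<open>auto intro!: mult_nonneg_nonneg sum_nonneg\<close>)
    have iH: "integrable lborel (\<lambda>z. Qker S r x z * H x s z)" and qH: "qint S r (H x s) x = H x (r + s) x"
      using g x r(1) s by (auto simp: germ_def)
    have "qint S r (F s) x - H x (r + s) x = (LINT z|lborel. Qker S r x z * (F s z - H x s z))"
      unfolding qH[symmetric] qint_def using iF iH by (simp add: right_diff_distrib)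
    also have "\<bar>\<dots>\<bar> \<le> (LINT z|lborel. \<bar>Qker S r x z * (F s z - H x s z)\<bar>)" by (rule integral_abs_bound)
    also have "\<dots> \<le> (LINT z|lborel. A / wfun u x * M * r powr (\<gamma> / ell S) * (phi S x powr (-\<kappa>) * ?h 0 r x z + ?h \<kappa> r x z))"
    proof (rule integral_mono_AE)
      show "integrable lborel (\<lambda>z. \<bar>Qker S r x z * (F s z - H x s z)\<bar>)"
        using iF iH by (simp add: right_diff_distrib)
      show "integrable lborel (\<lambda>z. A / wfun u x * M * r powr (\<gamma> / ell S) * (phi S x powr (-\<kappa>) * ?h 0 r x z + ?h \<kappa> r x z))"
        by (intro integrable_mult_right Bochner_Integration.integrable_add C0 C1 r)
      show "AE z in lborel. \<bar>Qker S r x z * (F s z - H x s z)\<bar> \<le> A / wfun u x * M * r powr (\<gamma> / ell S) * (phi S x powr (-\<kappa>) * ?h 0 r x z + ?h \<kappa> r x z)"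
        using AE_off_hyp
      proof eventually_elim
        case (elim z)
        let ?W = "wstar u (x - z)" and ?n = "snormr S r (x - z)" and ?a = "A / wfun u x"
        have W: "0 \<le> ?W" using wstar_ge1[OF u, of "x - z"] by linarith
        have n: "0 \<le> ?n" by (rule snormr_nonneg)
        have a: "0 \<le> ?a" using A wfun_pos[OF u, of x] by simp
        have p2: "phi2 S x z powr (\<eta> - \<gamma>) \<le> phi S x powr (-\<kappa>) + phi S z powr (-\<kappa>)"
          by (auto simp: phi2_def min_def)
        have sum: "(\<Sum>\<alpha>\<in>I. s powr (\<alpha> / ell S) * snorm S (z - x) powr (\<gamma> - \<alpha>)) \<le> M * r powr (\<gamma> / ell S) * (1 + ?n) ^ N"
        proof -
          have "(\<Sum>\<alpha>\<in>I. s powr (\<alpha> / ell S) * snorm S (z - x) powr (\<gamma> - \<alpha>)) \<le>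
                (\<Sum>\<alpha>\<in>I. 4 powr \<bar>\<alpha> / ell S\<bar> * (r powr (\<gamma> / ell S) * (1 + ?n) ^ N))"
          proof (rule sum_mono)
            fix \<alpha> assume al: "\<alpha> \<in> I"
            have "snorm S (z - x) = r powr (1 / ell S) * ?n"
              using r by (simp add: snormr_def snorm_minus_commute)
            then have "snorm S (z - x) powr (\<gamma> - \<alpha>) = r powr ((\<gamma> - \<alpha>) / ell S) * ?n powr (\<gamma> - \<alpha>)"
              using n by (simp add: powr_mult powr_powr)
            also have "?n powr (\<gamma> - \<alpha>) \<le> (1 + ?n) powr (\<gamma> - \<alpha>)"
              using n I_less[OF al] by (intro powr_mono2) auto
            also have "\<dots> \<le> (1 + ?n) powr (real N)"
              using n N[OF al] by (intro powr_mono) auto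
            also have "\<dots> = (1 + ?n) ^ N" using n by (intro powr_realpow) linarith
            finally have 1: "snorm S (z - x) powr (\<gamma> - \<alpha>) \<le> r powr ((\<gamma> - \<alpha>) / ell S) * (1 + ?n) ^ N"
              by (simp add: mult_left_mono)
            have "s powr (\<alpha> / ell S) * snorm S (z - x) powr (\<gamma> - \<alpha>)
               \<le> (4 powr \<bar>\<alpha> / ell S\<bar> * r powr (\<alpha> / ell S)) * (r powr ((\<gamma> - \<alpha>) / ell S) * (1 + ?n) ^ N)"
              using s by (intro mult_mono powr_comparable 1) auto
            also have "\<dots> = 4 powr \<bar>\<alpha> / ell S\<bar> * (r powr (\<gamma> / ell S) * (1 + ?n) ^ N)"
              using r by (simp add: powr_add[symmetric] diff_divide_distrib mult.assoc[symmetric])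
            finally show "s powr (\<alpha> / ell S) * snorm S (z - x) powr (\<gamma> - \<alpha>) \<le> 4 powr \<bar>\<alpha> / ell S\<bar> * (r powr (\<gamma> / ell S) * (1 + ?n) ^ N)" .
          qed
          also have "\<dots> \<le> M * (r powr (\<gamma> / ell S) * (1 + ?n) ^ N)"
            unfolding sum_distrib_right[symmetric] M_def using n by (intro mult_right_mono) auto
          finally show ?thesis by (simp add: mult.assoc)
        qed
        have "\<bar>F s z - H x s z\<bar> \<le> ?a * ?W * phi2 S x z powr (\<eta> - \<gamma>) * (\<Sum>\<alpha>\<in>I. s powr (\<alpha> / ell S) * snorm S (z - x) powr (\<gamma> - \<alpha>))"
          using g x elim s1' unfolding germ_def by blast
        also have "\<dots> \<le> ?a * ?W * (phi S x powr (-\<kappa>) + phi S z powr (-\<kappa>)) * (M * r powr (\<gamma> / ell S) * (1 + ?n) ^ N)"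
          using a W by (intro mult_mono p2 sum order_refl mult_nonneg_nonneg sum_nonneg add_nonneg_nonneg) auto
        finally have "\<bar>Qker S r x z\<bar> * \<bar>F s z - H x s z\<bar> \<le> \<bar>Qker S r x z\<bar> * (?a * ?W * (phi S x powr (-\<kappa>) + phi S z powr (-\<kappa>)) * (M * r powr (\<gamma> / ell S) * (1 + ?n) ^ N))"
          by (rule mult_left_mono) simp
        also have "\<dots> = ?a * M * r powr (\<gamma> / ell S) * (phi S x powr (-\<kappa>) * ?h 0 r x z + ?h \<kappa> r x z)"
          using phi_pos[OF elim] by (simp add: algebra_simps)
        finally show ?case by (simp add: abs_mult)
      qed
    qed
    also have "\<dots> = A / wfun u x * M * r powr (\<gamma> / ell S) * (phi S x powr (-\<kappa>) * (LINT z|lborel. ?h 0 r x z) + (LINT z|lborel. ?h \<kappa> r x z))"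
      using C0(2)[OF r, of x] C1(2)[OF r, of x] by simp
    also have "\<dots> \<le> A / wfun u x * M * r powr (\<gamma> / ell S) * (phi S x powr (-\<kappa>) * C0 + C1 * phi S x powr (-\<kappa>))"
    proof (intro mult_left_mono add_mono)
      show "(LINT z|lborel. ?h 0 r x z) \<le> C0" using C0(3)[OF r, of x] pmax_pos[OF r(1), of x] by simp
      have "(LINT z|lborel. ?h \<kappa> r x z) \<le> C1 * pmax S r x powr (-\<kappa>)" by (rule C1(3)[OF r])
      also have "\<dots> \<le> C1 * phi S x powr (-\<kappa>)"
        using C1 kap phi_pos[OF x] by (intro mult_left_mono powr_mono2') (auto simp: pmax_def)
      finally show "(LINT z|lborel. ?h \<kappa> r x z) \<le> C1 * phi S x powr (-\<kappa>)" .
    qed (use A M wfun_pos[OF u, of x] in auto)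
    also have "\<dots> = M * (C0 + C1) * A * r powr (\<gamma> / ell S) * phi S x powr (-\<kappa>) / wfun u x"
      by (simp add: field_simps)
    finally show "\<bar>qint S r (F s) x - H x (r + s) x\<bar> \<le> M * (C0 + C1) * A * r powr (\<gamma> / ell S) * phi S x powr (-\<kappa>) / wfun u x" .
  qed
qed

text \<open>Both terms are the operator at time t - 2s, applied to \<open>qint S s (F s)\<close> and
  to \<open>F (2 * s)\<close>. These two differ by the local error with r = s, as
  \<open>F (2 * s) z = H z (2 * s) z\<close>. Since 4s \<le> t, at least half of the time t is left
  for smoothing.\<close>

lemma telescope:
  obtains C where "0 < C"
    "\<And>A B F H x s t. germ A B F H \<Longrightarrow> 0 \<le> A \<Longrightarrow> 0 \<le> B \<Longrightarrow> 0 < s \<Longrightarrow> 4 * s \<le> t \<Longrightarrow> t \<le> 1 \<Longrightarrow>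
       \<bar>qint S (t - s) (F s) x - qint S (t - 2 * s) (F (2 * s)) x\<bar> \<le> C * A * s powr (\<gamma> / ell S) * pmax S (t / 2) x powr (-\<kappa>) / wfun u x"
proof -
  obtain C1 where C1: "0 < C1"
    "\<And>A B F H x r s. germ A B F H \<Longrightarrow> 0 \<le> A \<Longrightarrow> 0 \<le> B \<Longrightarrow> x \<in> off_hyp S \<Longrightarrow> 0 < s \<Longrightarrow> s \<le> r \<Longrightarrow> r \<le> 4 * s \<Longrightarrow>
       r + s \<le> 1 \<Longrightarrow> \<bar>qint S r (F s) x - H x (r + s) x\<bar> \<le> C1 * A * r powr (\<gamma> / ell S) * phi S x powr (-\<kappa>) / wfun u x"
    by (rule local_error) (rule that)
  obtain C where C: "0 < C"
    "\<And>g B r x. dominated S u \<kappa> B g \<Longrightarrow> 0 \<le> B \<Longrightarrow> 0 < r \<Longrightarrow> r \<le> 1 \<Longrightarrow>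
       \<bar>qint S r g x\<bar> \<le> C * B * pmax S r x powr (-\<kappa>) / wfun u x"
    by (rule qint_bound[OF u kap]) (rule that)
  obtain C' where C': "0 < C'"
    "\<And>g B r x. dominated S u 0 B g \<Longrightarrow> 0 \<le> B \<Longrightarrow> 0 < r \<Longrightarrow> r \<le> 1 \<Longrightarrow> \<bar>qint S r g x\<bar> \<le> C' * B / wfun u x"
    by (rule qint_bound_0[OF u]) (rule that)
  show ?thesis
  proof (rule that[of "C * C1"])
    show "0 < C * C1" using C C1 by simp
    fix A B F H x s t
    assume g: "germ A B F H" and A: "0 \<le> A" and B: "0 \<le> B" and s: "0 < s" "4 * s \<le> t" "t \<le> (1::real)"
    have sl: "s \<in> {0<..1}" "2 * s \<in> {0<..1}" and ts: "0 < t - 2 * s" "t - 2 * s \<le> 1" using s by auto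
    have nn: "0 \<le> B * (\<Sum>\<alpha>\<in>I. s powr (\<alpha> / ell S))" "0 \<le> B * (\<Sum>\<alpha>\<in>I. (2 * s) powr (\<alpha> / ell S))"
      using B by (auto intro!: mult_nonneg_nonneg sum_nonneg)
    let ?D = "\<lambda>y. qint S s (F s) y - F (2 * s) y"
    have cont: "continuous_on UNIV (qint S s (F s))"
      using sl by (intro qint_continuous[OF u kap germ_dominated[OF g B sl(1)] nn(1)]) auto
    have m2: "F (2 * s) \<in> borel_measurable borel" using g sl by (simp add: germ_def)
    have D: "dominated S u \<kappa> (C1 * A * s powr (\<gamma> / ell S)) ?D"
      unfolding dominated_def
    proof (intro conjI ballI)
      show "?D \<in> borel_measurable borel"
        using borel_measurable_continuous_onI[OF cont] m2 by simp
      fix z assume z: "z \<in> off_hyp S"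
      have "F (2 * s) z = H z (s + s) z" using g z sl unfolding germ_def by (metis mult_2)
      then show "\<bar>?D z\<bar> \<le> C1 * A * s powr (\<gamma> / ell S) * phi S z powr - \<kappa> / wfun u z"
        using C1(2)[OF g A B z, of s s] s by simp
    qed
    have Dnn: "0 \<le> C1 * A * s powr (\<gamma> / ell S)" using C1 A by simp
    have d1: "dominated S u \<kappa> (C * (B * (\<Sum>\<alpha>\<in>I. s powr (\<alpha> / ell S)))) (qint S s (F s))"
      unfolding dominated_def
    proof (intro conjI ballI)
      show "qint S s (F s) \<in> borel_measurable borel" by (rule borel_measurable_continuous_onI[OF cont])
      fix z assume z: "z \<in> off_hyp S"
      have "\<bar>qint S s (F s) z\<bar> \<le> C * (B * (\<Sum>\<alpha>\<in>I. s powr (\<alpha> / ell S))) * pmax S s z powr (-\<kappa>) / wfun u z"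
        using sl by (intro C(2)[OF germ_dominated[OF g B sl(1)] nn(1)]) auto
      also have "\<dots> \<le> C * (B * (\<Sum>\<alpha>\<in>I. s powr (\<alpha> / ell S))) * phi S z powr (-\<kappa>) / wfun u z"
        using C nn kap phi_pos[OF z] wfun_pos[OF u, of z]
        by (intro divide_right_mono mult_left_mono powr_mono2') (auto simp: pmax_def)
      finally show "\<bar>qint S s (F s) z\<bar> \<le> C * (B * (\<Sum>\<alpha>\<in>I. s powr (\<alpha> / ell S))) * phi S z powr (-\<kappa>) / wfun u z" .
    qed
    have Cnn: "0 \<le> C * (B * (\<Sum>\<alpha>\<in>I. s powr (\<alpha> / ell S)))" using C nn by simp
    have "qint S (t - s) (F s) x - qint S (t - 2 * s) (F (2 * s)) x = qint S (t - 2 * s) ?D x"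
      using qint_diff[OF u kap d1 Cnn germ_dominated[OF g B sl(2)] nn(2) ts, of x]
        qint_qint[OF u kap germ_dominated[OF g B sl(1)] nn(1) ts(1) s(1), of x] s by simp
    also have "\<bar>\<dots>\<bar> \<le> C * (C1 * A * s powr (\<gamma> / ell S)) * pmax S (t - 2 * s) x powr (-\<kappa>) / wfun u x"
      by (rule C(2)[OF D Dnn ts])
    also have "\<dots> \<le> C * (C1 * A * s powr (\<gamma> / ell S)) * pmax S (t / 2) x powr (-\<kappa>) / wfun u x"
    proof (intro divide_right_mono mult_left_mono powr_mono2')
      have "(t / 2) powr (1 / ell S) \<le> (t - 2 * s) powr (1 / ell S)"
        using s ell_pos by (intro powr_mono2) auto
      then show "pmax S (t / 2) x \<le> pmax S (t - 2 * s) x" by (auto simp: pmax_def)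
      show "0 < pmax S (t / 2) x" using s by (intro pmax_pos) auto
    qed (use kap C Dnn wfun_pos[OF u, of x] in auto)
    finally show "\<bar>qint S (t - s) (F s) x - qint S (t - 2 * s) (F (2 * s)) x\<bar> \<le> C * C1 * A * s powr (\<gamma> / ell S) * pmax S (t / 2) x powr (-\<kappa>) / wfun u x"
      by (simp add: mult.assoc)
  qed
qed

text \<open>Each degree \<alpha> has its own singular order max (\<alpha> - \<eta>) 0. The kernel at
  a time comparable with t turns it into a negative power of t, and the exponents combine to min
  \<alpha> \<eta>. The coefficients b are free for each degree, since at the critical exponent the
  lowest degree carries a small one.\<close>

lemma main_term_bound:
  obtains C where "0 < C"
    "\<And>b g x s t. g \<in> borel_measurable borel \<Longrightarrow> \<forall>\<alpha>\<in>I. 0 \<le> b \<alpha> \<Longrightarrow> 0 < s \<Longrightarrow> s \<le> t / 2 \<Longrightarrow> t \<le> 4 * s \<Longrightarrow> t \<le> 1 \<Longrightarrow>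
       \<forall>y\<in>off_hyp S. \<bar>g y\<bar> \<le> 1 / wfun u y * (\<Sum>\<alpha>\<in>I. b \<alpha> * s powr (\<alpha> / ell S) * phi S y powr (min (\<eta> - \<alpha>) 0)) \<Longrightarrow>
       \<bar>qint S (t - s) g x\<bar> \<le> C / wfun u x * (\<Sum>\<alpha>\<in>I. b \<alpha> * t powr (min \<alpha> \<eta> / ell S))"
proof -
  let ?k = "\<lambda>\<alpha>. - min (\<eta> - \<alpha>) 0"
  let ?g = "\<lambda>\<alpha> y. phi S y powr (min (\<eta> - \<alpha>) 0) / wfun u y"
  have kk: "0 \<le> ?k \<alpha>" "?k \<alpha> < s1" if "\<alpha> \<in> I" for \<alpha>
    using I_less[OF that] \<eta> s1_pos by auto
  have dom: "dominated S u (?k \<alpha>) 1 (?g \<alpha>)" for \<alpha>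
    using wfun_measurable[OF u] wfun_pos[OF u] by (auto simp: dominated_def less_imp_le abs_of_pos)
  have "\<forall>\<alpha>\<in>I. \<exists>C>0. \<forall>r x. 0 < r \<longrightarrow> r \<le> 1 \<longrightarrow> (LINT z|lborel. \<bar>Qker S r x z * ?g \<alpha> z\<bar>) \<le> C * 1 * pmax S r x powr (-?k \<alpha>) / wfun u x"
  proof
    fix \<alpha> assume al: "\<alpha> \<in> I"
    obtain C where C: "0 < C"
      "\<And>g B r x. dominated S u (?k \<alpha>) B g \<Longrightarrow> 0 \<le> B \<Longrightarrow> 0 < r \<Longrightarrow> r \<le> 1 \<Longrightarrow>
         (LINT z|lborel. \<bar>Qker S r x z * g z\<bar>) \<le> C * B * pmax S r x powr (-?k \<alpha>) / wfun u x"
      by (rule qint_dominated[OF u kk[OF al]]) (rule that)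
    show "\<exists>C>0. \<forall>r x. 0 < r \<longrightarrow> r \<le> 1 \<longrightarrow> (LINT z|lborel. \<bar>Qker S r x z * ?g \<alpha> z\<bar>) \<le> C * 1 * pmax S r x powr (-?k \<alpha>) / wfun u x"
      using C(1) C(2)[OF dom] by (intro exI[of _ C]) auto
  qed
  from bchoice[OF this] obtain Ca where Ca0: "\<forall>\<alpha>\<in>I. 0 < Ca \<alpha> \<and> (\<forall>r x. 0 < r \<longrightarrow> r \<le> 1 \<longrightarrow>
      (LINT z|lborel. \<bar>Qker S r x z * ?g \<alpha> z\<bar>) \<le> Ca \<alpha> * 1 * pmax S r x powr (-?k \<alpha>) / wfun u x)" ..
  then have Ca: "\<And>\<alpha>. \<alpha> \<in> I \<Longrightarrow> 0 < Ca \<alpha>"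
    "\<And>\<alpha> r x. \<alpha> \<in> I \<Longrightarrow> 0 < r \<Longrightarrow> r \<le> 1 \<Longrightarrow> (LINT z|lborel. \<bar>Qker S r x z * ?g \<alpha> z\<bar>) \<le> Ca \<alpha> * 1 * pmax S r x powr (-?k \<alpha>) / wfun u x"
    by blast+
  \<comment> \<open>The power of 4 is the price of replacing s by t, the power of 2 that of t - s
    \<ge> t / 2.\<close>
  define c where "c = (\<lambda>\<alpha>. 4 powr \<bar>\<alpha> / ell S\<bar> * (Ca \<alpha> * 2 powr (?k \<alpha> / ell S)))"
  define C where "C = 1 + (\<Sum>\<alpha>\<in>I. c \<alpha>)"
  have c: "0 \<le> c \<alpha>" if "\<alpha> \<in> I" for \<alpha> using Ca(1)[OF that] by (simp add: c_def)
  have C: "0 < C" unfolding C_def using c by (intro add_pos_nonneg sum_nonneg) auto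
  have cC: "c \<alpha> \<le> C" if "\<alpha> \<in> I" for \<alpha>
    using member_le_sum[of \<alpha> I c] that c finI by (simp add: C_def)
  show ?thesis
  proof (rule that[OF C])
    fix b g x s t
    assume gm [measurable]: "g \<in> borel_measurable borel" and b0: "\<forall>\<alpha>\<in>I. 0 \<le> b \<alpha>"
      and s: "0 < s" "s \<le> t / 2" "t \<le> 4 * s" "t \<le> (1::real)"
      and le0: "\<forall>y\<in>off_hyp S. \<bar>g y\<bar> \<le> 1 / wfun u y * (\<Sum>\<alpha>\<in>I. b \<alpha> * s powr (\<alpha> / ell S) * phi S y powr (min (\<eta> - \<alpha>) 0))"
    note b = bspec[OF b0] and le = bspec[OF le0]
    let ?r = "t - s"
    have r: "0 < ?r" "?r \<le> 1" using s by auto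
    note [measurable] = Q_measurable2[OF r(1)]
    have gi: "integrable lborel (\<lambda>z. \<bar>Qker S ?r x z * ?g \<alpha> z\<bar>)" if "\<alpha> \<in> I" for \<alpha>
      using qint_integrable[OF u kk[OF that] dom _ r] by (intro integrable_abs) auto
    have hi: "integrable lborel (\<lambda>z. \<Sum>\<alpha>\<in>I. b \<alpha> * s powr (\<alpha> / ell S) * \<bar>Qker S ?r x z * ?g \<alpha> z\<bar>)"
      using gi by (intro Bochner_Integration.integrable_sum integrable_mult_right)
    have pt: "AE z in lborel. \<bar>Qker S ?r x z * g z\<bar> \<le> (\<Sum>\<alpha>\<in>I. b \<alpha> * s powr (\<alpha> / ell S) * \<bar>Qker S ?r x z * ?g \<alpha> z\<bar>)"
      using AE_off_hyp
    proof eventually_elim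
      case (elim z)
      have "\<bar>Qker S ?r x z * g z\<bar> \<le> \<bar>Qker S ?r x z\<bar> * (1 / wfun u z * (\<Sum>\<alpha>\<in>I. b \<alpha> * s powr (\<alpha> / ell S) * phi S z powr (min (\<eta> - \<alpha>) 0)))"
        unfolding abs_mult by (intro mult_left_mono le elim) auto
      also have "\<dots> = (\<Sum>\<alpha>\<in>I. b \<alpha> * s powr (\<alpha> / ell S) * \<bar>Qker S ?r x z * ?g \<alpha> z\<bar>)"
        using wfun_pos[OF u, of z] by (simp add: sum_distrib_left abs_mult mult_ac)
      finally show ?case .
    qed
    have int: "integrable lborel (\<lambda>z. Qker S ?r x z * g z)"
      by (rule Bochner_Integration.integrable_bound[OF hi])
        (measurable, use pt in eventually_elim, unfold real_norm_def, rule order_trans[OF _ abs_ge_self])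
    have "\<bar>qint S ?r g x\<bar> \<le> (LINT z|lborel. \<bar>Qker S ?r x z * g z\<bar>)"
      unfolding qint_def by (rule integral_abs_bound)
    also have "\<dots> \<le> (LINT z|lborel. (\<Sum>\<alpha>\<in>I. b \<alpha> * s powr (\<alpha> / ell S) * \<bar>Qker S ?r x z * ?g \<alpha> z\<bar>))"
      using int hi pt by (intro integral_mono_AE integrable_abs)
    also have "\<dots> = (\<Sum>\<alpha>\<in>I. b \<alpha> * s powr (\<alpha> / ell S) * (LINT z|lborel. \<bar>Qker S ?r x z * ?g \<alpha> z\<bar>))"
      by (subst Bochner_Integration.integral_sum) (intro integrable_mult_right gi, assumption, simp only: integral_mult_right_zero)
    also have "\<dots> \<le> (\<Sum>\<alpha>\<in>I. C / wfun u x * (b \<alpha> * t powr (min \<alpha> \<eta> / ell S)))"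
    proof (rule sum_mono)
      fix \<alpha> assume al: "\<alpha> \<in> I"
      have "(LINT z|lborel. \<bar>Qker S ?r x z * ?g \<alpha> z\<bar>) \<le> Ca \<alpha> * 1 * pmax S ?r x powr (-?k \<alpha>) / wfun u x"
        by (rule Ca(2)[OF al r])
      also have "\<dots> \<le> Ca \<alpha> * 1 * (2 powr (?k \<alpha> / ell S) * t powr (- ?k \<alpha> / ell S)) / wfun u x"
      proof (intro divide_right_mono mult_left_mono)
        have "pmax S ?r x powr (-?k \<alpha>) \<le> ((t / 2) powr (1 / ell S)) powr (-?k \<alpha>)"
        proof (rule powr_mono2')
          have "(t / 2) powr (1 / ell S) \<le> ?r powr (1 / ell S)" using s ell_pos by (intro powr_mono2) auto
          then show "(t / 2) powr (1 / ell S) \<le> pmax S ?r x" by (simp add: pmax_def)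
        qed (use kk[OF al] s in auto)
        also have "\<dots> = 2 powr (?k \<alpha> / ell S) * t powr (- ?k \<alpha> / ell S)"
          using s by (simp add: powr_powr powr_divide powr_minus field_simps)
        finally show "pmax S ?r x powr (-?k \<alpha>) \<le> 2 powr (?k \<alpha> / ell S) * t powr (- ?k \<alpha> / ell S)" .
      qed (use Ca(1)[OF al] wfun_pos[OF u, of x] in auto)
      finally have 1: "(LINT z|lborel. \<bar>Qker S ?r x z * ?g \<alpha> z\<bar>) \<le> Ca \<alpha> * 1 * (2 powr (?k \<alpha> / ell S) * t powr (- ?k \<alpha> / ell S)) / wfun u x" .
      have 2: "s powr (\<alpha> / ell S) \<le> 4 powr \<bar>\<alpha> / ell S\<bar> * t powr (\<alpha> / ell S)"
        using s by (intro powr_comparable) auto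
      have "b \<alpha> * s powr (\<alpha> / ell S) * (LINT z|lborel. \<bar>Qker S ?r x z * ?g \<alpha> z\<bar>)
         \<le> b \<alpha> * (4 powr \<bar>\<alpha> / ell S\<bar> * t powr (\<alpha> / ell S)) * (Ca \<alpha> * 1 * (2 powr (?k \<alpha> / ell S) * t powr (- ?k \<alpha> / ell S)) / wfun u x)"
        using b[OF al] Ca(1)[OF al] wfun_pos[OF u, of x] by (intro mult_mono[OF mult_left_mono[OF 2] 1]) auto
      also have "\<dots> = c \<alpha> / wfun u x * (b \<alpha> * (t powr (\<alpha> / ell S) * t powr (- ?k \<alpha> / ell S)))"
        by (simp add: c_def)
      also have "t powr (\<alpha> / ell S) * t powr (- ?k \<alpha> / ell S) = t powr (min \<alpha> \<eta> / ell S)"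
        using s by (simp add: powr_add[symmetric] add_divide_distrib[symmetric] min_def)
      also have "c \<alpha> / wfun u x * (b \<alpha> * t powr (min \<alpha> \<eta> / ell S)) \<le> C / wfun u x * (b \<alpha> * t powr (min \<alpha> \<eta> / ell S))"
        using cC[OF al] b[OF al] wfun_pos[OF u, of x] by (intro mult_right_mono divide_right_mono) auto
      finally show "b \<alpha> * s powr (\<alpha> / ell S) * (LINT z|lborel. \<bar>Qker S ?r x z * ?g \<alpha> z\<bar>) \<le> C / wfun u x * (b \<alpha> * t powr (min \<alpha> \<eta> / ell S))" .
    qed
    finally show "\<bar>qint S (t - s) g x\<bar> \<le> C / wfun u x * (\<Sum>\<alpha>\<in>I. b \<alpha> * t powr (min \<alpha> \<eta> / ell S))"
      by (simp add: sum_distrib_left)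
  qed
qed

text \<open>The last clause retains a main term \<open>qint S (t - s) (F s)\<close> with s
  comparable to t and a remainder of order \<open>t powr (\<eta> / ell S)\<close>. Size bounds then
  only have to be proved for the main term, with whatever information on F is at hand.\<close>

theorem germ_reconstruction:
  obtains C where "0 < C"
    "\<And>A B F H. germ A B F H \<Longrightarrow> 0 \<le> A \<Longrightarrow> 0 \<le> B \<Longrightarrow>
      \<exists>\<Lambda>. consistent S \<Lambda> \<and> (\<forall>t\<in>{0<..1}. \<Lambda> t \<in> Cw u) \<and> (\<forall>t. t \<notin> {0<..1} \<longrightarrow> \<Lambda> t = (\<lambda>x. 0)) \<and>
        (\<forall>t\<in>{0<..1}. \<forall>x\<in>off_hyp S. \<bar>\<Lambda> t x - H x t x\<bar> \<le> C * A * t powr (\<gamma> / ell S) * phi S x powr (-\<kappa>) / wfun u x) \<and>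
        (\<forall>t\<in>{0<..1}. \<exists>s. 0 < s \<and> s \<le> t / 2 \<and> t \<le> 4 * s \<and>
           (\<forall>x. \<bar>\<Lambda> t x - qint S (t - s) (F s) x\<bar> \<le> C * A * t powr (\<eta> / ell S) / wfun u x))"
proof -
  obtain C1 where C1: "0 < C1"
    "\<And>A B F H x r s. germ A B F H \<Longrightarrow> 0 \<le> A \<Longrightarrow> 0 \<le> B \<Longrightarrow> x \<in> off_hyp S \<Longrightarrow> 0 < s \<Longrightarrow> s \<le> r \<Longrightarrow> r \<le> 4 * s \<Longrightarrow>
       r + s \<le> 1 \<Longrightarrow> \<bar>qint S r (F s) x - H x (r + s) x\<bar> \<le> C1 * A * r powr (\<gamma> / ell S) * phi S x powr (-\<kappa>) / wfun u x"
    by (rule local_error) (rule that)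
  obtain C2 where C2: "0 < C2"
    "\<And>A B F H x s t. germ A B F H \<Longrightarrow> 0 \<le> A \<Longrightarrow> 0 \<le> B \<Longrightarrow> 0 < s \<Longrightarrow> 4 * s \<le> t \<Longrightarrow> t \<le> 1 \<Longrightarrow>
       \<bar>qint S (t - s) (F s) x - qint S (t - 2 * s) (F (2 * s)) x\<bar> \<le> C2 * A * s powr (\<gamma> / ell S) * pmax S (t / 2) x powr (-\<kappa>) / wfun u x"
    by (rule telescope) (rule that)
  obtain C3 where C3: "0 < C3"
    "\<And>g B r x. dominated S u 0 B g \<Longrightarrow> 0 \<le> B \<Longrightarrow> 0 < r \<Longrightarrow> r \<le> 1 \<Longrightarrow> \<bar>qint S r g x\<bar> \<le> C3 * B / wfun u x"
    by (rule qint_bound_0[OF u]) (rule that)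
  obtain C4 where C4: "0 < C4"
    "\<And>g B r x. dominated S u \<kappa> B g \<Longrightarrow> 0 \<le> B \<Longrightarrow> 0 < r \<Longrightarrow> r \<le> 1 \<Longrightarrow>
       \<bar>qint S r g x\<bar> \<le> C4 * B * pmax S r x powr (-\<kappa>) / wfun u x"
    by (rule qint_bound[OF u kap]) (rule that)
  define q where "q = (1/2::real) powr (\<gamma> / ell S)"
  have q: "0 < q" "q < 1"
  proof -
    have "(1/2::real) powr (\<gamma> / ell S) < 1 powr (\<gamma> / ell S)"
      using \<gamma> ell_pos by (intro powr_less_mono2) auto
    then show "q < 1" by (simp add: q_def)
  qed (simp add: q_def)
  have qn: "((1/2::real) ^ n) powr (\<gamma> / ell S) = q ^ n" for n
    by (simp add: q_def powr_realpow[symmetric] powr_powr mult.commute)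
  define K where "K = C2 / (1 - q)"
  have K: "0 < K" using C2 q by (simp add: K_def)
  define C where "C = (K + C1) + K * 2 powr (\<kappa> / ell S)"
  have C: "0 < C" "K + C1 \<le> C" "K * 2 powr (\<kappa> / ell S) \<le> C"
    using K C1 by (auto simp: C_def intro!: add_pos_nonneg)
  show ?thesis
  proof (rule that[OF C(1)])
    fix A B F H assume g: "germ A B F H" and A: "0 \<le> A" and B: "0 \<le> B"
    \<comment> \<open>The times (1/2)^n do not depend on t. Hence the operator at time r maps
      \<open>a t\<close> to \<open>a (r + t)\<close> exactly, and the limit inherits
      consistency.\<close>
    define a where "a = (\<lambda>t x n. qint S (t - (1/2) ^ n) (F ((1/2) ^ n)) x)"
    define \<Lambda> where "\<Lambda> = (\<lambda>t x. if t \<in> {0<..1} then lim (a t x) else 0)"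
    have P_le: "pmax S (t / 2) x powr (-\<kappa>) \<le> 2 powr (\<kappa> / ell S) * t powr (-\<kappa> / ell S)" if "0 < t" for t x
    proof -
      have "pmax S (t / 2) x powr (-\<kappa>) \<le> ((t / 2) powr (1 / ell S)) powr (-\<kappa>)"
        using that kap by (intro powr_mono2') (auto simp: pmax_def)
      also have "\<dots> = 2 powr (\<kappa> / ell S) * t powr (-\<kappa> / ell S)"
        using that
        by (simp add: powr_powr powr_divide field_simps) (simp add: powr_add[symmetric] add_divide_distrib[symmetric])
      finally show ?thesis .
    qed
    have conv: "convergent (a t x)" "n0 \<le> n \<Longrightarrow> \<bar>\<Lambda> t x - a t x n\<bar> \<le> K * A * q ^ n * pmax S (t / 2) x powr (-\<kappa>) / wfun u x"
      if t: "t \<in> {0<..1}" and n0: "(1/2) ^ n0 \<le> t / 2" for t x n0 n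
    proof -
      let ?P = "C2 * A * pmax S (t / 2) x powr (-\<kappa>) / wfun u x"
      have Pnn: "0 \<le> ?P" using C2 A wfun_pos[OF u, of x] by simp
      have inc: "\<bar>a t x (Suc n) - a t x n\<bar> \<le> ?P * q ^ n" if n: "n0 \<le> n" for n
      proof -
        have "(1/2::real) ^ n \<le> (1/2) ^ n0" using n by (intro power_decreasing) auto
        with n0 have "(1/2) ^ n \<le> t / 2" by linarith
        then have "\<bar>qint S (t - (1/2) ^ Suc n) (F ((1/2) ^ Suc n)) x - qint S (t - 2 * (1/2) ^ Suc n) (F (2 * (1/2) ^ Suc n)) x\<bar>
            \<le> C2 * A * ((1/2) ^ Suc n) powr (\<gamma> / ell S) * pmax S (t / 2) x powr (-\<kappa>) / wfun u x"
          using t by (intro C2(2)[OF g A B]) auto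
        then have "\<bar>a t x (Suc n) - a t x n\<bar> \<le> ?P * q ^ Suc n"
          unfolding qn by (simp add: a_def mult_ac)
        also have "\<dots> \<le> ?P * q ^ n"
          using Pnn q by (intro mult_left_mono power_decreasing) auto
        finally show ?thesis .
      qed
      show "convergent (a t x)" by (rule geometric_increments(1)[OF q inc])
      show "\<bar>\<Lambda> t x - a t x n\<bar> \<le> K * A * q ^ n * pmax S (t / 2) x powr (-\<kappa>) / wfun u x" if "n0 \<le> n"
        using geometric_increments(2)[OF q inc that] t by (simp add: \<Lambda>_def K_def mult_ac)
    qed
    \<comment> \<open>Bounding \<open>pmax\<close> below by \<open>(t / 2) powr (1 / ell S)\<close>
      makes the rate uniform in the point up to the weight, with a constant depending on t. This
      uniformity allows the limit to be exchanged with the operators.\<close>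
    have unif: "\<exists>K' n0. 0 \<le> K' \<and> (1/2) ^ n0 \<le> t / 2 \<and> (\<forall>n\<ge>n0. \<forall>y. \<bar>\<Lambda> t y - a t y n\<bar> \<le> K' * q ^ n / wfun u y)" if t: "t \<in> {0<..1}" for t
    proof -
      obtain n0 where n0: "(1/2) ^ n0 \<le> t / 2" using dyadic_near[of t] t by auto
      let ?K = "K * A * (2 powr (\<kappa> / ell S) * t powr (-\<kappa> / ell S))"
      have "\<bar>\<Lambda> t y - a t y n\<bar> \<le> ?K * q ^ n / wfun u y" if "n0 \<le> n" for n y
      proof -
        have "\<bar>\<Lambda> t y - a t y n\<bar> \<le> K * A * q ^ n * pmax S (t / 2) y powr (-\<kappa>) / wfun u y"
          by (rule conv(2)[OF t n0 that])
        also have "\<dots> \<le> K * A * q ^ n * (2 powr (\<kappa> / ell S) * t powr (-\<kappa> / ell S)) / wfun u y"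
          using K A q t wfun_pos[OF u, of y] by (intro divide_right_mono mult_left_mono P_le) auto
        finally show ?thesis by (simp add: mult_ac)
      qed
      then show ?thesis using n0 K A by (intro exI[of _ ?K] exI[of _ n0]) auto
    qed
    have sn: "(1/2::real) ^ n \<in> {0<..1}" for n by (auto intro: power_le_one)
    have nnF: "0 \<le> B * (\<Sum>\<alpha>\<in>I. s powr (\<alpha> / ell S))" for s using B by (auto intro!: mult_nonneg_nonneg sum_nonneg)
    have half_le: "(1/2::real) ^ n \<le> t / 2" if "(1/2) ^ n0 \<le> t / 2" "n0 \<le> n" for n n0 and t :: real
      using that power_decreasing[of n0 n "1/2::real"] by linarith
    have a_dom: "\<exists>B'\<ge>0. dominated S u 0 B' (\<lambda>y. a t y n)" if t: "t \<in> {0<..1}" and n: "(1/2) ^ n \<le> t / 2" for t n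
    proof -
      have r: "0 < t - (1/2) ^ n" "t - (1/2) ^ n \<le> 1" using t n by (auto simp: diff_le_eq intro: add_increasing2)
      let ?N = "B * (\<Sum>\<alpha>\<in>I. ((1/2) ^ n) powr (\<alpha> / ell S))"
      let ?B = "C4 * ?N * ((t - (1/2) ^ n) powr (1 / ell S)) powr (-\<kappa>)"
      have "\<bar>a t y n\<bar> \<le> ?B / wfun u y" for y
      proof -
        have "\<bar>a t y n\<bar> \<le> C4 * ?N * pmax S (t - (1/2) ^ n) y powr (-\<kappa>) / wfun u y"
          unfolding a_def by (rule C4(2)[OF germ_dominated[OF g B sn] nnF r])
        also have "\<dots> \<le> ?B / wfun u y"
          using C4 nnF[of "(1/2) ^ n"] wfun_pos[OF u, of y] r kap
          by (intro divide_right_mono mult_left_mono powr_mono2') (auto simp: pmax_def)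
        finally show ?thesis .
      qed
      moreover have "(\<lambda>y. a t y n) \<in> borel_measurable borel"
        unfolding a_def by (rule borel_measurable_continuous_onI[OF qint_continuous[OF u kap germ_dominated[OF g B sn] nnF r]])
      ultimately show ?thesis using C4 nnF[of "(1/2) ^ n"] by (intro exI[of _ ?B]) (auto intro!: dominated_0I[OF u])
    qed
    have L_dom: "\<exists>B'\<ge>0. dominated S u 0 B' (\<Lambda> t) \<and> (\<forall>y. \<bar>\<Lambda> t y\<bar> \<le> B' / wfun u y)" if t: "t \<in> {0<..1}" for t
    proof -
      obtain K' n0 where n0: "0 \<le> K'" "(1/2) ^ n0 \<le> t / 2" "\<And>n y. n0 \<le> n \<Longrightarrow> \<bar>\<Lambda> t y - a t y n\<bar> \<le> K' * q ^ n / wfun u y"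
        using unif[OF t] by blast
      have "(\<lambda>n. a t y (n + n0)) \<longlonglongrightarrow> \<Lambda> t y" for y
        using conv(1)[OF t n0(2), of y] t by (intro LIMSEQ_ignore_initial_segment) (simp add: \<Lambda>_def convergent_LIMSEQ_iff)
      moreover have "(\<lambda>y. a t y (n + n0)) \<in> borel_measurable borel" for n
        using a_dom[OF t half_le[OF n0(2)], of "n + n0"] by (auto simp: dominated_def)
      ultimately have "\<Lambda> t \<in> borel_measurable borel" by (rule borel_measurable_LIMSEQ_real)
      moreover obtain B1 where B1: "0 \<le> B1" "dominated S u 0 B1 (\<lambda>y. a t y n0)" using a_dom[OF t n0(2)] by blast
      have r: "0 < t - (1/2) ^ n0" "t - (1/2) ^ n0 \<le> 1" using t n0(2) by (auto simp: diff_le_eq intro: add_increasing2)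
      define N where "N = C4 * (B * (\<Sum>\<alpha>\<in>I. ((1/2) ^ n0) powr (\<alpha> / ell S))) * ((t - (1/2) ^ n0) powr (1 / ell S)) powr (-\<kappa>)"
      have N: "0 \<le> N" using C4 nnF[of "(1/2) ^ n0"] by (simp add: N_def)
      have an: "\<bar>a t y n0\<bar> \<le> N / wfun u y" for y
      proof -
        have "\<bar>a t y n0\<bar> \<le> C4 * (B * (\<Sum>\<alpha>\<in>I. ((1/2) ^ n0) powr (\<alpha> / ell S))) * pmax S (t - (1/2) ^ n0) y powr (-\<kappa>) / wfun u y"
          unfolding a_def by (rule C4(2)[OF germ_dominated[OF g B sn] nnF r])
        also have "\<dots> \<le> N / wfun u y"
          unfolding N_def using C4 nnF[of "(1/2) ^ n0"] wfun_pos[OF u, of y] r kap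
          by (intro divide_right_mono mult_left_mono powr_mono2') (auto simp: pmax_def)
        finally show ?thesis .
      qed
      have "\<bar>\<Lambda> t y\<bar> \<le> (N + K' * q ^ n0) / wfun u y" for y
        using an[of y] n0(3)[of n0 y] by (simp add: add_divide_distrib)
      moreover have "0 \<le> N + K' * q ^ n0" using N n0(1) q by simp
      ultimately show ?thesis
        using dominated_0I[OF u] by (intro exI[of _ "N + K' * q ^ n0"]) auto
    qed
    have cons: "consistent S \<Lambda>"
      unfolding consistent_def
    proof (intro allI impI)
      fix r t x assume r: "0 < r" and t0: "0 < t" and rt: "r + t \<le> (1::real)"
      then have t: "t \<in> {0<..1}" and rt': "r + t \<in> {0<..1}" and r1: "r \<le> 1" by auto
      obtain K1 n1 where n1: "0 \<le> K1" "(1/2) ^ n1 \<le> t / 2" "\<And>n y. n1 \<le> n \<Longrightarrow> \<bar>\<Lambda> t y - a t y n\<bar> \<le> K1 * q ^ n / wfun u y"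
        using unif[OF t] by blast
      obtain K2 n2 where n2: "0 \<le> K2" "(1/2) ^ n2 \<le> (r + t) / 2" "\<And>n y. n2 \<le> n \<Longrightarrow> \<bar>\<Lambda> (r + t) y - a (r + t) y n\<bar> \<le> K2 * q ^ n / wfun u y"
        using unif[OF rt'] by blast
      obtain B1 where B1: "0 \<le> B1" "dominated S u 0 B1 (\<Lambda> t)" using L_dom[OF t] by blast
      have main: "\<bar>qint S r (\<Lambda> t) x - \<Lambda> (r + t) x\<bar> \<le> (C3 * K1 + K2) / wfun u x * q ^ n" if n: "max n1 n2 \<le> n" for n
      proof -
        have hn: "(1/2) ^ n \<le> t / 2" using half_le[OF n1(2)] n by auto
        obtain B2 where B2: "0 \<le> B2" "dominated S u 0 B2 (\<lambda>y. a t y n)" using a_dom[OF t hn] by blast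
        have D: "dominated S u 0 (K1 * q ^ n) (\<lambda>y. \<Lambda> t y - a t y n)"
          using B1 B2 n1(3) n by (intro dominated_0I[OF u]) (auto simp: dominated_def)
        have ra: "qint S r (\<lambda>y. a t y n) x = a (r + t) x n"
        proof -
          have "0 < (1/2::real) ^ n" by simp
          with hn rt t0 have "0 < t - (1/2) ^ n" "r + (t - (1/2) ^ n) \<le> 1" by linarith+
          from qint_qint[OF u kap germ_dominated[OF g B sn[of n]] nnF r this, of x] show ?thesis
            by (simp add: a_def add_diff_eq)
        qed
        have "qint S r (\<Lambda> t) x - a (r + t) x n = qint S r (\<lambda>y. \<Lambda> t y - a t y n) x"
          using qint_diff[OF u order_refl s1_pos B1(2,1) B2(2,1) r r1] ra by simp
        then have "\<bar>qint S r (\<Lambda> t) x - a (r + t) x n\<bar> \<le> C3 * (K1 * q ^ n) / wfun u x"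
          using C3(2)[OF D _ r r1] n1(1) q by simp
        moreover have "\<bar>\<Lambda> (r + t) x - a (r + t) x n\<bar> \<le> K2 * q ^ n / wfun u x" using n2(3) n by simp
        ultimately have "\<bar>qint S r (\<Lambda> t) x - \<Lambda> (r + t) x\<bar> \<le> C3 * (K1 * q ^ n) / wfun u x + K2 * q ^ n / wfun u x" by linarith
        then show ?thesis by (simp add: algebra_simps add_divide_distrib)
      qed
      have lim: "(\<lambda>n. (C3 * K1 + K2) / wfun u x * q ^ n) \<longlonglongrightarrow> (C3 * K1 + K2) / wfun u x * 0"
        using q by (intro tendsto_intros LIMSEQ_realpow_zero) auto
      have "\<bar>qint S r (\<Lambda> t) x - \<Lambda> (r + t) x\<bar> \<le> (C3 * K1 + K2) / wfun u x * 0"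
        by (rule LIMSEQ_le_const[OF lim]) (use main in blast)
      then show "qint S r (\<Lambda> t) x = \<Lambda> (r + t) x" by simp
    qed
    show "\<exists>\<Lambda>. consistent S \<Lambda> \<and> (\<forall>t\<in>{0<..1}. \<Lambda> t \<in> Cw u) \<and> (\<forall>t. t \<notin> {0<..1} \<longrightarrow> \<Lambda> t = (\<lambda>x. 0)) \<and>
        (\<forall>t\<in>{0<..1}. \<forall>x\<in>off_hyp S. \<bar>\<Lambda> t x - H x t x\<bar> \<le> C * A * t powr (\<gamma> / ell S) * phi S x powr (-\<kappa>) / wfun u x) \<and>
        (\<forall>t\<in>{0<..1}. \<exists>s. 0 < s \<and> s \<le> t / 2 \<and> t \<le> 4 * s \<and>
           (\<forall>x. \<bar>\<Lambda> t x - qint S (t - s) (F s) x\<bar> \<le> C * A * t powr (\<eta> / ell S) / wfun u x))"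
    proof (intro exI[of _ \<Lambda>] conjI ballI cons)
      show "\<forall>t. t \<notin> {0<..1} \<longrightarrow> \<Lambda> t = (\<lambda>x. 0)" by (auto simp: \<Lambda>_def)
      fix t assume t: "t \<in> {0<..(1::real)}"
      have th: "t / 2 \<in> {0<..1}" using t by auto
      obtain B1 where B1: "0 \<le> B1" "dominated S u 0 B1 (\<Lambda> (t / 2))" using L_dom[OF th] by blast
      \<comment> \<open>Continuity comes from smoothing the member at half the time, which is so far
        known to be measurable and bounded.\<close>
      have "\<Lambda> t = qint S (t / 2) (\<Lambda> (t / 2))"
        using consistentD[OF cons, of "t / 2" "t / 2"] t by (intro ext) auto
      then have "continuous_on UNIV (\<Lambda> t)"
        using qint_continuous[OF u order_refl s1_pos B1(2,1), of "t / 2"] t by auto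
      then show "\<Lambda> t \<in> Cw u"
        using L_dom[OF t] unfolding Cw_iff[OF u] by blast
      obtain n0 where n0: "(1/2) ^ n0 \<le> t / 2" "t / 2 < 2 * (1/2) ^ n0" using dyadic_near[of t] t by auto
      define s where "s = (1/2::real) ^ n0"
      have s: "0 < s" "s \<le> t / 2" "t \<le> 4 * s" using n0 by (auto simp: s_def)
      have qs: "q ^ n0 \<le> t powr (\<gamma> / ell S)"
        unfolding qn[symmetric] s_def[symmetric] using s \<gamma> ell_pos by (intro powr_mono2) auto
      have base: "\<bar>\<Lambda> t x - qint S (t - s) (F s) x\<bar> \<le> K * A * t powr (\<gamma> / ell S) * pmax S (t / 2) x powr (-\<kappa>) / wfun u x" for x
      proof -
        have "\<bar>\<Lambda> t x - a t x n0\<bar> \<le> K * A * q ^ n0 * pmax S (t / 2) x powr (-\<kappa>) / wfun u x"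
          by (rule conv(2)[OF t n0(1) order_refl])
        also have "\<dots> \<le> K * A * t powr (\<gamma> / ell S) * pmax S (t / 2) x powr (-\<kappa>) / wfun u x"
          using qs K A wfun_pos[OF u, of x] by (intro divide_right_mono mult_right_mono mult_left_mono) auto
        finally show ?thesis by (simp add: a_def s_def)
      qed
      show "\<exists>s. 0 < s \<and> s \<le> t / 2 \<and> t \<le> 4 * s \<and>
           (\<forall>x. \<bar>\<Lambda> t x - qint S (t - s) (F s) x\<bar> \<le> C * A * t powr (\<eta> / ell S) / wfun u x)"
      proof (intro exI[of _ s] conjI allI s)
        fix x
        have "\<bar>\<Lambda> t x - qint S (t - s) (F s) x\<bar> \<le> K * A * t powr (\<gamma> / ell S) * (2 powr (\<kappa> / ell S) * t powr (-\<kappa> / ell S)) / wfun u x"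
          using K A t wfun_pos[OF u, of x] by (intro order_trans[OF base] divide_right_mono mult_left_mono P_le) auto
        also have "\<dots> = (K * 2 powr (\<kappa> / ell S)) * A * (t powr (\<gamma> / ell S) * t powr (-\<kappa> / ell S)) / wfun u x" by simp
        also have "t powr (\<gamma> / ell S) * t powr (-\<kappa> / ell S) = t powr (\<eta> / ell S)"
          using t by (simp add: powr_add[symmetric] add_divide_distrib[symmetric] diff_divide_distrib)
        also have "(K * 2 powr (\<kappa> / ell S)) * A * t powr (\<eta> / ell S) / wfun u x \<le> C * A * t powr (\<eta> / ell S) / wfun u x"
          using C A wfun_pos[OF u, of x] by (intro divide_right_mono mult_right_mono) auto
        finally show "\<bar>\<Lambda> t x - qint S (t - s) (F s) x\<bar> \<le> C * A * t powr (\<eta> / ell S) / wfun u x" .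
      qed
      fix x assume x: "x \<in> off_hyp S"
      have "pmax S (t / 2) x powr (-\<kappa>) \<le> phi S x powr (-\<kappa>)"
        using kap phi_pos[OF x] by (intro powr_mono2') (auto simp: pmax_def)
      then have 1: "\<bar>\<Lambda> t x - qint S (t - s) (F s) x\<bar> \<le> K * A * t powr (\<gamma> / ell S) * phi S x powr (-\<kappa>) / wfun u x"
        using K A t wfun_pos[OF u, of x] by (intro order_trans[OF base] divide_right_mono mult_left_mono) auto
      \<comment> \<open>Here s \<le> t - s \<le> 4s, so the local error applies to the main term
        with r = t - s.\<close>
      have "\<bar>qint S (t - s) (F s) x - H x (t - s + s) x\<bar> \<le> C1 * A * (t - s) powr (\<gamma> / ell S) * phi S x powr (-\<kappa>) / wfun u x"
        using s t by (intro C1(2)[OF g A B x]) auto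
      also have "\<dots> \<le> C1 * A * t powr (\<gamma> / ell S) * phi S x powr (-\<kappa>) / wfun u x"
        using C1 A s \<gamma> ell_pos wfun_pos[OF u, of x] by (intro divide_right_mono mult_right_mono mult_left_mono powr_mono2) auto
      finally have "\<bar>qint S (t - s) (F s) x - H x t x\<bar> \<le> C1 * A * t powr (\<gamma> / ell S) * phi S x powr (-\<kappa>) / wfun u x" by simp
      with 1 have "\<bar>\<Lambda> t x - H x t x\<bar> \<le> K * A * t powr (\<gamma> / ell S) * phi S x powr (-\<kappa>) / wfun u x + C1 * A * t powr (\<gamma> / ell S) * phi S x powr (-\<kappa>) / wfun u x"
        by linarith
      also have "\<dots> = (K + C1) * A * t powr (\<gamma> / ell S) * phi S x powr (-\<kappa>) / wfun u x" by (simp add: algebra_simps add_divide_distrib)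
      also have "\<dots> \<le> C * A * t powr (\<gamma> / ell S) * phi S x powr (-\<kappa>) / wfun u x"
        using C A wfun_pos[OF u, of x] by (intro divide_right_mono mult_right_mono) auto
      finally show "\<bar>\<Lambda> t x - H x t x\<bar> \<le> C * A * t powr (\<gamma> / ell S) * phi S x powr (-\<kappa>) / wfun u x" .
    qed
  qed
qed

end

section \<open>Regularity structures\<close>

context
  fixes \<T> :: "('v::real_vector) regstruct" and \<alpha>0 :: real
  assumes reg: "regularity_structure \<T> \<alpha>0"
begin

lemma decomp_unique: "decomp \<T> \<tau> c \<Longrightarrow> decomp \<T> \<tau> d \<Longrightarrow> c = d"
proof -
  assume c: "decomp \<T> \<tau> c" and d: "decomp \<T> \<tau> d"
  have "\<exists>!c. decomp \<T> \<tau> c" using reg by (simp add: regularity_structure_def)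
  then show "c = d" using c d by (elim ex1E) metis
qed

lemma decomp_proj: "decomp \<T> \<tau> (\<lambda>\<alpha>. proj \<T> \<alpha> \<tau>)"
proof -
  have "\<exists>!c. decomp \<T> \<tau> c" using reg by (simp add: regularity_structure_def)
  then have "decomp \<T> \<tau> (THE c. decomp \<T> \<tau> c)" by (rule theI')
  then show ?thesis by (simp add: proj_def)
qed

lemma proj_eqI: "decomp \<T> \<tau> c \<Longrightarrow> proj \<T> \<alpha> \<tau> = c \<alpha>"
  using decomp_unique[OF decomp_proj] by (metis (full_types))

lemma sector_banach: "\<alpha> \<in> idx \<T> \<Longrightarrow> banach_on (sector \<T> \<alpha>) (secnorm \<T> \<alpha>)"
  using reg by (simp add: regularity_structure_def)

lemma sector_subspace: "\<alpha> \<in> idx \<T> \<Longrightarrow> subspace (sector \<T> \<alpha>)"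
  using sector_banach by (auto simp: banach_on_def)

lemma proj_in_sector: "\<alpha> \<in> idx \<T> \<Longrightarrow> proj \<T> \<alpha> \<tau> \<in> sector \<T> \<alpha>"
  using decomp_proj by (auto simp: decomp_def)

lemma decomp_finite_sum:
  assumes "decomp \<T> \<tau> c" "finite J" "{\<alpha>. c \<alpha> \<noteq> 0} \<subseteq> J"
  shows "\<tau> = (\<Sum>\<alpha>\<in>J. c \<alpha>)"
proof -
  have "\<tau> = (\<Sum>\<alpha> | c \<alpha> \<noteq> 0. c \<alpha>)" using assms(1) by (simp add: decomp_def)
  also have "\<dots> = (\<Sum>\<alpha>\<in>J. c \<alpha>)" using assms by (intro sum.mono_neutral_left) auto
  finally show ?thesis .
qed

lemma decompI:
  assumes "\<And>\<alpha>. \<alpha> \<in> idx \<T> \<Longrightarrow> c \<alpha> \<in> sector \<T> \<alpha>" "\<And>\<alpha>. \<alpha> \<notin> idx \<T> \<Longrightarrow> c \<alpha> = 0"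
    and "finite J" "{\<alpha>. c \<alpha> \<noteq> 0} \<subseteq> J" "\<tau> = (\<Sum>\<alpha>\<in>J. c \<alpha>)"
  shows "decomp \<T> \<tau> c"
  unfolding decomp_def
proof (intro conjI ballI allI impI)
  show "finite {\<alpha>. c \<alpha> \<noteq> 0}" using assms(3,4) by (rule finite_subset[rotated])
  show "\<tau> = (\<Sum>\<alpha> | c \<alpha> \<noteq> 0. c \<alpha>)"
    unfolding assms(5) using assms(3,4) by (intro sum.mono_neutral_right) auto
qed (use assms(1,2) in auto)

text \<open>Componentwise sums and multiples over a common finite set of degrees are again
  decompositions, and uniqueness identifies them with the projections.\<close>

lemma linear_proj: "linear (proj \<T> \<alpha>)"
proof (rule linearI)
  fix \<tau> \<sigma> :: 'v and a :: real
  let ?c = "\<lambda>\<tau> \<alpha>. proj \<T> \<alpha> \<tau>"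
  let ?J = "{\<alpha>. ?c \<tau> \<alpha> \<noteq> 0} \<union> {\<alpha>. ?c \<sigma> \<alpha> \<noteq> 0}"
  have f: "finite ?J" using decomp_proj[of \<tau>] decomp_proj[of \<sigma>] by (simp add: decomp_def)
  have z: "?c \<tau> \<alpha> = 0" if "\<alpha> \<notin> idx \<T>" for \<alpha> \<tau> using decomp_proj[of \<tau>] that by (simp add: decomp_def)
  have s: "\<tau> = (\<Sum>\<alpha>\<in>?J. ?c \<tau> \<alpha>)" "\<sigma> = (\<Sum>\<alpha>\<in>?J. ?c \<sigma> \<alpha>)"
    using f by (intro decomp_finite_sum decomp_proj; auto)+
  have "decomp \<T> (\<tau> + \<sigma>) (\<lambda>\<alpha>. ?c \<tau> \<alpha> + ?c \<sigma> \<alpha>)"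
  proof (rule decompI[OF _ _ f])
    show "\<tau> + \<sigma> = (\<Sum>\<alpha>\<in>?J. ?c \<tau> \<alpha> + ?c \<sigma> \<alpha>)"
      unfolding sum.distrib s[symmetric] ..
  qed (auto simp: z intro!: subspace_add sector_subspace proj_in_sector)
  then show "proj \<T> \<alpha> (\<tau> + \<sigma>) = proj \<T> \<alpha> \<tau> + proj \<T> \<alpha> \<sigma>" by (rule proj_eqI)
  have "decomp \<T> (a *\<^sub>R \<tau>) (\<lambda>\<alpha>. a *\<^sub>R ?c \<tau> \<alpha>)"
  proof (rule decompI[OF _ _ f])
    show "a *\<^sub>R \<tau> = (\<Sum>\<alpha>\<in>?J. a *\<^sub>R ?c \<tau> \<alpha>)"
      unfolding scaleR_sum_right[symmetric] s(1)[symmetric] ..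
  qed (auto simp: z intro!: subspace_mul sector_subspace proj_in_sector)
  then show "proj \<T> \<alpha> (a *\<^sub>R \<tau>) = a *\<^sub>R proj \<T> \<alpha> \<tau>" by (rule proj_eqI)
qed

lemma proj_sector:
  assumes "\<alpha> \<in> idx \<T>" "\<tau> \<in> sector \<T> \<alpha>"
  shows "proj \<T> \<beta> \<tau> = (if \<beta> = \<alpha> then \<tau> else 0)"
proof -
  have "decomp \<T> \<tau> (\<lambda>\<beta>. if \<beta> = \<alpha> then \<tau> else 0)"
    by (rule decompI[where J="{\<alpha>}"]) (use assms in \<open>auto intro: subspace_0 sector_subspace\<close>)
  then show ?thesis by (rule proj_eqI)
qed

lemma finite_idx_less: "finite {\<alpha> \<in> idx \<T>. \<alpha> < \<gamma>}"
proof (rule finite_subset)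
  show "finite (idx \<T> \<inter> {\<alpha>0..\<gamma>})" using reg by (simp add: regularity_structure_def)
  show "{\<alpha> \<in> idx \<T>. \<alpha> < \<gamma>} \<subseteq> idx \<T> \<inter> {\<alpha>0..\<gamma>}" using reg by (auto simp: regularity_structure_def)
qed

lemma idx_ge: "\<alpha> \<in> idx \<T> \<Longrightarrow> \<alpha>0 \<le> \<alpha>" and \<alpha>0_idx: "\<alpha>0 \<in> idx \<T>"
  using reg by (auto simp: regularity_structure_def)

lemma subspace_below: "subspace (below \<T> \<gamma>)"
  unfolding below_def
  by (rule subspaceI) (auto simp: linear_0[OF linear_proj] linear_add[OF linear_proj] linear_scale[OF linear_proj])

lemma below_mono: "\<gamma> \<le> \<gamma>' \<Longrightarrow> below \<T> \<gamma> \<subseteq> below \<T> \<gamma>'"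
  by (auto simp: below_def)

lemma sector_below: "\<alpha> \<in> idx \<T> \<Longrightarrow> \<alpha> < \<gamma> \<Longrightarrow> sector \<T> \<alpha> \<subseteq> below \<T> \<gamma>"
  by (auto simp: below_def proj_sector)

lemma below_sum:
  assumes "\<tau> \<in> below \<T> \<gamma>"
  shows "\<tau> = (\<Sum>\<alpha>\<in>{\<alpha> \<in> idx \<T>. \<alpha> < \<gamma>}. proj \<T> \<alpha> \<tau>)"
proof (rule decomp_finite_sum[OF decomp_proj finite_idx_less])
  show "{\<alpha>. proj \<T> \<alpha> \<tau> \<noteq> 0} \<subseteq> {\<alpha> \<in> idx \<T>. \<alpha> < \<gamma>}"
    using assms decomp_proj[of \<tau>] by (auto simp: below_def decomp_def not_le[symmetric])
qed

text \<open>Triangularity speaks of single sectors; it extends by linearity because an element of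
  bounded degree is a finite sum of components.\<close>

lemma lower_triangular_below:
  assumes L: "linear L" "lower_triangular \<T> L" and \<tau>: "\<tau> \<in> below \<T> \<gamma>"
  shows "L \<tau> \<in> below \<T> \<gamma>"
proof -
  have "L \<tau> = (\<Sum>\<alpha>\<in>{\<alpha> \<in> idx \<T>. \<alpha> < \<gamma>}. L (proj \<T> \<alpha> \<tau>))"
    by (subst below_sum[OF \<tau>]) (simp add: linear_sum[OF L(1)])
  also have "\<dots> \<in> below \<T> \<gamma>"
  proof (rule subspace_sum[OF subspace_below])
    fix \<alpha> assume \<alpha>: "\<alpha> \<in> {\<alpha> \<in> idx \<T>. \<alpha> < \<gamma>}"
    then have "L (proj \<T> \<alpha> \<tau>) - proj \<T> \<alpha> \<tau> \<in> below \<T> \<alpha>"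
      using L(2) proj_in_sector by (auto simp: lower_triangular_def)
    then have "L (proj \<T> \<alpha> \<tau>) - proj \<T> \<alpha> \<tau> \<in> below \<T> \<gamma>"
      using below_mono[of \<alpha> \<gamma>] \<alpha> by auto
    moreover have "proj \<T> \<alpha> \<tau> \<in> below \<T> \<gamma>"
      using sector_below[of \<alpha> \<gamma>] \<alpha> proj_in_sector by auto
    ultimately have "(L (proj \<T> \<alpha> \<tau>) - proj \<T> \<alpha> \<tau>) + proj \<T> \<alpha> \<tau> \<in> below \<T> \<gamma>"
      by (rule subspace_add[OF subspace_below])
    then show "L (proj \<T> \<alpha> \<tau>) \<in> below \<T> \<gamma>" by simp
  qed
  finally show ?thesis .
qed

lemma secnorm_nonneg: "\<alpha> \<in> idx \<T> \<Longrightarrow> \<tau> \<in> sector \<T> \<alpha> \<Longrightarrow> 0 \<le> secnorm \<T> \<alpha> \<tau>"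
  and secnorm_eq_0: "\<alpha> \<in> idx \<T> \<Longrightarrow> \<tau> \<in> sector \<T> \<alpha> \<Longrightarrow> secnorm \<T> \<alpha> \<tau> = 0 \<longleftrightarrow> \<tau> = 0"
  and secnorm_scale: "\<alpha> \<in> idx \<T> \<Longrightarrow> \<tau> \<in> sector \<T> \<alpha> \<Longrightarrow> secnorm \<T> \<alpha> (a *\<^sub>R \<tau>) = \<bar>a\<bar> * secnorm \<T> \<alpha> \<tau>"
  and secnorm_triangle: "\<alpha> \<in> idx \<T> \<Longrightarrow> \<tau> \<in> sector \<T> \<alpha> \<Longrightarrow> \<sigma> \<in> sector \<T> \<alpha> \<Longrightarrow>
     secnorm \<T> \<alpha> (\<tau> + \<sigma>) \<le> secnorm \<T> \<alpha> \<tau> + secnorm \<T> \<alpha> \<sigma>"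
  using sector_banach[of \<alpha>] by (auto simp: banach_on_def)

lemma hnorm_nonneg: "\<alpha> \<in> idx \<T> \<Longrightarrow> 0 \<le> hnorm \<T> \<alpha> \<tau>"
  unfolding hnorm_def by (intro secnorm_nonneg proj_in_sector)

lemma hnorm_0: "\<alpha> \<in> idx \<T> \<Longrightarrow> hnorm \<T> \<alpha> 0 = 0"
  unfolding hnorm_def using secnorm_eq_0[of \<alpha> 0] by (simp add: linear_0[OF linear_proj] subspace_0 sector_subspace)

lemma hnorm_triangle: "\<alpha> \<in> idx \<T> \<Longrightarrow> hnorm \<T> \<alpha> (\<tau> + \<sigma>) \<le> hnorm \<T> \<alpha> \<tau> + hnorm \<T> \<alpha> \<sigma>"
  unfolding hnorm_def linear_add[OF linear_proj] by (intro secnorm_triangle proj_in_sector)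

lemma hnorm_minus: "\<alpha> \<in> idx \<T> \<Longrightarrow> hnorm \<T> \<alpha> (- \<tau>) = hnorm \<T> \<alpha> \<tau>"
  unfolding hnorm_def using secnorm_scale[OF _ proj_in_sector, of \<alpha> "-1" \<tau>] by (simp add: linear_neg[OF linear_proj])

lemma hnorm_triangle_diff: "\<alpha> \<in> idx \<T> \<Longrightarrow> hnorm \<T> \<alpha> (\<tau> - \<sigma>) \<le> hnorm \<T> \<alpha> \<tau> + hnorm \<T> \<alpha> \<sigma>"
  using hnorm_triangle[of \<alpha> \<tau> "- \<sigma>"] by (simp add: hnorm_minus)

end

section \<open>Models and modelled distributions as germs\<close>

lemma wmul_simps [simp]:
  "wfun (wmul w v) x = wfun w x * wfun v x" "wstar (wmul w v) x = wstar w x * wstar v x"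
  by (simp_all add: wmul_def)

locale rec_setting = gsemi S for S :: "('n::finite) setting" +
  fixes \<T> :: "('v::real_vector) regstruct" and \<alpha>0 \<gamma> \<eta> \<zeta> :: real and w v w1 :: "'n weight"
  assumes reg: "regularity_structure \<T> \<alpha>0"
    and w: "G_controlled S w" and v: "G_controlled S v" and wv: "G_controlled S (wmul w v)"
    and ww1: "G_controlled S (wmul w w1)"
    and \<gamma>_pos: "0 < \<gamma>" and \<eta>_gt: "\<gamma> - scl S $ axis1 S < \<eta>" and \<eta>_le: "\<eta> \<le> \<gamma>"
    and \<zeta>: "\<zeta> = min (min \<eta> \<alpha>0) 0"
begin

abbreviation "I \<equiv> {\<alpha> \<in> idx \<T>. \<alpha> < \<gamma>}"

sublocale germ_setting S "wmul w v" I \<gamma> \<eta>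
  using wv \<gamma>_pos \<eta>_gt \<eta>_le finite_idx_less[OF reg] by unfold_locales auto

text \<open>The bound behind \<open>pi_norm\<close> in real numbers, for all elements of degree
  below \<gamma> instead of one sector at a time, and with 0 included.\<close>

definition pi_le :: "real \<Rightarrow> ('n, 'v) pimap \<Rightarrow> bool" where
  "pi_le N P \<longleftrightarrow> (\<forall>x t. \<forall>\<tau>\<in>below \<T> \<gamma>. 0 < t \<longrightarrow> t \<le> 1 \<longrightarrow>
     \<bar>P x \<tau> t x\<bar> \<le> N / wfun w x * (\<Sum>\<alpha>\<in>I. t powr (\<alpha> / ell S) * hnorm \<T> \<alpha> \<tau>))"

text \<open>Includes the diagonal z = x, where the right-hand side is 0.\<close>

definition sharp_le :: "real \<Rightarrow> (real^'n \<Rightarrow> real^'n \<Rightarrow> 'v) \<Rightarrow> bool" where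
  "sharp_le K D \<longleftrightarrow> (\<forall>x\<in>off_hyp S. \<forall>z\<in>off_hyp S. \<forall>\<alpha>\<in>I. hnorm \<T> \<alpha> (D z x) \<le>
     K / wfun v x * (phi2 S x z powr (\<eta> - \<gamma>) * wstar v (x - z) * snorm S (z - x) powr (\<gamma> - \<alpha>)))"

definition sing_le :: "real \<Rightarrow> (real^'n \<Rightarrow> 'v) \<Rightarrow> bool" where
  "sing_le K f \<longleftrightarrow> (\<forall>x\<in>off_hyp S. \<forall>\<alpha>\<in>I. hnorm \<T> \<alpha> (f x) \<le> K / wfun v x * phi S x powr (min (\<eta> - \<alpha>) 0))"

section \<open>Passage from extended norms to pointwise bounds\<close>

lemma ennreal_ratio_le:
  fixes a b c N :: real
  assumes "ennreal (a * b / c) \<le> ennreal N" "0 < a" "0 < c" "0 \<le> N"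
  shows "b \<le> N / a * c"
proof -
  have "a * b / c \<le> N" using assms by (simp add: ennreal_le_iff)
  then show ?thesis using assms by (simp add: field_simps)
qed

lemma pi_norm_sector:
  assumes N: "pi_norm S \<T> \<gamma> w P \<le> ennreal N" "0 \<le> N" and P0: "P x 0 t x = 0"
    and \<alpha>: "\<alpha> \<in> idx \<T>" "\<alpha> < \<gamma>" and \<tau>: "\<tau> \<in> sector \<T> \<alpha>" and t: "0 < t" "t \<le> 1"
  shows "\<bar>P x \<tau> t x\<bar> \<le> N / wfun w x * (t powr (\<alpha> / ell S) * secnorm \<T> \<alpha> \<tau>)"
proof (cases "\<tau> = 0")
  case True
  have "secnorm \<T> \<alpha> 0 = 0" using secnorm_eq_0[OF reg \<alpha>(1), of 0] \<tau> True by simp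
  then show ?thesis using True P0 by simp
next
  case False
  have sp: "0 < secnorm \<T> \<alpha> \<tau>"
    using secnorm_nonneg[OF reg \<alpha>(1) \<tau>] secnorm_eq_0[OF reg \<alpha>(1) \<tau>] False by (simp add: less_le)
  have "ennreal (t powr (- \<alpha> / ell S) * wfun w x * (\<bar>P x \<tau> t x\<bar> / secnorm \<T> \<alpha> \<tau>)) \<le> pi_norm S \<T> \<gamma> w P"
    unfolding pi_norm_def
    by (rule SUP_upper2[of \<alpha>], use \<alpha> in simp, rule SUP_upper2[of t], use t in simp, rule SUP_upper2[of x], simp,
        rule SUP_upper2[of \<tau>], use \<tau> False in simp, simp)
  then have "ennreal (t powr (- \<alpha> / ell S) * wfun w x * (\<bar>P x \<tau> t x\<bar> / secnorm \<T> \<alpha> \<tau>)) \<le> ennreal N" by (intro order_trans[OF _ N(1)])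
  then have "t powr (- \<alpha> / ell S) * wfun w x * (\<bar>P x \<tau> t x\<bar> / secnorm \<T> \<alpha> \<tau>) \<le> N"
    using N by (simp add: ennreal_le_iff)
  then show ?thesis
    using t sp wfun_pos[OF w, of x] by (simp add: powr_minus field_simps)
qed

text \<open>Splits an element into its components; linearity also settles vanishing components, over
  which the supremum does not range.\<close>

lemma pi_leI:
  assumes N: "pi_norm S \<T> \<gamma> w P \<le> ennreal N" "0 \<le> N" and lin: "\<And>x t. linear (\<lambda>\<tau>. P x \<tau> t x)"
  shows "pi_le N P"
  unfolding pi_le_def
proof (intro allI ballI impI)
  fix x t \<tau> assume \<tau>: "\<tau> \<in> below \<T> \<gamma>" and t: "0 < t" "t \<le> (1::real)"
  have "P x \<tau> t x = (\<Sum>\<alpha>\<in>I. P x (proj \<T> \<alpha> \<tau>) t x)"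
    by (subst below_sum[OF reg \<tau>]) (simp add: linear_sum[OF lin])
  also have "\<bar>\<dots>\<bar> \<le> (\<Sum>\<alpha>\<in>I. N / wfun w x * (t powr (\<alpha> / ell S) * hnorm \<T> \<alpha> \<tau>))"
    unfolding hnorm_def
    by (intro order_trans[OF sum_abs] sum_mono pi_norm_sector[OF N linear_0[OF lin]]) (use t proj_in_sector[OF reg] in auto)
  finally show "\<bar>P x \<tau> t x\<bar> \<le> N / wfun w x * (\<Sum>\<alpha>\<in>I. t powr (\<alpha> / ell S) * hnorm \<T> \<alpha> \<tau>)"
    by (simp add: sum_distrib_left)
qed

lemma phi2_pos: "x \<in> off_hyp S \<Longrightarrow> y \<in> off_hyp S \<Longrightarrow> 0 < phi2 S x y"
  by (auto simp: phi2_def phi_pos)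

lemma sharp_leI:
  assumes K: "sharp_norm S \<T> \<gamma> \<eta> v D \<le> ennreal K" "0 \<le> K" and D: "\<And>x. x \<in> off_hyp S \<Longrightarrow> D x x = 0"
  shows "sharp_le K D"
  unfolding sharp_le_def
proof (intro ballI)
  fix x z \<alpha> assume x: "x \<in> off_hyp S" and z: "z \<in> off_hyp S" and \<alpha>: "\<alpha> \<in> I"
  let ?R = "phi2 S x z powr (\<eta> - \<gamma>) * wstar v (x - z) * snorm S (z - x) powr (\<gamma> - \<alpha>)"
  have ws: "0 < wstar v (x - z)" using wstar_ge1[OF v, of "x - z"] by linarith
  show "hnorm \<T> \<alpha> (D z x) \<le> K / wfun v x * ?R"
  proof (cases "z = x")
    case True
    have "0 \<le> K / wfun v x * ?R" using K wfun_pos[OF v, of x] ws by (intro mult_nonneg_nonneg) auto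
    then show ?thesis using True D[OF x] hnorm_0[OF reg] \<alpha> by simp
  next
    case False
    have "0 < ?R" using phi2_pos[OF x z] ws snorm_pos[of "z - x"] False by simp
    have "ennreal (wfun v x * hnorm \<T> \<alpha> (D z x) / ?R) \<le> sharp_norm S \<T> \<gamma> \<eta> v D"
      unfolding sharp_norm_def
      by (rule SUP_upper2[OF \<alpha>], rule SUP_upper2[OF x], rule SUP_upper2[of z], use z False in simp, simp)
    then have "ennreal (wfun v x * hnorm \<T> \<alpha> (D z x) / ?R) \<le> ennreal K" by (intro order_trans[OF _ K(1)])
    then show ?thesis using \<open>0 < ?R\<close> K wfun_pos[OF v, of x] by (intro ennreal_ratio_le)
  qed
qed

lemma sing_leI:
  assumes K: "sing_norm S \<T> \<gamma> \<eta> v f \<le> ennreal K" "0 \<le> K"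
  shows "sing_le K f"
  unfolding sing_le_def
proof (intro ballI)
  fix x \<alpha> assume x: "x \<in> off_hyp S" and \<alpha>: "\<alpha> \<in> I"
  have "ennreal (wfun v x * hnorm \<T> \<alpha> (f x) / phi S x powr (min (\<eta> - \<alpha>) 0)) \<le> sing_norm S \<T> \<gamma> \<eta> v f"
    unfolding sing_norm_def by (rule SUP_upper2[OF \<alpha>], rule SUP_upper2[OF x], simp)
  then have "ennreal (wfun v x * hnorm \<T> \<alpha> (f x) / phi S x powr (min (\<eta> - \<alpha>) 0)) \<le> ennreal K" by (intro order_trans[OF _ K(1)])
  then show "hnorm \<T> \<alpha> (f x) \<le> K / wfun v x * phi S x powr (min (\<eta> - \<alpha>) 0)"
    using phi_pos[OF x] K wfun_pos[OF v, of x] by (intro ennreal_ratio_le) auto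
qed

text \<open>Provides the coherence clause of \<open>germ\<close>. Both weights have to sit at the
  base point x: \<open>v\<close> is there already, and moving \<open>w\<close> from z to x costs
  \<open>wstar w (x - z)\<close>, so the factors combine into those of the product weight.\<close>

lemma pi_sharp:
  assumes P: "pi_le N P" and N: "0 \<le> N" and D: "sharp_le K D" and K: "0 \<le> K"
    and x: "x \<in> off_hyp S" and z: "z \<in> off_hyp S" and b: "D z x \<in> below \<T> \<gamma>" and s: "s \<in> {0<..1}"
  shows "\<bar>P z (D z x) s z\<bar> \<le> N * K / wfun (wmul w v) x * wstar (wmul w v) (x - z) * phi2 S x z powr (\<eta> - \<gamma>) *
           (\<Sum>\<alpha>\<in>I. s powr (\<alpha> / ell S) * snorm S (z - x) powr (\<gamma> - \<alpha>))"
proof -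
  let ?\<Sigma> = "\<Sum>\<alpha>\<in>I. s powr (\<alpha> / ell S) * snorm S (z - x) powr (\<gamma> - \<alpha>)"
  let ?c = "K / wfun v x * (phi2 S x z powr (\<eta> - \<gamma>) * wstar v (x - z))"
  have ws: "0 \<le> wstar v (x - z)" using wstar_ge1[OF v, of "x - z"] by linarith
  have cnn: "0 \<le> ?c" using K wfun_pos[OF v, of x] ws by (intro mult_nonneg_nonneg) auto
  have "\<bar>P z (D z x) s z\<bar> \<le> N / wfun w z * (\<Sum>\<alpha>\<in>I. s powr (\<alpha> / ell S) * hnorm \<T> \<alpha> (D z x))"
    using P b s by (auto simp: pi_le_def)
  also have "\<dots> \<le> N / wfun w z * (\<Sum>\<alpha>\<in>I. s powr (\<alpha> / ell S) * (K / wfun v x * (phi2 S x z powr (\<eta> - \<gamma>) * wstar v (x - z) * snorm S (z - x) powr (\<gamma> - \<alpha>))))"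
    using D x z N wfun_pos[OF w, of z] by (intro mult_left_mono sum_mono) (auto simp: sharp_le_def)
  also have "\<dots> = N * (1 / wfun w z) * (?c * ?\<Sigma>)"
    by (simp add: sum_distrib_left mult_ac)
  also have "\<dots> \<le> N * (wstar w (x - z) / wfun w x) * (?c * ?\<Sigma>)"
    using N by (intro mult_right_mono mult_left_mono inverse_wfun_le[OF w] mult_nonneg_nonneg[OF cnn] sum_nonneg) auto
  finally show ?thesis by (simp add: mult_ac)
qed

lemma pi_sing:
  assumes P: "pi_le N P" and N: "0 \<le> N" and f: "sing_le K f"
    and y: "y \<in> off_hyp S" and b: "f y \<in> below \<T> \<gamma>" and s: "s \<in> {0<..1}"
  shows "\<bar>P y (f y) s y\<bar> \<le> N * K / wfun (wmul w v) y * (\<Sum>\<alpha>\<in>I. s powr (\<alpha> / ell S) * phi S y powr (min (\<eta> - \<alpha>) 0))"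
proof -
  have "\<bar>P y (f y) s y\<bar> \<le> N / wfun w y * (\<Sum>\<alpha>\<in>I. s powr (\<alpha> / ell S) * hnorm \<T> \<alpha> (f y))"
    using P b s by (auto simp: pi_le_def)
  also have "\<dots> \<le> N / wfun w y * (\<Sum>\<alpha>\<in>I. s powr (\<alpha> / ell S) * (K / wfun v y * phi S y powr (min (\<eta> - \<alpha>) 0)))"
    using f y N wfun_pos[OF w, of y] by (intro mult_left_mono sum_mono) (auto simp: sing_le_def)
  finally show ?thesis by (simp add: sum_distrib_left mult_ac)
qed

text \<open>The value 0 on the hyperplane, where f carries no information, makes this a function on
  the whole space that can be measurable.\<close>

definition Fgerm :: "('n, 'v) pimap \<Rightarrow> (real^'n \<Rightarrow> 'v) \<Rightarrow> real \<Rightarrow> real^'n \<Rightarrow> real" where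
  "Fgerm P f s y = (if y \<in> off_hyp S then P y (f y) s y else 0)"

abbreviation "mods \<equiv> models S \<T> \<alpha>0 w w1"
abbreviation "mdists \<Gamma> \<equiv> modelled S \<T> \<gamma> \<eta> v \<Gamma>"

section \<open>Germs of one model and of the difference of two models\<close>

lemma model_facts:
  assumes "(P, \<Gamma>) \<in> mods"
  shows "P x \<tau> \<in> besov S (min \<alpha>0 0) (wmul w w1)" "linear (\<lambda>\<tau>. P x \<tau> t y)"
    "linear (\<Gamma> x y)" "lower_triangular \<T> (\<Gamma> x y)" "P x (\<Gamma> x y \<tau>) = P y \<tau>" "\<Gamma> x x = id"
  using assms unfolding models_def by blast+

lemma delta_below:
  assumes M: "(P, \<Gamma>) \<in> mods" and f: "f \<in> mdists \<Gamma>" and "x \<in> off_hyp S" "z \<in> off_hyp S"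
  shows "delta \<Gamma> f z x \<in> below \<T> \<gamma>"
  unfolding delta_def
  using assms lower_triangular_below[OF reg model_facts(3,4)[OF M]]
  by (intro subspace_diff[OF subspace_below[OF reg]]) (auto simp: modelled_def)

lemma Fgerm_diff:
  assumes M: "(P, \<Gamma>) \<in> mods" and z: "z \<in> off_hyp S"
  shows "Fgerm P f s z - P x (f x) s z = P z (delta \<Gamma> f z x) s z"
proof -
  have "P x (f x) = P z (\<Gamma> z x (f x))" using model_facts(5)[OF M] by simp
  then show ?thesis
    using z linear_diff[OF model_facts(2)[OF M]] by (simp add: Fgerm_def delta_def)
qed

lemma delta_refl: "(P, \<Gamma>) \<in> mods \<Longrightarrow> delta \<Gamma> f x x = 0"
  using model_facts(6)[of P \<Gamma> x] by (simp add: delta_def)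

lemma P_Cw:
  assumes M: "(P, \<Gamma>) \<in> mods" and s: "s \<in> {0<..1}"
  shows "P x \<tau> s \<in> Cw (wmul w w1)"
  using model_facts(1)[OF M, of x \<tau>] s unfolding besov_iff[OF ww1] by blast

lemma P_consistent: "(P, \<Gamma>) \<in> mods \<Longrightarrow> consistent S (P x \<tau>)"
  by (rule besov_consistent[OF ww1 model_facts(1)])

lemma open_off_hyp: "open (off_hyp S)"
proof -
  have "off_hyp S = (\<lambda>x. x $ axis1 S) -` (- {0})" by (auto simp: off_hyp_def)
  then show ?thesis by (auto intro!: open_vimage continuous_intros)
qed

text \<open>Every distance exponent \<gamma> - \<alpha> is positive, and the other factors stay
  bounded near a point off the hyperplane.\<close>

lemma error_tendsto:
  assumes x: "x \<in> off_hyp S"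
  shows "((\<lambda>z. N * K / wfun (wmul w v) x * wstar (wmul w v) (x - z) * phi2 S x z powr (\<eta> - \<gamma>) *
           (\<Sum>\<alpha>\<in>I. s powr (\<alpha> / ell S) * snorm S (z - x) powr (\<gamma> - \<alpha>))) \<longlongrightarrow> 0) (at x)"
proof -
  let ?E = "\<lambda>z. N * K / wfun (wmul w v) x * wstar (wmul w v) (x - z) * phi2 S x z powr (\<eta> - \<gamma>) *
         (\<Sum>\<alpha>\<in>I. s powr (\<alpha> / ell S) * snorm S (z - x) powr (\<gamma> - \<alpha>))"
  have sn0: "((\<lambda>z. snorm S (z - x)) \<longlongrightarrow> 0) (at x)"
  proof -
    have "isCont (\<lambda>z. snorm S (z - x)) x"
      using continuous_on_compose2[OF continuous_snorm, of UNIV "\<lambda>z. z - x"]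
      by (simp add: continuous_on_eq_continuous_at continuous_on_diff continuous_on_id continuous_on_const)
    then show ?thesis by (simp add: isCont_def)
  qed
  have ws: "((\<lambda>z. wstar (wmul w v) (x - z)) \<longlongrightarrow> wstar (wmul w v) 0) (at x)"
  proof -
    have "isCont (\<lambda>z. wstar (wmul w v) (x - z)) x"
      using continuous_on_compose2[OF continuous_wstar[OF wv], of UNIV "\<lambda>z. x - z"]
      by (simp add: continuous_on_eq_continuous_at continuous_on_diff continuous_on_id continuous_on_const)
    then show ?thesis by (simp add: isCont_def)
  qed
  have ph: "((\<lambda>z. phi2 S x z powr (\<eta> - \<gamma>)) \<longlongrightarrow> phi2 S x x powr (\<eta> - \<gamma>)) (at x)"
  proof (intro tendsto_powr tendsto_const)
    have "isCont (phi2 S x) x"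
      using continuous_phi unfolding phi2_def by (auto simp: continuous_on_eq_continuous_at intro!: continuous_intros)
    then show "(phi2 S x \<longlongrightarrow> phi2 S x x) (at x)" by (simp add: isCont_def)
  qed (use phi2_pos[OF x x] in simp)
  have "((\<lambda>z. \<Sum>\<alpha>\<in>I. s powr (\<alpha> / ell S) * snorm S (z - x) powr (\<gamma> - \<alpha>)) \<longlongrightarrow> (\<Sum>\<alpha>\<in>I. s powr (\<alpha> / ell S) * 0)) (at x)"
  proof (intro tendsto_sum tendsto_mult tendsto_const)
    fix \<alpha> assume "\<alpha> \<in> I"
    then have "((\<lambda>z. snorm S (z - x) powr (\<gamma> - \<alpha>)) \<longlongrightarrow> 0 powr (\<gamma> - \<alpha>)) (at x)"
      by (intro tendsto_powr'[OF sn0 tendsto_const]) (auto simp: snorm_nonneg)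
    then show "((\<lambda>z. snorm S (z - x) powr (\<gamma> - \<alpha>)) \<longlongrightarrow> 0) (at x)" by simp
  qed
  then have "(?E \<longlongrightarrow> N * K / wfun (wmul w v) x * wstar (wmul w v) 0 * phi2 S x x powr (\<eta> - \<gamma>) * (\<Sum>\<alpha>\<in>I. s powr (\<alpha> / ell S) * 0)) (at x)"
    by (intro tendsto_mult tendsto_const ws ph)
  then show ?thesis by simp
qed

text \<open>Measurability comes from coherence: near x the diagonal differs from the continuous
  function \<open>P x (f x) s\<close> by a quantity that tends to 0, so it is continuous on the open
  set \<open>off_hyp S\<close>.\<close>

lemma Fgerm_measurable:
  assumes M: "(P, \<Gamma>) \<in> mods" and f: "f \<in> mdists \<Gamma>"
    and P: "pi_le N P" and N: "0 \<le> N" and D: "sharp_le K (delta \<Gamma> f)" and K: "0 \<le> K" and s: "s \<in> {0<..1}"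
  shows "Fgerm P f s \<in> borel_measurable borel"
proof -
  have "continuous_on (off_hyp S) (Fgerm P f s)"
    unfolding continuous_on_eq_continuous_at[OF open_off_hyp]
  proof
    fix x assume x: "x \<in> off_hyp S"
    have E0: "((\<lambda>z. N * K / wfun (wmul w v) x * wstar (wmul w v) (x - z) * phi2 S x z powr (\<eta> - \<gamma>) *
           (\<Sum>\<alpha>\<in>I. s powr (\<alpha> / ell S) * snorm S (z - x) powr (\<gamma> - \<alpha>))) \<longlongrightarrow> 0) (at x)"
      (is "(?E \<longlongrightarrow> 0) _")
      by (rule error_tendsto[OF x])
    have "\<forall>\<^sub>F z in at x. norm (Fgerm P f s z - P x (f x) s z) \<le> ?E z"
      using eventually_at_in_open'[OF open_off_hyp x]
    proof eventually_elim
      case (elim z)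
      show ?case
        unfolding real_norm_def Fgerm_diff[OF M elim]
        by (rule pi_sharp[OF P N D K x elim delta_below[OF M f x elim] s])
    qed
    then have d0: "((\<lambda>z. Fgerm P f s z - P x (f x) s z) \<longlongrightarrow> 0) (at x)"
      using E0 by (rule Lim_null_comparison)
    have "isCont (P x (f x) s) x"
      using Cw_continuous[OF P_Cw[OF M s]] by (simp add: continuous_on_eq_continuous_at)
    then have "(P x (f x) s \<longlongrightarrow> P x (f x) s x) (at x)" by (simp add: isCont_def)
    from tendsto_add[OF d0 this] have "(Fgerm P f s \<longlongrightarrow> P x (f x) s x) (at x)" by simp
    moreover have "Fgerm P f s x = P x (f x) s x" using x by (simp add: Fgerm_def)
    ultimately show "isCont (Fgerm P f s) x" by (simp add: isCont_def)
  qed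
  then have "(\<lambda>y. indicator (off_hyp S) y *\<^sub>R Fgerm P f s y) \<in> borel_measurable borel"
    using off_hyp_sets by (intro borel_measurable_continuous_on_indicator)
  moreover have "(\<lambda>y. indicator (off_hyp S) y *\<^sub>R Fgerm P f s y) = Fgerm P f s"
    by (auto simp: Fgerm_def indicator_def)
  ultimately show ?thesis by simp
qed

lemma P_integrable:
  assumes M: "(P, \<Gamma>) \<in> mods" and "0 < r" "0 < s" "r + s \<le> 1"
  shows "integrable lborel (\<lambda>z. Qker S r y z * P x \<tau> s z)"
proof -
  obtain B where B: "0 \<le> B" "dominated S (wmul w w1) 0 B (P x \<tau> s)"
    by (rule Cw_dominated[OF ww1 P_Cw[OF M, of s x \<tau>]]) (use assms in auto)
  show ?thesis using assms by (intro qint_integrable[OF ww1 order_refl s1_pos B(2,1)]) auto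
qed

lemma model_germ:
  assumes M: "(P, \<Gamma>) \<in> mods" and f: "f \<in> mdists \<Gamma>"
    and P: "pi_le N P" and N: "0 \<le> N" and D: "sharp_le K (delta \<Gamma> f)" and K: "0 \<le> K"
    and G: "sing_le L f"
  shows "germ (N * K) (N * L) (Fgerm P f) (\<lambda>x. P x (f x))"
  unfolding germ_def
proof (intro conjI ballI allI impI)
  have fb: "\<And>x. x \<in> off_hyp S \<Longrightarrow> f x \<in> below \<T> \<gamma>" using f by (simp add: modelled_def)
  show "Fgerm P f s \<in> borel_measurable borel" if "s \<in> {0<..1}" for s
    by (rule Fgerm_measurable[OF M f P N D K that])
  show "\<bar>Fgerm P f s z - P x (f x) s z\<bar> \<le> N * K / wfun (wmul w v) x * wstar (wmul w v) (x - z) * phi2 S x z powr (\<eta> - \<gamma>) *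
         (\<Sum>\<alpha>\<in>I. s powr (\<alpha> / ell S) * snorm S (z - x) powr (\<gamma> - \<alpha>))"
    if "x \<in> off_hyp S" "z \<in> off_hyp S" "s \<in> {0<..1}" for x z s
    unfolding Fgerm_diff[OF M that(2)] by (rule pi_sharp[OF P N D K that(1,2) delta_below[OF M f that(1,2)] that(3)])
  show "\<bar>Fgerm P f s y\<bar> \<le> N * L / wfun (wmul w v) y * (\<Sum>\<alpha>\<in>I. s powr (\<alpha> / ell S) * phi S y powr (min (\<eta> - \<alpha>) 0))"
    if "y \<in> off_hyp S" "s \<in> {0<..1}" for y s
    using pi_sing[OF P N G that(1) fb[OF that(1)] that(2)] that(1) by (simp add: Fgerm_def)
qed (auto simp: Fgerm_def intro: P_integrable[OF M] consistentD[OF P_consistent[OF M]])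

lemma qint_P_diff:
  assumes M1: "(P1, \<Gamma>1) \<in> mods" and M2: "(P2, \<Gamma>2) \<in> mods" and r: "0 < r" "0 < s" "r + s \<le> 1"
  shows "qint S r (\<lambda>z. P1 x \<tau> s z - P2 x \<sigma> s z) y = P1 x \<tau> (r + s) y - P2 x \<sigma> (r + s) y"
  using P_integrable[OF M1 r, of y x \<tau>] P_integrable[OF M2 r, of y x \<sigma>]
    consistentD[OF P_consistent[OF M1] r, of x \<tau> y] consistentD[OF P_consistent[OF M2] r, of x \<sigma> y]
  by (simp add: qint_def right_diff_distrib)

text \<open>Split as P1 - P2 applied to the first argument plus P2 applied to the difference of the
  arguments. The constants are then linear in the distances \<open>Nd\<close>, \<open>Kd\<close>,
  \<open>Ld\<close>; the bounds \<open>N1\<close> and \<open>K2\<close> enter through the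
  measurability of the two diagonals.\<close>

lemma model_diff_germ:
  assumes M1: "(P1, \<Gamma>1) \<in> mods" and f1: "f1 \<in> mdists \<Gamma>1" and M2: "(P2, \<Gamma>2) \<in> mods" and f2: "f2 \<in> mdists \<Gamma>2"
    and P1: "pi_le N1 P1" "0 \<le> N1" and P2: "pi_le N2 P2" "0 \<le> N2" and Pd: "pi_le Nd (pi_diff P1 P2)" "0 \<le> Nd"
    and D1: "sharp_le K1 (delta \<Gamma>1 f1)" "0 \<le> K1" and D2: "sharp_le K2 (delta \<Gamma>2 f2)" "0 \<le> K2"
    and Dd: "sharp_le Kd (\<lambda>y x. delta \<Gamma>1 f1 y x - delta \<Gamma>2 f2 y x)" "0 \<le> Kd"
    and G1: "sing_le L1 f1" and Gd: "sing_le Ld (\<lambda>x. f1 x - f2 x)"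
  shows "germ (Nd * K1 + N2 * Kd) (Nd * L1 + N2 * Ld)
     (\<lambda>s y. Fgerm P1 f1 s y - Fgerm P2 f2 s y) (\<lambda>x s z. P1 x (f1 x) s z - P2 x (f2 x) s z)"
  unfolding germ_def
proof (intro conjI ballI allI impI)
  have fb1: "\<And>x. x \<in> off_hyp S \<Longrightarrow> f1 x \<in> below \<T> \<gamma>" and fb2: "\<And>x. x \<in> off_hyp S \<Longrightarrow> f2 x \<in> below \<T> \<gamma>"
    using f1 f2 by (auto simp: modelled_def)
  note lin2 = linear_diff[OF model_facts(2)[OF M2]]
  show "(\<lambda>y. Fgerm P1 f1 s y - Fgerm P2 f2 s y) \<in> borel_measurable borel" if "s \<in> {0<..1}" for s
    using Fgerm_measurable[OF M1 f1 P1 D1 that] Fgerm_measurable[OF M2 f2 P2 D2 that] by simp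
  show "\<bar>(Fgerm P1 f1 s z - Fgerm P2 f2 s z) - (P1 x (f1 x) s z - P2 x (f2 x) s z)\<bar>
      \<le> (Nd * K1 + N2 * Kd) / wfun (wmul w v) x * wstar (wmul w v) (x - z) * phi2 S x z powr (\<eta> - \<gamma>) *
         (\<Sum>\<alpha>\<in>I. s powr (\<alpha> / ell S) * snorm S (z - x) powr (\<gamma> - \<alpha>))"
    if x: "x \<in> off_hyp S" and z: "z \<in> off_hyp S" and s: "s \<in> {0<..1}" for x z s
  proof -
    have "(Fgerm P1 f1 s z - Fgerm P2 f2 s z) - (P1 x (f1 x) s z - P2 x (f2 x) s z)
      = P1 z (delta \<Gamma>1 f1 z x) s z - P2 z (delta \<Gamma>2 f2 z x) s z"
      unfolding Fgerm_diff[OF M1 z, symmetric] Fgerm_diff[OF M2 z, symmetric] by simp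
    also have "\<dots> = pi_diff P1 P2 z (delta \<Gamma>1 f1 z x) s z + P2 z (delta \<Gamma>1 f1 z x - delta \<Gamma>2 f2 z x) s z"
      by (simp add: pi_diff_def qdiff_def lin2)
    finally have eq: "(Fgerm P1 f1 s z - Fgerm P2 f2 s z) - (P1 x (f1 x) s z - P2 x (f2 x) s z)
      = pi_diff P1 P2 z (delta \<Gamma>1 f1 z x) s z + P2 z (delta \<Gamma>1 f1 z x - delta \<Gamma>2 f2 z x) s z" .
    have b: "delta \<Gamma>1 f1 z x - delta \<Gamma>2 f2 z x \<in> below \<T> \<gamma>"
      using delta_below[OF M1 f1 x z] delta_below[OF M2 f2 x z] by (rule subspace_diff[OF subspace_below[OF reg]])
    note a1 = pi_sharp[OF Pd D1 x z delta_below[OF M1 f1 x z] s]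
      and a2 = pi_sharp[OF P2 Dd x z b s]
    have dist: "(p + q) / c * W * h * \<Sigma> = p / c * W * h * \<Sigma> + q / c * W * h * \<Sigma>" for p q c W h \<Sigma> :: real
      by (simp add: add_divide_distrib algebra_simps)
    show ?thesis
      unfolding eq dist by (rule order_trans[OF abs_triangle_ineq add_mono[OF a1 a2]])
  qed
  show "\<bar>Fgerm P1 f1 s y - Fgerm P2 f2 s y\<bar> \<le> (Nd * L1 + N2 * Ld) / wfun (wmul w v) y * (\<Sum>\<alpha>\<in>I. s powr (\<alpha> / ell S) * phi S y powr (min (\<eta> - \<alpha>) 0))"
    if y: "y \<in> off_hyp S" and s: "s \<in> {0<..1}" for y s
  proof -
    have eq: "Fgerm P1 f1 s y - Fgerm P2 f2 s y = pi_diff P1 P2 y (f1 y) s y + P2 y (f1 y - f2 y) s y"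
      using y by (simp add: Fgerm_def pi_diff_def qdiff_def lin2)
    have b: "f1 y - f2 y \<in> below \<T> \<gamma>"
      using fb1[OF y] fb2[OF y] by (rule subspace_diff[OF subspace_below[OF reg]])
    note a1 = pi_sing[OF Pd G1 y fb1[OF y] s] and a2 = pi_sing[OF P2 Gd y b s]
    have dist: "(p + q) / c * \<Sigma> = p / c * \<Sigma> + q / c * \<Sigma>" for p q c \<Sigma> :: real
      by (simp add: add_divide_distrib algebra_simps)
    show ?thesis
      unfolding eq dist by (rule order_trans[OF abs_triangle_ineq add_mono[OF a1 a2]])
  qed
  show "integrable lborel (\<lambda>z. Qker S r y z * (P1 x (f1 x) s z - P2 x (f2 x) s z))"
    if "0 < r" "0 < s" "r + s \<le> 1" for x r s y
    using P_integrable[OF M1 that] P_integrable[OF M2 that] by (simp add: right_diff_distrib)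
qed (auto simp: Fgerm_def intro: qint_P_diff[OF M1 M2])

end

context rec_setting
begin

section \<open>Existence, uniqueness and bounds of reconstructions\<close>

abbreviation "u \<equiv> wmul w v"

lemma rec_norm_le_iff:
  assumes c: "0 \<le> c"
  shows "rec_norm S \<gamma> \<eta> u E \<le> ennreal c \<longleftrightarrow>
    (\<forall>t\<in>{0<..1}. \<forall>x\<in>off_hyp S. \<bar>E x t x\<bar> \<le> c * t powr (\<gamma> / ell S) * phi S x powr (-\<kappa>) / wfun u x)"
proof -
  have "ennreal (t powr (- \<gamma> / ell S) * phi S x powr (\<gamma> - \<eta>) * wfun u x * \<bar>E x t x\<bar>) \<le> ennreal c \<longleftrightarrow>
      \<bar>E x t x\<bar> \<le> c * t powr (\<gamma> / ell S) * phi S x powr (-\<kappa>) / wfun u x" if t: "t \<in> {0<..1}" and x: "x \<in> off_hyp S" for t x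
  proof -
    define p where "p = t powr (\<gamma> / ell S)"
    define h where "h = phi S x powr \<kappa>"
    have p: "0 < p" "t powr (- \<gamma> / ell S) = 1 / p" using t by (auto simp: p_def powr_minus_divide)
    have h: "0 < h" "phi S x powr (-\<kappa>) = 1 / h" using phi_pos[OF x] by (auto simp: h_def powr_minus_divide[symmetric])
    show ?thesis
      using p h wfun_pos[OF wv, of x] c
      unfolding p(2) h(2) h_def[symmetric] p_def[symmetric] by (simp add: ennreal_le_iff field_simps)
  qed
  then show ?thesis unfolding rec_norm_def SUP_le_iff by auto
qed

lemma finite_ennreal: "(X::ennreal) < \<infinity> \<Longrightarrow> \<exists>c\<ge>0. X = ennreal c"
  by (cases X) auto

text \<open>The two candidates may belong to Besov spaces of different exponents; what is used of
  them is consistency and membership of their members in C(wv). Subtracting the two local bounds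
  eliminates the germ.\<close>

lemma rec_unique:
  assumes M: "(P, \<Gamma>) \<in> mods" and 1: "is_reconstruction S \<gamma> \<eta> u P f \<Lambda>" and 2: "is_reconstruction S \<gamma> \<eta> u P f \<Lambda>'"
  shows "\<Lambda> = \<Lambda>'"
proof -
  have *: "consistent S \<Lambda> \<and> (\<forall>t\<in>{0<..1}. \<Lambda> t \<in> Cw u) \<and> (\<forall>t. t \<notin> {0<..1} \<longrightarrow> \<Lambda> t = (\<lambda>x. 0)) \<and>
     (\<exists>c\<ge>0. \<forall>t\<in>{0<..1}. \<forall>x\<in>off_hyp S. \<bar>\<Lambda> t x - P x (f x) t x\<bar> \<le> c * t powr (\<gamma> / ell S) * phi S x powr (-\<kappa>) / wfun u x)"
    if r: "is_reconstruction S \<gamma> \<eta> u P f \<Lambda>" for \<Lambda>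
  proof -
    from r obtain \<zeta>' where b: "\<Lambda> \<in> besov S \<zeta>' u" and n: "rec_norm S \<gamma> \<eta> u (local_err P f \<Lambda>) < \<infinity>"
      by (auto simp: is_reconstruction_def)
    obtain c where c: "c \<ge> 0" "rec_norm S \<gamma> \<eta> u (local_err P f \<Lambda>) = ennreal c" using finite_ennreal[OF n] by auto
    then have "rec_norm S \<gamma> \<eta> u (local_err P f \<Lambda>) \<le> ennreal c" by simp
    then have "\<forall>t\<in>{0<..1}. \<forall>x\<in>off_hyp S. \<bar>\<Lambda> t x - P x (f x) t x\<bar> \<le> c * t powr (\<gamma> / ell S) * phi S x powr (-\<kappa>) / wfun u x"
      unfolding rec_norm_le_iff[OF c(1)] by (simp add: local_err_def qdiff_def)
    then show ?thesis using besov_consistent[OF wv b] b c(1) unfolding besov_iff[OF wv] by blast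
  qed
  from *[OF 1] obtain c where c: "0 \<le> c"
    "\<And>t x. t \<in> {0<..1} \<Longrightarrow> x \<in> off_hyp S \<Longrightarrow> \<bar>\<Lambda> t x - P x (f x) t x\<bar> \<le> c * t powr (\<gamma> / ell S) * phi S x powr (-\<kappa>) / wfun u x" by blast
  from *[OF 2] obtain c' where c': "0 \<le> c'"
    "\<And>t x. t \<in> {0<..1} \<Longrightarrow> x \<in> off_hyp S \<Longrightarrow> \<bar>\<Lambda>' t x - P x (f x) t x\<bar> \<le> c' * t powr (\<gamma> / ell S) * phi S x powr (-\<kappa>) / wfun u x" by blast
  have eq: "\<Lambda> t x = \<Lambda>' t x" if t: "t \<in> {0<..1}" for t x
  proof (rule consistent_eqI[OF wv kap \<gamma>_pos conjunct1[OF *[OF 1]] conjunct1[OF *[OF 2]], where K="c + c'"])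
    fix t x assume t: "t \<in> {0<..(1::real)}" and x: "x \<in> off_hyp S"
    have "\<bar>\<Lambda> t x - \<Lambda>' t x\<bar> \<le> \<bar>\<Lambda> t x - P x (f x) t x\<bar> + \<bar>\<Lambda>' t x - P x (f x) t x\<bar>" by linarith
    also have "\<dots> \<le> c * t powr (\<gamma> / ell S) * phi S x powr (-\<kappa>) / wfun u x + c' * t powr (\<gamma> / ell S) * phi S x powr (-\<kappa>) / wfun u x"
      by (intro add_mono c(2) c'(2) t x)
    finally show "\<bar>\<Lambda> t x - \<Lambda>' t x\<bar> \<le> (c + c') * t powr (\<gamma> / ell S) * phi S x powr (-\<kappa>) / wfun u x"
      by (simp add: add_divide_distrib algebra_simps)
  qed (use *[OF 1] *[OF 2] t in auto)
  show ?thesis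
  proof (intro ext)
    fix t x show "\<Lambda> t x = \<Lambda>' t x"
      using eq[of t x] *[OF 1] *[OF 2] by (cases "t \<in> {0<..1}") auto
  qed
qed

lemma vanishing_powr:
  fixes M \<epsilon> e :: real
  assumes "0 \<le> M" "0 < \<epsilon>" "0 < e"
  obtains \<delta> where "0 < \<delta>" "\<And>t. 0 < t \<Longrightarrow> t \<le> \<delta> \<Longrightarrow> M * t powr \<epsilon> \<le> e"
proof (rule that)
  let ?\<delta> = "(e / (M + 1)) powr (1 / \<epsilon>)"
  show "0 < ?\<delta>" using assms by simp
  fix t assume t: "0 < t" "t \<le> ?\<delta>"
  have "t powr \<epsilon> \<le> ?\<delta> powr \<epsilon>" using t assms by (intro powr_mono2) auto
  also have "\<dots> = e / (M + 1)" using assms by (simp add: powr_powr)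
  finally have "M * t powr \<epsilon> \<le> M * (e / (M + 1))" using assms by (intro mult_left_mono) auto
  also have "\<dots> \<le> (M + 1) * (e / (M + 1))" using assms by (intro mult_right_mono) auto
  finally show "M * t powr \<epsilon> \<le> e" using assms by simp
qed

text \<open>A bound of order \<zeta> is negligible against any strictly lower exponent at small
  times, which is the criterion of \<open>besovI_vanishing\<close>.\<close>

lemma besov_of_bound:
  assumes L: "consistent S \<Lambda>" "\<And>t. t \<in> {0<..1} \<Longrightarrow> \<Lambda> t \<in> Cw u" "\<And>t. t \<notin> {0<..1} \<Longrightarrow> \<Lambda> t = (\<lambda>x. 0)"
    and c: "0 \<le> c" "\<And>t x. t \<in> {0<..1} \<Longrightarrow> \<bar>\<Lambda> t x\<bar> \<le> c * t powr (\<zeta> / ell S) / wfun u x" and z: "\<zeta>' < \<zeta>"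
  shows "\<Lambda> \<in> besov S \<zeta>' u"
proof (rule besovI_vanishing[OF wv L])
  show "\<zeta>' \<le> 0" using z \<zeta> by auto
  fix e :: real assume e: "0 < e"
  obtain \<delta> where d: "0 < \<delta>" "\<And>t. 0 < t \<Longrightarrow> t \<le> \<delta> \<Longrightarrow> c * t powr ((\<zeta> - \<zeta>') / ell S) \<le> e"
    using vanishing_powr[OF c(1) _ e, of "(\<zeta> - \<zeta>') / ell S"] z ell_pos by auto
  have "\<bar>\<Lambda> t x\<bar> \<le> e * t powr (\<zeta>' / ell S) / wfun u x" if t: "0 < t" "t \<le> \<delta>" "t \<le> 1" for t x
  proof -
    have "\<bar>\<Lambda> t x\<bar> \<le> c * t powr (\<zeta> / ell S) / wfun u x" using t by (intro c(2)) auto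
    also have "t powr (\<zeta> / ell S) = t powr ((\<zeta> - \<zeta>') / ell S) * t powr (\<zeta>' / ell S)"
      using t by (simp add: powr_add[symmetric] add_divide_distrib[symmetric])
    also have "c * (t powr ((\<zeta> - \<zeta>') / ell S) * t powr (\<zeta>' / ell S)) / wfun u x = c * t powr ((\<zeta> - \<zeta>') / ell S) * t powr (\<zeta>' / ell S) / wfun u x"
      by simp
    also have "\<dots> \<le> e * t powr (\<zeta>' / ell S) / wfun u x"
      using wfun_pos[OF wv, of x] by (intro divide_right_mono mult_right_mono d(2) t) auto
    finally show ?thesis .
  qed
  then show "\<exists>\<delta>>0. \<forall>t x. 0 < t \<longrightarrow> t \<le> \<delta> \<longrightarrow> t \<le> 1 \<longrightarrow> \<bar>\<Lambda> t x\<bar> \<le> e * t powr (\<zeta>' / ell S) / wfun u x"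
    using d(1) by blast
qed

lemma \<zeta>_facts: "\<zeta> \<le> 0" "\<zeta> \<le> \<eta>" "\<alpha> \<in> I \<Longrightarrow> \<zeta> \<le> min \<alpha> \<eta>"
  using \<zeta> idx_ge[OF reg, of \<alpha>] by auto

text \<open>Adds the size bound to \<open>germ_reconstruction\<close>: the remainder has exponent
  \<eta> and the main terms have exponents min \<alpha> \<eta>, all at least \<zeta>, and t \<le> 1.
  The cardinality of \<open>I\<close> enters since every degree contributes the same bound.\<close>

lemma germ_rec:
  obtains C where "0 < C"
    "\<And>A B F H. germ A B F H \<Longrightarrow> 0 \<le> A \<Longrightarrow> 0 \<le> B \<Longrightarrow>
      \<exists>\<Lambda>. consistent S \<Lambda> \<and> (\<forall>t\<in>{0<..1}. \<Lambda> t \<in> Cw u) \<and> (\<forall>t. t \<notin> {0<..1} \<longrightarrow> \<Lambda> t = (\<lambda>x. 0)) \<and>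
        (\<forall>t\<in>{0<..1}. \<forall>x\<in>off_hyp S. \<bar>\<Lambda> t x - H x t x\<bar> \<le> C * A * t powr (\<gamma> / ell S) * phi S x powr (-\<kappa>) / wfun u x) \<and>
        (\<forall>t\<in>{0<..1}. \<exists>s. 0 < s \<and> s \<le> t / 2 \<and> t \<le> 4 * s \<and>
           (\<forall>x. \<bar>\<Lambda> t x - qint S (t - s) (F s) x\<bar> \<le> C * A * t powr (\<eta> / ell S) / wfun u x)) \<and>
        (\<forall>t\<in>{0<..1}. \<forall>x. \<bar>\<Lambda> t x\<bar> \<le> C * (A + B) * t powr (\<zeta> / ell S) / wfun u x)"
proof -
  obtain C1 where C1: "0 < C1"
    "\<And>A B F H. germ A B F H \<Longrightarrow> 0 \<le> A \<Longrightarrow> 0 \<le> B \<Longrightarrow>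
      \<exists>\<Lambda>. consistent S \<Lambda> \<and> (\<forall>t\<in>{0<..1}. \<Lambda> t \<in> Cw u) \<and> (\<forall>t. t \<notin> {0<..1} \<longrightarrow> \<Lambda> t = (\<lambda>x. 0)) \<and>
        (\<forall>t\<in>{0<..1}. \<forall>x\<in>off_hyp S. \<bar>\<Lambda> t x - H x t x\<bar> \<le> C1 * A * t powr (\<gamma> / ell S) * phi S x powr (-\<kappa>) / wfun u x) \<and>
        (\<forall>t\<in>{0<..1}. \<exists>s. 0 < s \<and> s \<le> t / 2 \<and> t \<le> 4 * s \<and>
           (\<forall>x. \<bar>\<Lambda> t x - qint S (t - s) (F s) x\<bar> \<le> C1 * A * t powr (\<eta> / ell S) / wfun u x))"
    by (rule germ_reconstruction) (rule that)
  obtain C2 where C2: "0 < C2"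
    "\<And>b g x s t. g \<in> borel_measurable borel \<Longrightarrow> \<forall>\<alpha>\<in>I. 0 \<le> b \<alpha> \<Longrightarrow> 0 < s \<Longrightarrow> s \<le> t / 2 \<Longrightarrow> t \<le> 4 * s \<Longrightarrow> t \<le> 1 \<Longrightarrow>
       \<forall>y\<in>off_hyp S. \<bar>g y\<bar> \<le> 1 / wfun u y * (\<Sum>\<alpha>\<in>I. b \<alpha> * s powr (\<alpha> / ell S) * phi S y powr (min (\<eta> - \<alpha>) 0)) \<Longrightarrow>
       \<bar>qint S (t - s) g x\<bar> \<le> C2 / wfun u x * (\<Sum>\<alpha>\<in>I. b \<alpha> * t powr (min \<alpha> \<eta> / ell S))"
    by (rule main_term_bound) (rule that)
  define C where "C = C1 + C2 * card I"
  have C: "0 < C" "C1 \<le> C" "C2 * card I \<le> C" using C1 C2 by (auto simp: C_def intro!: add_pos_nonneg)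
  show ?thesis
  proof (rule that[OF C(1)])
    fix A B F H assume g: "germ A B F H" and A: "0 \<le> A" and B: "0 \<le> B"
    obtain \<Lambda> where L: "consistent S \<Lambda>" "\<forall>t\<in>{0<..1}. \<Lambda> t \<in> Cw u" "\<forall>t. t \<notin> {0<..1} \<longrightarrow> \<Lambda> t = (\<lambda>x. 0)"
      and L4: "\<And>t x. t \<in> {0<..1} \<Longrightarrow> x \<in> off_hyp S \<Longrightarrow> \<bar>\<Lambda> t x - H x t x\<bar> \<le> C1 * A * t powr (\<gamma> / ell S) * phi S x powr (-\<kappa>) / wfun u x"
      and L5: "\<And>t. t \<in> {0<..1} \<Longrightarrow> \<exists>s. 0 < s \<and> s \<le> t / 2 \<and> t \<le> 4 * s \<and>
           (\<forall>x. \<bar>\<Lambda> t x - qint S (t - s) (F s) x\<bar> \<le> C1 * A * t powr (\<eta> / ell S) / wfun u x)"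
      using C1(2)[OF g A B] by blast
    have up: "C1 * A * p / wfun u x \<le> C * A * p / wfun u x" if "0 \<le> p" for p x
      using C A that wfun_pos[OF wv, of x] by (intro divide_right_mono mult_right_mono) auto
    have L4': "\<bar>\<Lambda> t x - H x t x\<bar> \<le> C * A * t powr (\<gamma> / ell S) * phi S x powr (-\<kappa>) / wfun u x" if "t \<in> {0<..1}" "x \<in> off_hyp S" for t x
      using L4[OF that] up[of "t powr (\<gamma> / ell S) * phi S x powr (-\<kappa>)" x] by (simp add: mult.assoc)
    have L5': "\<exists>s. 0 < s \<and> s \<le> t / 2 \<and> t \<le> 4 * s \<and>
           (\<forall>x. \<bar>\<Lambda> t x - qint S (t - s) (F s) x\<bar> \<le> C * A * t powr (\<eta> / ell S) / wfun u x)" if "t \<in> {0<..1}" for t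
      using L5[OF that] up[of "t powr (\<eta> / ell S)"] by (meson order_trans powr_ge_zero)
    have L6: "\<bar>\<Lambda> t x\<bar> \<le> C * (A + B) * t powr (\<zeta> / ell S) / wfun u x" if t: "t \<in> {0<..1}" for t x
    proof -
      obtain s where s: "0 < s" "s \<le> t / 2" "t \<le> 4 * s"
        and sx: "\<bar>\<Lambda> t x - qint S (t - s) (F s) x\<bar> \<le> C1 * A * t powr (\<eta> / ell S) / wfun u x" using L5[OF t] by blast
      have sl: "s \<in> {0<..1}" using s t by auto
      have pm: "t powr (a / ell S) \<le> t powr (\<zeta> / ell S)" if "\<zeta> \<le> a" for a
        using that t ell_pos by (intro powr_mono') (auto simp: divide_right_mono)
      have "\<bar>qint S (t - s) (F s) x\<bar> \<le> C2 / wfun u x * (\<Sum>\<alpha>\<in>I. B * t powr (min \<alpha> \<eta> / ell S))"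
      proof (rule C2(2))
        show "F s \<in> borel_measurable borel" using g sl unfolding germ_def by blast
        show "\<forall>y\<in>off_hyp S. \<bar>F s y\<bar> \<le> 1 / wfun u y * (\<Sum>\<alpha>\<in>I. B * s powr (\<alpha> / ell S) * phi S y powr (min (\<eta> - \<alpha>) 0))"
        proof
        fix y assume y: "y \<in> off_hyp S"
        have "\<bar>F s y\<bar> \<le> B / wfun u y * (\<Sum>\<alpha>\<in>I. s powr (\<alpha> / ell S) * phi S y powr (min (\<eta> - \<alpha>) 0))"
          using g sl y unfolding germ_def by blast
        then show "\<bar>F s y\<bar> \<le> 1 / wfun u y * (\<Sum>\<alpha>\<in>I. B * s powr (\<alpha> / ell S) * phi S y powr (min (\<eta> - \<alpha>) 0))"
          by (simp add: sum_distrib_left mult_ac)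
        qed
      qed (use s t B in auto)
      also have "\<dots> \<le> C2 / wfun u x * (\<Sum>\<alpha>\<in>I. B * t powr (\<zeta> / ell S))"
        using C2 B wfun_pos[OF wv, of x] \<zeta>_facts(3) by (intro mult_left_mono sum_mono pm) auto
      also have "\<dots> = (C2 * card I) * (B * t powr (\<zeta> / ell S)) / wfun u x" by simp
      also have "\<dots> \<le> C * (B * t powr (\<zeta> / ell S)) / wfun u x"
        using C B wfun_pos[OF wv, of x] by (intro divide_right_mono mult_right_mono) auto
      finally have 1: "\<bar>qint S (t - s) (F s) x\<bar> \<le> C * (B * t powr (\<zeta> / ell S)) / wfun u x" .
      have "C1 * A * t powr (\<eta> / ell S) / wfun u x \<le> C * A * t powr (\<zeta> / ell S) / wfun u x"
        using C C1 A wfun_pos[OF wv, of x] pm[OF \<zeta>_facts(2)] by (intro divide_right_mono mult_mono) auto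
      with sx 1 have "\<bar>\<Lambda> t x\<bar> \<le> C * A * t powr (\<zeta> / ell S) / wfun u x + C * (B * t powr (\<zeta> / ell S)) / wfun u x" by linarith
      then show ?thesis by (simp add: algebra_simps add_divide_distrib)
    qed
    show "\<exists>\<Lambda>. consistent S \<Lambda> \<and> (\<forall>t\<in>{0<..1}. \<Lambda> t \<in> Cw u) \<and> (\<forall>t. t \<notin> {0<..1} \<longrightarrow> \<Lambda> t = (\<lambda>x. 0)) \<and>
        (\<forall>t\<in>{0<..1}. \<forall>x\<in>off_hyp S. \<bar>\<Lambda> t x - H x t x\<bar> \<le> C * A * t powr (\<gamma> / ell S) * phi S x powr (-\<kappa>) / wfun u x) \<and>
        (\<forall>t\<in>{0<..1}. \<exists>s. 0 < s \<and> s \<le> t / 2 \<and> t \<le> 4 * s \<and>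
           (\<forall>x. \<bar>\<Lambda> t x - qint S (t - s) (F s) x\<bar> \<le> C * A * t powr (\<eta> / ell S) / wfun u x)) \<and>
        (\<forall>t\<in>{0<..1}. \<forall>x. \<bar>\<Lambda> t x\<bar> \<le> C * (A + B) * t powr (\<zeta> / ell S) / wfun u x)"
      by (intro exI[of _ \<Lambda>] conjI ballI allI L4' L5' L6) (use L in auto)
  qed
qed

section \<open>Finiteness of the norms of a model\<close>

lemma ennreal_le_add:
  fixes a b c :: real
  assumes "a \<le> b + c" "0 \<le> b" "0 \<le> c" "ennreal b \<le> X" "ennreal c \<le> Y"
  shows "ennreal a \<le> X + Y"
proof -
  have "ennreal a \<le> ennreal b + ennreal c" using assms by (simp add: ennreal_plus[symmetric] ennreal_leI del: ennreal_plus)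
  also have "\<dots> \<le> X + Y" using assms by (intro add_mono) auto
  finally show ?thesis .
qed

lemma pi_norm_upper:
  assumes "\<alpha> \<in> I" "t \<in> {0<..1}" "\<tau> \<in> sector \<T> \<alpha> - {0}"
  shows "ennreal (t powr (- \<alpha> / ell S) * wfun w x * (\<bar>P x \<tau> t x\<bar> / secnorm \<T> \<alpha> \<tau>)) \<le> pi_norm S \<T> \<gamma> w P"
  unfolding pi_norm_def
  by (rule SUP_upper2[OF assms(1)], rule SUP_upper2[OF assms(2)], rule SUP_upper2[of x], simp, rule SUP_upper2[OF assms(3)], simp)

lemma gamma_norm_upper:
  fixes x y :: "real^'n"
  assumes "\<alpha> \<in> I" "\<beta> \<in> idx \<T>" "\<beta> < \<alpha>" "y \<noteq> x" "\<tau> \<in> sector \<T> \<alpha> - {0}"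
  shows "ennreal (wfun w x * hnorm \<T> \<beta> (\<Gamma> y x \<tau>) /
                 (wstar w (y - x) * snorm S (y - x) powr (\<alpha> - \<beta>) * secnorm \<T> \<alpha> \<tau>)) \<le> gamma_norm S \<T> \<gamma> w \<Gamma>"
  unfolding gamma_norm_def
  by (rule SUP_upper2[OF assms(1)], rule SUP_upper2[of \<beta>], use assms in simp, rule SUP_upper2[of x], simp,
      rule SUP_upper2[of y], use assms in simp, rule SUP_upper2[OF assms(5)], simp)

lemma smooth_approx:
  assumes M: "(P, \<Gamma>) \<in> mods" and e: "0 < e"
  obtains Pf \<Gamma>' where "smooth_model S \<T> w Pf \<Gamma>'" "pi_norm S \<T> \<gamma> w (pi_diff (\<lambda>x \<tau>. qfam S (Pf x \<tau>)) P) \<le> ennreal e"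
    "gamma_norm S \<T> \<gamma> w (gamma_diff \<Gamma>' \<Gamma>) \<le> ennreal e"
proof -
  from M obtain Pn \<Gamma>n where sm: "\<And>n::nat. smooth_model S \<T> w (Pn n) (\<Gamma>n n)"
    and lim: "(\<lambda>n. model_dist S \<T> \<gamma> w (\<lambda>x \<tau>. qfam S (Pn n x \<tau>), \<Gamma>n n) (P, \<Gamma>)) \<longlonglongrightarrow> 0"
    unfolding models_def by blast
  have "\<forall>\<^sub>F n in sequentially. model_dist S \<T> \<gamma> w (\<lambda>x \<tau>. qfam S (Pn n x \<tau>), \<Gamma>n n) (P, \<Gamma>) < ennreal e"
    using e by (intro order_tendstoD(2)[OF lim]) simp
  then obtain n where n: "model_dist S \<T> \<gamma> w (\<lambda>x \<tau>. qfam S (Pn n x \<tau>), \<Gamma>n n) (P, \<Gamma>) < ennreal e"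
    by (auto simp: eventually_sequentially)
  then have sum: "pi_norm S \<T> \<gamma> w (pi_diff (\<lambda>x \<tau>. qfam S (Pn n x \<tau>)) P) + gamma_norm S \<T> \<gamma> w (gamma_diff (\<Gamma>n n) \<Gamma>) \<le> ennreal e"
    by (simp add: model_dist_def)
  show ?thesis
    by (rule that[OF sm[of n]]) (use sum in \<open>auto intro: order_trans[rotated] simp: add_increasing add_increasing2\<close>)
qed

text \<open>A model is at distance at most 1 from a smooth one, whose norms are finite by
  definition.\<close>

lemma norms_finite:
  assumes M: "(P, \<Gamma>) \<in> mods"
  shows pi_norm_finite: "pi_norm S \<T> \<gamma> w P < \<infinity>" and gamma_norm_finite: "gamma_norm S \<T> \<gamma> w \<Gamma> < \<infinity>"
proof -
  obtain Pf \<Gamma>' where sm: "smooth_model S \<T> w Pf \<Gamma>'" and d: "pi_norm S \<T> \<gamma> w (pi_diff (\<lambda>x \<tau>. qfam S (Pf x \<tau>)) P) \<le> ennreal 1"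
    "gamma_norm S \<T> \<gamma> w (gamma_diff \<Gamma>' \<Gamma>) \<le> ennreal 1"
    by (rule smooth_approx[OF M zero_less_one])
  let ?P' = "\<lambda>x \<tau>. qfam S (Pf x \<tau>)"
  have fin: "pi_norm S \<T> \<gamma> w ?P' < \<infinity>" "gamma_norm S \<T> \<gamma> w \<Gamma>' < \<infinity>"
    using sm by (auto simp: smooth_model_def)
  have "pi_norm S \<T> \<gamma> w P \<le> pi_norm S \<T> \<gamma> w ?P' + pi_norm S \<T> \<gamma> w (pi_diff ?P' P)"
    unfolding pi_norm_def[of S \<T> \<gamma> w P]
  proof (intro SUP_least)
    fix \<alpha> t x \<tau> assume a: "\<alpha> \<in> I" "t \<in> {0<..(1::real)}" "\<tau> \<in> sector \<T> \<alpha> - {0}"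
    let ?c = "t powr (- \<alpha> / ell S) * wfun w x" and ?s = "secnorm \<T> \<alpha> \<tau>"
    have s: "0 \<le> ?s" using a secnorm_nonneg[OF reg] by auto
    have c: "0 \<le> ?c" using wfun_pos[OF w, of x] by simp
    have "\<bar>P x \<tau> t x\<bar> \<le> \<bar>?P' x \<tau> t x\<bar> + \<bar>pi_diff ?P' P x \<tau> t x\<bar>" by (simp add: pi_diff_def qdiff_def)
    then have "?c * (\<bar>P x \<tau> t x\<bar> / ?s) \<le> ?c * ((\<bar>?P' x \<tau> t x\<bar> + \<bar>pi_diff ?P' P x \<tau> t x\<bar>) / ?s)"
      using s c by (intro mult_left_mono divide_right_mono) auto
    then have le: "?c * (\<bar>P x \<tau> t x\<bar> / ?s) \<le> ?c * (\<bar>?P' x \<tau> t x\<bar> / ?s) + ?c * (\<bar>pi_diff ?P' P x \<tau> t x\<bar> / ?s)"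
      by (simp add: add_divide_distrib distrib_left)
    show "ennreal (?c * (\<bar>P x \<tau> t x\<bar> / ?s)) \<le> pi_norm S \<T> \<gamma> w ?P' + pi_norm S \<T> \<gamma> w (pi_diff ?P' P)"
      using s c by (intro ennreal_le_add[OF le] pi_norm_upper a) auto
  qed
  also have "\<dots> < \<infinity>" using fin(1) d(1) by (auto simp: less_top[symmetric] top_unique)
  finally show "pi_norm S \<T> \<gamma> w P < \<infinity>" .
  have "gamma_norm S \<T> \<gamma> w \<Gamma> \<le> gamma_norm S \<T> \<gamma> w \<Gamma>' + gamma_norm S \<T> \<gamma> w (gamma_diff \<Gamma>' \<Gamma>)"
    unfolding gamma_norm_def[of S \<T> \<gamma> w \<Gamma>]
  proof (intro SUP_least)
    fix \<alpha> \<beta> \<tau> and x y :: "real^'n" assume a: "\<alpha> \<in> I" "\<beta> \<in> {\<beta> \<in> idx \<T>. \<beta> < \<alpha>}" "y \<in> - {x}" "\<tau> \<in> sector \<T> \<alpha> - {0}"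
    let ?s = "wstar w (y - x) * snorm S (y - x) powr (\<alpha> - \<beta>) * secnorm \<T> \<alpha> \<tau>"
    have s: "0 \<le> ?s" using a secnorm_nonneg[OF reg] wstar_ge1[OF w, of "y - x"] by (intro mult_nonneg_nonneg) auto
    have b: "\<beta> \<in> idx \<T>" using a by auto
    have "\<Gamma> y x \<tau> = \<Gamma>' y x \<tau> - gamma_diff \<Gamma>' \<Gamma> y x \<tau>" by (simp add: gamma_diff_def)
    then have "hnorm \<T> \<beta> (\<Gamma> y x \<tau>) \<le> hnorm \<T> \<beta> (\<Gamma>' y x \<tau>) + hnorm \<T> \<beta> (gamma_diff \<Gamma>' \<Gamma> y x \<tau>)"
      using hnorm_triangle_diff[OF reg b] by metis
    then have "wfun w x * hnorm \<T> \<beta> (\<Gamma> y x \<tau>) / ?s \<le> wfun w x * (hnorm \<T> \<beta> (\<Gamma>' y x \<tau>) + hnorm \<T> \<beta> (gamma_diff \<Gamma>' \<Gamma> y x \<tau>)) / ?s"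
      using s wfun_pos[OF w, of x] by (intro mult_left_mono divide_right_mono) auto
    then have le: "wfun w x * hnorm \<T> \<beta> (\<Gamma> y x \<tau>) / ?s \<le> wfun w x * hnorm \<T> \<beta> (\<Gamma>' y x \<tau>) / ?s + wfun w x * hnorm \<T> \<beta> (gamma_diff \<Gamma>' \<Gamma> y x \<tau>) / ?s"
      by (simp add: add_divide_distrib distrib_left)
    show "ennreal (wfun w x * hnorm \<T> \<beta> (\<Gamma> y x \<tau>) / ?s) \<le> gamma_norm S \<T> \<gamma> w \<Gamma>' + gamma_norm S \<T> \<gamma> w (gamma_diff \<Gamma>' \<Gamma>)"
      using s hnorm_nonneg[OF reg b] wfun_pos[OF w, of x] a
      by (intro ennreal_le_add[OF le] gamma_norm_upper divide_nonneg_nonneg) auto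
  qed
  also have "\<dots> < \<infinity>" using fin(2) d(2) by (auto simp: less_top[symmetric] top_unique)
  finally show "gamma_norm S \<T> \<gamma> w \<Gamma> < \<infinity>" .
qed

section \<open>The reconstruction operator, its bounds and the bounds for differences\<close>

abbreviation "Rec \<equiv> reconstruction S \<gamma> \<eta> u"

text \<open>The norms appear as real values so that products are ordinary. By uniqueness the
  description in \<open>reconstruction\<close> denotes the family built from the germ, and all
  properties of that family transfer.\<close>

lemma rec_bounds:
  obtains C where "0 < C"
    "\<And>P \<Gamma> f N K L. (P, \<Gamma>) \<in> mods \<Longrightarrow> f \<in> mdists \<Gamma> \<Longrightarrow> pi_norm S \<T> \<gamma> w P = ennreal N \<Longrightarrow> 0 \<le> N \<Longrightarrow>
       sharp_norm S \<T> \<gamma> \<eta> v (delta \<Gamma> f) = ennreal K \<Longrightarrow> 0 \<le> K \<Longrightarrow> sing_norm S \<T> \<gamma> \<eta> v f = ennreal L \<Longrightarrow> 0 \<le> L \<Longrightarrow>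
       is_reconstruction S \<gamma> \<eta> u P f (Rec P f) \<and> consistent S (Rec P f) \<and> (\<forall>t\<in>{0<..1}. Rec P f t \<in> Cw u) \<and>
       (\<forall>t. t \<notin> {0<..1} \<longrightarrow> Rec P f t = (\<lambda>x. 0)) \<and> (\<forall>\<zeta>'<\<zeta>. Rec P f \<in> besov S \<zeta>' u) \<and>
       (\<forall>t\<in>{0<..1}. \<forall>x\<in>off_hyp S. \<bar>Rec P f t x - P x (f x) t x\<bar> \<le> C * (N * K) * t powr (\<gamma> / ell S) * phi S x powr (-\<kappa>) / wfun u x) \<and>
       (\<forall>t\<in>{0<..1}. \<exists>s. 0 < s \<and> s \<le> t / 2 \<and> t \<le> 4 * s \<and>
           (\<forall>x. \<bar>Rec P f t x - qint S (t - s) (Fgerm P f s) x\<bar> \<le> C * (N * K) * t powr (\<eta> / ell S) / wfun u x)) \<and>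
       (\<forall>t\<in>{0<..1}. \<forall>x. \<bar>Rec P f t x\<bar> \<le> C * (N * K + N * L) * t powr (\<zeta> / ell S) / wfun u x)"
proof -
  obtain C where C: "0 < C"
    "\<And>A B F H. germ A B F H \<Longrightarrow> 0 \<le> A \<Longrightarrow> 0 \<le> B \<Longrightarrow>
      \<exists>\<Lambda>. consistent S \<Lambda> \<and> (\<forall>t\<in>{0<..1}. \<Lambda> t \<in> Cw u) \<and> (\<forall>t. t \<notin> {0<..1} \<longrightarrow> \<Lambda> t = (\<lambda>x. 0)) \<and>
        (\<forall>t\<in>{0<..1}. \<forall>x\<in>off_hyp S. \<bar>\<Lambda> t x - H x t x\<bar> \<le> C * A * t powr (\<gamma> / ell S) * phi S x powr (-\<kappa>) / wfun u x) \<and>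
        (\<forall>t\<in>{0<..1}. \<exists>s. 0 < s \<and> s \<le> t / 2 \<and> t \<le> 4 * s \<and>
           (\<forall>x. \<bar>\<Lambda> t x - qint S (t - s) (F s) x\<bar> \<le> C * A * t powr (\<eta> / ell S) / wfun u x)) \<and>
        (\<forall>t\<in>{0<..1}. \<forall>x. \<bar>\<Lambda> t x\<bar> \<le> C * (A + B) * t powr (\<zeta> / ell S) / wfun u x)"
    by (rule germ_rec) (rule that)
  show ?thesis
  proof (rule that[OF C(1)])
    fix P \<Gamma> f N K L
    assume M: "(P, \<Gamma>) \<in> mods" and f: "f \<in> mdists \<Gamma>" and N: "pi_norm S \<T> \<gamma> w P = ennreal N" "0 \<le> N"
      and K: "sharp_norm S \<T> \<gamma> \<eta> v (delta \<Gamma> f) = ennreal K" "0 \<le> K" and L: "sing_norm S \<T> \<gamma> \<eta> v f = ennreal L" "0 \<le> L"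
    have g: "germ (N * K) (N * L) (Fgerm P f) (\<lambda>x. P x (f x))"
      using N K L model_facts(2)[OF M] delta_refl[OF M]
      by (intro model_germ[OF M f] pi_leI sharp_leI sing_leI) auto
    have NK: "0 \<le> N * K" "0 \<le> N * L" using N K L by auto
    obtain \<Lambda> where L1: "consistent S \<Lambda>" "\<forall>t\<in>{0<..1}. \<Lambda> t \<in> Cw u" "\<forall>t. t \<notin> {0<..1} \<longrightarrow> \<Lambda> t = (\<lambda>x. 0)"
      and L4: "\<forall>t\<in>{0<..1}. \<forall>x\<in>off_hyp S. \<bar>\<Lambda> t x - P x (f x) t x\<bar> \<le> C * (N * K) * t powr (\<gamma> / ell S) * phi S x powr (-\<kappa>) / wfun u x"
      and L5: "\<forall>t\<in>{0<..1}. \<exists>s. 0 < s \<and> s \<le> t / 2 \<and> t \<le> 4 * s \<and>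
           (\<forall>x. \<bar>\<Lambda> t x - qint S (t - s) (Fgerm P f s) x\<bar> \<le> C * (N * K) * t powr (\<eta> / ell S) / wfun u x)"
      and L6: "\<forall>t\<in>{0<..1}. \<forall>x. \<bar>\<Lambda> t x\<bar> \<le> C * (N * K + N * L) * t powr (\<zeta> / ell S) / wfun u x"
      using C(2)[OF g NK] by blast
    have bes: "\<Lambda> \<in> besov S \<zeta>' u" if "\<zeta>' < \<zeta>" for \<zeta>'
      by (rule besov_of_bound[where c="C * (N * K + N * L)"]) (use L1 L6 NK C that in auto)
    have CNK: "0 \<le> C * (N * K)" using C NK by simp
    have "rec_norm S \<gamma> \<eta> u (local_err P f \<Lambda>) \<le> ennreal (C * (N * K))"
      unfolding rec_norm_le_iff[OF CNK] using L4 by (simp add: local_err_def qdiff_def)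
    then have "rec_norm S \<gamma> \<eta> u (local_err P f \<Lambda>) < \<infinity>" by (rule le_less_trans) simp
    \<comment> \<open>Any exponent below \<zeta> certifies that the family lies in some Besov space;
      \<zeta> - 1 is one.\<close>
    moreover have "\<Lambda> \<in> besov S (\<zeta> - 1) u" "\<zeta> - 1 \<le> 0" using bes[of "\<zeta> - 1"] \<zeta>_facts by auto
    ultimately have isr: "is_reconstruction S \<gamma> \<eta> u P f \<Lambda>" unfolding is_reconstruction_def by blast
    have "Rec P f = \<Lambda>"
      unfolding reconstruction_def
      by (rule the_equality[of "is_reconstruction S \<gamma> \<eta> u P f", OF isr rec_unique[OF M _ isr]])
    then show "is_reconstruction S \<gamma> \<eta> u P f (Rec P f) \<and> consistent S (Rec P f) \<and> (\<forall>t\<in>{0<..1}. Rec P f t \<in> Cw u) \<and>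
       (\<forall>t. t \<notin> {0<..1} \<longrightarrow> Rec P f t = (\<lambda>x. 0)) \<and> (\<forall>\<zeta>'<\<zeta>. Rec P f \<in> besov S \<zeta>' u) \<and>
       (\<forall>t\<in>{0<..1}. \<forall>x\<in>off_hyp S. \<bar>Rec P f t x - P x (f x) t x\<bar> \<le> C * (N * K) * t powr (\<gamma> / ell S) * phi S x powr (-\<kappa>) / wfun u x) \<and>
       (\<forall>t\<in>{0<..1}. \<exists>s. 0 < s \<and> s \<le> t / 2 \<and> t \<le> 4 * s \<and>
           (\<forall>x. \<bar>Rec P f t x - qint S (t - s) (Fgerm P f s) x\<bar> \<le> C * (N * K) * t powr (\<eta> / ell S) / wfun u x)) \<and>
       (\<forall>t\<in>{0<..1}. \<forall>x. \<bar>Rec P f t x\<bar> \<le> C * (N * K + N * L) * t powr (\<zeta> / ell S) / wfun u x)"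
      using isr L1 bes L4 L5 L6 by blast
  qed
qed

lemma modelled_norms:
  assumes "f \<in> mdists \<Gamma>"
  obtains K L where "sharp_norm S \<T> \<gamma> \<eta> v (delta \<Gamma> f) = ennreal K" "0 \<le> K" "sing_norm S \<T> \<gamma> \<eta> v f = ennreal L" "0 \<le> L"
proof -
  have "sing_norm S \<T> \<gamma> \<eta> v f < \<infinity>" "sharp_norm S \<T> \<gamma> \<eta> v (delta \<Gamma> f) < \<infinity>"
    using assms by (auto simp: modelled_def md_norm_def)
  from finite_ennreal[OF this(1)] finite_ennreal[OF this(2)] that show ?thesis by blast
qed

lemma rec_facts:
  assumes M: "(P, \<Gamma>) \<in> mods" and f: "f \<in> mdists \<Gamma>"
  shows "is_reconstruction S \<gamma> \<eta> u P f (Rec P f)" "consistent S (Rec P f)" "\<And>t. t \<in> {0<..1} \<Longrightarrow> Rec P f t \<in> Cw u"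
    "\<And>t. t \<notin> {0<..1} \<Longrightarrow> Rec P f t = (\<lambda>x. 0)" "\<And>\<zeta>'. \<zeta>' < \<zeta> \<Longrightarrow> Rec P f \<in> besov S \<zeta>' u"
    "\<exists>c\<ge>0. \<forall>t\<in>{0<..1}. \<forall>x\<in>off_hyp S. \<bar>Rec P f t x - P x (f x) t x\<bar> \<le> c * t powr (\<gamma> / ell S) * phi S x powr (-\<kappa>) / wfun u x"
    "\<exists>c\<ge>0. \<forall>t\<in>{0<..1}. \<exists>s. 0 < s \<and> s \<le> t / 2 \<and> t \<le> 4 * s \<and>
           (\<forall>x. \<bar>Rec P f t x - qint S (t - s) (Fgerm P f s) x\<bar> \<le> c * t powr (\<eta> / ell S) / wfun u x)"
    "\<exists>c\<ge>0. \<forall>t\<in>{0<..1}. \<forall>x. \<bar>Rec P f t x\<bar> \<le> c * t powr (\<zeta> / ell S) / wfun u x"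
proof -
  obtain K L where K: "sharp_norm S \<T> \<gamma> \<eta> v (delta \<Gamma> f) = ennreal K" "0 \<le> K" and L: "sing_norm S \<T> \<gamma> \<eta> v f = ennreal L" "0 \<le> L"
    by (rule modelled_norms[OF f])
  obtain N where N: "pi_norm S \<T> \<gamma> w P = ennreal N" "0 \<le> N" using finite_ennreal[OF pi_norm_finite[OF M]] by blast
  obtain C where C: "0 < C" and *: "is_reconstruction S \<gamma> \<eta> u P f (Rec P f) \<and> consistent S (Rec P f) \<and> (\<forall>t\<in>{0<..1}. Rec P f t \<in> Cw u) \<and>
       (\<forall>t. t \<notin> {0<..1} \<longrightarrow> Rec P f t = (\<lambda>x. 0)) \<and> (\<forall>\<zeta>'<\<zeta>. Rec P f \<in> besov S \<zeta>' u) \<and>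
       (\<forall>t\<in>{0<..1}. \<forall>x\<in>off_hyp S. \<bar>Rec P f t x - P x (f x) t x\<bar> \<le> C * (N * K) * t powr (\<gamma> / ell S) * phi S x powr (-\<kappa>) / wfun u x) \<and>
       (\<forall>t\<in>{0<..1}. \<exists>s. 0 < s \<and> s \<le> t / 2 \<and> t \<le> 4 * s \<and>
           (\<forall>x. \<bar>Rec P f t x - qint S (t - s) (Fgerm P f s) x\<bar> \<le> C * (N * K) * t powr (\<eta> / ell S) / wfun u x)) \<and>
       (\<forall>t\<in>{0<..1}. \<forall>x. \<bar>Rec P f t x\<bar> \<le> C * (N * K + N * L) * t powr (\<zeta> / ell S) / wfun u x)"
    by (rule rec_bounds) (use M f N K L in blast)
  have nn: "0 \<le> C * (N * K)" "0 \<le> C * (N * K + N * L)" using C N K L by auto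
  show "is_reconstruction S \<gamma> \<eta> u P f (Rec P f)" "consistent S (Rec P f)" "\<And>t. t \<in> {0<..1} \<Longrightarrow> Rec P f t \<in> Cw u"
    "\<And>t. t \<notin> {0<..1} \<Longrightarrow> Rec P f t = (\<lambda>x. 0)" "\<And>\<zeta>'. \<zeta>' < \<zeta> \<Longrightarrow> Rec P f \<in> besov S \<zeta>' u"
    "\<exists>c\<ge>0. \<forall>t\<in>{0<..1}. \<forall>x\<in>off_hyp S. \<bar>Rec P f t x - P x (f x) t x\<bar> \<le> c * t powr (\<gamma> / ell S) * phi S x powr (-\<kappa>) / wfun u x"
    "\<exists>c\<ge>0. \<forall>t\<in>{0<..1}. \<exists>s. 0 < s \<and> s \<le> t / 2 \<and> t \<le> 4 * s \<and>
           (\<forall>x. \<bar>Rec P f t x - qint S (t - s) (Fgerm P f s) x\<bar> \<le> c * t powr (\<eta> / ell S) / wfun u x)"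
    "\<exists>c\<ge>0. \<forall>t\<in>{0<..1}. \<forall>x. \<bar>Rec P f t x\<bar> \<le> c * t powr (\<zeta> / ell S) / wfun u x"
    using * nn by blast+
qed

text \<open>The difference of the two reconstructions is consistent and locally close to the
  difference germ, so it equals the family that \<open>germ_rec\<close> builds from that germ and
  inherits its bounds.\<close>

lemma rec_diff_bounds:
  obtains C where "0 < C"
    "\<And>P1 \<Gamma>1 f1 P2 \<Gamma>2 f2 N2 Nd K1 Kd L1 Ld.
       (P1, \<Gamma>1) \<in> mods \<Longrightarrow> f1 \<in> mdists \<Gamma>1 \<Longrightarrow> (P2, \<Gamma>2) \<in> mods \<Longrightarrow> f2 \<in> mdists \<Gamma>2 \<Longrightarrow>
       pi_norm S \<T> \<gamma> w P2 \<le> ennreal N2 \<Longrightarrow> 0 \<le> N2 \<Longrightarrow> pi_norm S \<T> \<gamma> w (pi_diff P1 P2) \<le> ennreal Nd \<Longrightarrow> 0 \<le> Nd \<Longrightarrow>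
       sharp_norm S \<T> \<gamma> \<eta> v (delta \<Gamma>1 f1) \<le> ennreal K1 \<Longrightarrow> 0 \<le> K1 \<Longrightarrow> sing_norm S \<T> \<gamma> \<eta> v f1 \<le> ennreal L1 \<Longrightarrow> 0 \<le> L1 \<Longrightarrow>
       sharp_dist S \<T> \<gamma> \<eta> v \<Gamma>1 f1 \<Gamma>2 f2 \<le> ennreal Kd \<Longrightarrow> 0 \<le> Kd \<Longrightarrow> sing_norm S \<T> \<gamma> \<eta> v (\<lambda>x. f1 x - f2 x) \<le> ennreal Ld \<Longrightarrow> 0 \<le> Ld \<Longrightarrow>
       (\<forall>t\<in>{0<..1}. \<forall>x\<in>off_hyp S. \<bar>(Rec P1 f1 t x - P1 x (f1 x) t x) - (Rec P2 f2 t x - P2 x (f2 x) t x)\<bar>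
           \<le> C * (Nd * K1 + N2 * Kd) * t powr (\<gamma> / ell S) * phi S x powr (-\<kappa>) / wfun u x) \<and>
       (\<forall>t\<in>{0<..1}. \<forall>x. \<bar>Rec P1 f1 t x - Rec P2 f2 t x\<bar> \<le> C * ((Nd * K1 + N2 * Kd) + (Nd * L1 + N2 * Ld)) * t powr (\<zeta> / ell S) / wfun u x)"
proof -
  obtain C where C: "0 < C"
    "\<And>A B F H. germ A B F H \<Longrightarrow> 0 \<le> A \<Longrightarrow> 0 \<le> B \<Longrightarrow>
      \<exists>\<Lambda>. consistent S \<Lambda> \<and> (\<forall>t\<in>{0<..1}. \<Lambda> t \<in> Cw u) \<and> (\<forall>t. t \<notin> {0<..1} \<longrightarrow> \<Lambda> t = (\<lambda>x. 0)) \<and>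
        (\<forall>t\<in>{0<..1}. \<forall>x\<in>off_hyp S. \<bar>\<Lambda> t x - H x t x\<bar> \<le> C * A * t powr (\<gamma> / ell S) * phi S x powr (-\<kappa>) / wfun u x) \<and>
        (\<forall>t\<in>{0<..1}. \<exists>s. 0 < s \<and> s \<le> t / 2 \<and> t \<le> 4 * s \<and>
           (\<forall>x. \<bar>\<Lambda> t x - qint S (t - s) (F s) x\<bar> \<le> C * A * t powr (\<eta> / ell S) / wfun u x)) \<and>
        (\<forall>t\<in>{0<..1}. \<forall>x. \<bar>\<Lambda> t x\<bar> \<le> C * (A + B) * t powr (\<zeta> / ell S) / wfun u x)"
    by (rule germ_rec) (rule that)
  show ?thesis
  proof (rule that[OF C(1)])
    fix P1 \<Gamma>1 f1 P2 \<Gamma>2 f2 N2 Nd K1 Kd L1 Ld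
    assume M1: "(P1, \<Gamma>1) \<in> mods" and f1: "f1 \<in> mdists \<Gamma>1" and M2: "(P2, \<Gamma>2) \<in> mods" and f2: "f2 \<in> mdists \<Gamma>2"
      and N2: "pi_norm S \<T> \<gamma> w P2 \<le> ennreal N2" "0 \<le> N2" and Nd: "pi_norm S \<T> \<gamma> w (pi_diff P1 P2) \<le> ennreal Nd" "0 \<le> Nd"
      and K1: "sharp_norm S \<T> \<gamma> \<eta> v (delta \<Gamma>1 f1) \<le> ennreal K1" "0 \<le> K1" and L1: "sing_norm S \<T> \<gamma> \<eta> v f1 \<le> ennreal L1" "0 \<le> L1"
      and Kd: "sharp_dist S \<T> \<gamma> \<eta> v \<Gamma>1 f1 \<Gamma>2 f2 \<le> ennreal Kd" "0 \<le> Kd"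
      and Ld: "sing_norm S \<T> \<gamma> \<eta> v (\<lambda>x. f1 x - f2 x) \<le> ennreal Ld" "0 \<le> Ld"
    obtain N1 where N1: "pi_norm S \<T> \<gamma> w P1 = ennreal N1" "0 \<le> N1" using finite_ennreal[OF pi_norm_finite[OF M1]] by blast
    obtain K2 where K2: "sharp_norm S \<T> \<gamma> \<eta> v (delta \<Gamma>2 f2) = ennreal K2" "0 \<le> K2" by (rule modelled_norms[OF f2])
    have lind: "linear (\<lambda>\<tau>. pi_diff P1 P2 x \<tau> t x)" for x t
      unfolding pi_diff_def qdiff_def by (intro linear_compose_sub model_facts(2)[OF M1] model_facts(2)[OF M2])
    have g: "germ (Nd * K1 + N2 * Kd) (Nd * L1 + N2 * Ld)
       (\<lambda>s y. Fgerm P1 f1 s y - Fgerm P2 f2 s y) (\<lambda>x s z. P1 x (f1 x) s z - P2 x (f2 x) s z)"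
    proof (rule model_diff_germ[OF M1 f1 M2 f2])
      show "pi_le N1 P1" "pi_le N2 P2" "pi_le Nd (pi_diff P1 P2)"
        using N1 N2 Nd model_facts(2)[OF M1] model_facts(2)[OF M2] lind by (auto intro!: pi_leI)
      show "sharp_le K1 (delta \<Gamma>1 f1)" "sharp_le K2 (delta \<Gamma>2 f2)" "sharp_le Kd (\<lambda>y x. delta \<Gamma>1 f1 y x - delta \<Gamma>2 f2 y x)"
        using K1 K2 Kd delta_refl[OF M1] delta_refl[OF M2] by (auto intro!: sharp_leI simp: sharp_dist_def)
      show "sing_le L1 f1" "sing_le Ld (\<lambda>x. f1 x - f2 x)" using L1 Ld by (auto intro!: sing_leI)
    qed (use N1 N2 Nd K1 K2 Kd in auto)
    have A: "0 \<le> Nd * K1 + N2 * Kd" "0 \<le> Nd * L1 + N2 * Ld" using Nd K1 N2 Kd L1 Ld by auto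
    obtain \<Lambda> where L: "consistent S \<Lambda>" "\<forall>t\<in>{0<..1}. \<Lambda> t \<in> Cw u"
      and L4: "\<And>t x. t\<in>{0<..1} \<Longrightarrow> x\<in>off_hyp S \<Longrightarrow> \<bar>\<Lambda> t x - (P1 x (f1 x) t x - P2 x (f2 x) t x)\<bar> \<le> C * (Nd * K1 + N2 * Kd) * t powr (\<gamma> / ell S) * phi S x powr (-\<kappa>) / wfun u x"
      and L6: "\<And>t x. t\<in>{0<..1} \<Longrightarrow> \<bar>\<Lambda> t x\<bar> \<le> C * ((Nd * K1 + N2 * Kd) + (Nd * L1 + N2 * Ld)) * t powr (\<zeta> / ell S) / wfun u x"
      using C(2)[OF g A] by blast
    note r1 = rec_facts[OF M1 f1] and r2 = rec_facts[OF M2 f2]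
    obtain c1 where c1: "0 \<le> c1" "\<And>t x. t\<in>{0<..1} \<Longrightarrow> x\<in>off_hyp S \<Longrightarrow> \<bar>Rec P1 f1 t x - P1 x (f1 x) t x\<bar> \<le> c1 * t powr (\<gamma> / ell S) * phi S x powr (-\<kappa>) / wfun u x"
      using r1(6) by blast
    obtain c2 where c2: "0 \<le> c2" "\<And>t x. t\<in>{0<..1} \<Longrightarrow> x\<in>off_hyp S \<Longrightarrow> \<bar>Rec P2 f2 t x - P2 x (f2 x) t x\<bar> \<le> c2 * t powr (\<gamma> / ell S) * phi S x powr (-\<kappa>) / wfun u x"
      using r2(6) by blast
    let ?D = "\<lambda>t x. Rec P1 f1 t x - Rec P2 f2 t x"
    have consD: "consistent S ?D"
      unfolding consistent_def
    proof (intro allI impI)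
      fix r s x assume r: "0 < r" and s: "0 < s" and rs: "r + s \<le> (1::real)"
      then have sl: "s \<in> {0<..1}" and rl: "r \<le> 1" by auto
      obtain B1 where B1: "0 \<le> B1" "dominated S u 0 B1 (Rec P1 f1 s)" by (rule Cw_dominated[OF wv r1(3)[OF sl]])
      obtain B2 where B2: "0 \<le> B2" "dominated S u 0 B2 (Rec P2 f2 s)" by (rule Cw_dominated[OF wv r2(3)[OF sl]])
      show "qint S r (?D s) x = ?D (r + s) x"
        using qint_diff[OF wv order_refl s1_pos B1(2,1) B2(2,1) r rl, of x] consistentD[OF r1(2) r s rs] consistentD[OF r2(2) r s rs] by simp
    qed
    let ?A = "C * (Nd * K1 + N2 * Kd)"
    \<comment> \<open>The constant c1 + c2 + ?A serves the identification only and does not reach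
      the final bounds.\<close>
    have eq: "?D t x = \<Lambda> t x" if t: "t \<in> {0<..1}" for t x
    proof (rule consistent_eqI[OF wv kap \<gamma>_pos consD L(1), where K="c1 + c2 + ?A"])
      fix t x assume t: "t \<in> {0<..(1::real)}" and x: "x \<in> off_hyp S"
      let ?e = "t powr (\<gamma> / ell S) * phi S x powr (-\<kappa>) / wfun u x"
      have "\<bar>?D t x - \<Lambda> t x\<bar> \<le> \<bar>Rec P1 f1 t x - P1 x (f1 x) t x\<bar> + \<bar>Rec P2 f2 t x - P2 x (f2 x) t x\<bar> + \<bar>\<Lambda> t x - (P1 x (f1 x) t x - P2 x (f2 x) t x)\<bar>" by linarith
      also have "\<dots> \<le> c1 * t powr (\<gamma> / ell S) * phi S x powr (-\<kappa>) / wfun u x + c2 * t powr (\<gamma> / ell S) * phi S x powr (-\<kappa>) / wfun u x + ?A * t powr (\<gamma> / ell S) * phi S x powr (-\<kappa>) / wfun u x"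
        by (intro add_mono c1(2) c2(2) L4 t x)
      also have "\<dots> = (c1 + c2 + ?A) * t powr (\<gamma> / ell S) * phi S x powr (-\<kappa>) / wfun u x"
        by (simp only: add_divide_distrib distrib_right)
      finally show "\<bar>?D t x - \<Lambda> t x\<bar> \<le> (c1 + c2 + ?A) * t powr (\<gamma> / ell S) * phi S x powr (-\<kappa>) / wfun u x" .
    qed (use t L r1(3) r2(3) in \<open>auto intro: Cw_diff[OF wv]\<close>)
    have "\<bar>(Rec P1 f1 t x - P1 x (f1 x) t x) - (Rec P2 f2 t x - P2 x (f2 x) t x)\<bar> \<le> ?A * t powr (\<gamma> / ell S) * phi S x powr (-\<kappa>) / wfun u x"
      if "t \<in> {0<..1}" "x \<in> off_hyp S" for t x
    proof -
      have "(Rec P1 f1 t x - P1 x (f1 x) t x) - (Rec P2 f2 t x - P2 x (f2 x) t x) = \<Lambda> t x - (P1 x (f1 x) t x - P2 x (f2 x) t x)"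
        unfolding eq[OF that(1), symmetric] by simp
      then show ?thesis using L4[OF that] by simp
    qed
    moreover have "\<bar>Rec P1 f1 t x - Rec P2 f2 t x\<bar> \<le> C * ((Nd * K1 + N2 * Kd) + (Nd * L1 + N2 * Ld)) * t powr (\<zeta> / ell S) / wfun u x"
      if "t \<in> {0<..1}" for t x
      using L6[OF that] eq[OF that] by simp
    ultimately show "(\<forall>t\<in>{0<..1}. \<forall>x\<in>off_hyp S. \<bar>(Rec P1 f1 t x - P1 x (f1 x) t x) - (Rec P2 f2 t x - P2 x (f2 x) t x)\<bar>
           \<le> C * (Nd * K1 + N2 * Kd) * t powr (\<gamma> / ell S) * phi S x powr (-\<kappa>) / wfun u x) \<and>
       (\<forall>t\<in>{0<..1}. \<forall>x. \<bar>Rec P1 f1 t x - Rec P2 f2 t x\<bar> \<le> C * ((Nd * K1 + N2 * Kd) + (Nd * L1 + N2 * Ld)) * t powr (\<zeta> / ell S) / wfun u x)"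
      by blast
  qed
qed

end

section \<open>Membership in the Besov space of the critical exponent\<close>

text \<open>The approximating constants may depend on e and on the point, which may lie outside A.
  For e = 1 / (n + 1) they form a Cauchy sequence at each point, and the limits define the
  extension.\<close>

lemma continuous_extension_from_dense:
  fixes U :: "'a::metric_space \<Rightarrow> real"
  assumes dense: "\<And>x e. 0 < e \<Longrightarrow> \<exists>y\<in>A. dist y x < e"
    and osc: "\<And>x e. 0 < e \<Longrightarrow> \<exists>c d. 0 < d \<and> (\<forall>y\<in>A. dist y x < d \<longrightarrow> \<bar>U y - c\<bar> \<le> e)"
  obtains V where "continuous_on UNIV V" "\<And>x. x \<in> A \<Longrightarrow> V x = U x"
proof -
  have "\<exists>l. \<forall>e>0. \<exists>d>0. \<forall>y\<in>A. dist y x < d \<longrightarrow> \<bar>U y - l\<bar> \<le> e" for x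
  proof -
    let ?e = "\<lambda>n. inverse (real (Suc n))"
    have "\<exists>c d. 0 < d \<and> (\<forall>y\<in>A. dist y x < d \<longrightarrow> \<bar>U y - c\<bar> \<le> ?e n)" for n by (rule osc) simp
    then obtain c d where d: "\<And>n. 0 < d n" and c: "\<And>n y. y \<in> A \<Longrightarrow> dist y x < d n \<Longrightarrow> \<bar>U y - c n\<bar> \<le> ?e n" by metis
    \<comment> \<open>Two constants at the same point are compared through a common nearby point of
      the dense set.\<close>
    have cc: "\<bar>c n - c m\<bar> \<le> ?e n + ?e m" for n m
    proof -
      obtain y where "y \<in> A" "dist y x < min (d n) (d m)" using dense[of "min (d n) (d m)" x] d by auto
      then show ?thesis using c[of y n] c[of y m] by auto
    qed
    have e0: "?e \<longlonglongrightarrow> 0" by (rule LIMSEQ_inverse_real_of_nat)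
    have "Cauchy c"
    proof (rule metric_CauchyI)
      fix e :: real assume "0 < e"
      then have "\<forall>\<^sub>F n in sequentially. ?e n < e / 2" by (intro order_tendstoD(2)[OF e0]) simp
      then obtain N where N: "\<And>n. N \<le> n \<Longrightarrow> ?e n < e / 2" by (auto simp: eventually_sequentially)
      have "\<bar>c m - c n\<bar> < e" if "N \<le> m" "N \<le> n" for m n using cc[of m n] N[OF that(1)] N[OF that(2)] by linarith
      then show "\<exists>M. \<forall>m\<ge>M. \<forall>n\<ge>M. dist (c m) (c n) < e" by (auto simp: dist_real_def)
    qed
    then obtain l where l: "c \<longlonglongrightarrow> l" by (auto simp: Cauchy_convergent_iff convergent_def)
    have cl: "\<bar>c n - l\<bar> \<le> ?e n" for n
    proof (rule LIMSEQ_le)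
      show "(\<lambda>m. \<bar>c n - c m\<bar>) \<longlonglongrightarrow> \<bar>c n - l\<bar>" by (intro tendsto_intros l)
      show "(\<lambda>m. ?e n + ?e m) \<longlonglongrightarrow> ?e n" using tendsto_add[OF tendsto_const[of "?e n"] e0] by simp
    qed (use cc in auto)
    have "\<exists>d>0. \<forall>y\<in>A. dist y x < d \<longrightarrow> \<bar>U y - l\<bar> \<le> e" if e: "0 < e" for e
    proof -
      have "\<forall>\<^sub>F n in sequentially. ?e n < e / 2" using e by (intro order_tendstoD(2)[OF e0]) simp
      then obtain n where n: "?e n < e / 2" by (auto simp: eventually_sequentially)
      have "\<bar>U y - l\<bar> \<le> e" if "y \<in> A" "dist y x < d n" for y using c[OF that] cl[of n] n by linarith
      then show ?thesis using d[of n] by blast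
    qed
    then show ?thesis by blast
  qed
  then obtain V where V: "\<And>x e. 0 < e \<Longrightarrow> \<exists>d>0. \<forall>y\<in>A. dist y x < d \<longrightarrow> \<bar>U y - V x\<bar> \<le> e" by metis
  show ?thesis
  proof
    show "V x = U x" if x: "x \<in> A" for x
    proof (rule ccontr)
      assume ne: "V x \<noteq> U x"
      then obtain d where "d > 0" "\<forall>y\<in>A. dist y x < d \<longrightarrow> \<bar>U y - V x\<bar> \<le> \<bar>U x - V x\<bar> / 2"
        using V[of "\<bar>U x - V x\<bar> / 2" x] by auto
      with x have "\<bar>U x - V x\<bar> \<le> \<bar>U x - V x\<bar> / 2" by auto
      with ne show False by auto
    qed
    show "continuous_on UNIV V"
      unfolding continuous_on_iff
    proof (intro ballI allI impI)
      fix x and e :: real assume e: "0 < e"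
      obtain d where d: "d > 0" "\<And>y. y \<in> A \<Longrightarrow> dist y x < d \<Longrightarrow> \<bar>U y - V x\<bar> \<le> e / 3" using V[of "e / 3" x] e by auto
      have "\<bar>V z - V x\<bar> < e" if z: "dist z x < d / 2" for z
      proof -
        obtain d' where d': "d' > 0" "\<And>y. y \<in> A \<Longrightarrow> dist y z < d' \<Longrightarrow> \<bar>U y - V z\<bar> \<le> e / 3" using V[of "e / 3" z] e by auto
        obtain y where y: "y \<in> A" "dist y z < min d' (d / 2)" using dense[of "min d' (d / 2)" z] d d' by auto
        have "dist y x < d" using y z dist_triangle[of y x z] by auto
        then have "\<bar>U y - V x\<bar> \<le> e / 3" "\<bar>U y - V z\<bar> \<le> e / 3" using d(2)[of y] d'(2)[of y] y by auto
        then show ?thesis using e by linarith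
      qed
      then show "\<exists>d>0. \<forall>x'\<in>UNIV. dist x' x < d \<longrightarrow> dist (V x') (V x) < e"
        using d by (intro exI[of _ "d / 2"]) (auto simp: dist_real_def)
    qed
  qed
qed

context gsemi
begin

section \<open>The semigroup as time tends to 0, and the Besov space of exponent 0\<close>

lemma norm_axis_real: "norm (axis k c :: real^'n) = \<bar>c\<bar>"
proof -
  have "axis k c = c *\<^sub>R (axis k 1 :: real^'n)" by (simp add: axis_def vec_eq_iff)
  then show ?thesis by simp
qed

lemma snorm_ge_norm:
  assumes "snorm S x \<le> 1"
  shows "norm x \<le> real CARD('n) * snorm S x"
proof -
  have "norm x \<le> (\<Sum>i\<in>UNIV. \<bar>x $ i\<bar>)" by (rule norm_le_l1_cart)
  also have "\<dots> \<le> (\<Sum>i\<in>(UNIV::'n set). snorm S x)"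
  proof (rule sum_mono)
    fix i
    have "\<bar>x $ i\<bar> \<le> snorm S x powr (scl S $ i)" by (rule component_le_snorm)
    also have "\<dots> \<le> snorm S x powr 1"
      using assms snorm_nonneg scl_ge1[of i] by (intro powr_mono') auto
    finally show "\<bar>x $ i\<bar> \<le> snorm S x" using snorm_nonneg[of x] by simp
  qed
  finally show ?thesis by simp
qed

lemma powr_at_right_0:
  fixes a :: real
  assumes "0 < a"
  shows "((\<lambda>t. t powr a) \<longlongrightarrow> 0) (at_right 0)"
proof -
  have "((\<lambda>s. s powr a) \<longlongrightarrow> 0 powr a) (at_right 0)"
    by (intro tendsto_powr') (use assms in \<open>auto simp: eventually_at_filter intro: tendsto_eq_intros\<close>)
  then show ?thesis by simp
qed

lemma eventually_at_right_01: "\<forall>\<^sub>F t in at_right 0. t \<in> {0<..(1::real)}"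
  unfolding eventually_at_right_field by (intro exI[of _ 1]) auto

text \<open>The kernel may change sign and its mass is 1 only in the limit, so g y is split off. The
  increment g z - g y is at most (e + M |y - z|) times \<open>wstar\<close>: near y by continuity,
  at scaled distance at least r by the weighted bound, with M = 2 B / (w(y) r). One moment of the
  kernel turns |y - z| into \<open>t powr (1 / ell S)\<close>.\<close>

lemma qint_tendsto:
  assumes u: "G_controlled S u" and g: "g \<in> Cw u"
  shows "((\<lambda>t. qint S t g y) \<longlongrightarrow> g y) (at_right 0)"
proof -
  obtain B where B: "0 \<le> B" "\<And>x. \<bar>g x\<bar> \<le> B / wfun u x" by (rule Cw_D[OF u g]) (rule that)
  have gc: "continuous_on UNIV g" by (rule Cw_continuous[OF g])
  have [measurable]: "g \<in> borel_measurable borel" by (rule Cw_measurable[OF g])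
  let ?h = "\<lambda>t z. \<bar>Qker S t y z\<bar> * (wstar u (y - z) * (1 + snormr S t (y - z)) ^ 1) * phi S z powr (-0)"
  obtain C where C: "0 < C"
    "\<And>t y. 0 < t \<Longrightarrow> t \<le> 1 \<Longrightarrow> integrable lborel (\<lambda>z. \<bar>Qker S t y z\<bar> * (wstar u (y - z) * (1 + snormr S t (y - z)) ^ 1) * phi S z powr (-0))"
    "\<And>t y. 0 < t \<Longrightarrow> t \<le> 1 \<Longrightarrow> (LINT z|lborel. \<bar>Qker S t y z\<bar> * (wstar u (y - z) * (1 + snormr S t (y - z)) ^ 1) * phi S z powr (-0)) \<le> C * pmax S t y powr (-0)"
    by (rule Q_weighted_integral[OF u order_refl s1_pos, of 1]) (rule that)
  have one: "((\<lambda>t. LINT z|lborel. Qker S t y z) \<longlongrightarrow> 1) (at_right 0)"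
    using semi by (simp add: G_semigroup_def)
  let ?d = "\<lambda>t. LINT z|lborel. Qker S t y z * (g z - g y)"
  have key: "\<exists>M\<ge>0. \<forall>t. 0 < t \<longrightarrow> t \<le> 1 \<longrightarrow> integrable lborel (\<lambda>z. Qker S t y z * (g z - g y)) \<and> \<bar>?d t\<bar> \<le> C * (e + M * t powr (1 / ell S))" if e: "0 < e" for e
  proof -
    have "\<exists>\<delta>>0. \<forall>z. dist z y < \<delta> \<longrightarrow> dist (g z) (g y) < e"
      using gc e unfolding continuous_on_iff by auto
    then obtain \<delta> where \<delta>: "0 < \<delta>" "\<And>z. dist z y < \<delta> \<Longrightarrow> \<bar>g z - g y\<bar> < e" by (auto simp: dist_real_def)
    define r where "r = min 1 (\<delta> / (2 * real CARD('n)))"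
    have cardp: "0 < real CARD('n)" by simp
    have r: "0 < r" "r \<le> 1" using \<delta> by (auto simp: r_def)
    have rc: "real CARD('n) * r < \<delta>"
    proof -
      have "r \<le> \<delta> / (2 * real CARD('n))" unfolding r_def by (rule min.cobounded2)
      then have "real CARD('n) * r \<le> real CARD('n) * (\<delta> / (2 * real CARD('n)))" by (intro mult_left_mono) auto
      also have "\<dots> = \<delta> / 2" using cardp by simp
      finally show ?thesis using \<delta> by linarith
    qed
    define M where "M = 2 * B / wfun u y / r"
    have M: "0 \<le> M" using B r wfun_pos[OF u, of y] by (simp add: M_def)
    have pt: "\<bar>g z - g y\<bar> \<le> (e + M * snorm S (y - z)) * wstar u (y - z)" for z
    proof -
      have W: "1 \<le> wstar u (y - z)" by (rule wstar_ge1[OF u])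
      show ?thesis
      proof (cases "snorm S (y - z) < r")
        case True
        then have "norm (y - z) \<le> real CARD('n) * snorm S (y - z)" using r by (intro snorm_ge_norm) auto
        also have "\<dots> \<le> real CARD('n) * r" using True by (intro mult_left_mono) auto
        finally have "dist z y < \<delta>" using rc by (simp add: dist_norm norm_minus_commute)
        then have "\<bar>g z - g y\<bar> \<le> e * 1" using \<delta>(2)[of z] by simp
        also have "\<dots> \<le> (e + M * snorm S (y - z)) * wstar u (y - z)"
          using e M W snorm_nonneg[of "y - z"] by (intro mult_mono) auto
        finally show ?thesis .
      next
        case False
        have "\<bar>g z - g y\<bar> \<le> B * (1 / wfun u z) + B * (1 / wfun u y)" using B(2)[of z] B(2)[of y] by simp
        also have "\<dots> \<le> B * (wstar u (y - z) / wfun u y) + B * (wstar u (y - z) / wfun u y)"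
          using B W wfun_pos[OF u, of y] by (intro add_mono mult_left_mono inverse_wfun_le[OF u] divide_right_mono) auto
        also have "\<dots> = M * r * wstar u (y - z)" using r by (simp add: M_def)
        also have "\<dots> \<le> (e + M * snorm S (y - z)) * wstar u (y - z)"
          using e M W False by (intro mult_right_mono add_increasing mult_left_mono) auto
        finally show ?thesis .
      qed
    qed
    have "integrable lborel (\<lambda>z. Qker S t y z * (g z - g y)) \<and> \<bar>?d t\<bar> \<le> C * (e + M * t powr (1 / ell S))" if t: "0 < t" "t \<le> 1" for t
    proof -
      note [measurable] = Q_measurable2[OF t(1)]
      let ?c = "e + M * t powr (1 / ell S)"
      have le: "AE z in lborel. \<bar>Qker S t y z * (g z - g y)\<bar> \<le> ?c * ?h t z"
        using AE_off_hyp
      proof eventually_elim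
        case (elim z)
        have W: "1 \<le> wstar u (y - z)" by (rule wstar_ge1[OF u])
        have sn: "snorm S (y - z) = t powr (1 / ell S) * snormr S t (y - z)" using t by (simp add: snormr_def)
        have "e + M * snorm S (y - z) \<le> ?c * (1 + snormr S t (y - z))"
          unfolding sn using e M snormr_nonneg[of t "y - z"] by (simp add: algebra_simps)
        then have "(e + M * snorm S (y - z)) * wstar u (y - z) \<le> ?c * (1 + snormr S t (y - z)) * wstar u (y - z)"
          using W by (intro mult_right_mono) auto
        with pt[of z] have "\<bar>g z - g y\<bar> \<le> ?c * (1 + snormr S t (y - z)) * wstar u (y - z)" by linarith
        then have "\<bar>Qker S t y z\<bar> * \<bar>g z - g y\<bar> \<le> \<bar>Qker S t y z\<bar> * (?c * (1 + snormr S t (y - z)) * wstar u (y - z))"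
          by (rule mult_left_mono) simp
        then show ?case using phi_pos[OF elim] by (simp add: abs_mult mult_ac)
      qed
      have hi: "integrable lborel (\<lambda>z. ?c * ?h t z)" by (intro integrable_mult_right C(2) t)
      have int: "integrable lborel (\<lambda>z. Qker S t y z * (g z - g y))"
        by (rule Bochner_Integration.integrable_bound[OF hi])
          (measurable, use le in eventually_elim, unfold real_norm_def, rule order_trans[OF _ abs_ge_self])
      have "\<bar>?d t\<bar> \<le> (LINT z|lborel. \<bar>Qker S t y z * (g z - g y)\<bar>)" by (rule integral_abs_bound)
      also have "\<dots> \<le> (LINT z|lborel. ?c * ?h t z)" using int hi le by (intro integral_mono_AE integrable_abs)
      also have "\<dots> = ?c * (LINT z|lborel. ?h t z)" by (rule integral_mult_right_zero)
      also have "\<dots> \<le> ?c * C" using C(3)[OF t, of y] pmax_pos[OF t(1), of y] e M by (intro mult_left_mono) auto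
      finally show ?thesis using int by (simp add: mult.commute)
    qed
    then show ?thesis using M by blast
  qed
  have "(?d \<longlongrightarrow> 0) (at_right 0)"
    unfolding tendsto_iff
  proof (intro allI impI)
    fix e :: real assume e: "0 < e"
    define e' where "e' = e / (2 * C)"
    have e': "0 < e'" using e C by (simp add: e'_def)
    obtain M where M: "0 \<le> M" "\<And>t. 0 < t \<Longrightarrow> t \<le> 1 \<Longrightarrow> \<bar>?d t\<bar> \<le> C * (e' + M * t powr (1 / ell S))" using key[OF e'] by blast
    have "((\<lambda>t. C * (e' + M * t powr (1 / ell S))) \<longlongrightarrow> C * (e' + M * 0)) (at_right 0)"
      using ell_pos by (intro tendsto_intros powr_at_right_0) auto
    moreover have "C * (e' + M * 0) < e" using e C by (simp add: e'_def)
    ultimately have "\<forall>\<^sub>F t in at_right 0. C * (e' + M * t powr (1 / ell S)) < e" by (rule order_tendstoD)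
    then show "\<forall>\<^sub>F t in at_right 0. dist (?d t) 0 < e"
      using eventually_at_right_01
    proof eventually_elim
      case (elim t)
      then show ?case using M(2)[of t] by auto
    qed
  qed
  from tendsto_add[OF this tendsto_mult[OF tendsto_const[of "g y"] one]]
  have lim: "((\<lambda>t. ?d t + g y * (LINT z|lborel. Qker S t y z)) \<longlongrightarrow> g y) (at_right 0)" by simp
  have "\<forall>\<^sub>F t in at_right 0. ?d t + g y * (LINT z|lborel. Qker S t y z) = qint S t g y"
    using eventually_at_right_01
  proof eventually_elim
    case (elim t)
    then have t: "0 < t" "t \<le> 1" by auto
    obtain B' where B': "0 \<le> B'" "dominated S u 0 B' g" by (rule Cw_dominated[OF u g])
    have i1: "integrable lborel (\<lambda>z. Qker S t y z * g z)" by (rule qint_integrable[OF u order_refl s1_pos B'(2,1) t])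
    have i2: "integrable lborel (\<lambda>z. Qker S t y z * (g z - g y))" using key[of 1] t by auto
    have "integrable lborel (\<lambda>z. Qker S t y z * g z - Qker S t y z * (g z - g y))" using i1 i2 by (rule Bochner_Integration.integrable_diff)
    then have i3: "integrable lborel (\<lambda>z. g y * Qker S t y z)" by (simp add: algebra_simps)
    have "qint S t g y = (LINT z|lborel. Qker S t y z * (g z - g y) + g y * Qker S t y z)"
      unfolding qint_def by (simp add: algebra_simps)
    also have "\<dots> = ?d t + (LINT z|lborel. g y * Qker S t y z)" using i2 i3 by (rule Bochner_Integration.integral_add)
    finally show ?case by simp
  qed
  from Lim_transform_eventually[OF lim this] show ?thesis .
qed

lemma tendsto_le_abs:
  fixes f :: "real \<Rightarrow> real"
  assumes "(f \<longlongrightarrow> l) (at_right 0)" "\<And>t. t \<in> {0<..1} \<Longrightarrow> \<bar>f t\<bar> \<le> b"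
  shows "\<bar>l\<bar> \<le> b"
proof (rule tendsto_upperbound[OF tendsto_rabs[OF assms(1)]])
  show "\<forall>\<^sub>F t in at_right 0. \<bar>f t\<bar> \<le> b" using eventually_at_right_01 by eventually_elim (rule assms(2))
qed simp

text \<open>At exponent 0 the rate is constant, so the approximating functions are Cauchy in the
  weighted sup norm: letting t tend to 0 recovers their differences from those of the smoothed
  functions. Their limit represents the family.\<close>

lemma besov_0_function:
  assumes u: "G_controlled S u" and L: "\<Lambda> \<in> besov S 0 u"
  obtains g where "g \<in> Cw u" "\<And>t. t \<in> {0<..1} \<Longrightarrow> \<Lambda> t = qint S t g"
proof -
  let ?e = "\<lambda>n. inverse (real (Suc n))"
  have "\<exists>h\<in>Cw u. \<forall>t\<in>{0<..1}. \<forall>x. \<bar>\<Lambda> t x - qint S t h x\<bar> \<le> ?e n / wfun u x" for n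
  proof -
    have "\<exists>h\<in>Cw u. \<forall>t\<in>{0<..1}. \<forall>x. \<bar>\<Lambda> t x - qint S t h x\<bar> \<le> ?e n * t powr (0 / ell S) / wfun u x"
      using L unfolding besov_iff[OF u] by (meson inverse_positive_iff_positive of_nat_0_less_iff zero_less_Suc)
    then show ?thesis by auto
  qed
  then obtain h where h: "\<And>n. h n \<in> Cw u"
    and hb: "\<And>n t x. t \<in> {0<..1} \<Longrightarrow> \<bar>\<Lambda> t x - qint S t (h n) x\<bar> \<le> ?e n / wfun u x" by metis
  have e0: "?e \<longlonglongrightarrow> 0" by (rule LIMSEQ_inverse_real_of_nat)
  have hh: "\<bar>h n x - h m x\<bar> \<le> (?e n + ?e m) / wfun u x" for n m x
  proof (rule tendsto_le_abs[OF tendsto_diff[OF qint_tendsto[OF u h] qint_tendsto[OF u h]]])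
    fix t assume "t \<in> {0<..(1::real)}"
    then show "\<bar>qint S t (h n) x - qint S t (h m) x\<bar> \<le> (?e n + ?e m) / wfun u x"
      using hb[of t x n] hb[of t x m] by (simp add: add_divide_distrib abs_le_iff del: of_nat_Suc)
  qed
  have conv: "convergent (\<lambda>n. h n x)" for x
  proof (rule Cauchy_convergent, rule metric_CauchyI)
    fix e :: real assume e: "0 < e"
    have "\<forall>\<^sub>F n in sequentially. ?e n < e / 2 * wfun u x" using e wfun_pos[OF u, of x] by (intro order_tendstoD(2)[OF e0]) simp
    then obtain N where N: "\<And>n. N \<le> n \<Longrightarrow> ?e n < e / 2 * wfun u x" by (auto simp: eventually_sequentially)
    have "\<bar>h m x - h n x\<bar> < e" if "N \<le> m" "N \<le> n" for m n
    proof -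
      have "(?e m + ?e n) / wfun u x < (e / 2 * wfun u x + e / 2 * wfun u x) / wfun u x"
        using N[OF that(1)] N[OF that(2)] wfun_pos[OF u, of x] by (intro divide_strict_right_mono add_strict_mono) auto
      then show ?thesis using hh[of m x n] wfun_pos[OF u, of x] by simp
    qed
    then show "\<exists>M. \<forall>m\<ge>M. \<forall>n\<ge>M. dist (h m x) (h n x) < e" by (auto simp: dist_real_def)
  qed
  define g where "g = (\<lambda>x. lim (\<lambda>n. h n x))"
  have g: "(\<lambda>n. h n x) \<longlonglongrightarrow> g x" for x using conv[of x] by (simp add: g_def convergent_LIMSEQ_iff)
  have hg: "\<bar>h n x - g x\<bar> \<le> ?e n / wfun u x" for n x
  proof (rule LIMSEQ_le)
    show "(\<lambda>m. \<bar>h n x - h m x\<bar>) \<longlonglongrightarrow> \<bar>h n x - g x\<bar>" by (intro tendsto_intros g)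
    have "(\<lambda>m. (?e n + ?e m) / wfun u x) \<longlonglongrightarrow> (?e n + 0) / wfun u x"
      using wfun_pos[OF u, of x] by (intro tendsto_divide tendsto_add tendsto_const e0) auto
    then show "(\<lambda>m. (?e n + ?e m) / wfun u x) \<longlonglongrightarrow> ?e n / wfun u x" by simp
  qed (use hh in auto)
  have gcont: "continuous_on UNIV g"
  proof -
    \<comment> \<open>After multiplication by the weight the convergence is uniform; dividing by the
      weight afterwards returns the continuity of g.\<close>
    have "uniform_limit UNIV (\<lambda>n x. h n x * wfun u x) (\<lambda>x. g x * wfun u x) sequentially"
    proof (rule uniform_limitI)
      fix e :: real assume "0 < e"
      then have "\<forall>\<^sub>F n in sequentially. ?e n < e" by (intro order_tendstoD(2)[OF e0])
      then show "\<forall>\<^sub>F n in sequentially. \<forall>x\<in>UNIV. dist (h n x * wfun u x) (g x * wfun u x) < e"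
      proof eventually_elim
        case (elim n)
        have "\<bar>h n x - g x\<bar> * wfun u x \<le> ?e n" for x
          using hg[of n x] wfun_pos[OF u, of x] by (simp add: field_simps del: of_nat_Suc)
        moreover have "dist (h n x * wfun u x) (g x * wfun u x) = \<bar>h n x - g x\<bar> * wfun u x" for x
          using wfun_pos[OF u, of x] by (simp add: dist_real_def left_diff_distrib[symmetric] abs_mult)
        ultimately show ?case using elim by (auto intro: le_less_trans)
      qed
    qed
    then have "continuous_on UNIV (\<lambda>x. g x * wfun u x)"
      by (rule uniform_limit_theorem[rotated])
        (auto intro!: always_eventually continuous_on_mult Cw_continuous[OF h] continuous_wfun[OF u])
    then have "continuous_on UNIV (\<lambda>x. g x * wfun u x / wfun u x)"
      using wfun_pos[OF u] by (intro continuous_on_divide continuous_wfun[OF u]) (auto simp: less_imp_neq[symmetric])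
    moreover have "g x * wfun u x / wfun u x = g x" for x using wfun_pos[OF u, of x] by simp
    ultimately show ?thesis by simp
  qed
  have gC: "g \<in> Cw u"
  proof -
    obtain B where B: "0 \<le> B" "\<And>x. \<bar>h 0 x\<bar> \<le> B / wfun u x" by (rule Cw_D[OF u h[of 0]]) (rule that)
    have "\<bar>g x\<bar> \<le> (B + 1) / wfun u x" for x using B(2)[of x] hg[of 0 x] by (simp add: add_divide_distrib)
    then show ?thesis unfolding Cw_iff[OF u] using gcont B by (intro conjI exI[of _ "B + 1"]) auto
  qed
  obtain C where C: "0 < C"
    "\<And>g B r x. dominated S u 0 B g \<Longrightarrow> 0 \<le> B \<Longrightarrow> 0 < r \<Longrightarrow> r \<le> 1 \<Longrightarrow> \<bar>qint S r g x\<bar> \<le> C * B / wfun u x"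
    by (rule qint_bound_0[OF u]) (rule that)
  obtain Bg where Bg: "0 \<le> Bg" "dominated S u 0 Bg g" by (rule Cw_dominated[OF u gC])
  show ?thesis
  proof (rule that[OF gC], rule ext)
    fix t x assume t: "t \<in> {0<..(1::real)}"
    have le: "\<bar>\<Lambda> t x - qint S t g x\<bar> \<le> (1 + C) / wfun u x * ?e n" for n
    proof -
      obtain Bh where Bh: "0 \<le> Bh" "dominated S u 0 Bh (h n)" by (rule Cw_dominated[OF u h])
      have D: "dominated S u 0 (?e n) (\<lambda>z. h n z - g z)"
        using Bh Bg hg by (intro dominated_0I[OF u]) (auto simp: dominated_def)
      have "\<bar>qint S t (h n) x - qint S t g x\<bar> \<le> C * ?e n / wfun u x"
        using C(2)[OF D, of t x] qint_diff[OF u order_refl s1_pos Bh(2,1) Bg(2,1), of t x] t by simp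
      with hb[OF t, of x n] have "\<bar>\<Lambda> t x - qint S t g x\<bar> \<le> ?e n / wfun u x + C * ?e n / wfun u x" by linarith
      also have "\<dots> = (1 + C) / wfun u x * ?e n" by (simp only: add_divide_distrib distrib_right times_divide_eq_left mult_1)
      finally show ?thesis .
    qed
    have "(\<lambda>n. (1 + C) / wfun u x * ?e n) \<longlonglongrightarrow> (1 + C) / wfun u x * 0" by (intro tendsto_mult tendsto_const e0)
    from LIMSEQ_le_const[OF this, of "\<bar>\<Lambda> t x - qint S t g x\<bar>"] le have "\<bar>\<Lambda> t x - qint S t g x\<bar> \<le> (1 + C) / wfun u x * 0" by blast
    then show "\<Lambda> t x = qint S t g x" by simp
  qed
qed

lemma off_hyp_dense:
  assumes "0 < e"
  shows "\<exists>y\<in>off_hyp S. dist y x < e"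
proof (cases "x \<in> off_hyp S")
  case True
  then show ?thesis using assms by (intro bexI[of _ x]) auto
next
  case False
  let ?y = "x + axis (axis1 S) (e / 2)"
  have "?y \<in> off_hyp S" using False assms by (simp add: off_hyp_def)
  moreover have "dist ?y x < e" using assms by (simp add: dist_norm norm_axis_real)
  ultimately show ?thesis by blast
qed

end

context rec_setting
begin

section \<open>Critical exponent for negative regularity\<close>

lemma below_\<alpha>0: "\<tau> \<in> below \<T> \<alpha>0 \<Longrightarrow> \<tau> = 0"
  proof -
  assume "\<tau> \<in> below \<T> \<alpha>0"
  then have "\<tau> = (\<Sum>\<alpha>\<in>{\<alpha> \<in> idx \<T>. \<alpha> < \<alpha>0}. proj \<T> \<alpha> \<tau>)" by (rule below_sum[OF reg])
  also have "\<dots> = 0" using idx_ge[OF reg] by (intro sum.neutral) (auto simp: not_less[symmetric])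
  finally show "\<tau> = 0" .
qed

text \<open>There is no degree below the lowest one, so triangularity leaves no correction.\<close>

lemma lowest_sector_fixed: "lower_triangular \<T> L \<Longrightarrow> \<tau> \<in> sector \<T> \<alpha>0 \<Longrightarrow> L \<tau> = \<tau>"
  using below_\<alpha>0[of "L \<tau> - \<tau>"] \<alpha>0_idx[OF reg] by (auto simp: lower_triangular_def)

text \<open>
  On the lowest sector a smooth model is translation invariant, so that there its functions are
  bounded uniformly in the base point and hence vanish relative to the rate $t^{\alpha_0/\ell}$.
\<close>

lemma rec_besov_negative:
  assumes M: "(P, \<Gamma>) \<in> mods" and f: "f \<in> mdists \<Gamma>" and a0: "\<alpha>0 < 0" "\<alpha>0 < \<eta>"
  shows "Rec P f \<in> besov S \<zeta> u"
proof -
  have zeta: "\<zeta> = \<alpha>0" using \<zeta> a0 by auto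
  have a0I: "\<alpha>0 \<in> I" using \<alpha>0_idx[OF reg] a0 \<gamma>_pos by auto
  obtain K L where L: "sing_norm S \<T> \<gamma> \<eta> v f = ennreal L" "0 \<le> L" by (rule modelled_norms[OF f])
  obtain N where N: "pi_norm S \<T> \<gamma> w P = ennreal N" "0 \<le> N" using finite_ennreal[OF pi_norm_finite[OF M]] by blast
  have sl: "sing_le L f" using L by (intro sing_leI) auto
  note r = rec_facts[OF M f]
  obtain c where c: "0 \<le> c" "\<And>t. t \<in> {0<..1} \<Longrightarrow> \<exists>s. 0 < s \<and> s \<le> t / 2 \<and> t \<le> 4 * s \<and>
           (\<forall>x. \<bar>Rec P f t x - qint S (t - s) (Fgerm P f s) x\<bar> \<le> c * t powr (\<eta> / ell S) / wfun u x)"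
    using r(7) by blast
  obtain C2 where C2: "0 < C2"
    "\<And>b g x s t. g \<in> borel_measurable borel \<Longrightarrow> \<forall>\<alpha>\<in>I. 0 \<le> b \<alpha> \<Longrightarrow> 0 < s \<Longrightarrow> s \<le> t / 2 \<Longrightarrow> t \<le> 4 * s \<Longrightarrow> t \<le> 1 \<Longrightarrow>
       \<forall>y\<in>off_hyp S. \<bar>g y\<bar> \<le> 1 / wfun u y * (\<Sum>\<alpha>\<in>I. b \<alpha> * s powr (\<alpha> / ell S) * phi S y powr (min (\<eta> - \<alpha>) 0)) \<Longrightarrow>
       \<bar>qint S (t - s) g x\<bar> \<le> C2 / wfun u x * (\<Sum>\<alpha>\<in>I. b \<alpha> * t powr (min \<alpha> \<eta> / ell S))"
    by (rule main_term_bound) (rule that)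
  obtain C3 where C3: "0 < C3"
    "\<And>g B r x. dominated S w 0 B g \<Longrightarrow> 0 \<le> B \<Longrightarrow> 0 < r \<Longrightarrow> r \<le> 1 \<Longrightarrow> \<bar>qint S r g x\<bar> \<le> C3 * B / wfun w x"
    by (rule qint_bound_0[OF w]) (rule that)
  \<comment> \<open>Gaps between the critical rate \<alpha>0 and the better ones: \<eta> for the
    remainder, 0 for a bounded function, and the other degrees. The minimum \<epsilon> is a gain
    available to all these terms at once.\<close>
  define X where "X = insert (\<eta> - \<alpha>0) (insert (- \<alpha>0) ((\<lambda>\<alpha>. \<alpha> - \<alpha>0) ` (I - {\<alpha>0})))"
  have X: "finite X" "X \<noteq> {}" using finI by (auto simp: X_def)
  define \<epsilon> where "\<epsilon> = Min X"
  have Xpos: "0 < x" if "x \<in> X" for x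
    using that a0 idx_ge[OF reg] by (auto simp: X_def less_le)
  have eps: "0 < \<epsilon>" unfolding \<epsilon>_def using X Xpos by (subst Min_gr_iff) auto
  have epsle: "\<epsilon> \<le> x" if "x \<in> X" for x unfolding \<epsilon>_def using X that by (rule_tac Min_le) auto
  show ?thesis
  proof (rule besovI_vanishing[OF wv r(2,3,4) \<zeta>_facts(1)])
    fix e :: real assume e: "0 < e"
    \<comment> \<open>Chosen so that the contribution C2 * L * e1 of the approximation error in the
      lowest sector is at most e / 2; the summand 1 covers L = 0.\<close>
    define e1 where "e1 = e / (2 * (C2 * L + 1))"
    have CL: "0 < C2 * L + 1" using C2 L by (intro add_nonneg_pos) auto
    have e1: "0 < e1" "C2 * L * e1 \<le> e / 2"
    proof -
      show "0 < e1" using e CL by (simp add: e1_def)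
      then have "C2 * L * e1 \<le> (C2 * L + 1) * e1" by (intro mult_right_mono) auto
      also have "\<dots> = e / 2"
      proof -
        have "a * (e / (2 * a)) = e / 2" if "0 < a" for a :: real using that by simp
        from this[OF CL] show ?thesis by (simp only: e1_def)
      qed
      finally show "C2 * L * e1 \<le> e / 2" .
    qed
    obtain Pf \<Gamma>' where sm: "smooth_model S \<T> w Pf \<Gamma>'"
      and ap: "pi_norm S \<T> \<gamma> w (pi_diff (\<lambda>x \<tau>. qfam S (Pf x \<tau>)) P) \<le> ennreal e1"
      by (rule smooth_approx[OF M e1(1)])
    have sm1: "\<And>x y. linear (\<lambda>\<tau>. Pf x \<tau> y)" "\<And>x \<tau>. Pf x \<tau> \<in> Cw w" "\<And>x y. \<Gamma>' x y \<in> sgroup \<T>"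
      "\<And>x y \<tau>. Pf x (\<Gamma>' x y \<tau>) = Pf y \<tau>"
      "\<And>x \<alpha>. \<alpha> \<in> idx \<T> \<Longrightarrow> \<exists>C. \<forall>\<tau>\<in>sector \<T> \<alpha>. Linf w (Pf x \<tau>) \<le> ennreal (C * secnorm \<T> \<alpha> \<tau>)"
      using sm unfolding smooth_model_def by blast+
    obtain C0 where C0: "\<And>\<tau>. \<tau> \<in> sector \<T> \<alpha>0 \<Longrightarrow> Linf w (Pf 0 \<tau>) \<le> ennreal (C0 * secnorm \<T> \<alpha>0 \<tau>)"
      using sm1(5)[OF \<alpha>0_idx[OF reg], of 0] by blast
    have inv: "Pf y \<tau> = Pf 0 \<tau>" if "\<tau> \<in> sector \<T> \<alpha>0" for y \<tau>
    proof -
      have "lower_triangular \<T> (\<Gamma>' 0 y)" using reg sm1(3)[of 0 y] by (auto simp: regularity_structure_def)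
      from lowest_sector_fixed[OF this that] sm1(4)[of 0 y \<tau>] show ?thesis by simp
    qed
    have low: "\<bar>P y \<tau> s y\<bar> \<le> (C3 * \<bar>C0\<bar> + e1 * s powr (\<alpha>0 / ell S)) / wfun w y * secnorm \<T> \<alpha>0 \<tau>"
      if \<tau>: "\<tau> \<in> sector \<T> \<alpha>0" and s: "s \<in> {0<..1}" for y \<tau> s
    proof -
      have sn: "0 \<le> secnorm \<T> \<alpha>0 \<tau>" using secnorm_nonneg[OF reg \<alpha>0_idx[OF reg] \<tau>] .
      have "Linf w (Pf 0 \<tau>) \<le> ennreal (\<bar>C0\<bar> * secnorm \<T> \<alpha>0 \<tau>)"
        using C0[OF \<tau>] sn by (rule_tac order_trans) (auto intro!: ennreal_leI mult_right_mono)
      then have "\<bar>Pf 0 \<tau> x\<bar> \<le> \<bar>C0\<bar> * secnorm \<T> \<alpha>0 \<tau> / wfun w x" for x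
        using Linf_le_iff[OF w Cw_continuous[OF sm1(2)], of "\<bar>C0\<bar> * secnorm \<T> \<alpha>0 \<tau>"] sn by simp
      then have "dominated S w 0 (\<bar>C0\<bar> * secnorm \<T> \<alpha>0 \<tau>) (Pf 0 \<tau>)"
        by (intro dominated_0I[OF w] Cw_measurable[OF sm1(2)])
      from C3(2)[OF this, of s y] have 1: "\<bar>qfam S (Pf y \<tau>) s y\<bar> \<le> C3 * (\<bar>C0\<bar> * secnorm \<T> \<alpha>0 \<tau>) / wfun w y"
        using s sn inv[OF \<tau>, of y] by (simp add: qfam_def qint_def)
      have z: "pi_diff (\<lambda>x \<tau>. qfam S (Pf x \<tau>)) P y 0 s y = 0"
        using s linear_0[OF sm1(1)] linear_0[OF model_facts(2)[OF M]] by (simp add: pi_diff_def qdiff_def qfam_def)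
      have "\<bar>pi_diff (\<lambda>x \<tau>. qfam S (Pf x \<tau>)) P y \<tau> s y\<bar> \<le> e1 / wfun w y * (s powr (\<alpha>0 / ell S) * secnorm \<T> \<alpha>0 \<tau>)"
        using a0I \<tau> s e1 by (intro pi_norm_sector[OF ap _ z]) auto
      with 1 have "\<bar>P y \<tau> s y\<bar> \<le> C3 * (\<bar>C0\<bar> * secnorm \<T> \<alpha>0 \<tau>) / wfun w y + e1 / wfun w y * (s powr (\<alpha>0 / ell S) * secnorm \<T> \<alpha>0 \<tau>)"
        by (simp add: pi_diff_def qdiff_def)
      also have "\<dots> = (C3 * \<bar>C0\<bar> + e1 * s powr (\<alpha>0 / ell S)) / wfun w y * secnorm \<T> \<alpha>0 \<tau>"
        by (simp add: add_divide_distrib algebra_simps)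
      finally show ?thesis .
    qed
    \<comment> \<open>Collects the coefficients of all terms that gain
      \<open>t powr (\<epsilon> / ell S)\<close>: the remainder, the smooth part of the lowest
      sector and the other degrees.\<close>
    define M1 where "M1 = c + C2 * (C3 * \<bar>C0\<bar> * L) + C2 * (card I * (N * L))"
    have M1: "0 \<le> M1" unfolding M1_def using c C2 C3 N L by (intro add_nonneg_nonneg mult_nonneg_nonneg) auto
    obtain \<delta> where \<delta>: "0 < \<delta>" "\<And>t. 0 < t \<Longrightarrow> t \<le> \<delta> \<Longrightarrow> M1 * t powr (\<epsilon> / ell S) \<le> e / 2"
      using vanishing_powr[OF M1, of "\<epsilon> / ell S" "e / 2"] eps ell_pos e by auto
    have "\<bar>Rec P f t x\<bar> \<le> e * t powr (\<zeta> / ell S) / wfun u x" if t: "0 < t" "t \<le> \<delta>" "t \<le> 1" for t x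
    proof -
      obtain s where s: "0 < s" "s \<le> t / 2" "t \<le> 4 * s"
        and rs: "\<bar>Rec P f t x - qint S (t - s) (Fgerm P f s) x\<bar> \<le> c * t powr (\<eta> / ell S) / wfun u x"
        using c(2)[of t] t by auto
      have sl01: "s \<in> {0<..1}" using s t by auto
      \<comment> \<open>Coefficients relative to \<open>s powr (\<alpha> / ell S)\<close>. In the
        lowest degree the smooth part is bounded, hence of relative size
        \<open>s powr (- \<alpha>0 / ell S)\<close>, which is small because \<alpha>0 < 0; the
        approximation error adds e1. The other degrees keep the full bound N * L.\<close>
      define b where "b = (\<lambda>\<alpha>. if \<alpha> = \<alpha>0 then (C3 * \<bar>C0\<bar> * s powr (- \<alpha>0 / ell S) + e1) * L else N * L)"
      have b: "\<forall>\<alpha>\<in>I. 0 \<le> b \<alpha>" using C3 e1 L N by (auto simp: b_def)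
      have wp: "0 < wfun u x" by (rule wfun_pos[OF wv])
      have F: "\<bar>Fgerm P f s y\<bar> \<le> 1 / wfun u y * (\<Sum>\<alpha>\<in>I. b \<alpha> * s powr (\<alpha> / ell S) * phi S y powr (min (\<eta> - \<alpha>) 0))" if y: "y \<in> off_hyp S" for y
      proof -
        have fb: "f y \<in> below \<T> \<gamma>" using f y by (simp add: modelled_def)
        have "Fgerm P f s y = (\<Sum>\<alpha>\<in>I. P y (proj \<T> \<alpha> (f y)) s y)"
          using y by (simp add: Fgerm_def linear_sum[OF model_facts(2)[OF M], symmetric] below_sum[OF reg fb, symmetric])
        also have "\<bar>\<dots>\<bar> \<le> (\<Sum>\<alpha>\<in>I. 1 / wfun u y * (b \<alpha> * s powr (\<alpha> / ell S) * phi S y powr (min (\<eta> - \<alpha>) 0)))"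
        proof (intro order_trans[OF sum_abs] sum_mono)
          fix \<alpha> assume al: "\<alpha> \<in> I"
          then have ps: "proj \<T> \<alpha> (f y) \<in> sector \<T> \<alpha>" using proj_in_sector[OF reg] by auto
          have hn: "secnorm \<T> \<alpha> (proj \<T> \<alpha> (f y)) \<le> L / wfun v y * phi S y powr (min (\<eta> - \<alpha>) 0)"
            using sl y al unfolding sing_le_def hnorm_def by blast
          show "\<bar>P y (proj \<T> \<alpha> (f y)) s y\<bar> \<le> 1 / wfun u y * (b \<alpha> * s powr (\<alpha> / ell S) * phi S y powr (min (\<eta> - \<alpha>) 0))"
          proof (cases "\<alpha> = \<alpha>0")
            case True
            let ?k = "C3 * \<bar>C0\<bar> + e1 * s powr (\<alpha>0 / ell S)"
            have kk: "?k = (C3 * \<bar>C0\<bar> * s powr (- \<alpha>0 / ell S) + e1) * s powr (\<alpha>0 / ell S)"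
              using s by (simp add: distrib_right mult.assoc powr_add[symmetric])
            have "\<bar>P y (proj \<T> \<alpha> (f y)) s y\<bar> \<le> ?k / wfun w y * secnorm \<T> \<alpha>0 (proj \<T> \<alpha> (f y))"
              using ps True sl01 by (intro low) auto
            also have "\<dots> \<le> ?k / wfun w y * (L / wfun v y * phi S y powr (min (\<eta> - \<alpha>) 0))"
              using hn True C3 e1 wfun_pos[OF w, of y] by (intro mult_left_mono) auto
            finally show ?thesis unfolding kk using True by (simp add: b_def mult_ac)
          next
            case False
            have "\<bar>P y (proj \<T> \<alpha> (f y)) s y\<bar> \<le> N / wfun w y * (s powr (\<alpha> / ell S) * secnorm \<T> \<alpha> (proj \<T> \<alpha> (f y)))"
              using N al ps sl01 by (intro pi_norm_sector linear_0[OF model_facts(2)[OF M]]) auto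
            also have "\<dots> \<le> N / wfun w y * (s powr (\<alpha> / ell S) * (L / wfun v y * phi S y powr (min (\<eta> - \<alpha>) 0)))"
              using hn N wfun_pos[OF w, of y] by (intro mult_left_mono) auto
            finally show ?thesis using False by (simp add: b_def mult_ac)
          qed
        qed
        finally show ?thesis by (simp add: sum_distrib_left)
      qed
      have meas: "Fgerm P f s \<in> borel_measurable borel"
      proof -
        obtain K' where "sharp_norm S \<T> \<gamma> \<eta> v (delta \<Gamma> f) = ennreal K'" "0 \<le> K'" by (rule modelled_norms[OF f])
        then show ?thesis
          using N model_facts(2)[OF M] delta_refl[OF M] sl01
          by (intro Fgerm_measurable[OF M f pi_leI[of P N] _ sharp_leI]) auto
      qed
      have q: "\<bar>qint S (t - s) (Fgerm P f s) x\<bar> \<le> C2 / wfun u x * (\<Sum>\<alpha>\<in>I. b \<alpha> * t powr (min \<alpha> \<eta> / ell S))"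
        using F by (intro C2(2)[OF meas b s] t(3)) auto
      let ?A = "t powr (\<alpha>0 / ell S)" and ?E = "t powr (\<epsilon> / ell S)"
      have AE: "t powr (a / ell S) \<le> ?A * ?E" if "\<alpha>0 + \<epsilon> \<le> a" for a
      proof -
        have "t powr (a / ell S) \<le> t powr ((\<alpha>0 + \<epsilon>) / ell S)"
          using that t ell_pos by (intro powr_mono') (auto simp: divide_right_mono)
        then show ?thesis using t by (simp add: add_divide_distrib powr_add)
      qed
      have "(\<Sum>\<alpha>\<in>I. b \<alpha> * t powr (min \<alpha> \<eta> / ell S)) \<le> (C3 * \<bar>C0\<bar> * ?E + e1) * L * ?A + (\<Sum>\<alpha>\<in>I - {\<alpha>0}. N * L * (?A * ?E))"
        unfolding sum.remove[OF finI a0I]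
      proof (intro add_mono sum_mono)
        have "s powr (- \<alpha>0 / ell S) \<le> t powr (- \<alpha>0 / ell S)"
          using s t a0 ell_pos by (intro powr_mono2) (auto simp: divide_le_0_iff)
        also have "\<dots> \<le> ?E"
          using t ell_pos epsle[of "- \<alpha>0"] by (intro powr_mono' divide_right_mono) (auto simp: X_def)
        finally have "(C3 * \<bar>C0\<bar> * s powr (- \<alpha>0 / ell S) + e1) * L * ?A \<le> (C3 * \<bar>C0\<bar> * ?E + e1) * L * ?A"
          using C3 L by (intro mult_right_mono add_right_mono mult_left_mono) auto
        then show "b \<alpha>0 * t powr (min \<alpha>0 \<eta> / ell S) \<le> (C3 * \<bar>C0\<bar> * ?E + e1) * L * ?A"
          using a0 by (simp add: b_def)
        fix \<alpha> assume al: "\<alpha> \<in> I - {\<alpha>0}"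
        have "\<epsilon> \<le> \<alpha> - \<alpha>0" "\<epsilon> \<le> \<eta> - \<alpha>0" using al by (auto intro!: epsle simp: X_def)
        then have "t powr (min \<alpha> \<eta> / ell S) \<le> ?A * ?E" by (intro AE) auto
        then show "b \<alpha> * t powr (min \<alpha> \<eta> / ell S) \<le> N * L * (?A * ?E)"
          using al N L by (auto simp: b_def intro!: mult_left_mono)
      qed
      also have "(\<Sum>\<alpha>\<in>I - {\<alpha>0}. N * L * (?A * ?E)) \<le> (\<Sum>\<alpha>\<in>I. N * L * (?A * ?E))"
        using N L finI by (intro sum_mono2) auto
      finally have sumle: "(\<Sum>\<alpha>\<in>I. b \<alpha> * t powr (min \<alpha> \<eta> / ell S)) \<le> (C3 * \<bar>C0\<bar> * ?E + e1) * L * ?A + card I * (N * L * (?A * ?E))"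
        by simp
      have "t powr (\<eta> / ell S) \<le> ?A * ?E" using epsle[of "\<eta> - \<alpha>0"] by (intro AE) (auto simp: X_def)
      then have "c * t powr (\<eta> / ell S) / wfun u x \<le> c * (?A * ?E) / wfun u x"
        using c wp by (intro divide_right_mono mult_left_mono) auto
      moreover have "C2 / wfun u x * (\<Sum>\<alpha>\<in>I. b \<alpha> * t powr (min \<alpha> \<eta> / ell S))
         \<le> C2 / wfun u x * ((C3 * \<bar>C0\<bar> * ?E + e1) * L * ?A + card I * (N * L * (?A * ?E)))"
        using C2 wp sumle by (intro mult_left_mono) auto
      ultimately have "\<bar>Rec P f t x\<bar> \<le> c * (?A * ?E) / wfun u x + C2 / wfun u x * ((C3 * \<bar>C0\<bar> * ?E + e1) * L * ?A + card I * (N * L * (?A * ?E)))"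
        using rs q by linarith
      also have "\<dots> = (M1 * ?E + C2 * L * e1) * ?A / wfun u x"
        by (simp add: M1_def algebra_simps add_divide_distrib)
      also have "\<dots> \<le> (e / 2 + e / 2) * ?A / wfun u x"
        using wp e1 \<delta>(2)[OF t(1,2)] by (intro divide_right_mono mult_right_mono add_mono) auto
      finally show ?thesis by (simp add: zeta)
    qed
    then show "\<exists>\<delta>>0. \<forall>t x. 0 < t \<longrightarrow> t \<le> \<delta> \<longrightarrow> t \<le> 1 \<longrightarrow> \<bar>Rec P f t x\<bar> \<le> e * t powr (\<zeta> / ell S) / wfun u x"
      using \<delta>(1) by blast
  qed
qed

text \<open>Off the hyperplane the reconstruction tends to U at small times, as the local error
  vanishes with t. Letting the inner time tend to 0 in the semigroup relation, dominated convergence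
  identifies the member at time t with Q_t U, so the family is that of one function in
  C(wv).\<close>

lemma rec_besov_0I:
  assumes M: "(P, \<Gamma>) \<in> mods" and f: "f \<in> mdists \<Gamma>" and z: "\<zeta> = 0"
    and U: "continuous_on UNIV U" and lim: "\<And>x. x \<in> off_hyp S \<Longrightarrow> ((\<lambda>t. P x (f x) t x) \<longlongrightarrow> U x) (at_right 0)"
  shows "Rec P f \<in> besov S 0 u"
proof -
  note r = rec_facts[OF M f]
  obtain c where c: "0 \<le> c" "\<And>t x. t\<in>{0<..1} \<Longrightarrow> x\<in>off_hyp S \<Longrightarrow> \<bar>Rec P f t x - P x (f x) t x\<bar> \<le> c * t powr (\<gamma> / ell S) * phi S x powr (-\<kappa>) / wfun u x"
    using r(6) by blast
  obtain d where d: "0 \<le> d" "\<And>t x. t\<in>{0<..1} \<Longrightarrow> \<bar>Rec P f t x\<bar> \<le> d * t powr (\<zeta> / ell S) / wfun u x"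
    using r(8) by blast
  have d': "\<bar>Rec P f t x\<bar> \<le> d / wfun u x" if "t \<in> {0<..1}" for t x using d(2)[OF that] that z by auto
  have RU: "((\<lambda>t. Rec P f t x) \<longlongrightarrow> U x) (at_right 0)" if x: "x \<in> off_hyp S" for x
  proof -
    have "((\<lambda>t. c * t powr (\<gamma> / ell S) * phi S x powr (-\<kappa>) / wfun u x) \<longlongrightarrow> c * 0 * phi S x powr (-\<kappa>) / wfun u x) (at_right 0)"
      using \<gamma>_pos ell_pos wfun_pos[OF wv, of x] by (intro tendsto_divide tendsto_mult tendsto_const powr_at_right_0) auto
    then have "((\<lambda>t. Rec P f t x - P x (f x) t x) \<longlongrightarrow> 0) (at_right 0)"
    proof (rule_tac Lim_null_comparison[where g="\<lambda>t. c * t powr (\<gamma> / ell S) * phi S x powr (-\<kappa>) / wfun u x"])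
      show "\<forall>\<^sub>F t in at_right 0. norm (Rec P f t x - P x (f x) t x) \<le> c * t powr (\<gamma> / ell S) * phi S x powr (-\<kappa>) / wfun u x"
        using eventually_at_right_01 by eventually_elim (simp only: real_norm_def c(2)[OF _ x])
    qed simp
    from tendsto_add[OF this lim[OF x]] show ?thesis by simp
  qed
  have Uoff: "\<bar>U x\<bar> \<le> d / wfun u x" if "x \<in> off_hyp S" for x
    by (rule tendsto_le_abs[OF RU[OF that]]) (rule d')
  \<comment> \<open>The bound extends across the hyperplane by continuity: a violation would persist
    on a ball, and every ball meets \<open>off_hyp S\<close>.\<close>
  have Ub: "\<bar>U x\<bar> \<le> d / wfun u x" for x
  proof (rule ccontr)
    assume "\<not> \<bar>U x\<bar> \<le> d / wfun u x"
    then have x: "x \<in> {y. d / wfun u y < \<bar>U y\<bar>}" by simp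
    have "open {y. d / wfun u y < \<bar>U y\<bar>}"
      by (intro open_Collect_less continuous_intros U continuous_on_divide continuous_wfun[OF wv])
        (auto simp: less_imp_neq[OF wfun_pos[OF w], symmetric] less_imp_neq[OF wfun_pos[OF v], symmetric])
    then obtain e where "0 < e" "ball x e \<subseteq> {y. d / wfun u y < \<bar>U y\<bar>}" using x openE by blast
    moreover obtain y where "y \<in> off_hyp S" "dist y x < e" using off_hyp_dense \<open>0 < e\<close> by blast
    ultimately have "d / wfun u y < \<bar>U y\<bar>" by (auto simp: dist_commute)
    with Uoff[OF \<open>y \<in> off_hyp S\<close>] show False by simp
  qed
  have UC: "U \<in> Cw u" unfolding Cw_iff[OF wv] using U d(1) Ub by blast
  obtain B where B: "0 \<le> B" "dominated S u 0 B U" by (rule Cw_dominated[OF wv UC])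
  \<comment> \<open>The shifted times t + s n must stay in (0, 1], so t = 1 is left to the semigroup
    relation afterwards.\<close>
  have half: "Rec P f t x = qint S t U x" if t: "0 < t" "t < 1" for t x
  proof -
    define s where "s = (\<lambda>n. (1 - t) * inverse (real (Suc n)))"
    have s0: "s \<longlonglongrightarrow> 0" unfolding s_def using tendsto_mult[OF tendsto_const[of "1 - t"] LIMSEQ_inverse_real_of_nat] by simp
    have sp: "0 < s n" "t + s n \<le> 1" "s n \<in> {0<..1}" for n
    proof -
      show "0 < s n" using t by (simp add: s_def)
      have "inverse (real (Suc n)) \<le> 1" by (simp add: inverse_le_1_iff)
      then have "s n \<le> (1 - t) * 1" unfolding s_def using t by (intro mult_left_mono) auto
      then show "t + s n \<le> 1" by simp
      with \<open>0 < s n\<close> t show "s n \<in> {0<..1}" by auto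
    qed
    have tl: "t \<le> 1" "t / 2 \<in> {0<..1}" using t by auto
    note [measurable] = Q_measurable2[OF t(1)] Cw_measurable[OF UC]
    have "(\<lambda>n. qint S t (Rec P f (s n)) x) \<longlonglongrightarrow> qint S t U x"
      unfolding qint_def
    proof (rule integral_dominated_convergence)
      have "dominated S u 0 d (\<lambda>z. d / wfun u z)"
      proof (rule dominated_0I[OF wv])
        show "(\<lambda>z. d / wfun u z) \<in> borel_measurable borel"
          by (intro borel_measurable_divide borel_measurable_const wfun_measurable[OF wv])
        show "\<bar>d / wfun u z\<bar> \<le> d / wfun u z" for z
          using divide_nonneg_pos[OF d(1) wfun_pos[OF wv, of z]] by (simp only: abs_of_nonneg order_refl)
      qed
      from qint_integrable[OF wv order_refl s1_pos this d(1) t(1) tl(1), of x]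
      show "integrable lborel (\<lambda>z. \<bar>Qker S t x z * (d / wfun u z)\<bar>)" by (rule integrable_abs)
      show "(\<lambda>z. Qker S t x z * Rec P f (s n) z) \<in> borel_measurable lborel" for n
        using Cw_measurable[OF r(3)[OF sp(3)]] by measurable
      show "AE z in lborel. (\<lambda>n. Qker S t x z * Rec P f (s n) z) \<longlonglongrightarrow> Qker S t x z * U z"
        using AE_off_hyp
      proof eventually_elim
        case (elim z)
        have "filterlim s (at_right 0) sequentially"
          using s0 sp(1) by (intro tendsto_imp_filterlim_at_right) auto
        from filterlim_compose[OF RU[OF elim] this] show ?case by (intro tendsto_mult tendsto_const)
      qed
      show "AE z in lborel. norm (Qker S t x z * Rec P f (s n) z) \<le> \<bar>Qker S t x z * (d / wfun u z)\<bar>" for n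
      proof (rule AE_I2)
        fix z
        have "\<bar>Rec P f (s n) z\<bar> \<le> \<bar>d / wfun u z\<bar>" using d'[OF sp(3), of n z] by linarith
        then show "norm (Qker S t x z * Rec P f (s n) z) \<le> \<bar>Qker S t x z * (d / wfun u z)\<bar>"
          unfolding real_norm_def abs_mult by (intro mult_left_mono) auto
      qed
    qed measurable
    then have l1: "(\<lambda>n. Rec P f (t + s n) x) \<longlonglongrightarrow> qint S t U x"
      using consistentD[OF r(2) t(1) sp(1,2)] by simp
    obtain B1 where B1: "0 \<le> B1" "dominated S u 0 B1 (Rec P f (t / 2))" by (rule Cw_dominated[OF wv r(3)[OF tl(2)]])
    obtain C where C: "0 < C"
      "\<And>g B r r' x. dominated S u 0 B g \<Longrightarrow> 0 \<le> B \<Longrightarrow> t / 2 \<le> r \<Longrightarrow> r \<le> r' \<Longrightarrow> r' \<le> 1 \<Longrightarrow>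
         \<bar>qint S r' g x - qint S r g x\<bar> \<le> C * (r' - r) * B / wfun u x"
      by (rule qint_time_difference[OF wv, of "t / 2"]) (use t that in auto)
    \<comment> \<open>Right continuity in time, obtained from the member at time t / 2.\<close>
    have "(\<lambda>n. Rec P f (t + s n) x - Rec P f t x) \<longlonglongrightarrow> 0"
    proof (rule Lim_null_comparison)
      show "\<forall>\<^sub>F n in sequentially. norm (Rec P f (t + s n) x - Rec P f t x) \<le> C * B1 / wfun u x * s n"
      proof (rule always_eventually, rule allI)
        fix n
        have "t / 2 + s n + t / 2 = t + s n" "t / 2 + t / 2 = t" by simp_all
        then have "Rec P f (t + s n) x = qint S (t / 2 + s n) (Rec P f (t / 2)) x" "Rec P f t x = qint S (t / 2) (Rec P f (t / 2)) x"
          using consistentD[OF r(2), of "t / 2 + s n" "t / 2" x] consistentD[OF r(2), of "t / 2" "t / 2" x] t sp(1,2)[of n]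
          by (auto simp: add_pos_pos)
        then show "norm (Rec P f (t + s n) x - Rec P f t x) \<le> C * B1 / wfun u x * s n"
          using C(2)[OF B1(2,1), of "t / 2" "t / 2 + s n" x] t sp(1,2)[of n] by (simp add: mult_ac)
      qed
      show "(\<lambda>n. C * B1 / wfun u x * s n) \<longlonglongrightarrow> 0" using tendsto_mult[OF tendsto_const s0, of "C * B1 / wfun u x"] by simp
    qed
    then have "(\<lambda>n. Rec P f (t + s n) x) \<longlonglongrightarrow> Rec P f t x" by (simp add: LIM_zero_iff)
    with l1 show ?thesis using LIMSEQ_unique by blast
  qed
  have full: "Rec P f t x = qint S t U x" if t: "t \<in> {0<..1}" for t x
  proof (cases "t < 1")
    case False
    then have t1: "t = 1" using t by auto
    have h: "Rec P f (1/2) = qint S (1/2) U" using half[of "1/2"] by (intro ext) auto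
    have "Rec P f 1 x = qint S (1/2) (Rec P f (1/2)) x" using consistentD[OF r(2), of "1/2" "1/2" x] by simp
    also have "\<dots> = qint S (1/2 + 1/2) U x" unfolding h by (rule qint_qint[OF wv order_refl s1_pos B(2,1)]) auto
    finally show ?thesis by (simp add: t1)
  qed (use half t in auto)
  show ?thesis
    unfolding besov_iff[OF wv]
  proof (intro conjI ballI allI impI)
    fix e :: real assume "0 < e"
    then show "\<exists>g\<in>Cw u. \<forall>t\<in>{0<..1}. \<forall>x. \<bar>Rec P f t x - qint S t g x\<bar> \<le> e * t powr (0 / ell S) / wfun u x"
      using UC full wfun_pos[OF wv] by (intro bexI[of _ U]) (auto simp: less_imp_le)
  qed (use r(3,4) in auto)
qed

end

section \<open>Nonnegative regularity: point evaluation of the model\<close>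

context rec_setting
begin

text \<open>The continuous function that \<open>P x \<tau>\<close> is at exponent 0. The choice
  depends on the family \<open>P x \<tau>\<close> alone, so equal families get the same function;
  this is all that \<open>ev_shift\<close> uses.\<close>

definition ev :: "('n, 'v) pimap \<Rightarrow> real^'n \<Rightarrow> 'v \<Rightarrow> real^'n \<Rightarrow> real" where
  "ev P x \<tau> = (SOME g. g \<in> Cw (wmul w w1) \<and> (\<forall>t\<in>{0<..1}. P x \<tau> t = qint S t g))"

context
  fixes P :: "('n, 'v) pimap" and \<Gamma> :: "('n, 'v) gmap" and f :: "real^'n \<Rightarrow> 'v"
  assumes M: "(P, \<Gamma>) \<in> mods" and f: "f \<in> mdists \<Gamma>" and a0: "0 \<le> \<alpha>0" and eta: "0 < \<eta>"
begin

lemma ev: "ev P x \<tau> \<in> Cw (wmul w w1)" "t \<in> {0<..1} \<Longrightarrow> P x \<tau> t = qint S t (ev P x \<tau>)"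
proof -
  have "P x \<tau> \<in> besov S 0 (wmul w w1)" using model_facts(1)[OF M, of x \<tau>] min_absorb2[OF a0] by simp
  then obtain g where "g \<in> Cw (wmul w w1)" "\<And>t. t \<in> {0<..1} \<Longrightarrow> P x \<tau> t = qint S t g"
    by (rule besov_0_function[OF ww1]) (rule that)
  then have "\<exists>g. g \<in> Cw (wmul w w1) \<and> (\<forall>t\<in>{0<..1}. P x \<tau> t = qint S t g)" by blast
  then have "ev P x \<tau> \<in> Cw (wmul w w1) \<and> (\<forall>t\<in>{0<..1}. P x \<tau> t = qint S t (ev P x \<tau>))"
    unfolding ev_def by (rule someI_ex)
  then show "ev P x \<tau> \<in> Cw (wmul w w1)" "t \<in> {0<..1} \<Longrightarrow> P x \<tau> t = qint S t (ev P x \<tau>)" by blast+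
qed

lemma ev_tendsto: "((\<lambda>t. P x \<tau> t y) \<longlongrightarrow> ev P x \<tau> y) (at_right 0)"
proof (rule Lim_transform_eventually[OF qint_tendsto[OF ww1 ev(1)]])
  show "\<forall>\<^sub>F t in at_right 0. qint S t (ev P x \<tau>) y = P x \<tau> t y"
    using eventually_at_right_01 by eventually_elim (simp add: ev(2))
qed

lemma ev_continuous: "continuous_on UNIV (ev P x \<tau>)"
  by (rule Cw_continuous[OF ev(1)])

lemma ev_shift: "ev P x (\<Gamma> x y \<tau>) = ev P y \<tau>"
  unfolding ev_def by (simp only: model_facts(5)[OF M])

text \<open>A chosen representative is not additive by construction, but as the limit of the family
  at small times it is.\<close>

lemma ev_diff: "ev P x (\<tau> - \<sigma>) y = ev P x \<tau> y - ev P x \<sigma> y"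
proof (rule tendsto_unique[OF _ ev_tendsto])
  show "((\<lambda>t. P x (\<tau> - \<sigma>) t y) \<longlongrightarrow> ev P x \<tau> y - ev P x \<sigma> y) (at_right 0)"
    unfolding linear_diff[OF model_facts(2)[OF M]] by (intro tendsto_diff ev_tendsto)
qed simp

text \<open>As t tends to 0, \<open>t powr (\<alpha> / ell S)\<close> tends to 0 for \<alpha> > 0
  and is constantly 1 for \<alpha> = 0.\<close>

lemma ev_bound:
  assumes P: "pi_le N P" and \<tau>: "\<tau> \<in> below \<T> \<gamma>"
  shows "\<bar>ev P z \<tau> z\<bar> \<le> N / wfun w z * (\<Sum>\<alpha>\<in>I. (if \<alpha> = 0 then 1 else 0) * hnorm \<T> \<alpha> \<tau>)"
proof (rule tendsto_le[OF _ _ tendsto_rabs[OF ev_tendsto]])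
  show "((\<lambda>t. N / wfun w z * (\<Sum>\<alpha>\<in>I. t powr (\<alpha> / ell S) * hnorm \<T> \<alpha> \<tau>)) \<longlongrightarrow>
      N / wfun w z * (\<Sum>\<alpha>\<in>I. (if \<alpha> = 0 then 1 else 0) * hnorm \<T> \<alpha> \<tau>)) (at_right 0)"
  proof (intro tendsto_mult tendsto_sum tendsto_const)
    fix \<alpha> assume "\<alpha> \<in> I"
    then have "0 \<le> \<alpha>" using idx_ge[OF reg, of \<alpha>] a0 by auto
    show "((\<lambda>t. t powr (\<alpha> / ell S)) \<longlongrightarrow> (if \<alpha> = 0 then 1 else 0)) (at_right 0)"
    proof (cases "\<alpha> = 0")
      case True
      have "\<forall>\<^sub>F t in at_right 0. (1::real) = t powr (\<alpha> / ell S)"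
        using eventually_at_right_01 by eventually_elim (simp add: True)
      from Lim_transform_eventually[OF tendsto_const this] show ?thesis using True by simp
    next
      case False
      then show ?thesis using powr_at_right_0[of "\<alpha> / ell S"] \<open>0 \<le> \<alpha>\<close> ell_pos by simp
    qed
  qed
  show "\<forall>\<^sub>F t in at_right 0. \<bar>P z \<tau> t z\<bar> \<le> N / wfun w z * (\<Sum>\<alpha>\<in>I. t powr (\<alpha> / ell S) * hnorm \<T> \<alpha> \<tau>)"
    using eventually_at_right_01 by eventually_elim (use P \<tau> in \<open>auto simp: pi_le_def\<close>)
qed simp

lemma zeta_0: "\<zeta> = 0"
  using \<zeta> a0 eta by auto

lemma pi_obtain:
  obtains N where "0 \<le> N" "pi_le N P"
proof -
  obtain N where N: "pi_norm S \<T> \<gamma> w P = ennreal N" "0 \<le> N" using finite_ennreal[OF pi_norm_finite[OF M]] by blast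
  then have "pi_le N P" using model_facts(2)[OF M] by (intro pi_leI) auto
  with N that show ?thesis by blast
qed

lemma norms_obtain:
  obtains K L where "0 \<le> K" "sharp_le K (delta \<Gamma> f)" "0 \<le> L" "sing_le L f"
proof -
  obtain K L where KL: "sharp_norm S \<T> \<gamma> \<eta> v (delta \<Gamma> f) = ennreal K" "0 \<le> K" "sing_norm S \<T> \<gamma> \<eta> v f = ennreal L" "0 \<le> L"
    by (rule modelled_norms[OF f])
  then have "sharp_le K (delta \<Gamma> f)" "sing_le L f" using delta_refl[OF M] by (auto intro!: sharp_leI sing_leI)
  with KL that show ?thesis by blast
qed

lemma f_below: "x \<in> off_hyp S \<Longrightarrow> f x \<in> below \<T> \<gamma>"
  using f by (simp add: modelled_def)

text \<open>All degrees are positive, so every point evaluation vanishes and the limiting function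
  is 0.\<close>

lemma rec_besov_positive:
  assumes "0 < \<alpha>0"
  shows "Rec P f \<in> besov S 0 u"
proof (rule rec_besov_0I[OF M f zeta_0 continuous_on_const[of _ 0]])
  fix x assume x: "x \<in> off_hyp S"
  obtain N where N: "0 \<le> N" "pi_le N P" by (rule pi_obtain)
  have "(\<Sum>\<alpha>\<in>I. (if \<alpha> = 0 then 1 else 0) * hnorm \<T> \<alpha> (f x)) = 0"
    using idx_ge[OF reg] assms by (intro sum.neutral) force
  then have "ev P x (f x) x = 0" using ev_bound[OF N(2) f_below[OF x], of x] by simp
  then show "((\<lambda>t. P x (f x) t x) \<longlongrightarrow> 0) (at_right 0)" using ev_tendsto[of x "f x" x] by simp
qed

text \<open>With all degrees nonnegative the coherence bound at times t \<le> 1 is at most the one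
  at t = 1. It survives the limit of small times as a bound on point evaluations and vanishes as y
  approaches x.\<close>

lemma osc_off_hyp:
  assumes x: "x \<in> off_hyp S" and e: "0 < e"
  shows "\<exists>c d. 0 < d \<and> (\<forall>y\<in>off_hyp S. dist y x < d \<longrightarrow> \<bar>ev P y (f y) y - c\<bar> \<le> e)"
proof -
  obtain N where N: "0 \<le> N" "pi_le N P" by (rule pi_obtain)
  obtain K where K: "0 \<le> K" "sharp_le K (delta \<Gamma> f)" by (rule norms_obtain)
  let ?E = "\<lambda>s z. N * K / wfun u x * wstar u (x - z) * phi2 S x z powr (\<eta> - \<gamma>) *
           (\<Sum>\<alpha>\<in>I. s powr (\<alpha> / ell S) * snorm S (z - x) powr (\<gamma> - \<alpha>))"
  have le: "\<bar>ev P y (f y) y - ev P x (f x) y\<bar> \<le> ?E 1 y" if y: "y \<in> off_hyp S" for y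
  proof -
    have "ev P y (f y) y - ev P x (f x) y = ev P y (delta \<Gamma> f y x) y"
      by (simp add: delta_def ev_diff ev_shift)
    also have "\<bar>\<dots>\<bar> \<le> ?E 1 y"
    proof (rule tendsto_le_abs[OF ev_tendsto])
      fix t assume t: "t \<in> {0<..(1::real)}"
      have "\<bar>P y (delta \<Gamma> f y x) t y\<bar> \<le> ?E t y"
        by (rule pi_sharp[OF N(2,1) K(2,1) x y delta_below[OF M f x y] t])
      also have "\<dots> \<le> ?E 1 y"
      proof (rule mult_left_mono)
        show "(\<Sum>\<alpha>\<in>I. t powr (\<alpha> / ell S) * snorm S (y - x) powr (\<gamma> - \<alpha>))
          \<le> (\<Sum>\<alpha>\<in>I. 1 powr (\<alpha> / ell S) * snorm S (y - x) powr (\<gamma> - \<alpha>))"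
        proof (intro sum_mono mult_right_mono)
          fix \<alpha> assume "\<alpha> \<in> I"
          then have "0 \<le> \<alpha>" using idx_ge[OF reg, of \<alpha>] a0 by auto
          then show "t powr (\<alpha> / ell S) \<le> 1 powr (\<alpha> / ell S)" using t ell_pos by (intro powr_mono2) auto
        qed simp
        show "0 \<le> N * K / wfun u x * wstar u (x - y) * phi2 S x y powr (\<eta> - \<gamma>)"
          using N K wfun_pos[OF wv, of x] wstar_ge1[OF wv, of "x - y"] by (intro mult_nonneg_nonneg divide_nonneg_pos) auto
      qed
      finally show "\<bar>P y (delta \<Gamma> f y x) t y\<bar> \<le> ?E 1 y" .
    qed
    finally show ?thesis .
  qed
  have "\<forall>\<^sub>F y in at x. ?E 1 y < e / 2" using e by (intro order_tendstoD(2)[OF error_tendsto[OF x]]) simp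
  then obtain d1 where d1: "0 < d1" "\<And>y. y \<noteq> x \<Longrightarrow> dist y x < d1 \<Longrightarrow> ?E 1 y < e / 2"
    unfolding eventually_at by auto
  have "\<exists>d>0. \<forall>y. dist y x < d \<longrightarrow> dist (ev P x (f x) y) (ev P x (f x) x) < e / 2"
    using ev_continuous[of x "f x", unfolded continuous_on_iff, rule_format, of x "e / 2"] e by simp
  then obtain d2 where d2: "0 < d2" "\<And>y. dist y x < d2 \<Longrightarrow> \<bar>ev P x (f x) y - ev P x (f x) x\<bar> < e / 2"
    by (auto simp: dist_real_def)
  have "\<bar>ev P y (f y) y - ev P x (f x) x\<bar> \<le> e" if y: "y \<in> off_hyp S" "dist y x < min d1 d2" for y
  proof (cases "y = x")
    case False
    have "?E 1 y < e / 2" using False y by (intro d1(2)) auto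
    moreover have "\<bar>ev P x (f x) y - ev P x (f x) x\<bar> < e / 2" using y by (intro d2(2)) auto
    ultimately show ?thesis using le[OF y(1)] by linarith
  qed (use e in auto)
  then show ?thesis using d1 d2 by (intro exI[of _ "ev P x (f x) x"] exI[of _ "min d1 d2"]) auto
qed

lemma wfun_lower_local:
  fixes a :: "real^'n"
  assumes u': "G_controlled S u'" and r: "0 \<le> r"
  obtains c where "0 < c" "\<And>x. x \<in> cball a r \<Longrightarrow> c \<le> wfun u' x"
proof -
  have "\<exists>y\<in>cball a r. \<forall>x\<in>cball a r. wfun u' y \<le> wfun u' x"
    using r by (intro continuous_attains_inf compact_cball continuous_on_subset[OF continuous_wfun[OF u']]) auto
  then show ?thesis using that wfun_pos[OF u'] by blast
qed

lemma wstar_upper_local: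
  fixes a :: "real^'n"
  assumes u': "G_controlled S u'" and r: "0 \<le> r"
  obtains C where "1 \<le> C" "\<And>x. x \<in> cball a r \<Longrightarrow> wstar u' x \<le> C"
proof -
  have "\<exists>y\<in>cball a r. \<forall>x\<in>cball a r. wstar u' x \<le> wstar u' y"
    using r by (intro continuous_attains_sup compact_cball continuous_on_subset[OF continuous_wstar[OF u']]) auto
  then show ?thesis using that wstar_ge1[OF u'] by blast
qed

lemma gamma_bound:
  assumes G: "gamma_norm S \<T> \<gamma> w \<Gamma> \<le> ennreal Gm" "0 \<le> Gm" and \<alpha>: "\<alpha> \<in> I" and \<beta>: "\<beta> \<in> idx \<T>" "\<beta> < \<alpha>"
    and yx: "y \<noteq> x" and \<tau>: "\<tau> \<in> sector \<T> \<alpha>"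
  shows "hnorm \<T> \<beta> (\<Gamma> y x \<tau>) \<le> Gm / wfun w x * (wstar w (y - x) * snorm S (y - x) powr (\<alpha> - \<beta>) * secnorm \<T> \<alpha> \<tau>)"
proof (cases "\<tau> = 0")
  case True
  have "secnorm \<T> \<alpha> 0 = 0" using secnorm_eq_0[OF reg, of \<alpha> 0] \<tau> True \<alpha> by simp
  then show ?thesis using True linear_0[OF model_facts(3)[OF M]] hnorm_0[OF reg \<beta>(1)] by simp
next
  case False
  have sp: "0 < secnorm \<T> \<alpha> \<tau>"
    using secnorm_nonneg[OF reg _ \<tau>] secnorm_eq_0[OF reg _ \<tau>] \<alpha> False by (simp add: less_le)
  have "ennreal (wfun w x * hnorm \<T> \<beta> (\<Gamma> y x \<tau>) / (wstar w (y - x) * snorm S (y - x) powr (\<alpha> - \<beta>) * secnorm \<T> \<alpha> \<tau>)) \<le> ennreal Gm"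
    using \<tau> False by (intro order_trans[OF gamma_norm_upper[OF \<alpha> \<beta> yx] G(1)]) auto
  then show ?thesis
    using sp snorm_pos[of "y - x"] yx wstar_ge1[OF w, of "y - x"] wfun_pos[OF w, of x] G
    by (intro ennreal_ratio_le mult_pos_pos) auto
qed

section \<open>Regularity exactly 0: continuity across the hyperplane\<close>

context
  assumes a00: "\<alpha>0 = 0"
begin

lemma zero_I: "0 \<in> I" and zero_idx: "0 \<in> idx \<T>"
  using \<alpha>0_idx[OF reg] a00 \<gamma>_pos by auto

lemma I_pos: "\<alpha> \<in> I - {0} \<Longrightarrow> 0 < \<alpha>"
  using idx_ge[OF reg, of \<alpha>] a00 by (auto simp: less_le)

lemma Gamma_fixed: "\<tau> \<in> sector \<T> 0 \<Longrightarrow> \<Gamma> x y \<tau> = \<tau>"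
  using lowest_sector_fixed[OF model_facts(4)[OF M]] a00 by simp

lemma ev_sector: "\<tau> \<in> sector \<T> 0 \<Longrightarrow> ev P x \<tau> = ev P y \<tau>"
  using ev_shift[of x y \<tau>] Gamma_fixed by simp

text \<open>In degree 0 the function does not depend on the base point. So the evaluation of f y at
  y can be compared with a fixed continuous function built from one reference value, at the cost of
  the degree 0 component of the difference.\<close>

lemma ev_proj:
  assumes N: "pi_le N P" "0 \<le> N" and \<tau>: "\<tau> \<in> below \<T> \<gamma>" and \<sigma>: "\<sigma> \<in> below \<T> \<gamma>"
  shows "\<bar>ev P y \<tau> y - ev P 0 (proj \<T> 0 \<sigma>) y\<bar> \<le> N / wfun w y * hnorm \<T> 0 (\<tau> - \<sigma>)"
proof -
  have ps: "proj \<T> 0 \<sigma> \<in> sector \<T> 0" by (rule proj_in_sector[OF reg zero_idx])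
  then have pb: "proj \<T> 0 \<sigma> \<in> below \<T> \<gamma>" using sector_below[OF reg zero_idx \<gamma>_pos] by blast
  have "ev P y \<tau> y - ev P 0 (proj \<T> 0 \<sigma>) y = ev P y (\<tau> - proj \<T> 0 \<sigma>) y"
    using ev_sector[OF ps, of 0 y] by (simp add: ev_diff)
  also have "\<bar>\<dots>\<bar> \<le> N / wfun w y * (\<Sum>\<alpha>\<in>I. (if \<alpha> = 0 then 1 else 0) * hnorm \<T> \<alpha> (\<tau> - proj \<T> 0 \<sigma>))"
    by (intro ev_bound N subspace_diff[OF subspace_below[OF reg]] \<tau> pb)
  also have "(\<Sum>\<alpha>\<in>I. (if \<alpha> = 0 then 1 else 0) * hnorm \<T> \<alpha> (\<tau> - proj \<T> 0 \<sigma>)) = hnorm \<T> 0 (\<tau> - proj \<T> 0 \<sigma>)"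
    unfolding sum.remove[OF finI zero_I] by (simp add: sum.neutral)
  also have "\<dots> = hnorm \<T> 0 (\<tau> - \<sigma>)"
    by (simp add: hnorm_def linear_diff[OF linear_proj[OF reg]] proj_sector[OF reg zero_idx ps])
  finally show ?thesis .
qed

text \<open>
  The increments of the component of degree 0 (the only one seen by point evaluation), at pairs
  of points whose distance is comparable to their distance from the hyperplane.
\<close>

lemma increment_near:
  obtains C \<epsilon> where "0 \<le> C" "0 < \<epsilon>"
    "\<And>x y. x \<in> off_hyp S \<Longrightarrow> y \<in> off_hyp S \<Longrightarrow> dist x x0 \<le> 2 \<Longrightarrow> dist y x0 \<le> 2 \<Longrightarrow> snorm S (y - x) \<le> 5 * phi2 S x y \<Longrightarrow>
       hnorm \<T> 0 (f y - f x) \<le> C * phi2 S x y powr \<epsilon>"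
proof -
  obtain K L where K: "0 \<le> K" "sharp_le K (delta \<Gamma> f)" and L: "0 \<le> L" "sing_le L f" by (rule norms_obtain)
  obtain Gm where Gm: "gamma_norm S \<T> \<gamma> w \<Gamma> = ennreal Gm" "0 \<le> Gm" using finite_ennreal[OF gamma_norm_finite[OF M]] by blast
  then have Gm': "gamma_norm S \<T> \<gamma> w \<Gamma> \<le> ennreal Gm" by simp
  obtain cv where cv: "0 < cv" "\<And>x. x \<in> cball x0 2 \<Longrightarrow> cv \<le> wfun v x" by (rule wfun_lower_local[OF v, of 2 x0]) (simp, rule that)
  obtain cw where cw: "0 < cw" "\<And>x. x \<in> cball x0 2 \<Longrightarrow> cw \<le> wfun w x" by (rule wfun_lower_local[OF w, of 2 x0]) (simp, rule that)
  obtain Cv where Cv: "1 \<le> Cv" "\<And>x. x \<in> cball 0 4 \<Longrightarrow> wstar v x \<le> Cv" by (rule wstar_upper_local[OF v, of 4 0]) (simp, rule that)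
  obtain Cw' where Cw': "1 \<le> Cw'" "\<And>x. x \<in> cball 0 4 \<Longrightarrow> wstar w x \<le> Cw'" by (rule wstar_upper_local[OF w, of 4 0]) (simp, rule that)
  \<comment> \<open>The increments have rates \<eta> and min \<eta> \<alpha> with \<alpha> > 0;
    \<epsilon> is a positive lower bound for all of them.\<close>
  define X where "X = insert \<eta> (I - {0})"
  have X: "finite X" "X \<noteq> {}" using finI by (auto simp: X_def)
  define \<epsilon> where "\<epsilon> = Min X"
  have eps: "0 < \<epsilon>" unfolding \<epsilon>_def using X eta I_pos by (subst Min_gr_iff) (auto simp: X_def)
  have epsle: "\<epsilon> \<le> x" if "x \<in> X" for x unfolding \<epsilon>_def using X that by (rule_tac Min_le) auto
  define C where "C = K / cv * (Cv * 5 powr \<gamma>) + (\<Sum>\<alpha>\<in>I - {0}. Gm / cw * (Cw' * 5 powr \<gamma> * (L / cv)))"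
  have C: "0 \<le> C" unfolding C_def using K cv Cv Gm cw Cw' L by (intro add_nonneg_nonneg sum_nonneg mult_nonneg_nonneg) auto
  show ?thesis
  proof (rule that[OF C eps])
    fix x y assume x: "x \<in> off_hyp S" and y: "y \<in> off_hyp S" and dx: "dist x x0 \<le> 2" and dy: "dist y x0 \<le> 2"
      and s: "snorm S (y - x) \<le> 5 * phi2 S x y"
    let ?p = "phi2 S x y" and ?s = "snorm S (y - x)"
    have p: "0 < ?p" "?p \<le> 1" "?p \<le> phi S x" using phi2_pos[OF x y] phi_le1[of x] by (auto simp: phi2_def)
    show "hnorm \<T> 0 (f y - f x) \<le> C * ?p powr \<epsilon>"
    proof (cases "y = x")
      case True
      then show ?thesis using C hnorm_0[OF reg zero_idx] by simp
    next
      case False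
      have xb: "cv \<le> wfun v x" "cw \<le> wfun w x" using dx by (auto intro!: cv cw simp: dist_commute)
      have "dist x y \<le> 4" using dx dy dist_triangle[of x y x0] by (simp add: dist_commute)
      then have wb: "wstar v (x - y) \<le> Cv" "wstar w (y - x) \<le> Cw'"
        by (auto intro!: Cv Cw' simp: dist_norm norm_minus_commute)
      have sg: "?s powr a \<le> 5 powr \<gamma> * ?p powr a" if "0 \<le> a" "a \<le> \<gamma>" for a
      proof -
        have "?s powr a \<le> (5 * ?p) powr a" using s snorm_nonneg that by (intro powr_mono2) auto
        also have "\<dots> = 5 powr a * ?p powr a" by (simp add: powr_mult)
        also have "\<dots> \<le> 5 powr \<gamma> * ?p powr a" using that by (intro mult_right_mono powr_mono) auto
        finally show ?thesis .
      qed
      have pe: "?p powr a \<le> ?p powr \<epsilon>" if "\<epsilon> \<le> a" for a using that p by (intro powr_mono') auto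
      have d: "hnorm \<T> 0 (delta \<Gamma> f y x) \<le> K / cv * (Cv * 5 powr \<gamma>) * ?p powr \<epsilon>"
      proof -
        have "hnorm \<T> 0 (delta \<Gamma> f y x) \<le> K / wfun v x * (?p powr (\<eta> - \<gamma>) * wstar v (x - y) * ?s powr (\<gamma> - 0))"
          using K(2) x y zero_I unfolding sharp_le_def by blast
        also have "\<dots> \<le> K / cv * (?p powr (\<eta> - \<gamma>) * Cv * (5 powr \<gamma> * ?p powr \<gamma>))"
          using K cv xb wb Cv \<gamma>_pos sg[of \<gamma>] wstar_ge1[OF v, of "x - y"]
          by (intro mult_mono frac_le mult_nonneg_nonneg) auto
        also have "\<dots> = K / cv * (Cv * 5 powr \<gamma>) * (?p powr (\<eta> - \<gamma>) * ?p powr \<gamma>)" by simp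
        also have "?p powr (\<eta> - \<gamma>) * ?p powr \<gamma> = ?p powr \<eta>" by (simp add: powr_add[symmetric])
        also have "K / cv * (Cv * 5 powr \<gamma>) * ?p powr \<eta> \<le> K / cv * (Cv * 5 powr \<gamma>) * ?p powr \<epsilon>"
          using K cv Cv epsle[of \<eta>] by (intro mult_left_mono pe mult_nonneg_nonneg) (auto simp: X_def)
        finally show ?thesis .
      qed
      have g: "hnorm \<T> 0 (\<Gamma> y x (proj \<T> \<alpha> (f x)) - proj \<T> \<alpha> (f x)) \<le> Gm / cw * (Cw' * 5 powr \<gamma> * (L / cv)) * ?p powr \<epsilon>"
        if al: "\<alpha> \<in> I - {0}" for \<alpha>
      proof -
        let ?\<tau> = "proj \<T> \<alpha> (f x)"
        have ai: "\<alpha> \<in> idx \<T>" "\<alpha> \<in> I" "0 < \<alpha>" "\<alpha> \<le> \<gamma>" using al I_pos[OF al] by auto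
        have ps: "?\<tau> \<in> sector \<T> \<alpha>" by (rule proj_in_sector[OF reg ai(1)])
        have "hnorm \<T> 0 (\<Gamma> y x ?\<tau> - ?\<tau>) = hnorm \<T> 0 (\<Gamma> y x ?\<tau>)"
          using al by (simp add: hnorm_def linear_diff[OF linear_proj[OF reg]] proj_sector[OF reg ai(1) ps])
        also have "\<dots> \<le> Gm / wfun w x * (wstar w (y - x) * ?s powr (\<alpha> - 0) * secnorm \<T> \<alpha> ?\<tau>)"
          by (rule gamma_bound[OF Gm' Gm(2) ai(2) zero_idx ai(3) False ps])
        also have "\<dots> \<le> Gm / cw * (Cw' * (5 powr \<gamma> * ?p powr \<alpha>) * (L / cv * ?p powr (min (\<eta> - \<alpha>) 0)))"
        proof (intro mult_mono frac_le mult_nonneg_nonneg)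
          have "secnorm \<T> \<alpha> ?\<tau> \<le> L / wfun v x * phi S x powr (min (\<eta> - \<alpha>) 0)"
            using L(2) x ai unfolding sing_le_def hnorm_def by blast
          also have "\<dots> \<le> L / cv * ?p powr (min (\<eta> - \<alpha>) 0)"
            using L cv xb p by (intro mult_mono frac_le powr_mono2') auto
          finally show "secnorm \<T> \<alpha> ?\<tau> \<le> L / cv * ?p powr (min (\<eta> - \<alpha>) 0)" .
          show "?s powr (\<alpha> - 0) \<le> 5 powr \<gamma> * ?p powr \<alpha>" using sg[of \<alpha>] ai by simp
        qed (use Gm cw xb wb Cw' wstar_ge1[OF w, of "y - x"] secnorm_nonneg[OF reg ai(1) ps] in auto)
        also have "\<dots> = Gm / cw * (Cw' * 5 powr \<gamma> * (L / cv)) * (?p powr \<alpha> * ?p powr (min (\<eta> - \<alpha>) 0))" by simp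
        \<comment> \<open>The blow-up of the component of degree \<alpha> at the hyperplane is
          compensated by the power \<alpha> in the bound on \<open>\<Gamma>\<close>, and the
          resulting exponent is positive because \<eta> and \<alpha> are.\<close>
        also have "?p powr \<alpha> * ?p powr (min (\<eta> - \<alpha>) 0) = ?p powr (min \<eta> \<alpha>)"
          by (simp add: powr_add[symmetric] min_def)
        also have "Gm / cw * (Cw' * 5 powr \<gamma> * (L / cv)) * ?p powr (min \<eta> \<alpha>) \<le> Gm / cw * (Cw' * 5 powr \<gamma> * (L / cv)) * ?p powr \<epsilon>"
          using Gm cw Cw' L cv epsle[of \<eta>] epsle[of \<alpha>] al by (intro mult_left_mono pe mult_nonneg_nonneg) (auto simp: X_def)
        finally show ?thesis .
      qed
      \<comment> \<open>The degree 0 component of the increment consists of the coherence defect and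
        of what \<open>\<Gamma>\<close> sends down from the positive degrees.\<close>
      have "\<Gamma> y x (f x) - f x = (\<Sum>\<alpha>\<in>I. \<Gamma> y x (proj \<T> \<alpha> (f x)) - proj \<T> \<alpha> (f x))"
        unfolding sum_subtractf linear_sum[OF model_facts(3)[OF M], symmetric] below_sum[OF reg f_below[OF x], symmetric] ..
      also have "\<dots> = (\<Sum>\<alpha>\<in>I - {0}. \<Gamma> y x (proj \<T> \<alpha> (f x)) - proj \<T> \<alpha> (f x))"
        unfolding sum.remove[OF finI zero_I] using Gamma_fixed[OF proj_in_sector[OF reg zero_idx]] by simp
      finally have eq: "f y - f x = delta \<Gamma> f y x + (\<Sum>\<alpha>\<in>I - {0}. \<Gamma> y x (proj \<T> \<alpha> (f x)) - proj \<T> \<alpha> (f x))"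
        by (simp add: delta_def algebra_simps)
      have hsum: "hnorm \<T> 0 (\<Sum>\<alpha>\<in>J. h \<alpha>) \<le> (\<Sum>\<alpha>\<in>J. hnorm \<T> 0 (h \<alpha>))" if "finite J" for J and h :: "real \<Rightarrow> 'v"
        using that
      proof (induction J rule: finite_induct)
        case (insert \<alpha> J)
        then show ?case using hnorm_triangle[OF reg zero_idx, of "h \<alpha>" "\<Sum>\<alpha>\<in>J. h \<alpha>"] by auto
      qed (simp add: hnorm_0[OF reg zero_idx])
      have "hnorm \<T> 0 (f y - f x) \<le> hnorm \<T> 0 (delta \<Gamma> f y x) + hnorm \<T> 0 (\<Sum>\<alpha>\<in>I - {0}. \<Gamma> y x (proj \<T> \<alpha> (f x)) - proj \<T> \<alpha> (f x))"
        unfolding eq by (rule hnorm_triangle[OF reg zero_idx])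
      also have "\<dots> \<le> K / cv * (Cv * 5 powr \<gamma>) * ?p powr \<epsilon> + (\<Sum>\<alpha>\<in>I - {0}. Gm / cw * (Cw' * 5 powr \<gamma> * (L / cv)) * ?p powr \<epsilon>)"
        using finI by (intro add_mono d order_trans[OF hsum] sum_mono g) auto
      also have "\<dots> = C * ?p powr \<epsilon>" by (simp only: C_def distrib_right sum_distrib_right)
      finally show ?thesis .
    qed
  qed
qed

text \<open>Multiplies the first coordinate by 2^k and fixes the others. While the heights stay
  below 1, a step from k to k + 1 has scaled length equal to \<open>phi\<close> of its starting
  point.\<close>

definition mv :: "nat \<Rightarrow> real^'n \<Rightarrow> real^'n" where
  "mv k x = x + axis (axis1 S) ((2 ^ k - 1) * x $ axis1 S)"

lemma mv_axis1: "mv k x $ axis1 S = 2 ^ k * x $ axis1 S"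
  by (simp add: mv_def algebra_simps)

lemma mv_other: "i \<noteq> axis1 S \<Longrightarrow> mv k x $ i = x $ i"
  by (simp add: mv_def axis_def)

lemma mv_0: "mv 0 x = x"
  by (simp add: mv_def vec_eq_iff axis_def)

lemma mv_off: "x \<in> off_hyp S \<Longrightarrow> mv k x \<in> off_hyp S"
  by (simp add: off_hyp_def mv_axis1)

lemma dist_mv: "dist (mv k x) x \<le> 2 ^ k * \<bar>x $ axis1 S\<bar>"
proof -
  have "dist (mv k x) x = \<bar>(2 ^ k - 1) * x $ axis1 S\<bar>" by (simp add: mv_def dist_norm norm_axis_real)
  also have "\<dots> = (2 ^ k - 1) * \<bar>x $ axis1 S\<bar>" by (simp add: abs_mult)
  also have "\<dots> \<le> 2 ^ k * \<bar>x $ axis1 S\<bar>" by (intro mult_right_mono) auto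
  finally show ?thesis .
qed

lemma hn_triangle: "hnorm \<T> 0 (a - c) \<le> hnorm \<T> 0 (a - b) + hnorm \<T> 0 (b - c)"
  using hnorm_triangle[OF reg zero_idx, of "a - b" "b - c"] by simp

lemma hn_commute: "hnorm \<T> 0 (a - b) = hnorm \<T> 0 (b - a)"
  using hnorm_minus[OF reg zero_idx, of "a - b"] by simp

text \<open>
  Moving a point away from the hyperplane by doubling its first coordinate, all steps are as in
  \<open>increment_near\<close>, and the increments form a geometric series dominated by the last one.
\<close>

lemma doubling_chain:
  assumes C: "0 \<le> C" "0 < \<epsilon>"
    "\<And>x y. x \<in> off_hyp S \<Longrightarrow> y \<in> off_hyp S \<Longrightarrow> dist x x0 \<le> 2 \<Longrightarrow> dist y x0 \<le> 2 \<Longrightarrow> snorm S (y - x) \<le> 5 * phi2 S x y \<Longrightarrow>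
       hnorm \<T> 0 (f y - f x) \<le> C * phi2 S x y powr \<epsilon>"
    and x: "x \<in> off_hyp S" "dist x x0 \<le> 1" and h: "2 * h \<le> 1"
  shows "(\<forall>j<k. 2 ^ j * \<bar>x $ axis1 S\<bar> < h) \<Longrightarrow>
     hnorm \<T> 0 (f (mv k x) - f x) \<le> C * (2 ^ k * \<bar>x $ axis1 S\<bar>) powr (\<epsilon> / s1) / (2 powr (\<epsilon> / s1) - 1)"
proof (induction k)
  case 0
  have "1 < 2 powr (\<epsilon> / s1)" using C s1_pos by simp
  then show ?case using C hnorm_0[OF reg zero_idx] by (simp add: mv_0)
next
  case (Suc k)
  define a where "a = \<bar>x $ axis1 S\<bar>"
  define b where "b = 2 powr (\<epsilon> / s1)"
  have b1: "1 < b" using C s1_pos by (simp add: b_def)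
  have a: "0 < a" using x by (simp add: a_def off_hyp_def)
  have kh: "2 ^ k * a < h" using Suc.prems by (simp add: a_def)
  have ka: "0 < 2 ^ k * a" using a by simp
  let ?p = "phi2 S (mv k x) (mv (Suc k) x)"
  have ab: "\<bar>mv k x $ axis1 S\<bar> = 2 ^ k * a" "\<bar>mv (Suc k) x $ axis1 S\<bar> = 2 * (2 ^ k * a)"
    by (simp_all add: mv_axis1 a_def abs_mult)
  have le1: "2 ^ k * a \<le> 1" "2 * (2 ^ k * a) \<le> 1" using kh h by auto
  have "phi S (mv k x) = (2 ^ k * a) powr (1 / s1)"
    unfolding phi_def ab using le1 ka s1_pos by (simp add: powr_le1)
  moreover have "phi S (mv (Suc k) x) = (2 * (2 ^ k * a)) powr (1 / s1)"
    unfolding phi_def ab using le1 ka s1_pos by (simp add: powr_le1)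
  moreover have "(2 ^ k * a) powr (1 / s1) \<le> (2 * (2 ^ k * a)) powr (1 / s1)"
    using a s1_pos by (intro powr_mono2) auto
  ultimately have p: "?p = (2 ^ k * a) powr (1 / s1)" by (simp add: phi2_def min_def)
  have "snorm S (mv (Suc k) x - mv k x) = (2 ^ k * a) powr (1 / s1)"
  proof -
    have "\<bar>(mv (Suc k) x - mv k x) $ axis1 S\<bar> = 2 ^ k * a"
      by (simp add: mv_axis1 left_diff_distrib[symmetric] abs_mult a_def)
    moreover have "(mv (Suc k) x - mv k x) $ i = 0" if "i \<noteq> axis1 S" for i using that by (simp add: mv_other)
    ultimately show ?thesis
      unfolding snorm_def by (subst sum.remove[of _ "axis1 S"]) auto
  qed
  then have sn: "snorm S (mv (Suc k) x - mv k x) \<le> 5 * ?p" unfolding p by simp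
  have d: "dist (mv k x) x0 \<le> 2" "dist (mv (Suc k) x) x0 \<le> 2"
    using dist_mv[of k x] dist_mv[of "Suc k" x] le1 x dist_triangle[of "mv k x" x0 x] dist_triangle[of "mv (Suc k) x" x0 x]
    by (auto simp: a_def)
  have pe: "?p powr \<epsilon> = (2 ^ k * a) powr (\<epsilon> / s1)" unfolding p by (simp add: powr_powr)
  have step: "hnorm \<T> 0 (f (mv (Suc k) x) - f (mv k x)) \<le> C * (2 ^ k * a) powr (\<epsilon> / s1)"
    using C(3)[OF mv_off[OF x(1)] mv_off[OF x(1)] d sn] unfolding pe .
  have IH: "hnorm \<T> 0 (f (mv k x) - f x) \<le> C * (2 ^ k * a) powr (\<epsilon> / s1) / (b - 1)"
    using Suc.IH Suc.prems by (simp add: a_def b_def)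
  have "hnorm \<T> 0 (f (mv (Suc k) x) - f x) \<le> C * (2 ^ k * a) powr (\<epsilon> / s1) + C * (2 ^ k * a) powr (\<epsilon> / s1) / (b - 1)"
    using hn_triangle[of "f (mv (Suc k) x)" "f x" "f (mv k x)"] step IH by linarith
  \<comment> \<open>With p the current power, p + p / (b - 1) = b p / (b - 1): the growing geometric
    series is a fixed multiple of its last term.\<close>
  also have "\<dots> = C * (b * (2 ^ k * a) powr (\<epsilon> / s1)) / (b - 1)"
    using b1 by (simp add: field_simps)
  also have "b * (2 ^ k * a) powr (\<epsilon> / s1) = (2 ^ Suc k * a) powr (\<epsilon> / s1)"
    by (simp add: b_def powr_mult[symmetric] mult.assoc)
  finally show ?case by (simp add: a_def b_def)
qed

text \<open>Two points may be much closer to the hyperplane than to each other, where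
  \<open>increment_near\<close> says nothing. Both are moved up to heights in [h, 2h), where their
  distance is bounded by a multiple of the distance to the hyperplane. The two chains and the middle
  step are each of order h powr \<beta>.\<close>

lemma osc_component:
  assumes x0: "x0 \<notin> off_hyp S" and e: "0 < e"
  obtains d where "0 < d" "d \<le> 1" "\<And>y y'. y \<in> off_hyp S \<Longrightarrow> y' \<in> off_hyp S \<Longrightarrow> dist y x0 < d \<Longrightarrow> dist y' x0 < d \<Longrightarrow>
     hnorm \<T> 0 (f y - f y') \<le> e"
proof -
  obtain C \<epsilon> where C: "0 \<le> C" "0 < \<epsilon>"
    "\<And>x y. x \<in> off_hyp S \<Longrightarrow> y \<in> off_hyp S \<Longrightarrow> dist x x0 \<le> 2 \<Longrightarrow> dist y x0 \<le> 2 \<Longrightarrow> snorm S (y - x) \<le> 5 * phi2 S x y \<Longrightarrow>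
       hnorm \<T> 0 (f y - f x) \<le> C * phi2 S x y powr \<epsilon>"
    by (rule increment_near[of x0]) (rule that)
  define \<beta> where "\<beta> = \<epsilon> / s1"
  have be: "0 < \<beta>" using C s1_pos by (simp add: \<beta>_def)
  define q where "q = 2 powr \<beta> - 1"
  have q: "0 < q" using be by (simp add: q_def)
  \<comment> \<open>Two chains contribute C / q each and the middle step C, all times (2h) powr
    \<beta>.\<close>
  define M' where "M' = (2 * C / q + C) * 2 powr \<beta>"
  have M': "0 \<le> M'" using C q by (simp add: M'_def)
  obtain h0 where h0: "0 < h0" "\<And>t. 0 < t \<Longrightarrow> t \<le> h0 \<Longrightarrow> M' * t powr \<beta> \<le> e"
    using vanishing_powr[OF M' be e] by blast
  define h where "h = min h0 (1/2)"
  have h: "0 < h" "2 * h \<le> 1" "M' * h powr \<beta> \<le> e" using h0 by (auto simp: h_def)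
  let ?r = "h powr (1 / s1)"
  have "\<exists>d>0. \<forall>z. dist z 0 < d \<longrightarrow> dist (snorm S z) (snorm S 0) < ?r"
    using continuous_snorm[unfolded continuous_on_iff, rule_format, of 0 ?r] h by simp
  then obtain d1 where d1: "0 < d1" "\<And>z. norm z < d1 \<Longrightarrow> snorm S z < ?r" by (auto simp: abs_of_nonneg[OF snorm_nonneg])
  define d where "d = min h (d1 / 2)"
  have d: "0 < d" "d \<le> 1" "d \<le> h" "d \<le> d1 / 2" using h d1 by (auto simp: d_def)
  have esc: "\<exists>m. h \<le> 2 ^ m * \<bar>y $ axis1 S\<bar> \<and> 2 ^ m * \<bar>y $ axis1 S\<bar> < 2 * h \<and> hnorm \<T> 0 (f (mv m y) - f y) \<le> C / q * (2 * h) powr \<beta>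
       \<and> dist (mv m y) x0 \<le> 2"
    if y: "y \<in> off_hyp S" "dist y x0 < d" for y
  proof -
    define a where "a = \<bar>y $ axis1 S\<bar>"
    have a: "0 < a" using y by (simp add: a_def off_hyp_def)
    have "a = \<bar>(y - x0) $ axis1 S\<bar>" using x0 by (simp add: a_def off_hyp_def)
    also have "\<dots> \<le> norm (y - x0)" by (rule component_le_norm_cart)
    finally have ah: "a < h" using y d by (simp add: dist_norm)
    have "\<exists>m. h / a < 2 ^ m" by (rule real_arch_pow) simp
    then have ex: "\<exists>m. h \<le> 2 ^ m * a" using a by (auto simp: field_simps intro: less_imp_le)
    \<comment> \<open>The first doubling that reaches height h. The point starts below h, so m > 0,
      and the step before m keeps the height below 2h.\<close>
    define m where "m = (LEAST m. h \<le> 2 ^ m * a)"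
    have m1: "h \<le> 2 ^ m * a" unfolding m_def using ex by (rule LeastI_ex)
    have m2: "2 ^ j * a < h" if "j < m" for j
      using not_less_Least[OF that[unfolded m_def]] by simp
    have "m \<noteq> 0" using m1 ah by (auto intro: ccontr)
    then obtain k where k: "m = Suc k" by (cases m) auto
    have m3: "2 ^ m * a < 2 * h" using m2[of k] k by simp
    have "hnorm \<T> 0 (f (mv m y) - f y) \<le> C * (2 ^ m * a) powr (\<epsilon> / s1) / (2 powr (\<epsilon> / s1) - 1)"
      unfolding a_def by (rule doubling_chain[OF C y(1) _ h(2)]) (use y d m2 in \<open>auto simp: a_def\<close>)
    also have "\<dots> = C / q * (2 ^ m * a) powr \<beta>" by (simp add: q_def \<beta>_def)
    also have "\<dots> \<le> C / q * (2 * h) powr \<beta>"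
      using C q m3 a be by (intro mult_left_mono powr_mono2) auto
    finally have "hnorm \<T> 0 (f (mv m y) - f y) \<le> C / q * (2 * h) powr \<beta>" .
    moreover have "dist (mv m y) x0 \<le> 2"
      using dist_mv[of m y] m3 h y d dist_triangle[of "mv m y" x0 y] by (simp add: a_def)
    ultimately show ?thesis using m1 m3 unfolding a_def by blast
  qed
  show ?thesis
  proof (rule that[OF d(1,2)])
    fix y y' assume y: "y \<in> off_hyp S" "dist y x0 < d" and y': "y' \<in> off_hyp S" "dist y' x0 < d"
    obtain m where m: "h \<le> 2 ^ m * \<bar>y $ axis1 S\<bar>" "2 ^ m * \<bar>y $ axis1 S\<bar> < 2 * h"
      "hnorm \<T> 0 (f (mv m y) - f y) \<le> C / q * (2 * h) powr \<beta>" "dist (mv m y) x0 \<le> 2" using esc[OF y] by blast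
    obtain m' where m': "h \<le> 2 ^ m' * \<bar>y' $ axis1 S\<bar>" "2 ^ m' * \<bar>y' $ axis1 S\<bar> < 2 * h"
      "hnorm \<T> 0 (f (mv m' y') - f y') \<le> C / q * (2 * h) powr \<beta>" "dist (mv m' y') x0 \<le> 2" using esc[OF y'] by blast
    let ?Y = "mv m y" and ?Y' = "mv m' y'"
    have abs: "\<bar>?Y $ axis1 S\<bar> = 2 ^ m * \<bar>y $ axis1 S\<bar>" "\<bar>?Y' $ axis1 S\<bar> = 2 ^ m' * \<bar>y' $ axis1 S\<bar>"
      by (simp_all add: mv_axis1 abs_mult)
    have ph: "?r \<le> phi S z \<and> phi S z \<le> (2 * h) powr (1 / s1)" if "h \<le> \<bar>z $ axis1 S\<bar>" "\<bar>z $ axis1 S\<bar> < 2 * h" for z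
    proof -
      have "?r \<le> \<bar>z $ axis1 S\<bar> powr (1 / s1)" "\<bar>z $ axis1 S\<bar> powr (1 / s1) \<le> (2 * h) powr (1 / s1)"
        using that h s1_pos by (auto intro!: powr_mono2)
      moreover have "?r \<le> 1" using h s1_pos by (intro powr_le1) auto
      ultimately show ?thesis by (auto simp: phi_def)
    qed
    have pY: "?r \<le> phi2 S ?Y' ?Y" "phi2 S ?Y' ?Y \<le> (2 * h) powr (1 / s1)"
      using ph[of ?Y] ph[of ?Y'] m m' unfolding abs phi2_def by auto
    \<comment> \<open>The first coordinates differ by at most 4h, of scaled size at most 4 times
      \<open>?r\<close>; the other coordinates have not moved and add at most \<open>?r\<close>.
      This is the origin of the factor 5 in \<open>increment_near\<close>.\<close>
    have sn: "snorm S (?Y - ?Y') \<le> 5 * phi2 S ?Y' ?Y"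
    proof -
      have "snorm S (?Y - ?Y') = \<bar>(?Y - ?Y') $ axis1 S\<bar> powr (1 / s1) + (\<Sum>i\<in>UNIV - {axis1 S}. \<bar>(?Y - ?Y') $ i\<bar> powr (1 / scl S $ i))"
        unfolding snorm_def by (rule sum.remove) auto
      also have "(\<Sum>i\<in>UNIV - {axis1 S}. \<bar>(?Y - ?Y') $ i\<bar> powr (1 / scl S $ i)) = (\<Sum>i\<in>UNIV - {axis1 S}. \<bar>(y - y') $ i\<bar> powr (1 / scl S $ i))"
        by (intro sum.cong) (auto simp: mv_other)
      also have "\<dots> \<le> snorm S (y - y')" unfolding snorm_def by (intro sum_mono2) auto
      also have "snorm S (y - y') \<le> ?r"
      proof -
        have "norm (y - y') \<le> dist y x0 + dist y' x0" using dist_triangle2[of y y' x0] by (simp add: dist_norm)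
        then have "norm (y - y') < d1" using y y' d by linarith
        then show ?thesis using d1(2) by (simp add: less_imp_le)
      qed
      also have "\<bar>(?Y - ?Y') $ axis1 S\<bar> powr (1 / s1) \<le> (4 * h) powr (1 / s1)"
      proof (rule powr_mono2)
        have "\<bar>(?Y - ?Y') $ axis1 S\<bar> \<le> \<bar>?Y $ axis1 S\<bar> + \<bar>?Y' $ axis1 S\<bar>" by simp
        then show "\<bar>(?Y - ?Y') $ axis1 S\<bar> \<le> 4 * h" using m m' unfolding abs by linarith
      qed (use s1_pos in auto)
      also have "(4 * h) powr (1 / s1) = 4 powr (1 / s1) * ?r" using h by (simp add: powr_mult)
      also have "4 powr (1 / s1) * ?r \<le> 4 * ?r"
      proof (rule mult_right_mono)
        have "(4::real) powr (1 / s1) \<le> 4 powr 1" using scl_ge1[of "axis1 S"] by (intro powr_mono) auto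
        then show "(4::real) powr (1 / s1) \<le> 4" by simp
      qed simp
      finally show ?thesis using pY(1) by simp
    qed
    have "hnorm \<T> 0 (f ?Y - f ?Y') \<le> C * phi2 S ?Y' ?Y powr \<epsilon>"
      by (rule C(3)[OF mv_off[OF y'(1)] mv_off[OF y(1)] m'(4) m(4) sn])
    also have "\<dots> \<le> C * ((2 * h) powr (1 / s1)) powr \<epsilon>"
      using C pY h phi2_pos[OF mv_off[OF y'(1)] mv_off[OF y(1)]] by (intro mult_left_mono powr_mono2) (auto intro: less_imp_le)
    also have "\<dots> = C * (2 * h) powr \<beta>" by (simp add: powr_powr \<beta>_def)
    finally have Y: "hnorm \<T> 0 (f ?Y - f ?Y') \<le> C * (2 * h) powr \<beta>" .
    have "hnorm \<T> 0 (f y - f y') \<le> hnorm \<T> 0 (f ?Y - f y) + (hnorm \<T> 0 (f ?Y - f ?Y') + hnorm \<T> 0 (f ?Y' - f y'))"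
      using hn_triangle[of "f y" "f y'" "f ?Y"] hn_triangle[of "f ?Y" "f y'" "f ?Y'"] hn_commute[of "f y" "f ?Y"] by linarith
    also have "\<dots> \<le> C / q * (2 * h) powr \<beta> + (C * (2 * h) powr \<beta> + C / q * (2 * h) powr \<beta>)"
      by (intro add_mono m m' Y)
    also have "\<dots> = M' * h powr \<beta>" using h by (simp add: M'_def powr_mult algebra_simps)
    also have "\<dots> \<le> e" by (rule h(3))
    finally show "hnorm \<T> 0 (f y - f y') \<le> e" .
  qed
qed

text \<open>The reference is the degree 0 component of f at one point z near x0: its function is
  continuous at x0, and \<open>osc_component\<close> controls how far the evaluations deviate from
  it.\<close>

lemma osc_hyperplane:
  assumes x0: "x0 \<notin> off_hyp S" and e: "0 < e"
  shows "\<exists>c d. 0 < d \<and> (\<forall>y\<in>off_hyp S. dist y x0 < d \<longrightarrow> \<bar>ev P y (f y) y - c\<bar> \<le> e)"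
proof -
  obtain N where N: "0 \<le> N" "pi_le N P" by (rule pi_obtain)
  obtain cw where cw: "0 < cw" "\<And>x. x \<in> cball x0 1 \<Longrightarrow> cw \<le> wfun w x" by (rule wfun_lower_local[OF w, of 1 x0]) (simp, rule that)
  define e1 where "e1 = e / 2 * (cw / (N + 1))"
  have e1: "0 < e1" using e cw N by (simp add: e1_def)
  obtain d where d: "0 < d" "d \<le> 1" "\<And>y y'. y \<in> off_hyp S \<Longrightarrow> y' \<in> off_hyp S \<Longrightarrow> dist y x0 < d \<Longrightarrow> dist y' x0 < d \<Longrightarrow>
     hnorm \<T> 0 (f y - f y') \<le> e1" by (rule osc_component[OF x0 e1]) (rule that)
  obtain z where z: "z \<in> off_hyp S" "dist z x0 < d" using off_hyp_dense[OF d(1)] by blast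
  let ?g = "ev P 0 (proj \<T> 0 (f z))"
  have "\<exists>d>0. \<forall>y. dist y x0 < d \<longrightarrow> dist (?g y) (?g x0) < e / 2"
    using ev_continuous[of 0 "proj \<T> 0 (f z)", unfolded continuous_on_iff, rule_format, of x0 "e / 2"] e by simp
  then obtain d2 where d2: "0 < d2" "\<And>y. dist y x0 < d2 \<Longrightarrow> \<bar>?g y - ?g x0\<bar> < e / 2" by (auto simp: dist_real_def)
  have "\<bar>ev P y (f y) y - ?g x0\<bar> \<le> e" if y: "y \<in> off_hyp S" "dist y x0 < min d d2" for y
  proof -
    have wy: "cw \<le> wfun w y" using y d by (intro cw) (auto simp: dist_commute)
    have "\<bar>ev P y (f y) y - ?g y\<bar> \<le> N / wfun w y * hnorm \<T> 0 (f y - f z)"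
      by (rule ev_proj[OF N(2,1) f_below[OF y(1)] f_below[OF z(1)]])
    also have "\<dots> \<le> (N + 1) / cw * e1"
      using N cw wy y z d(3)[OF y(1) z(1)] hnorm_nonneg[OF reg zero_idx] by (intro mult_mono frac_le) auto
    also have "\<dots> = e / 2"
    proof -
      have "a / b * (e / 2 * (b / a)) = e / 2" if "0 < a" "0 < b" for a b :: real using that by simp
      from this[of "N + 1" cw] show ?thesis using N cw by (simp add: e1_def)
    qed
    finally have "\<bar>ev P y (f y) y - ?g y\<bar> \<le> e / 2" .
    moreover have "\<bar>?g y - ?g x0\<bar> < e / 2" using y by (intro d2(2)) auto
    ultimately show ?thesis by linarith
  qed
  then show ?thesis using d d2 by (intro exI[of _ "?g x0"] exI[of _ "min d d2"]) auto
qed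

lemma rec_besov_zero: "Rec P f \<in> besov S 0 u"
proof -
  obtain U where U: "continuous_on UNIV U" "\<And>x. x \<in> off_hyp S \<Longrightarrow> U x = ev P x (f x) x"
  proof (rule continuous_extension_from_dense[of "off_hyp S" "\<lambda>x. ev P x (f x) x"])
    show "\<exists>y\<in>off_hyp S. dist y x < e" if "0 < e" for x e by (rule off_hyp_dense[OF that])
    show "\<exists>c d. 0 < d \<and> (\<forall>y\<in>off_hyp S. dist y x < d \<longrightarrow> \<bar>ev P y (f y) y - c\<bar> \<le> e)" if "0 < e" for x e
      using osc_off_hyp[OF _ that, of x] osc_hyperplane[OF _ that, of x] by blast
  qed (rule that)
  show ?thesis
    by (rule rec_besov_0I[OF M f zeta_0 U(1)]) (simp add: U(2) ev_tendsto)
qed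

end

end

section \<open>Assembly of the critical case and of the estimates in extended real numbers\<close>

lemma rec_besov_critical:
  assumes M: "(P, \<Gamma>) \<in> mods" and f: "f \<in> mdists \<Gamma>" and "min \<alpha>0 0 < \<eta>"
  shows "Rec P f \<in> besov S \<zeta> u"
proof -
  show ?thesis
  proof (cases rule: linorder_cases[of \<alpha>0 0])
    case less
    then show ?thesis using assms(3) by (intro rec_besov_negative[OF M f]) auto
  next
    case equal
    then have "Rec P f \<in> besov S 0 u" using assms(3) by (intro rec_besov_zero[OF M f]) auto
    then show ?thesis using zeta_0[OF M f] equal assms(3) by simp
  next
    case greater
    then have "Rec P f \<in> besov S 0 u" using assms(3) by (intro rec_besov_positive[OF M f]) auto
    then show ?thesis using zeta_0[OF M f] greater assms(3) by simp
  qed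
qed

text \<open>Gives finiteness of the singular norm of the difference from the two separate bounds,
  also where that norm does not occur in the estimate to be proved.\<close>

lemma sing_norm_diff: "sing_norm S \<T> \<gamma> \<eta> v (\<lambda>x. f1 x - f2 x) \<le> sing_norm S \<T> \<gamma> \<eta> v f1 + sing_norm S \<T> \<gamma> \<eta> v f2"
  unfolding sing_norm_def[of S \<T> \<gamma> \<eta> v "\<lambda>x. f1 x - f2 x"]
proof (intro SUP_least)
  fix \<alpha> x assume \<alpha>: "\<alpha> \<in> I" and x: "x \<in> off_hyp S"
  let ?s = "phi S x powr (min (\<eta> - \<alpha>) 0)"
  have ai: "\<alpha> \<in> idx \<T>" using \<alpha> by simp
  have up: "ennreal (wfun v x * hnorm \<T> \<alpha> (g x) / ?s) \<le> sing_norm S \<T> \<gamma> \<eta> v g" for g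
    unfolding sing_norm_def by (rule SUP_upper2[OF \<alpha>], rule SUP_upper2[OF x], simp)
  have "wfun v x * hnorm \<T> \<alpha> (f1 x - f2 x) / ?s \<le> wfun v x * (hnorm \<T> \<alpha> (f1 x) + hnorm \<T> \<alpha> (f2 x)) / ?s"
    using wfun_pos[OF v, of x] hnorm_triangle_diff[OF reg ai] by (intro divide_right_mono mult_left_mono) auto
  then have le: "wfun v x * hnorm \<T> \<alpha> (f1 x - f2 x) / ?s \<le> wfun v x * hnorm \<T> \<alpha> (f1 x) / ?s + wfun v x * hnorm \<T> \<alpha> (f2 x) / ?s"
    by (simp add: distrib_left add_divide_distrib)
  show "ennreal (wfun v x * hnorm \<T> \<alpha> (f1 x - f2 x) / ?s) \<le> sing_norm S \<T> \<gamma> \<eta> v f1 + sing_norm S \<T> \<gamma> \<eta> v f2"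
    using wfun_pos[OF v, of x] hnorm_nonneg[OF reg ai] by (intro ennreal_le_add[OF le] up) (auto intro!: divide_nonneg_nonneg mult_nonneg_nonneg less_imp_le)
qed

end

theorem theorem3p7:
  fixes S :: "('n::finite) setting"
    and \<T> :: "('v::real_vector) regstruct"
    and w v w1 w2 :: "'n weight"
    and \<alpha>0 \<gamma> \<eta> \<zeta> :: real
  assumes "G_semigroup S"
    and "regularity_structure \<T> \<alpha>0"
    and "G_controlled S w" and "G_controlled S v" and "G_controlled S (wmul w v)"
    and "auxiliary_weights S w w1 w2"
    and "0 < \<gamma>" and "\<gamma> - scl S $ axis1 S < \<eta>" and "\<eta> \<le> \<gamma>"
    and "\<zeta> = min (min \<eta> \<alpha>0) 0"
  shows
    "(\<forall>(P, \<Gamma>) \<in> models S \<T> \<alpha>0 w w1. \<forall>f \<in> modelled S \<T> \<gamma> \<eta> v \<Gamma>.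
        (\<exists>!\<Lambda>. is_reconstruction S \<gamma> \<eta> (wmul w v) P f \<Lambda>) \<and>
        (\<forall>\<zeta>'<\<zeta>. reconstruction S \<gamma> \<eta> (wmul w v) P f \<in> besov S \<zeta>' (wmul w v)) \<and>
        besov_norm S \<zeta> (wmul w v) (reconstruction S \<gamma> \<eta> (wmul w v) P f) < \<infinity> \<and>
        (min \<alpha>0 0 < \<eta> \<longrightarrow> reconstruction S \<gamma> \<eta> (wmul w v) P f \<in> besov S \<zeta> (wmul w v))) \<and>
     (\<exists>c>0. \<forall>(P, \<Gamma>) \<in> models S \<T> \<alpha>0 w w1. \<forall>f \<in> modelled S \<T> \<gamma> \<eta> v \<Gamma>.
        besov_norm S \<zeta> (wmul w v) (reconstruction S \<gamma> \<eta> (wmul w v) P f)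
          \<le> ennreal c * (pi_norm S \<T> \<gamma> w P * md_norm S \<T> \<gamma> \<eta> v \<Gamma> f) \<and>
        rec_norm S \<gamma> \<eta> (wmul w v) (local_err P f (reconstruction S \<gamma> \<eta> (wmul w v) P f))
          \<le> ennreal c * (pi_norm S \<T> \<gamma> w P * sharp_norm S \<T> \<gamma> \<eta> v (delta \<Gamma> f))) \<and>
     (\<exists>a b. (\<forall>R>0. 0 < a + b * R) \<and>
        (\<forall>R>0. \<forall>(P1, \<Gamma>1) \<in> models S \<T> \<alpha>0 w w1. \<forall>(P2, \<Gamma>2) \<in> models S \<T> \<alpha>0 w w1.
          \<forall>f1 \<in> modelled S \<T> \<gamma> \<eta> v \<Gamma>1. \<forall>f2 \<in> modelled S \<T> \<gamma> \<eta> v \<Gamma>2.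
            model_norm S \<T> \<gamma> w (P1, \<Gamma>1) \<le> ennreal R \<and> model_norm S \<T> \<gamma> w (P2, \<Gamma>2) \<le> ennreal R \<and>
            md_norm S \<T> \<gamma> \<eta> v \<Gamma>1 f1 \<le> ennreal R \<and> md_norm S \<T> \<gamma> \<eta> v \<Gamma>2 f2 \<le> ennreal R \<longrightarrow>
            besov_norm S \<zeta> (wmul w v)
                (qdiff (reconstruction S \<gamma> \<eta> (wmul w v) P1 f1) (reconstruction S \<gamma> \<eta> (wmul w v) P2 f2))
              \<le> ennreal (a + b * R)
                * (pi_norm S \<T> \<gamma> w (pi_diff P1 P2) + md_dist S \<T> \<gamma> \<eta> v \<Gamma>1 f1 \<Gamma>2 f2) \<and>
            rec_norm S \<gamma> \<eta> (wmul w v)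
                (\<lambda>x. qdiff (local_err P1 f1 (reconstruction S \<gamma> \<eta> (wmul w v) P1 f1) x)
                           (local_err P2 f2 (reconstruction S \<gamma> \<eta> (wmul w v) P2 f2) x))
              \<le> ennreal (a + b * R)
                * (pi_norm S \<T> \<gamma> w (pi_diff P1 P2) + sharp_dist S \<T> \<gamma> \<eta> v \<Gamma>1 f1 \<Gamma>2 f2)))"
proof -
  interpret rec_setting S \<T> \<alpha>0 \<gamma> \<eta> \<zeta> w v w1
    using assms by unfold_locales (auto simp: auxiliary_weights_def)
  let ?w = "wmul w v"
  have bnorm: "besov_norm S \<zeta> ?w \<Lambda> \<le> ennreal c"
    if "\<And>t. t \<in> {0<..1} \<Longrightarrow> continuous_on UNIV (\<Lambda> t)" "0 \<le> c"
      "\<forall>t\<in>{0<..1}. \<forall>x. \<bar>\<Lambda> t x\<bar> \<le> c * t powr (\<zeta> / ell S) / wfun ?w x" for \<Lambda> c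
    using that by (subst besov_norm_le_iff[OF wv]) auto
  have 1: "(\<exists>!\<Lambda>. is_reconstruction S \<gamma> \<eta> ?w P f \<Lambda>) \<and>
        (\<forall>\<zeta>'<\<zeta>. Rec P f \<in> besov S \<zeta>' ?w) \<and> besov_norm S \<zeta> ?w (Rec P f) < \<infinity> \<and>
        (min \<alpha>0 0 < \<eta> \<longrightarrow> Rec P f \<in> besov S \<zeta> ?w)"
    if M: "(P, \<Gamma>) \<in> mods" and f: "f \<in> mdists \<Gamma>" for P \<Gamma> f
  proof (intro conjI allI impI)
    note r = rec_facts[OF M f]
    show "\<exists>!\<Lambda>. is_reconstruction S \<gamma> \<eta> ?w P f \<Lambda>" using r(1) rec_unique[OF M] by blast
    show "Rec P f \<in> besov S \<zeta>' ?w" if "\<zeta>' < \<zeta>" for \<zeta>' using r(5)[OF that] .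
    obtain c where c: "0 \<le> c" "\<forall>t\<in>{0<..1}. \<forall>x. \<bar>Rec P f t x\<bar> \<le> c * t powr (\<zeta> / ell S) / wfun ?w x" using r(8) by blast
    have "besov_norm S \<zeta> ?w (Rec P f) \<le> ennreal c" by (rule bnorm[OF Cw_continuous[OF r(3)] c])
    then show "besov_norm S \<zeta> ?w (Rec P f) < \<infinity>" by (rule le_less_trans) simp
    show "Rec P f \<in> besov S \<zeta> ?w" if "min \<alpha>0 0 < \<eta>" by (rule rec_besov_critical[OF M f that])
  qed
  have 2: "\<exists>c>0. \<forall>P \<Gamma> f. (P, \<Gamma>) \<in> mods \<longrightarrow> f \<in> mdists \<Gamma> \<longrightarrow>
        besov_norm S \<zeta> ?w (Rec P f) \<le> ennreal c * (pi_norm S \<T> \<gamma> w P * md_norm S \<T> \<gamma> \<eta> v \<Gamma> f) \<and>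
        rec_norm S \<gamma> \<eta> ?w (local_err P f (Rec P f))
          \<le> ennreal c * (pi_norm S \<T> \<gamma> w P * sharp_norm S \<T> \<gamma> \<eta> v (delta \<Gamma> f))"
  proof (rule rec_bounds)
    fix C :: real
    assume C: "0 < C" and bounds: "\<And>P \<Gamma> f N K L. (P, \<Gamma>) \<in> mods \<Longrightarrow> f \<in> mdists \<Gamma> \<Longrightarrow> pi_norm S \<T> \<gamma> w P = ennreal N \<Longrightarrow> 0 \<le> N \<Longrightarrow>
       sharp_norm S \<T> \<gamma> \<eta> v (delta \<Gamma> f) = ennreal K \<Longrightarrow> 0 \<le> K \<Longrightarrow> sing_norm S \<T> \<gamma> \<eta> v f = ennreal L \<Longrightarrow> 0 \<le> L \<Longrightarrow>
       is_reconstruction S \<gamma> \<eta> u P f (Rec P f) \<and> consistent S (Rec P f) \<and> (\<forall>t\<in>{0<..1}. Rec P f t \<in> Cw u) \<and>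
       (\<forall>t. t \<notin> {0<..1} \<longrightarrow> Rec P f t = (\<lambda>x. 0)) \<and> (\<forall>\<zeta>'<\<zeta>. Rec P f \<in> besov S \<zeta>' u) \<and>
       (\<forall>t\<in>{0<..1}. \<forall>x\<in>off_hyp S. \<bar>Rec P f t x - P x (f x) t x\<bar> \<le> C * (N * K) * t powr (\<gamma> / ell S) * phi S x powr (-\<kappa>) / wfun u x) \<and>
       (\<forall>t\<in>{0<..1}. \<exists>s. 0 < s \<and> s \<le> t / 2 \<and> t \<le> 4 * s \<and>
           (\<forall>x. \<bar>Rec P f t x - qint S (t - s) (Fgerm P f s) x\<bar> \<le> C * (N * K) * t powr (\<eta> / ell S) / wfun u x)) \<and>
       (\<forall>t\<in>{0<..1}. \<forall>x. \<bar>Rec P f t x\<bar> \<le> C * (N * K + N * L) * t powr (\<zeta> / ell S) / wfun u x)"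
    show ?thesis
    proof (intro exI[of _ C] conjI C allI impI)
      fix P \<Gamma> f assume M: "(P, \<Gamma>) \<in> mods" and f: "f \<in> mdists \<Gamma>"
      obtain K L where KL: "sharp_norm S \<T> \<gamma> \<eta> v (delta \<Gamma> f) = ennreal K" "0 \<le> K" "sing_norm S \<T> \<gamma> \<eta> v f = ennreal L" "0 \<le> L"
        by (rule modelled_norms[OF f])
      obtain N where N: "pi_norm S \<T> \<gamma> w P = ennreal N" "0 \<le> N" using finite_ennreal[OF pi_norm_finite[OF M]] by blast
      note b = bounds[OF M f N KL]
      have nn: "0 \<le> C * (N * K)" "0 \<le> C * (N * K + N * L)" using C N KL by auto
      have "besov_norm S \<zeta> ?w (Rec P f) \<le> ennreal (C * (N * K + N * L))"
        using b by (intro bnorm Cw_continuous nn(2)) auto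
      also have "\<dots> = ennreal C * (ennreal N * (ennreal L + ennreal K))"
        using C N KL by (simp add: ennreal_mult[symmetric] ennreal_plus[symmetric] distrib_left add.commute del: ennreal_plus)
      finally show "besov_norm S \<zeta> ?w (Rec P f) \<le> ennreal C * (pi_norm S \<T> \<gamma> w P * md_norm S \<T> \<gamma> \<eta> v \<Gamma> f)"
        by (simp add: md_norm_def N KL)
      have "rec_norm S \<gamma> \<eta> ?w (local_err P f (Rec P f)) \<le> ennreal (C * (N * K))"
        unfolding rec_norm_le_iff[OF nn(1)] using b by (simp add: local_err_def qdiff_def)
      then show "rec_norm S \<gamma> \<eta> ?w (local_err P f (Rec P f))
          \<le> ennreal C * (pi_norm S \<T> \<gamma> w P * sharp_norm S \<T> \<gamma> \<eta> v (delta \<Gamma> f))"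
        using C N KL by (simp add: ennreal_mult[symmetric])
    qed
  qed
  have 3: "\<exists>a b. (\<forall>R>0. 0 < a + b * R) \<and>
        (\<forall>R P1 \<Gamma>1 P2 \<Gamma>2 f1 f2. 0 < R \<longrightarrow> (P1, \<Gamma>1) \<in> mods \<longrightarrow> (P2, \<Gamma>2) \<in> mods \<longrightarrow> f1 \<in> mdists \<Gamma>1 \<longrightarrow> f2 \<in> mdists \<Gamma>2 \<longrightarrow>
            model_norm S \<T> \<gamma> w (P1, \<Gamma>1) \<le> ennreal R \<and> model_norm S \<T> \<gamma> w (P2, \<Gamma>2) \<le> ennreal R \<and>
            md_norm S \<T> \<gamma> \<eta> v \<Gamma>1 f1 \<le> ennreal R \<and> md_norm S \<T> \<gamma> \<eta> v \<Gamma>2 f2 \<le> ennreal R \<longrightarrow>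
            besov_norm S \<zeta> ?w (qdiff (Rec P1 f1) (Rec P2 f2))
              \<le> ennreal (a + b * R) * (pi_norm S \<T> \<gamma> w (pi_diff P1 P2) + md_dist S \<T> \<gamma> \<eta> v \<Gamma>1 f1 \<Gamma>2 f2) \<and>
            rec_norm S \<gamma> \<eta> ?w (\<lambda>x. qdiff (local_err P1 f1 (Rec P1 f1) x) (local_err P2 f2 (Rec P2 f2) x))
              \<le> ennreal (a + b * R) * (pi_norm S \<T> \<gamma> w (pi_diff P1 P2) + sharp_dist S \<T> \<gamma> \<eta> v \<Gamma>1 f1 \<Gamma>2 f2))"
  proof (rule rec_diff_bounds)
    fix C :: real
    assume C: "0 < C" and bounds: "\<And>P1 \<Gamma>1 f1 P2 \<Gamma>2 f2 N2 Nd K1 Kd L1 Ld.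
       (P1, \<Gamma>1) \<in> mods \<Longrightarrow> f1 \<in> mdists \<Gamma>1 \<Longrightarrow> (P2, \<Gamma>2) \<in> mods \<Longrightarrow> f2 \<in> mdists \<Gamma>2 \<Longrightarrow>
       pi_norm S \<T> \<gamma> w P2 \<le> ennreal N2 \<Longrightarrow> 0 \<le> N2 \<Longrightarrow> pi_norm S \<T> \<gamma> w (pi_diff P1 P2) \<le> ennreal Nd \<Longrightarrow> 0 \<le> Nd \<Longrightarrow>
       sharp_norm S \<T> \<gamma> \<eta> v (delta \<Gamma>1 f1) \<le> ennreal K1 \<Longrightarrow> 0 \<le> K1 \<Longrightarrow> sing_norm S \<T> \<gamma> \<eta> v f1 \<le> ennreal L1 \<Longrightarrow> 0 \<le> L1 \<Longrightarrow>
       sharp_dist S \<T> \<gamma> \<eta> v \<Gamma>1 f1 \<Gamma>2 f2 \<le> ennreal Kd \<Longrightarrow> 0 \<le> Kd \<Longrightarrow> sing_norm S \<T> \<gamma> \<eta> v (\<lambda>x. f1 x - f2 x) \<le> ennreal Ld \<Longrightarrow> 0 \<le> Ld \<Longrightarrow>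
       (\<forall>t\<in>{0<..1}. \<forall>x\<in>off_hyp S. \<bar>(Rec P1 f1 t x - P1 x (f1 x) t x) - (Rec P2 f2 t x - P2 x (f2 x) t x)\<bar>
           \<le> C * (Nd * K1 + N2 * Kd) * t powr (\<gamma> / ell S) * phi S x powr (-\<kappa>) / wfun u x) \<and>
       (\<forall>t\<in>{0<..1}. \<forall>x. \<bar>Rec P1 f1 t x - Rec P2 f2 t x\<bar> \<le> C * ((Nd * K1 + N2 * Kd) + (Nd * L1 + N2 * Ld)) * t powr (\<zeta> / ell S) / wfun u x)"
    show ?thesis
    \<comment> \<open>The constant of \<open>rec_diff_bounds\<close> becomes linear in R once the
      norms of \<open>P2\<close> and \<open>f1\<close> are replaced by R. The factor 2 arises
      because the distance of the models occurs twice in the Besov bound.\<close>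
    proof (rule exI[of _ 1], rule exI[of _ "2 * C"], intro conjI allI impI)
      show "0 < 1 + 2 * C * R" if "0 < R" for R using C that by (simp add: add_pos_pos)
      fix R P1 \<Gamma>1 P2 \<Gamma>2 f1 f2
      assume R: "0 < (R::real)" and M1: "(P1, \<Gamma>1) \<in> mods" and M2: "(P2, \<Gamma>2) \<in> mods" and f1: "f1 \<in> mdists \<Gamma>1" and f2: "f2 \<in> mdists \<Gamma>2"
        and le: "model_norm S \<T> \<gamma> w (P1, \<Gamma>1) \<le> ennreal R \<and> model_norm S \<T> \<gamma> w (P2, \<Gamma>2) \<le> ennreal R \<and>
            md_norm S \<T> \<gamma> \<eta> v \<Gamma>1 f1 \<le> ennreal R \<and> md_norm S \<T> \<gamma> \<eta> v \<Gamma>2 f2 \<le> ennreal R"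
      let ?Nd = "pi_norm S \<T> \<gamma> w (pi_diff P1 P2)" and ?Kd = "sharp_dist S \<T> \<gamma> \<eta> v \<Gamma>1 f1 \<Gamma>2 f2"
        and ?Ld = "sing_norm S \<T> \<gamma> \<eta> v (\<lambda>x. f1 x - f2 x)" and ?c = "ennreal (1 + 2 * C * R)"
      have split: "X \<le> Z" "Y \<le> Z" if "X + Y \<le> Z" for X Y Z :: ennreal
        by (rule order_trans[OF add_increasing2[OF zero_le order_refl] that] order_trans[OF add_increasing[OF zero_le order_refl] that])+
      have "pi_norm S \<T> \<gamma> w P2 + gamma_norm S \<T> \<gamma> w \<Gamma>2 \<le> ennreal R" using le by (simp add: model_norm_def)
      note N2 = split(1)[OF this]
      have s1: "sing_norm S \<T> \<gamma> \<eta> v f1 + sharp_norm S \<T> \<gamma> \<eta> v (delta \<Gamma>1 f1) \<le> ennreal R"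
        and s2: "sing_norm S \<T> \<gamma> \<eta> v f2 + sharp_norm S \<T> \<gamma> \<eta> v (delta \<Gamma>2 f2) \<le> ennreal R"
        using le by (simp_all add: md_norm_def)
      note L1 = split(1)[OF s1] and K1 = split(2)[OF s1] and L2 = split(1)[OF s2]
      \<comment> \<open>\<open>rec_diff_bounds\<close> takes its norms as real numbers; this one is
        finite regardless of the right-hand side of the local estimate, which does not contain
        it.\<close>
      have "?Ld \<le> ennreal R + ennreal R" by (rule order_trans[OF sing_norm_diff add_mono[OF L1 L2]])
      also have "\<dots> < \<infinity>" by simp
      finally obtain Ld where Ld: "0 \<le> Ld" "?Ld = ennreal Ld" using finite_ennreal by blast
      have cpos: "0 < ?c" using C R by (simp add: add_pos_pos)
      have "besov_norm S \<zeta> ?w (qdiff (Rec P1 f1) (Rec P2 f2)) \<le> ?c * (?Nd + md_dist S \<T> \<gamma> \<eta> v \<Gamma>1 f1 \<Gamma>2 f2) \<and>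
            rec_norm S \<gamma> \<eta> ?w (\<lambda>x. qdiff (local_err P1 f1 (Rec P1 f1) x) (local_err P2 f2 (Rec P2 f2) x)) \<le> ?c * (?Nd + ?Kd)"
      \<comment> \<open>If one of the two distances is infinite, both right-hand sides are infinite,
        as the constant is positive.\<close>
      proof (cases "?Nd < \<infinity> \<and> ?Kd < \<infinity>")
        case True
        then obtain Nd Kd where Nd: "0 \<le> Nd" "?Nd = ennreal Nd" and Kd: "0 \<le> Kd" "?Kd = ennreal Kd"
          using finite_ennreal by blast
        have b: "(\<forall>t\<in>{0<..1}. \<forall>x\<in>off_hyp S. \<bar>(Rec P1 f1 t x - P1 x (f1 x) t x) - (Rec P2 f2 t x - P2 x (f2 x) t x)\<bar>
           \<le> C * (Nd * R + R * Kd) * t powr (\<gamma> / ell S) * phi S x powr (-\<kappa>) / wfun u x) \<and>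
          (\<forall>t\<in>{0<..1}. \<forall>x. \<bar>Rec P1 f1 t x - Rec P2 f2 t x\<bar> \<le> C * ((Nd * R + R * Kd) + (Nd * R + R * Ld)) * t powr (\<zeta> / ell S) / wfun u x)"
          using R Nd Kd Ld by (intro bounds[OF M1 f1 M2 f2 N2 _ _ _ K1 _ L1]) auto
        have nn: "0 \<le> C * (Nd * R + R * Kd)" "0 \<le> C * ((Nd * R + R * Kd) + (Nd * R + R * Ld))"
          using C R Nd Kd Ld by auto
        have "besov_norm S \<zeta> ?w (qdiff (Rec P1 f1) (Rec P2 f2)) \<le> ennreal (C * ((Nd * R + R * Kd) + (Nd * R + R * Ld)))"
        proof (rule bnorm[OF _ nn(2)])
          show "continuous_on UNIV (qdiff (Rec P1 f1) (Rec P2 f2) t)" if "t \<in> {0<..1}" for t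
            unfolding qdiff_def using rec_facts(3)[OF M1 f1 that] rec_facts(3)[OF M2 f2 that]
            by (intro continuous_on_diff Cw_continuous)
        qed (use b in \<open>simp add: qdiff_def\<close>)
        also have "\<dots> \<le> ennreal ((1 + 2 * C * R) * (Nd + (Ld + Kd)))"
        proof (rule ennreal_leI)
          have "C * ((Nd * R + R * Kd) + (Nd * R + R * Ld)) = 2 * C * R * (Nd + (Ld + Kd)) - C * R * (Ld + Kd)"
            by (simp add: algebra_simps)
          also have "\<dots> \<le> 2 * C * R * (Nd + (Ld + Kd))" using C R Ld Kd by simp
          also have "\<dots> \<le> (1 + 2 * C * R) * (Nd + (Ld + Kd))" using Nd Ld Kd by (intro mult_right_mono) auto
          finally show "C * ((Nd * R + R * Kd) + (Nd * R + R * Ld)) \<le> (1 + 2 * C * R) * (Nd + (Ld + Kd))" .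
        qed
        also have "\<dots> = ?c * (ennreal Nd + (ennreal Ld + ennreal Kd))"
          using C R Nd Ld Kd by (simp add: ennreal_mult ennreal_plus[symmetric] del: ennreal_plus)
        finally have bb: "besov_norm S \<zeta> ?w (qdiff (Rec P1 f1) (Rec P2 f2)) \<le> ?c * (?Nd + md_dist S \<T> \<gamma> \<eta> v \<Gamma>1 f1 \<Gamma>2 f2)"
          by (simp only: md_dist_def Nd(2) Ld(2) Kd(2))
        have "rec_norm S \<gamma> \<eta> ?w (\<lambda>x. qdiff (local_err P1 f1 (Rec P1 f1) x) (local_err P2 f2 (Rec P2 f2) x)) \<le> ennreal (C * (Nd * R + R * Kd))"
          unfolding rec_norm_le_iff[OF nn(1)] using b by (simp add: local_err_def qdiff_def)
        also have "\<dots> \<le> ennreal ((1 + 2 * C * R) * (Nd + Kd))"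
        proof (rule ennreal_leI)
          have "C * (Nd * R + R * Kd) = (C * R) * (Nd + Kd)" by (simp add: algebra_simps)
          also have "\<dots> \<le> (1 + 2 * C * R) * (Nd + Kd)" using C R Nd Kd by (intro mult_right_mono) auto
          finally show "C * (Nd * R + R * Kd) \<le> (1 + 2 * C * R) * (Nd + Kd)" .
        qed
        also have "\<dots> = ?c * (ennreal Nd + ennreal Kd)"
          using C R Nd Kd by (simp add: ennreal_mult ennreal_plus[symmetric] del: ennreal_plus)
        finally show ?thesis using bb by (simp only: Nd(2) Kd(2))
      next
        case False
        then have inf: "?Nd + ?Kd = top" "?Nd + md_dist S \<T> \<gamma> \<eta> v \<Gamma>1 f1 \<Gamma>2 f2 = top"
          by (auto simp: md_dist_def less_top[symmetric])
        have "?c * top = top" using cpos by (simp add: ennreal_mult_top)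
        then show ?thesis unfolding inf by simp
      qed
      then show "besov_norm S \<zeta> ?w (qdiff (Rec P1 f1) (Rec P2 f2)) \<le> ?c * (?Nd + md_dist S \<T> \<gamma> \<eta> v \<Gamma>1 f1 \<Gamma>2 f2)"
        "rec_norm S \<gamma> \<eta> ?w (\<lambda>x. qdiff (local_err P1 f1 (Rec P1 f1) x) (local_err P2 f2 (Rec P2 f2) x)) \<le> ?c * (?Nd + ?Kd)"
        by blast+
    qed
  qed
  show ?thesis
  proof (intro conjI)
    show "\<forall>(P, \<Gamma>) \<in> mods. \<forall>f \<in> mdists \<Gamma>.
        (\<exists>!\<Lambda>. is_reconstruction S \<gamma> \<eta> ?w P f \<Lambda>) \<and>
        (\<forall>\<zeta>'<\<zeta>. Rec P f \<in> besov S \<zeta>' ?w) \<and> besov_norm S \<zeta> ?w (Rec P f) < \<infinity> \<and>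
        (min \<alpha>0 0 < \<eta> \<longrightarrow> Rec P f \<in> besov S \<zeta> ?w)"
      using 1 by blast
    from 2 show "\<exists>c>0. \<forall>(P, \<Gamma>) \<in> mods. \<forall>f \<in> mdists \<Gamma>.
        besov_norm S \<zeta> ?w (Rec P f) \<le> ennreal c * (pi_norm S \<T> \<gamma> w P * md_norm S \<T> \<gamma> \<eta> v \<Gamma> f) \<and>
        rec_norm S \<gamma> \<eta> ?w (local_err P f (Rec P f))
          \<le> ennreal c * (pi_norm S \<T> \<gamma> w P * sharp_norm S \<T> \<gamma> \<eta> v (delta \<Gamma> f))"
      by blast
    from 3 obtain a b where ab: "\<forall>R>0. 0 < a + b * R"
      and le: "\<And>R P1 \<Gamma>1 P2 \<Gamma>2 f1 f2. 0 < R \<Longrightarrow> (P1, \<Gamma>1) \<in> mods \<Longrightarrow> (P2, \<Gamma>2) \<in> mods \<Longrightarrow> f1 \<in> mdists \<Gamma>1 \<Longrightarrow> f2 \<in> mdists \<Gamma>2 \<Longrightarrow>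
            model_norm S \<T> \<gamma> w (P1, \<Gamma>1) \<le> ennreal R \<and> model_norm S \<T> \<gamma> w (P2, \<Gamma>2) \<le> ennreal R \<and>
            md_norm S \<T> \<gamma> \<eta> v \<Gamma>1 f1 \<le> ennreal R \<and> md_norm S \<T> \<gamma> \<eta> v \<Gamma>2 f2 \<le> ennreal R \<Longrightarrow>
            besov_norm S \<zeta> ?w (qdiff (Rec P1 f1) (Rec P2 f2))
              \<le> ennreal (a + b * R) * (pi_norm S \<T> \<gamma> w (pi_diff P1 P2) + md_dist S \<T> \<gamma> \<eta> v \<Gamma>1 f1 \<Gamma>2 f2) \<and>
            rec_norm S \<gamma> \<eta> ?w (\<lambda>x. qdiff (local_err P1 f1 (Rec P1 f1) x) (local_err P2 f2 (Rec P2 f2) x))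
              \<le> ennreal (a + b * R) * (pi_norm S \<T> \<gamma> w (pi_diff P1 P2) + sharp_dist S \<T> \<gamma> \<eta> v \<Gamma>1 f1 \<Gamma>2 f2)"
      by blast
    show "\<exists>a b. (\<forall>R>0. 0 < a + b * R) \<and>
        (\<forall>R>0. \<forall>(P1, \<Gamma>1) \<in> mods. \<forall>(P2, \<Gamma>2) \<in> mods.
          \<forall>f1 \<in> mdists \<Gamma>1. \<forall>f2 \<in> mdists \<Gamma>2.
            model_norm S \<T> \<gamma> w (P1, \<Gamma>1) \<le> ennreal R \<and> model_norm S \<T> \<gamma> w (P2, \<Gamma>2) \<le> ennreal R \<and>
            md_norm S \<T> \<gamma> \<eta> v \<Gamma>1 f1 \<le> ennreal R \<and> md_norm S \<T> \<gamma> \<eta> v \<Gamma>2 f2 \<le> ennreal R \<longrightarrow>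
            besov_norm S \<zeta> ?w (qdiff (Rec P1 f1) (Rec P2 f2))
              \<le> ennreal (a + b * R) * (pi_norm S \<T> \<gamma> w (pi_diff P1 P2) + md_dist S \<T> \<gamma> \<eta> v \<Gamma>1 f1 \<Gamma>2 f2) \<and>
            rec_norm S \<gamma> \<eta> ?w (\<lambda>x. qdiff (local_err P1 f1 (Rec P1 f1) x) (local_err P2 f2 (Rec P2 f2) x))
              \<le> ennreal (a + b * R) * (pi_norm S \<T> \<gamma> w (pi_diff P1 P2) + sharp_dist S \<T> \<gamma> \<eta> v \<Gamma>1 f1 \<Gamma>2 f2))"
    proof (rule exI[of _ a], rule exI[of _ b], rule conjI[OF ab], clarify, rule le)
    qed simp_all
  qed
qed

end
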